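(* Let $A\in\mathfrak{so}(3,4)$ with adjoint orbit type $[A]\notin\mathrm{IV}_4$, let $G=\mathrm{SO}_0(3,4)$ and let $T=\{\exp(tA):t\in\mathbb{R}\}$ act on $G$ by left multiplication. Then the reduction associated to $A$ produces manifolds: the reduced spaces $T\backslash Z_G$, $T\backslash Z_G/H'$, $T\backslash Z_G/H'U$ and $T\backslash Z_G/H$ are (smooth, Hausdorff) manifolds.
   Context: $\mathbb{R}^{3,4}$ is $\mathbb{R}^7$ with the form $\langle\cdot,\cdot\rangle$ given by $dx_1^2+dx_2^2+dx_3^2-dx_4^2-\dots-dx_7^2$. $H=\mathrm{SO}(3)\times\mathrm{SO}(4)\subset G=\mathrm{SO}_0(3,4)$ is block diagonal (first three and last four coordinates). Write $\mathfrak{so}(4)$ as skew $4\times 4$ matrices $(b_{ij})$. $\mathrm{Sp}(1)_+$ and $\mathrm{Sp}(1)_-$ are the connected subgroups of $\mathrm{SO}(4)$ with Lie algebras $\{b_{12}=b_{34},\ b_{13}=-b_{24},\ b_{14}=b_{23}\}$ and $\{b_{12}=-b_{34},\ b_{13}=b_{24},\ b_{14}=-b_{23}\}$; $H'=\mathrm{SO}(3)\times\mathrm{Sp}(1)_-$, and $U\simeq\mathrm{U}(1)$ is a circle subgroup of $\mathrm{Sp}(1)_+$. With $\omega(u,w)=\langle Au,w\rangle$, the zero locus is $Z_G=\{g\in G:\ \omega(f_1,f_2)+\omega(f_3,f_4)=0,\ \omega(f_1,f_3)-\omega(f_2,f_4)=0,\ \omega(f_1,f_4)+\omega(f_2,f_3)=0\}$,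 where $f_1,\dots,f_4$ are the last four columns of $g$ (the vanishing of the quaternionic K\"ahler moment map of the action of $T$). $Z_G$ is invariant under left multiplication by $T$ and right multiplication by $H$. The spaces $T\backslash Z_G/H'$, $T\backslash Z_G/H'U$, $T\backslash Z_G/H$ are the 3-Sasakian, twistor and quaternionic K\"ahler reductions. Family $\mathrm{IV}_4$: $[A]\in\mathrm{IV}_4$ means that $\mathbb{R}^{3,4}$ is an orthogonal direct sum of $A$-invariant subspaces $P_1\oplus L\oplus P_2\oplus P_3$, where $P_1$ is a positive definite 2-plane, $L$ a positive definite line, $P_2,P_3$ negative definite 2-planes, $A|_L=0$, and on each $P_i$ there is an orthogonal basis $w_1,w_2$ of vectors of norm $\pm1$ with $Aw_1=b_iw_2$, $Aw_2=-b_iw_1$ for some $b_i\in\mathbb{R}$ (possibly $0$). *)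

theory Defs
  imports "HOL-Analysis.Analysis"
begin

section \<open>Smooth manifolds given by atlases\<close>

primrec Ck_on :: "nat \<Rightarrow> 'a::euclidean_space set \<Rightarrow> ('a \<Rightarrow> 'b::euclidean_space) \<Rightarrow> bool" where
  "Ck_on 0 S f \<longleftrightarrow> continuous_on S f"
| "Ck_on (Suc k) S f \<longleftrightarrow>
     (\<forall>x\<in>S. f differentiable (at x)) \<and> (\<forall>v. Ck_on k S (\<lambda>x. frechet_derivative f (at x) v))"

text \<open>Used for open \<open>S\<close> only, since derivatives are taken in full neighbourhoods.\<close>

definition smooth_on :: "'a::euclidean_space set \<Rightarrow> ('a \<Rightarrow> 'b::euclidean_space) \<Rightarrow> bool" where
  "smooth_on S f \<longleftrightarrow> (\<forall>k. Ck_on k S f)"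

type_synonym ('p, 'e) chart = "'p set \<times> ('p \<Rightarrow> 'e)"

definition is_chart :: "'p topology \<Rightarrow> ('p, 'e::euclidean_space) chart \<Rightarrow> bool" where
  "is_chart X = (\<lambda>(U, \<phi>). openin X U \<and> open (\<phi> ` U) \<and>
     homeomorphic_map (subtopology X U) (top_of_set (\<phi> ` U)) \<phi>)"

definition local_rep ::
  "('p, 'e) chart \<Rightarrow> ('q, 'f) chart \<Rightarrow> ('p \<Rightarrow> 'q) \<Rightarrow> 'e \<Rightarrow> 'f" where
  "local_rep c d f = snd d \<circ> f \<circ> inv_into (fst c) (snd c)"

definition smooth_atlas :: "'p topology \<Rightarrow> ('p, 'e::euclidean_space) chart set \<Rightarrow> bool" where
  "smooth_atlas X \<A> \<longleftrightarrow>
     (\<forall>c\<in>\<A>. is_chart X c) \<and>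
     (\<Union>c\<in>\<A>. fst c) = topspace X \<and>
     (\<forall>c\<in>\<A>. \<forall>d\<in>\<A>. smooth_on (snd c ` (fst c \<inter> fst d)) (local_rep c d id))"

text \<open>The dimension of the manifold is the dimension of the model space \<^typ>\<open>'e\<close>.\<close>

definition smooth_manifold :: "'p topology \<Rightarrow> ('p, 'e::euclidean_space) chart set \<Rightarrow> bool" where
  "smooth_manifold X \<A> \<longleftrightarrow> Hausdorff_space X \<and> second_countable X \<and> smooth_atlas X \<A>"

definition smooth_map ::
  "'p topology \<Rightarrow> ('p, 'e::euclidean_space) chart set \<Rightarrow>
   'q topology \<Rightarrow> ('q, 'f::euclidean_space) chart set \<Rightarrow> ('p \<Rightarrow> 'q) \<Rightarrow> bool" where
  "smooth_map X \<A> Y \<B> f \<longleftrightarrow> continuous_map X Y f \<and>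
     (\<forall>c\<in>\<A>. \<forall>d\<in>\<B>. smooth_on (snd c ` {x \<in> fst c. f x \<in> fst d}) (local_rep c d f))"

definition smooth_submersion ::
  "'p topology \<Rightarrow> ('p, 'e::euclidean_space) chart set \<Rightarrow>
   'q topology \<Rightarrow> ('q, 'f::euclidean_space) chart set \<Rightarrow> ('p \<Rightarrow> 'q) \<Rightarrow> bool" where
  "smooth_submersion X \<A> Y \<B> f \<longleftrightarrow> smooth_map X \<A> Y \<B> f \<and>
     (\<forall>c\<in>\<A>. \<forall>d\<in>\<B>. \<forall>x\<in>fst c. f x \<in> fst d \<longrightarrow>
        surj (frechet_derivative (local_rep c d f) (at (snd c x))))"

definition smooth_immersion ::
  "'p topology \<Rightarrow> ('p, 'e::euclidean_space) chart set \<Rightarrow>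
   'q topology \<Rightarrow> ('q, 'f::euclidean_space) chart set \<Rightarrow> ('p \<Rightarrow> 'q) \<Rightarrow> bool" where
  "smooth_immersion X \<A> Y \<B> f \<longleftrightarrow> smooth_map X \<A> Y \<B> f \<and>
     (\<forall>c\<in>\<A>. \<forall>d\<in>\<B>. \<forall>x\<in>fst c. f x \<in> fst d \<longrightarrow>
        inj (frechet_derivative (local_rep c d f) (at (snd c x))))"

text \<open>An atlas for the subspace topology of \<open>S\<close> for which the inclusion into the ambient
  Euclidean space is an immersion; such an atlas is unique up to compatibility of charts.\<close>

definition embedded_submanifold ::
  "'a::euclidean_space set \<Rightarrow> ('a, 'e::euclidean_space) chart set \<Rightarrow> bool" where
  "embedded_submanifold S \<A> \<longleftrightarrow> smooth_manifold (top_of_set S) \<A> \<and>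
     smooth_immersion (top_of_set S) \<A> euclidean {(UNIV, id :: 'a \<Rightarrow> 'a)} id"


section \<open>Linear groups\<close>

definition mexp :: "real^'n^'n \<Rightarrow> real^'n^'n" where
  "mexp X = (\<Sum>k. (1 / fact k) *\<^sub>R (((**) X) ^^ k) (mat 1))"

definition one_parameter_group :: "real^'n^'n \<Rightarrow> (real^'n^'n) set" where
  "one_parameter_group X = range (\<lambda>t. mexp (t *\<^sub>R X))"

text \<open>The connected Lie subgroup with Lie algebra \<open>\<k>\<close> consists of the finite products of
  exponentials of elements of \<open>\<k>\<close>.\<close>

inductive_set connected_subgroup :: "(real^'n^'n) set \<Rightarrow> (real^'n^'n) set"
  for \<k> :: "(real^'n^'n) set" where
  one: "mat 1 \<in> connected_subgroup \<k>"
| mult_exp: "g \<in> connected_subgroup \<k> \<Longrightarrow> X \<in> \<k> \<Longrightarrow> g ** mexp X \<in> connected_subgroup \<k>"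

text \<open>Images of \<open>U(1)\<close>, the unit circle in the complex plane, under injective continuous
  homomorphisms.\<close>

definition circle_subgroup :: "(real^'n^'n) set \<Rightarrow> bool" where
  "circle_subgroup U \<longleftrightarrow> (\<exists>\<rho> :: complex \<Rightarrow> real^'n^'n.
     continuous_on (sphere 0 1) \<rho> \<and> inj_on \<rho> (sphere 0 1) \<and>
     \<rho> 1 = mat 1 \<and> (\<forall>z\<in>sphere 0 1. \<forall>w\<in>sphere 0 1. \<rho> (z * w) = \<rho> z ** \<rho> w) \<and>
     U = \<rho> ` sphere 0 1)"

definition special_orthogonal :: "(real^'n^'n) set" where
  "special_orthogonal = {g. rotation_matrix g}"

text \<open>In the index type \<^typ>\<open>4\<close> the numeral \<open>4\<close> equals \<open>0\<close>, so \<open>1, 2, 3, 4\<close> are its four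
  distinct elements.\<close>

definition sp1_plus :: "(real^4^4) set" where
  "sp1_plus = {b. transpose b = - b \<and>
     b $ 1 $ 2 = b $ 3 $ 4 \<and> b $ 1 $ 3 = - (b $ 2 $ 4) \<and> b $ 1 $ 4 = b $ 2 $ 3}"

definition sp1_minus :: "(real^4^4) set" where
  "sp1_minus = {b. transpose b = - b \<and>
     b $ 1 $ 2 = - (b $ 3 $ 4) \<and> b $ 1 $ 3 = b $ 2 $ 4 \<and> b $ 1 $ 4 = - (b $ 2 $ 3)}"

definition Sp1_plus :: "(real^4^4) set" where
  "Sp1_plus = connected_subgroup sp1_plus"

definition Sp1_minus :: "(real^4^4) set" where
  "Sp1_minus = connected_subgroup sp1_minus"


section \<open>The pseudo-Euclidean space of signature (3,4)\<close>

text \<open>The seven coordinates are indexed by the sum type \<^typ>\<open>3 + 4\<close>: \<open>Inl i\<close> is the \<open>i\<close>-th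
  coordinate, and \<open>Inr j\<close> is the coordinate with number \<open>3 + j\<close>.\<close>

type_synonym R34 = "real^(3 + 4)"
type_synonym mat34 = "real^(3 + 4)^(3 + 4)"

definition form34 :: "R34 \<Rightarrow> R34 \<Rightarrow> real" where
  "form34 x y = (\<Sum>i\<in>UNIV. x $ Inl i * y $ Inl i) - (\<Sum>j\<in>UNIV. x $ Inr j * y $ Inr j)"

definition SO34 :: "mat34 set" where
  "SO34 = {g. (\<forall>x y. form34 (g *v x) (g *v y) = form34 x y) \<and> det g = 1}"

definition SO0_34 :: "mat34 set" where
  "SO0_34 = connected_component_set SO34 (mat 1)"

definition so34 :: "mat34 set" where
  "so34 = {A. \<forall>x y. form34 (A *v x) y + form34 x (A *v y) = 0}"

definition block_diag :: "real^3^3 \<Rightarrow> real^4^4 \<Rightarrow> mat34" where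
  "block_diag a b = (\<chi> r s. case (r, s) of
      (Inl i, Inl j) \<Rightarrow> a $ i $ j
    | (Inr i, Inr j) \<Rightarrow> b $ i $ j
    | _ \<Rightarrow> 0)"

definition H :: "mat34 set" where
  "H = {block_diag a b | a b. a \<in> special_orthogonal \<and> b \<in> special_orthogonal}"

definition H' :: "mat34 set" where
  "H' = {block_diag a b | a b. a \<in> special_orthogonal \<and> b \<in> Sp1_minus}"

definition H'_times :: "(real^4^4) set \<Rightarrow> mat34 set" where
  "H'_times U = {h ** block_diag (mat 1) u | h u. h \<in> H' \<and> u \<in> U}"

definition omega :: "mat34 \<Rightarrow> R34 \<Rightarrow> R34 \<Rightarrow> real" where
  "omega A u w = form34 (A *v u) w"

definition Z_G :: "mat34 \<Rightarrow> mat34 set" where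
  "Z_G A = {g \<in> SO0_34. let f = (\<lambda>j. column (Inr j) g) in
     omega A (f 1) (f 2) + omega A (f 3) (f 4) = 0 \<and>
     omega A (f 1) (f 3) - omega A (f 2) (f 4) = 0 \<and>
     omega A (f 1) (f 4) + omega A (f 2) (f 3) = 0}"


section \<open>The family \<open>IV\<^sub>4\<close>\<close>

definition pos_def_on :: "R34 set \<Rightarrow> bool" where
  "pos_def_on P \<longleftrightarrow> (\<forall>x\<in>P. x \<noteq> 0 \<longrightarrow> form34 x x > 0)"

definition neg_def_on :: "R34 set \<Rightarrow> bool" where
  "neg_def_on P \<longleftrightarrow> (\<forall>x\<in>P. x \<noteq> 0 \<longrightarrow> form34 x x < 0)"

definition form_orthogonal :: "R34 set \<Rightarrow> R34 set \<Rightarrow> bool" where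
  "form_orthogonal P Q \<longleftrightarrow> (\<forall>x\<in>P. \<forall>y\<in>Q. form34 x y = 0)"

definition invariant_under :: "mat34 \<Rightarrow> R34 set \<Rightarrow> bool" where
  "invariant_under A P \<longleftrightarrow> (\<forall>x\<in>P. A *v x \<in> P)"

definition acts_as_rotation :: "mat34 \<Rightarrow> R34 set \<Rightarrow> bool" where
  "acts_as_rotation A P \<longleftrightarrow> (\<exists>w1 w2 b.
     span {w1, w2} = P \<and> form34 w1 w2 = 0 \<and>
     \<bar>form34 w1 w1\<bar> = 1 \<and> \<bar>form34 w2 w2\<bar> = 1 \<and>
     A *v w1 = b *\<^sub>R w2 \<and> A *v w2 = - b *\<^sub>R w1)"

definition IV4 :: "mat34 set" where
  "IV4 = {A. \<exists>P1 L P2 P3.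
     subspace P1 \<and> subspace L \<and> subspace P2 \<and> subspace P3 \<and>
     dim P1 = 2 \<and> dim L = 1 \<and> dim P2 = 2 \<and> dim P3 = 2 \<and>
     (\<forall>v. \<exists>!(p1, l, p2, p3). p1 \<in> P1 \<and> l \<in> L \<and> p2 \<in> P2 \<and> p3 \<in> P3 \<and> v = p1 + l + p2 + p3) \<and>
     form_orthogonal P1 L \<and> form_orthogonal P1 P2 \<and> form_orthogonal P1 P3 \<and>
     form_orthogonal L P2 \<and> form_orthogonal L P3 \<and> form_orthogonal P2 P3 \<and>
     invariant_under A P1 \<and> invariant_under A L \<and> invariant_under A P2 \<and> invariant_under A P3 \<and>
     pos_def_on P1 \<and> pos_def_on L \<and> neg_def_on P2 \<and> neg_def_on P3 \<and>
     (\<forall>x\<in>L. A *v x = 0) \<and>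
     acts_as_rotation A P1 \<and> acts_as_rotation A P2 \<and> acts_as_rotation A P3}"


section \<open>Reduced spaces\<close>

definition double_coset :: "(real^'n^'n) set \<Rightarrow> (real^'n^'n) set \<Rightarrow> real^'n^'n \<Rightarrow> (real^'n^'n) set" where
  "double_coset T K g = {t ** g ** k | t k. t \<in> T \<and> k \<in> K}"

text \<open>The quotient topology on the set of double cosets \<open>T g K\<close> with \<open>g \<in> Z\<close>.\<close>

definition reduced_space ::
  "(real^'n^'n) set \<Rightarrow> (real^'n^'n) set \<Rightarrow> (real^'n^'n) set \<Rightarrow> (real^'n^'n) set topology" where
  "reduced_space T Z K = topology (\<lambda>\<U>. \<U> \<subseteq> double_coset T K ` Z \<and>
     openin (top_of_set Z) {g \<in> Z. double_coset T K g \<in> \<U>})"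

lemma openin_reduced_space:
  "openin (reduced_space T Z K) \<U> \<longleftrightarrow> \<U> \<subseteq> double_coset T K ` Z \<and>
     openin (top_of_set Z) {g \<in> Z. double_coset T K g \<in> \<U>}"
proof -
  let ?q = "double_coset T K"
  have "istopology (\<lambda>\<U>. \<U> \<subseteq> ?q ` Z \<and> openin (top_of_set Z) {g \<in> Z. ?q g \<in> \<U>})"
    unfolding istopology_def
  proof (intro conjI allI impI)
    fix \<U> \<V>
    assume 1: "\<U> \<subseteq> ?q ` Z \<and> openin (top_of_set Z) {g \<in> Z. ?q g \<in> \<U>}"
      and 2: "\<V> \<subseteq> ?q ` Z \<and> openin (top_of_set Z) {g \<in> Z. ?q g \<in> \<V>}"
    have eq: "{g \<in> Z. ?q g \<in> \<U> \<inter> \<V>} = {g \<in> Z. ?q g \<in> \<U>} \<inter> {g \<in> Z. ?q g \<in> \<V>}" by auto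
    show "\<U> \<inter> \<V> \<subseteq> ?q ` Z" using 1 by auto
    show "openin (top_of_set Z) {g \<in> Z. ?q g \<in> \<U> \<inter> \<V>}"
      unfolding eq using 1 2 by blast
  next
    fix \<K>
    assume 1: "\<forall>\<U>\<in>\<K>. \<U> \<subseteq> ?q ` Z \<and> openin (top_of_set Z) {g \<in> Z. ?q g \<in> \<U>}"
    have eq: "{g \<in> Z. ?q g \<in> \<Union>\<K>} = (\<Union>\<U>\<in>\<K>. {g \<in> Z. ?q g \<in> \<U>})" by auto
    show "\<Union>\<K> \<subseteq> ?q ` Z" using 1 by auto
    show "openin (top_of_set Z) {g \<in> Z. ?q g \<in> \<Union>\<K>}"
      unfolding eq using 1 by blast
  qed
  then show ?thesis
    unfolding reduced_space_def by (simp add: topology_inverse')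
qed

lemma topspace_reduced_space [simp]: "topspace (reduced_space T Z K) = double_coset T K ` Z"
proof -
  have "{g \<in> Z. double_coset T K g \<in> double_coset T K ` Z} = Z" by auto
  then have "openin (reduced_space T Z K) (double_coset T K ` Z)"
    by (simp add: openin_reduced_space)
  then show ?thesis
    using openin_reduced_space[of T Z K "topspace (reduced_space T Z K)"]
    by (metis openin_subset openin_topspace subset_antisym)
qed

lemma quotient_map_reduced_space:
  "quotient_map (top_of_set Z) (reduced_space T Z K) (double_coset T K)"
  unfolding quotient_map_def by (auto simp: openin_reduced_space)

text \<open>The smooth structure meant on a reduced space is the quotient structure: the unique one for
  which the projection from \<open>Z\<close> (with smooth structure \<open>\<B>\<close>) is a submersion.\<close>

definition reduced_manifold ::
  "(real^'n^'n) set \<Rightarrow> (real^'n^'n) set \<Rightarrow> (real^'n^'n, 'e::euclidean_space) chart set \<Rightarrow>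
   (real^'n^'n) set \<Rightarrow> ((real^'n^'n) set, 'f::euclidean_space) chart set \<Rightarrow> bool" where
  "reduced_manifold T Z \<B> K \<C> \<longleftrightarrow>
     smooth_manifold (reduced_space T Z K) \<C> \<and>
     smooth_submersion (top_of_set Z) \<B> (reduced_space T Z K) \<C> (double_coset T K)"

end

theory Submission
  imports Defs
begin

text \<open>With \<open>J\<close> the matrix of the form, \<open>Z\<^sub>G\<close> is locally the zero set of
  \<open>g \<mapsto> (g\<^sup>T J g - J, \<mu> g)\<close>, where \<open>\<mu> g\<close> is the self-dual part of the lower block of \<open>g\<^sup>T A\<^sup>T J g\<close>. The
  derivative at \<open>p\<close> is surjective unless the off-diagonal block of \<open>p\<^sup>-\<^sup>1 A p\<close> vanishes; in that case \<open>A\<close> preserves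
  a positive definite 3-space and its negative definite complement, so \<open>[A] \<in> IV\<^sub>4\<close>. Hence \<open>Z\<^sub>G\<close> is a submanifold
  of dimension 18.

  The four groups acting from the right are compact. If \<open>exp(tA)\<close> is bounded along a sequence \<open>t \<rightarrow> \<infinity>\<close>, then, by
  recurrence and averaging, \<open>A\<close> preserves an inner product, which splits the space into definite invariant
  subspaces, and again \<open>[A] \<in> IV\<^sub>4\<close>. So \<open>T\<close> acts properly; a relation \<open>exp(tA) p k = p\<close> with \<open>t \<noteq> 0\<close> would
  make the powers of \<open>exp(tA)\<close> bounded, so the joint action with the compact group is free. Slices of this free
  proper action give the charts of the quotients.\<close>

section \<open>Calculus of smooth functions\<close>

text \<open>Two obstacles shape the argument. Nothing is known about the spectrum of
  \<open>A\<close>, and \<open>T\<close> might fail to be closed. No normal form of \<open>A\<close>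
  is used: the hypothesis that \<open>A\<close> lies outside \<open>IV4\<close> enters only through
  \<open>IV4_if_positive_invariant\<close>, that is, as the absence of an invariant positive
  definite 3-space. Regularity, properness, freeness and infinitesimal freeness are all reduced to
  this one criterion. The second obstacle is that four different compact groups act, one generated
  by exponentials and one containing an arbitrary circle. Each of them agrees near 1 with the
  centralizer of a set of matrices in the isometry group. Then its Lie algebra is cut out by linear
  equations, and the Cayley transform, a rational map that respects these equations in both
  directions, serves as local parametrization in place of the exponential. The dimensions are 21 - 3
  = 18 for the zero locus and 18 - 1 - d for the quotients, with d = 0, 6, 7, 9 the dimension of the
  compact group.\<close>

lemma linear_euclidean_representation:
  assumes "linear f"
  shows "f w = (\<Sum>i\<in>Basis. (w \<bullet> i) *\<^sub>R f i)"
proof -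
  have "f w = f (\<Sum>i\<in>Basis. (w \<bullet> i) *\<^sub>R i)"
    by (simp add: euclidean_representation)
  also have "\<dots> = (\<Sum>i\<in>Basis. (w \<bullet> i) *\<^sub>R f i)"
    unfolding linear_sum[OF assms] by (simp add: linear_scale[OF assms])
  finally show ?thesis .
qed

lemma frechet_derivative_cong_open:
  assumes "open S" "x \<in> S" "\<And>y. y \<in> S \<Longrightarrow> f y = g y"
  shows "frechet_derivative f (at x) = frechet_derivative g (at x)"
proof -
  have "(f has_derivative D) (at x) \<longleftrightarrow> (g has_derivative D) (at x)" for D
    using assms has_derivative_transform_within_open[of f D x UNIV S g]
      has_derivative_transform_within_open[of g D x UNIV S f] by auto
  then show ?thesis
    unfolding frechet_derivative_def by simp
qed

lemma Ck_on_cong: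
  assumes "open S" "\<And>x. x \<in> S \<Longrightarrow> f x = g x"
  shows "Ck_on k S f \<longleftrightarrow> Ck_on k S g"
  using assms(2)
proof (induction k arbitrary: f g)
  case 0
  then show ?case by (auto cong: continuous_on_cong)
next
  case (Suc k)
  have "f differentiable at x \<longleftrightarrow> g differentiable at x" if "x \<in> S" for x
    using has_derivative_transform_within_open[of f _ x UNIV S g]
      has_derivative_transform_within_open[of g _ x UNIV S f] that Suc.prems assms(1)
    unfolding differentiable_def by (metis UNIV_I)
  moreover have "Ck_on k S (\<lambda>x. frechet_derivative f (at x) v) \<longleftrightarrow>
      Ck_on k S (\<lambda>x. frechet_derivative g (at x) v)" for v
    by (rule Suc.IH) (metis frechet_derivative_cong_open assms(1) Suc.prems)
  ultimately show ?case by auto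
qed

text \<open>With any explicit derivative at hand, the choice hidden in
  \<open>frechet_derivative\<close> never has to be evaluated; all closure properties below go
  through this rule.\<close>

lemma Ck_on_SucI:
  assumes "open S" "\<And>x. x \<in> S \<Longrightarrow> (f has_derivative f' x) (at x)"
    and "\<And>v. Ck_on k S (\<lambda>x. f' x v)"
  shows "Ck_on (Suc k) S f"
proof -
  have "frechet_derivative f (at x) = f' x" if "x \<in> S" for x
    using assms(2) that frechet_derivative_at by metis
  then have "Ck_on k S (\<lambda>x. frechet_derivative f (at x) v)" for v
    using Ck_on_cong[OF assms(1), THEN iffD2, OF _ assms(3)[of v]] by simp
  moreover have "\<forall>x\<in>S. f differentiable (at x)"
    using assms(2) differentiable_def by blast
  ultimately show ?thesis by simp
qed

lemma Ck_on_Suc_has_derivative: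
  assumes "Ck_on (Suc k) S f" "x \<in> S"
  shows "(f has_derivative frechet_derivative f (at x)) (at x)"
  using assms frechet_derivative_works by auto

lemma Ck_on_SucD: "Ck_on (Suc k) S f \<Longrightarrow> Ck_on k S f"
proof (induction k arbitrary: f)
  case 0
  then show ?case
    by (auto intro!: continuous_at_imp_continuous_on differentiable_imp_continuous_within)
next
  case (Suc k)
  then show ?case by (metis Ck_on.simps(2))
qed

lemma Ck_on_imp_continuous_on: "Ck_on k S f \<Longrightarrow> continuous_on S f"
  by (induction k) (use Ck_on_SucD in auto)

lemma Ck_on_subset: "Ck_on k S f \<Longrightarrow> T \<subseteq> S \<Longrightarrow> Ck_on k T f"
  by (induction k arbitrary: f) (auto intro: continuous_on_subset)

lemma Ck_on_local:
  assumes "\<And>x. x \<in> S \<Longrightarrow> \<exists>T. open T \<and> x \<in> T \<and> Ck_on k T f"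
  shows "Ck_on k S f"
  using assms
proof (induction k arbitrary: f)
  case 0
  then show ?case
    by (metis Ck_on.simps(1) continuous_at_imp_continuous_on continuous_on_eq_continuous_at)
next
  case (Suc k)
  have "Ck_on k S (\<lambda>x. frechet_derivative f (at x) v)" for v
    using Suc by (metis (mono_tags, lifting) Ck_on.simps(2))
  moreover have "\<forall>x\<in>S. f differentiable at x"
    using Suc.prems by (metis Ck_on.simps(2))
  ultimately show ?case by simp
qed

lemma Ck_on_const: "Ck_on k S (\<lambda>x. c)"
proof (induction k arbitrary: c)
  case (Suc k)
  have "frechet_derivative (\<lambda>x. c) (at x) = (\<lambda>v. 0)" for x
    by simp
  then show ?case using Suc[of 0] by simp
qed simp

lemma Ck_on_bounded_linear:
  assumes "bounded_linear f"
  shows "Ck_on k S f"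
proof (cases k)
  case 0
  then show ?thesis using assms by (simp add: linear_continuous_on)
next
  case (Suc j)
  have "frechet_derivative f (at x) = f" for x
    using frechet_derivative_at[OF bounded_linear.has_derivative[OF assms has_derivative_ident]]
    by simp
  then show ?thesis
    unfolding Suc using assms by (auto simp: Ck_on_const bounded_linear_imp_differentiable)
qed

lemma Ck_on_add:
  assumes "open S" "Ck_on k S f" "Ck_on k S g"
  shows "Ck_on k S (\<lambda>x. f x + g x)"
  using assms(2,3)
proof (induction k arbitrary: f g)
  case 0
  then show ?case by (simp add: continuous_on_add)
next
  case (Suc k)
  show ?case
  proof (rule Ck_on_SucI[OF assms(1) has_derivative_add])
    show "(f has_derivative frechet_derivative f (at x)) (at x)" if "x \<in> S" for x
      by (rule Ck_on_Suc_has_derivative[OF Suc.prems(1) that])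
    show "(g has_derivative frechet_derivative g (at x)) (at x)" if "x \<in> S" for x
      by (rule Ck_on_Suc_has_derivative[OF Suc.prems(2) that])
    show "Ck_on k S (\<lambda>x. frechet_derivative f (at x) v + frechet_derivative g (at x) v)" for v
      using Suc by simp
  qed
qed

lemma Ck_on_sum:
  assumes "open S" "\<And>i. i \<in> I \<Longrightarrow> Ck_on k S (f i)"
  shows "Ck_on k S (\<lambda>x. \<Sum>i\<in>I. f i x)"
  using assms(2)
proof (induction I rule: infinite_finite_induct)
  case (insert i I)
  have "Ck_on k S (\<lambda>x. f i x + (\<Sum>i\<in>I. f i x))"
    by (rule Ck_on_add[OF assms(1) insert.prems insert.IH]) (use insert.prems in blast)+
  moreover have "(\<lambda>x. \<Sum>i\<in>insert i I. f i x) = (\<lambda>x. f i x + (\<Sum>i\<in>I. f i x))"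
    using insert.hyps by simp
  ultimately show ?case by (simp only:)
qed (simp_all add: Ck_on_const)

lemma Ck_on_bounded_bilinear:
  assumes "bounded_bilinear bl" "open S" "Ck_on k S f" "Ck_on k S g"
  shows "Ck_on k S (\<lambda>x. bl (f x) (g x))"
  using assms(3,4)
proof (induction k arbitrary: f g)
  case 0
  then show ?case by (simp add: bounded_bilinear.continuous_on[OF assms(1)])
next
  case (Suc k)
  show ?case
  proof (rule Ck_on_SucI[where f' = "\<lambda>x v. bl (f x) (frechet_derivative g (at x) v)
        + bl (frechet_derivative f (at x) v) (g x)"])
    show "((\<lambda>x. bl (f x) (g x)) has_derivative
      (\<lambda>v. bl (f x) (frechet_derivative g (at x) v) + bl (frechet_derivative f (at x) v) (g x))) (at x)"
      if "x \<in> S" for x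
      using bounded_bilinear.FDERIV[OF assms(1)] Ck_on_Suc_has_derivative[OF Suc.prems(1) that]
        Ck_on_Suc_has_derivative[OF Suc.prems(2) that] by blast
    show "Ck_on k S (\<lambda>x. bl (f x) (frechet_derivative g (at x) v)
        + bl (frechet_derivative f (at x) v) (g x))" for v
      by (intro Ck_on_add[OF assms(2)] Suc.IH Ck_on_SucD[OF Suc.prems(1)] Ck_on_SucD[OF Suc.prems(2)])
        (use Suc.prems in simp_all)
  qed (rule assms(2))
qed

lemma Ck_on_compose:
  assumes "open S" "open T" "Ck_on k S f" "Ck_on k T g" "f ` S \<subseteq> T"
  shows "Ck_on k S (\<lambda>x. g (f x))"
  using assms(3,4)
proof (induction k arbitrary: g)
  case 0
  then show ?case
    using continuous_on_compose2[OF _ _ assms(5)] by simp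
next
  case (Suc k)
  \<comment> \<open>The chain rule applies the derivative of \<open>g\<close> to a moving vector.
    Expanding that vector in \<open>Basis\<close> leaves products of scalars with partial
    derivatives along fixed directions, to which the induction hypothesis applies.\<close>
  let ?D = "\<lambda>x v. \<Sum>i\<in>Basis. (frechet_derivative f (at x) v \<bullet> i) *\<^sub>R frechet_derivative g (at (f x)) i"
  have lin: "linear (frechet_derivative g (at y))" if "y \<in> T" for y
    using Ck_on_Suc_has_derivative[OF Suc.prems(2) that] has_derivative_linear by blast
  show ?case
  proof (rule Ck_on_SucI[where f' = ?D])
    show "((\<lambda>x. g (f x)) has_derivative ?D x) (at x)" if "x \<in> S" for x
    proof -
      have fx: "f x \<in> T" using that assms(5) by auto
      have "((\<lambda>x. g (f x)) has_derivative (\<lambda>v. frechet_derivative g (at (f x)) (frechet_derivative f (at x) v))) (at x)"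
        using has_derivative_compose[OF Ck_on_Suc_has_derivative[OF Suc.prems(1) that]
            Ck_on_Suc_has_derivative[OF Suc.prems(2) fx]] .
      then show ?thesis
        by (rule has_derivative_eq_rhs) (rule ext, rule linear_euclidean_representation[OF lin[OF fx]])
    qed
    show "Ck_on k S (\<lambda>x. ?D x v)" for v
    proof (rule Ck_on_sum[OF assms(1)])
      fix i :: 'b assume "i \<in> Basis"
      have 1: "Ck_on k S (\<lambda>x. frechet_derivative f (at x) v \<bullet> i)"
        using Suc.prems(1)
        by (auto intro!: Ck_on_bounded_bilinear[OF bounded_bilinear_inner assms(1)] Ck_on_const)
      have 2: "Ck_on k S (\<lambda>x. frechet_derivative g (at (f x)) i)"
        using Suc.IH[OF Ck_on_SucD[OF Suc.prems(1)], of "\<lambda>y. frechet_derivative g (at y) i"] Suc.prems(2)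
        by simp
      show "Ck_on k S (\<lambda>x. (frechet_derivative f (at x) v \<bullet> i) *\<^sub>R frechet_derivative g (at (f x)) i)"
        by (rule Ck_on_bounded_bilinear[OF bounded_bilinear_scaleR assms(1) 1 2])
    qed
  qed (rule assms(1))
qed

lemma smooth_on_cong:
  "open S \<Longrightarrow> (\<And>x. x \<in> S \<Longrightarrow> f x = g x) \<Longrightarrow> smooth_on S f \<longleftrightarrow> smooth_on S g"
  unfolding smooth_on_def using Ck_on_cong by blast

lemma smooth_on_subset: "smooth_on S f \<Longrightarrow> T \<subseteq> S \<Longrightarrow> smooth_on T f"
  unfolding smooth_on_def using Ck_on_subset by blast

lemma smooth_on_local:
  assumes "\<And>x. x \<in> S \<Longrightarrow> \<exists>T. open T \<and> x \<in> T \<and> smooth_on T f"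
  shows "smooth_on S f"
  unfolding smooth_on_def
proof (intro allI Ck_on_local)
  show "\<exists>T. open T \<and> x \<in> T \<and> Ck_on k T f" if "x \<in> S" for k x
    using assms[OF that] unfolding smooth_on_def by blast
qed

lemma smooth_on_imp_continuous_on: "smooth_on S f \<Longrightarrow> continuous_on S f"
  unfolding smooth_on_def using Ck_on_imp_continuous_on by blast

lemma smooth_on_has_derivative:
  "smooth_on S f \<Longrightarrow> x \<in> S \<Longrightarrow> (f has_derivative frechet_derivative f (at x)) (at x)"
  unfolding smooth_on_def using Ck_on_Suc_has_derivative by blast

lemma smooth_on_frechet_derivative:
  "smooth_on S f \<Longrightarrow> smooth_on S (\<lambda>x. frechet_derivative f (at x) v)"
  unfolding smooth_on_def by (metis Ck_on.simps(2))

lemma smooth_on_const [simp]: "smooth_on S (\<lambda>x. c)"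
  unfolding smooth_on_def by (simp add: Ck_on_const)

lemma smooth_on_linear: "linear f \<Longrightarrow> smooth_on S f"
  unfolding smooth_on_def by (simp add: Ck_on_bounded_linear linear_conv_bounded_linear)

lemma smooth_on_ident [simp]: "smooth_on S (\<lambda>x. x)"
  by (intro smooth_on_linear linear_ident)

lemma smooth_on_add: "open S \<Longrightarrow> smooth_on S f \<Longrightarrow> smooth_on S g \<Longrightarrow> smooth_on S (\<lambda>x. f x + g x)"
  unfolding smooth_on_def by (simp add: Ck_on_add)

lemma smooth_on_bounded_bilinear:
  "bounded_bilinear bl \<Longrightarrow> open S \<Longrightarrow> smooth_on S f \<Longrightarrow> smooth_on S g \<Longrightarrow>
    smooth_on S (\<lambda>x. bl (f x) (g x))"
  unfolding smooth_on_def by (simp add: Ck_on_bounded_bilinear)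

lemma smooth_on_compose:
  "open S \<Longrightarrow> open T \<Longrightarrow> smooth_on S f \<Longrightarrow> smooth_on T g \<Longrightarrow> f ` S \<subseteq> T \<Longrightarrow>
    smooth_on S (\<lambda>x. g (f x))"
  unfolding smooth_on_def by (simp add: Ck_on_compose)

lemma smooth_on_linear_compose:
  "open S \<Longrightarrow> linear g \<Longrightarrow> smooth_on S f \<Longrightarrow> smooth_on S (\<lambda>x. g (f x))"
  by (rule smooth_on_compose[where T = UNIV]) (auto intro: smooth_on_linear)

lemma smooth_on_diff:
  assumes "open S" "smooth_on S f" "smooth_on S g"
  shows "smooth_on S (\<lambda>x. f x - g x)"
  using smooth_on_add[OF assms(1,2) smooth_on_linear_compose[OF assms(1) linear_uminus assms(3)]]
  by simp

section \<open>Inverses of families of linear maps and the inverse function theorem\<close>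

text \<open>If \<open>M\<close> is a family of invertible linear maps with inverses \<open>N\<close>, then
  \<open>N y - N z = - N y \<circ> (M y - M z) \<circ> N z\<close>; hence \<open>N\<close> is as often differentiable as \<open>M\<close>.\<close>

lemma Ck_on_inverse_family:
  fixes M :: "'c::euclidean_space \<Rightarrow> 'a::euclidean_space \<Rightarrow> 'b::euclidean_space"
  assumes "open S" "\<And>u. Ck_on k S (\<lambda>y. M y u)"
    and linM: "\<And>y. y \<in> S \<Longrightarrow> linear (M y)"
    and NM: "\<And>y u. y \<in> S \<Longrightarrow> N y (M y u) = u"
    and MN: "\<And>y v. y \<in> S \<Longrightarrow> M y (N y v) = v"
  shows "Ck_on k S (\<lambda>y. N y v)"
proof -
  have linN: "linear (N y)" if "y \<in> S" for y
  proof (rule linearI)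
    show "N y (a + b) = N y a + N y b" for a b
      using NM[OF that, of "N y a + N y b"] MN[OF that] linear_add[OF linM[OF that]] by simp
    show "N y (r *\<^sub>R a) = r *\<^sub>R N y a" for r a
      using NM[OF that, of "r *\<^sub>R N y a"] MN[OF that] linear_scale[OF linM[OF that]] by simp
  qed
  have Mrep: "M y w = (\<Sum>i\<in>Basis. (w \<bullet> i) *\<^sub>R M y i)" if "y \<in> S" for y w
    by (rule linear_euclidean_representation[OF linM[OF that]])
  have Nrep: "N y w = (\<Sum>i\<in>Basis. (w \<bullet> i) *\<^sub>R N y i)" if "y \<in> S" for y w
    by (rule linear_euclidean_representation[OF linN[OF that]])
  have diffN: "N y v - N z v = - N y (M y (N z v) - M z (N z v))" if "y \<in> S" "z \<in> S" for y z v
    using that by (simp add: MN NM linear_diff[OF linN[OF that(1)]])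
  have cM: "continuous_on S (\<lambda>y. M y u)" for u
    using assms(2) Ck_on_imp_continuous_on by blast
  \<comment> \<open>Local uniform boundedness of the inverses, which makes both continuity and the
    derivative formula a matter of null sequences.\<close>
  have bound: "\<exists>C>0. \<exists>T. open T \<and> y0 \<in> T \<and> T \<subseteq> S \<and> (\<forall>y\<in>T. \<forall>v. norm (N y v) \<le> C * norm v)"
    if y0: "y0 \<in> S" for y0
  proof -
    obtain B where B: "B > 0" "\<And>v. norm (N y0 v) \<le> B * norm v"
      using linear_bounded_pos[OF linN[OF y0]] by blast
    \<comment> \<open>With this size of perturbation the error term is at most half of
      \<open>norm w\<close> and is absorbed on the left.\<close>
    define \<epsilon> where "\<epsilon> = 1 / (2 * B)"
    have "\<epsilon> > 0" unfolding \<epsilon>_def using B by simp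
    define T where "T = {y \<in> S. (\<Sum>i\<in>Basis. norm (M y i - M y0 i)) < \<epsilon>}"
    have cont: "continuous_on S (\<lambda>y. \<Sum>i\<in>Basis. norm (M y i - M y0 i))"
      by (intro continuous_intros cM)
    have "open T"
      using continuous_open_preimage[OF cont assms(1) open_lessThan[of \<epsilon>]]
      unfolding T_def vimage_def by (simp add: Int_def)
    moreover have "y0 \<in> T" unfolding T_def using y0 \<open>\<epsilon> > 0\<close> by simp
    moreover have "T \<subseteq> S" unfolding T_def by auto
    moreover have "norm (N y v) \<le> (2 * B) * norm v" if "y \<in> T" for y v
    proof -
      have yS: "y \<in> S" using that \<open>T \<subseteq> S\<close> by auto
      define w where "w = N y v"
      have "norm (M y w - M y0 w) = norm (\<Sum>i\<in>Basis. (w \<bullet> i) *\<^sub>R (M y i - M y0 i))"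
        unfolding Mrep[OF yS, of w] Mrep[OF y0, of w] by (simp add: sum_subtractf scaleR_diff_right)
      also have "\<dots> \<le> (\<Sum>i\<in>Basis. norm w * norm (M y i - M y0 i))"
        by (rule sum_norm_le) (simp add: Basis_le_norm mult_right_mono)
      also have "\<dots> \<le> norm w * \<epsilon>"
        unfolding sum_distrib_left[symmetric] using that unfolding T_def
        by (intro mult_left_mono) auto
      finally have *: "norm (M y w - M y0 w) \<le> norm w * \<epsilon>" .
      have "w = N y0 (M y0 w)" using NM[OF y0] by simp
      also have "\<dots> = N y0 (v - (M y w - M y0 w))" unfolding w_def MN[OF yS] by simp
      finally have "norm w \<le> B * norm (v - (M y w - M y0 w))" using B(2) by metis
      also have "\<dots> \<le> B * (norm v + norm w * \<epsilon>)"
        using * B(1) norm_triangle_ineq4[of v "M y w - M y0 w"] by (intro mult_left_mono) auto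
      also have "\<dots> = B * norm v + norm w / 2" unfolding \<epsilon>_def using B(1) by (simp add: field_simps)
      finally show ?thesis unfolding w_def by simp
    qed
    ultimately show ?thesis using B(1) by (intro exI[of _ "2 * B"]) auto
  qed
  have isCont: "isCont (\<lambda>y. N y v) y0" if y0: "y0 \<in> S" for y0 v
  proof -
    obtain C T where C: "C > 0" "open T" "y0 \<in> T" "T \<subseteq> S" "\<And>y v. y \<in> T \<Longrightarrow> norm (N y v) \<le> C * norm v"
      using bound[OF y0] by metis
    have "((\<lambda>y. M y (N y0 v) - M y0 (N y0 v)) \<longlongrightarrow> 0) (at y0)"
      using cM[of "N y0 v"] y0 assms(1)
      by (intro LIM_zero isContD) (simp add: continuous_on_eq_continuous_at)
    then have "((\<lambda>y. C * norm (M y (N y0 v) - M y0 (N y0 v))) \<longlongrightarrow> 0) (at y0)"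
      by (simp add: tendsto_mult_right_zero tendsto_norm_zero)
    moreover have "\<forall>\<^sub>F y in at y0. norm (N y v - N y0 v) \<le> C * norm (M y (N y0 v) - M y0 (N y0 v))"
      using eventually_at_in_open'[OF C(2,3)]
    proof eventually_elim
      case (elim y)
      then show ?case using C(4,5) diffN[of y y0 v] y0 by (metis norm_minus_cancel subsetD)
    qed
    ultimately have "((\<lambda>y. N y v - N y0 v) \<longlongrightarrow> 0) (at y0)"
      by (rule Lim_null_comparison[rotated])
    then show ?thesis by (simp add: isCont_def LIM_zero_iff)
  qed
  show ?thesis
    using assms(2)
  proof (induction k arbitrary: v)
    case 0
    then show ?case using isCont by (simp add: continuous_at_imp_continuous_on)
  next
    case (Suc k)
    define D where "D = (\<lambda>y h w. frechet_derivative (\<lambda>y. M y w) (at y) h)"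
    have D: "((\<lambda>y. M y w) has_derivative (\<lambda>h. D y h w)) (at y)" if "y \<in> S" for y w
      using Ck_on_Suc_has_derivative[OF Suc.prems that] unfolding D_def .
    \<comment> \<open>The usual formula for the derivative of an inverse, evaluated at
      \<open>v\<close>.\<close>
    let ?E = "\<lambda>y h. - N y (D y h (N y v))"
    have Drep: "D y h w = (\<Sum>i\<in>Basis. (w \<bullet> i) *\<^sub>R D y h i)" if "y \<in> S" for y h w
    proof -
      have "((\<lambda>y. \<Sum>i\<in>Basis. (w \<bullet> i) *\<^sub>R M y i) has_derivative (\<lambda>h. \<Sum>i\<in>Basis. (w \<bullet> i) *\<^sub>R D y h i)) (at y)"
        by (intro has_derivative_sum has_derivative_scaleR_right D that)
      then have "((\<lambda>y. M y w) has_derivative (\<lambda>h. \<Sum>i\<in>Basis. (w \<bullet> i) *\<^sub>R D y h i)) (at y)"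
        by (rule has_derivative_transform_within_open[OF _ assms(1) that]) (simp add: Mrep[symmetric])
      from has_derivative_unique[OF this D[OF that]] show ?thesis by metis
    qed
    show ?case
    proof (rule Ck_on_SucI[OF assms(1), where f' = ?E])
      fix z assume z: "z \<in> S"
      obtain C T where C: "C > 0" "open T" "z \<in> T" "T \<subseteq> S" "\<And>y v. y \<in> T \<Longrightarrow> norm (N y v) \<le> C * norm v"
        using bound[OF z] by metis
      define w where "w = N z v"
      have blD: "bounded_linear (\<lambda>h. D z h w)" using D[OF z] has_derivative_bounded_linear by blast
      have Dw: "((\<lambda>y. (M y w - M z w - D z (y - z) w) /\<^sub>R norm (y - z)) \<longlongrightarrow> 0) (at z)"
        using D[OF z, of w] unfolding has_derivative_at_within by simp
      have one: "((\<lambda>y. N y ((M y w - M z w - D z (y - z) w) /\<^sub>R norm (y - z))) \<longlongrightarrow> 0) (at z)"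
      proof (rule Lim_null_comparison)
        show "((\<lambda>y. C * norm ((M y w - M z w - D z (y - z) w) /\<^sub>R norm (y - z))) \<longlongrightarrow> 0) (at z)"
          using tendsto_norm_zero[OF Dw] by (rule tendsto_mult_right_zero)
        show "\<forall>\<^sub>F y in at z. norm (N y ((M y w - M z w - D z (y - z) w) /\<^sub>R norm (y - z)))
            \<le> C * norm ((M y w - M z w - D z (y - z) w) /\<^sub>R norm (y - z))"
          using eventually_at_in_open'[OF C(2,3)] by eventually_elim (rule C(5))
      qed
      obtain K where K: "K > 0" "\<And>h. norm (D z h w) \<le> norm h * K"
        using bounded_linear.pos_bounded[OF blD] by blast
      have two: "((\<lambda>y. (N y (D z (y - z) w) - N z (D z (y - z) w)) /\<^sub>R norm (y - z)) \<longlongrightarrow> 0) (at z)"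
      proof (rule Lim_null_comparison)
        have "((\<lambda>y. \<Sum>i\<in>Basis. K * norm (N y i - N z i)) \<longlongrightarrow> (\<Sum>i\<in>(Basis::'b set). K * norm (N z i - N z i))) (at z)"
          using isCont[OF z] by (intro tendsto_intros) (simp add: isCont_def)
        then show "((\<lambda>y. \<Sum>i\<in>Basis. K * norm (N y i - N z i)) \<longlongrightarrow> 0) (at z)" by simp
        show "\<forall>\<^sub>F y in at z. norm ((N y (D z (y - z) w) - N z (D z (y - z) w)) /\<^sub>R norm (y - z))
            \<le> (\<Sum>i\<in>Basis. K * norm (N y i - N z i))"
          using eventually_at_in_open[OF C(2,3)]
        proof eventually_elim
          case (elim y)
          then have yS: "y \<in> S" and yz: "norm (y - z) > 0" using C(4) by auto
          define u where "u = D z (y - z) w"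
          have u: "norm u \<le> norm (y - z) * K" unfolding u_def by (rule K(2))
          have "norm (N y u - N z u) = norm (\<Sum>i\<in>Basis. (u \<bullet> i) *\<^sub>R (N y i - N z i))"
            unfolding Nrep[OF yS, of u] Nrep[OF z, of u] by (simp add: sum_subtractf scaleR_diff_right)
          also have "\<dots> \<le> (\<Sum>i\<in>Basis. (norm (y - z) * K) * norm (N y i - N z i))"
          proof (rule sum_norm_le)
            fix i :: 'b assume "i \<in> Basis"
            then have "\<bar>u \<bullet> i\<bar> \<le> norm (y - z) * K" using u Basis_le_norm[of i u] by simp
            then show "norm ((u \<bullet> i) *\<^sub>R (N y i - N z i)) \<le> (norm (y - z) * K) * norm (N y i - N z i)"
              by (simp add: mult_right_mono)
          qed
          also have "\<dots> = norm (y - z) * (\<Sum>i\<in>Basis. K * norm (N y i - N z i))"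
            by (simp add: sum_distrib_left mult.assoc)
          finally have "norm (N y u - N z u) / norm (y - z) \<le> (\<Sum>i\<in>Basis. K * norm (N y i - N z i))"
            using yz by (simp only: pos_divide_le_eq mult.commute)
          moreover have "norm ((N y u - N z u) /\<^sub>R norm (y - z)) = norm (N y u - N z u) / norm (y - z)"
            unfolding norm_scaleR by (simp add: divide_inverse mult.commute)
          ultimately show ?case unfolding u_def by simp
        qed
      qed
      \<comment> \<open>The remainder splits into the Taylor remainder of \<open>M\<close>, hit by
        the bounded map \<open>N y\<close>, and the change of \<open>N\<close> on the derivative
        term; \<open>one\<close> and \<open>two\<close> treat them separately.\<close>
      have eq: "(N y v - N z v - ?E z (y - z)) /\<^sub>R norm (y - z) =
         - (N y ((M y w - M z w - D z (y - z) w) /\<^sub>R norm (y - z)))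
         - (N y (D z (y - z) w) - N z (D z (y - z) w)) /\<^sub>R norm (y - z)" if "y \<in> S" for y
      proof -
        have "N y v - N z v - ?E z (y - z) =
            - N y (M y w - M z w - D z (y - z) w) - (N y (D z (y - z) w) - N z (D z (y - z) w))"
          using diffN[OF that z, of v] unfolding w_def[symmetric] linear_diff[OF linN[OF that]]
          by (simp add: algebra_simps)
        then show ?thesis
          unfolding linear_scale[OF linN[OF that]] by (simp only: scaleR_diff_right scaleR_minus_right)
      qed
      have "((\<lambda>y. - (N y ((M y w - M z w - D z (y - z) w) /\<^sub>R norm (y - z)))
         - (N y (D z (y - z) w) - N z (D z (y - z) w)) /\<^sub>R norm (y - z)) \<longlongrightarrow> - 0 - 0) (at z)"
        by (intro tendsto_intros one two)
      then have "((\<lambda>y. (N y v - N z v - ?E z (y - z)) /\<^sub>R norm (y - z)) \<longlongrightarrow> - 0 - 0) (at z)"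
        by (rule Lim_transform_eventually)
          (use eventually_at_in_open'[OF assms(1) z] in eventually_elim, simp only: eq)
      moreover have "bounded_linear (?E z)"
        using bounded_linear_minus[OF bounded_linear_compose[OF linear_conv_bounded_linear[THEN iffD1, OF linN[OF z]] blD]]
        unfolding w_def .
      ultimately show "((\<lambda>y. N y v) has_derivative ?E z) (at z)"
        unfolding has_derivative_at_within by simp
    next
      fix h
      have N: "Ck_on k S (\<lambda>y. N y v)" for v
        using Suc.IH Suc.prems Ck_on_SucD by blast
      have 1: "Ck_on k S (\<lambda>y. \<Sum>i\<in>Basis. (N y v \<bullet> i) *\<^sub>R D y h i)"
      proof (intro Ck_on_sum[OF assms(1)] Ck_on_bounded_bilinear[OF bounded_bilinear_scaleR assms(1)]
          Ck_on_bounded_bilinear[OF bounded_bilinear_inner assms(1)] N Ck_on_const)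
        show "Ck_on k S (\<lambda>y. D y h i)" for i
          using Suc.prems unfolding D_def by simp
      qed
      have 2: "Ck_on k S (\<lambda>y. D y h (N y v))"
        using 1 by (rule Ck_on_cong[OF assms(1), THEN iffD1, rotated]) (simp add: Drep[symmetric])
      have "Ck_on k S (\<lambda>y. \<Sum>j\<in>Basis. (D y h (N y v) \<bullet> j) *\<^sub>R N y j)"
        by (intro Ck_on_sum[OF assms(1)] Ck_on_bounded_bilinear[OF bounded_bilinear_scaleR assms(1)]
          Ck_on_bounded_bilinear[OF bounded_bilinear_inner assms(1)] N Ck_on_const 2)
      then have 3: "Ck_on k S (\<lambda>y. N y (D y h (N y v)))"
        by (rule Ck_on_cong[OF assms(1), THEN iffD1, rotated]) (simp add: Nrep[symmetric])
      have "Ck_on k S (\<lambda>y. (-1) *\<^sub>R N y (D y h (N y v)))"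
        by (rule Ck_on_bounded_bilinear[OF bounded_bilinear_scaleR assms(1) Ck_on_const 3])
      then show "Ck_on k S (\<lambda>y. ?E y h)" by simp
    qed
  qed
qed

lemma smooth_on_inverse_family:
  fixes M :: "'c::euclidean_space \<Rightarrow> 'a::euclidean_space \<Rightarrow> 'b::euclidean_space"
  assumes "open S" "\<And>u. smooth_on S (\<lambda>y. M y u)"
    and "\<And>y. y \<in> S \<Longrightarrow> linear (M y)"
    and "\<And>y u. y \<in> S \<Longrightarrow> N y (M y u) = u"
    and "\<And>y v. y \<in> S \<Longrightarrow> M y (N y v) = v"
  shows "smooth_on S (\<lambda>y. N y v)"
  unfolding smooth_on_def
proof
  show "Ck_on k S (\<lambda>y. N y v)" for k
    by (rule Ck_on_inverse_family[where M = M])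
      (use assms(1,3-5) assms(2)[unfolded smooth_on_def] in simp_all)
qed

text \<open>The \<open>C^1\<close> theorem supplies the inverse \<open>g\<close>; smoothness follows
  by bootstrapping. The derivative of \<open>g\<close> at \<open>y\<close> inverts that of
  \<open>f\<close> at \<open>g y\<close>, so if \<open>g\<close> is \<open>Ck_on k\<close>, then by
  \<open>Ck_on_inverse_family\<close> so is its derivative.\<close>

theorem smooth_inverse_function:
  fixes f :: "'a::euclidean_space \<Rightarrow> 'a"
  assumes "open S" "smooth_on S f" "p \<in> S" "inj (frechet_derivative f (at p))"
  obtains U V g where "open U" "U \<subseteq> S" "p \<in> U" "open V" "f ` U = V"
    "\<And>x. x \<in> U \<Longrightarrow> g (f x) = x" "g ` V = U" "\<And>y. y \<in> V \<Longrightarrow> f (g y) = y" "smooth_on V g"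
proof -
  define f' where "f' = (\<lambda>x. Blinfun (frechet_derivative f (at x)))"
  have bl: "bounded_linear (frechet_derivative f (at x))" if "x \<in> S" for x
    using smooth_on_has_derivative[OF assms(2) that] has_derivative_bounded_linear by blast
  have f': "blinfun_apply (f' x) = frechet_derivative f (at x)" if "x \<in> S" for x
    unfolding f'_def using bl[OF that] by (simp add: bounded_linear_Blinfun_apply)
  have 1: "(f has_derivative blinfun_apply (f' x)) (at x)" if "x \<in> S" for x
    using smooth_on_has_derivative[OF assms(2) that] f'[OF that] by simp
  have 2: "continuous_on S f'"
  proof (rule continuous_on_blinfun_componentwise)
    fix i :: 'a
    have "continuous_on S (\<lambda>x. frechet_derivative f (at x) i)"
      using smooth_on_frechet_derivative[OF assms(2)] smooth_on_imp_continuous_on by blast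
    then show "continuous_on S (\<lambda>x. blinfun_apply (f' x) i)"
      by (rule continuous_on_eq) (simp add: f')
  qed
  have lin: "linear (frechet_derivative f (at p))" using bl[OF assms(3)] bounded_linear.linear by blast
  then obtain h where h: "linear h" "h \<circ> frechet_derivative f (at p) = id"
    using linear_injective_left_inverse assms(4) by blast
  have "Blinfun h o\<^sub>L f' p = id_blinfun"
    using h(2) by (intro blinfun_eqI)
      (simp add: f'[OF assms(3)] bounded_linear_Blinfun_apply linear_conv_bounded_linear[THEN iffD1, OF h(1)] pointfree_idE)
  then obtain U V g g' where g: "open U" "U \<subseteq> S" "p \<in> U" "open V" "f p \<in> V" "homeomorphism U V f g"
    "\<And>y. y \<in> V \<Longrightarrow> (g has_derivative (g' y)) (at y)"
    "\<And>y. y \<in> V \<Longrightarrow> g' y = inv (blinfun_apply (f' (g y)))"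
    "\<And>y. y \<in> V \<Longrightarrow> bij (blinfun_apply (f' (g y)))"
    using inverse_function_theorem[OF assms(1) 1 2 assms(3)] by blast
  have gV: "g ` V = U" and fU: "f ` U = V" and gf: "\<And>x. x \<in> U \<Longrightarrow> g (f x) = x"
    and fg: "\<And>y. y \<in> V \<Longrightarrow> f (g y) = y"
    using g(6) unfolding homeomorphism_def by auto
  have gS: "g y \<in> S" if "y \<in> V" for y using that gV g(2) by auto
  have "Ck_on k V g" for k
  proof (induction k)
    case 0
    then show ?case using g(6) unfolding homeomorphism_def by simp
  next
    case (Suc k)
    show ?case
    proof (rule Ck_on_SucI[OF g(4,7)])
      fix v
      show "Ck_on k V (\<lambda>y. g' y v)"
      proof (rule Ck_on_inverse_family[where M = "\<lambda>y. frechet_derivative f (at (g y))"])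
        show "Ck_on k V (\<lambda>y. frechet_derivative f (at (g y)) u)" for u
          using smooth_on_frechet_derivative[OF assms(2)] gS unfolding smooth_on_def
          by (intro Ck_on_compose[OF g(4) assms(1) Suc]) auto
        show "linear (frechet_derivative f (at (g y)))" if "y \<in> V" for y
          using bl[OF gS[OF that]] bounded_linear.linear by blast
        show "g' y (frechet_derivative f (at (g y)) u) = u" if "y \<in> V" for y u
          using g(8,9)[OF that] f'[OF gS[OF that]] by (simp add: bij_is_inj)
        show "frechet_derivative f (at (g y)) (g' y v) = v" if "y \<in> V" for y v
          using g(8,9)[OF that] f'[OF gS[OF that]] by (simp add: bij_is_surj surj_f_inv_f)
      qed (rule g(4))
    qed
  qed
  then show ?thesis
    using that[of U V g] g(1-4) fU gf gV fg unfolding smooth_on_def by blast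
qed

section \<open>Local coordinates of submanifolds and of their quotients\<close>

lemma open_preimage_Collect:
  "open S \<Longrightarrow> continuous_on S f \<Longrightarrow> open T \<Longrightarrow> open {x \<in> S. f x \<in> T}"
  using continuous_open_preimage[of S f T] by (simp add: vimage_def Int_def)

lemma left_inverse_derivative:
  assumes "open S" "x \<in> S" "(f has_derivative f') (at x)" "(g has_derivative g') (at (f x))"
    and "\<And>y. y \<in> S \<Longrightarrow> g (f y) = y"
  shows "g' (f' v) = v"
proof -
  have "((\<lambda>y. g (f y)) has_derivative (\<lambda>v. g' (f' v))) (at x)"
    using has_derivative_compose[OF assms(3,4)] .
  then have "((\<lambda>y. y) has_derivative (\<lambda>v. g' (f' v))) (at x)"
    by (rule has_derivative_transform_within_open[OF _ assms(1,2)]) (rule assms(5))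
  from has_derivative_unique[OF this has_derivative_ident] show ?thesis by metis
qed

lemma second_countable_top_of_set:
  "second_countable (top_of_set (S :: 'a::second_countable_topology set))"
proof (rule second_countable_subtopology)
  obtain B :: "'a set set" where B: "countable B" "topological_basis B"
    using ex_countable_basis by blast
  show "second_countable (euclidean :: 'a topology)"
    unfolding second_countable_def
  proof (intro exI[of _ B] conjI ballI allI impI)
    show "openin euclidean V" if "V \<in> B" for V
      using topological_basis_open[OF B(2) that] by simp
    show "\<exists>V\<in>B. x \<in> V \<and> V \<subseteq> U" if "openin euclidean U \<and> x \<in> U" for U x
      using that B(2) by (meson open_openin topological_basisE)
  qed (rule B(1))
qed

text \<open>The coordinate map is required to be smooth on an open set of the ambient space.
  Transition maps are then compositions of smooth maps between open sets.\<close>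

definition local_coords ::
  "'a::euclidean_space set \<Rightarrow> 'a set \<Rightarrow> ('a \<Rightarrow> 'e::euclidean_space) \<Rightarrow> 'e set \<Rightarrow> ('e \<Rightarrow> 'a) \<Rightarrow> bool" where
  "local_coords Z N \<kappa> W \<psi> \<longleftrightarrow> open N \<and> open W \<and> smooth_on N \<kappa> \<and> smooth_on W \<psi> \<and>
     \<psi> ` W = Z \<inter> N \<and> (\<forall>w\<in>W. \<kappa> (\<psi> w) = w)"

lemma local_coordsD:
  assumes "local_coords Z N \<kappa> W \<psi>"
  shows "open N" "open W" "smooth_on N \<kappa>" "smooth_on W \<psi>" "\<psi> ` W = Z \<inter> N"
    and "\<And>w. w \<in> W \<Longrightarrow> \<kappa> (\<psi> w) = w" "\<And>w. w \<in> W \<Longrightarrow> \<psi> w \<in> Z" "\<And>w. w \<in> W \<Longrightarrow> \<psi> w \<in> N"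
    and "\<And>x. x \<in> Z \<Longrightarrow> x \<in> N \<Longrightarrow> \<kappa> x \<in> W" "\<And>x. x \<in> Z \<Longrightarrow> x \<in> N \<Longrightarrow> \<psi> (\<kappa> x) = x"
    and "\<kappa> ` (Z \<inter> N) = W" "\<And>w. w \<in> W \<Longrightarrow> inv_into (Z \<inter> N) \<kappa> w = \<psi> w"
proof -
  show 1: "open N" "open W" "smooth_on N \<kappa>" "smooth_on W \<psi>" "\<psi> ` W = Z \<inter> N"
    and 2: "\<And>w. w \<in> W \<Longrightarrow> \<kappa> (\<psi> w) = w"
    using assms unfolding local_coords_def by auto
  show 3: "\<And>w. w \<in> W \<Longrightarrow> \<psi> w \<in> Z" "\<And>w. w \<in> W \<Longrightarrow> \<psi> w \<in> N" using 1(5) by auto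
  show 4: "\<kappa> x \<in> W" and 5: "\<psi> (\<kappa> x) = x" if "x \<in> Z" "x \<in> N" for x
  proof -
    have "x \<in> \<psi> ` W" using 1(5) that by simp
    then obtain w where w: "w \<in> W" "x = \<psi> w" by auto
    show "\<kappa> x \<in> W" "\<psi> (\<kappa> x) = x" unfolding w(2) 2[OF w(1)] using w(1) by simp_all
  qed
  show "\<kappa> ` (Z \<inter> N) = W"
  proof
    show "\<kappa> ` (Z \<inter> N) \<subseteq> W" using 4 by auto
    show "W \<subseteq> \<kappa> ` (Z \<inter> N)"
      using 2 3 by (auto intro!: image_eqI[of _ \<kappa> "\<psi> _"])
  qed
  have inj: "inj_on \<kappa> (Z \<inter> N)" by (rule inj_on_inverseI[of _ \<psi>]) (simp add: 5)
  show "inv_into (Z \<inter> N) \<kappa> w = \<psi> w" if "w \<in> W" for w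
    using inv_into_f_f[OF inj, of "\<psi> w"] 2[OF that] 3[OF that] by simp
qed

text \<open>Taking every admissible coordinate system makes the atlas a function of \<open>Z\<close>
  alone, so the same atlas can be named in all later statements.\<close>

definition coord_atlas :: "'a::euclidean_space set \<Rightarrow> ('a, 'e::euclidean_space) chart set" where
  "coord_atlas Z = {(Z \<inter> N, \<kappa>) | N \<kappa> W \<psi>. local_coords Z N \<kappa> W \<psi>}"

lemma coord_chart:
  assumes "local_coords Z N \<kappa> W \<psi>"
  shows "is_chart (top_of_set Z) (Z \<inter> N, \<kappa>)"
proof -
  note lc = local_coordsD[OF assms]
  have "homeomorphic_maps (subtopology (top_of_set Z) (Z \<inter> N)) (top_of_set W) \<kappa> \<psi>"
    unfolding homeomorphic_maps_def subtopology_subtopology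
  proof (intro conjI ballI)
    show "continuous_map (top_of_set (Z \<inter> (Z \<inter> N))) (top_of_set W) \<kappa>"
      using lc(9) continuous_on_subset[OF smooth_on_imp_continuous_on[OF lc(3)]] by auto
    show "continuous_map (top_of_set W) (top_of_set (Z \<inter> (Z \<inter> N))) \<psi>"
      using lc(7,8) smooth_on_imp_continuous_on[OF lc(4)] by auto
  qed (use lc in auto)
  then show ?thesis
    unfolding is_chart_def using lc(1,2,11) homeomorphic_map_maps by (auto simp: openin_open)
qed

theorem embedded_submanifold_coord_atlas:
  fixes Z :: "'a::euclidean_space set"
  assumes "\<And>p. p \<in> Z \<Longrightarrow> \<exists>N (\<kappa> :: 'a \<Rightarrow> 'e::euclidean_space) W \<psi>. p \<in> N \<and> local_coords Z N \<kappa> W \<psi>"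
  shows "embedded_submanifold Z (coord_atlas Z :: ('a, 'e) chart set)"
proof -
  let ?A = "coord_atlas Z :: ('a, 'e) chart set"
  have transition: "smooth_on (\<kappa> ` (Z \<inter> N \<inter> (Z \<inter> N'))) (local_rep (Z \<inter> N, \<kappa>) (Z \<inter> N', \<kappa>') id)"
    if "local_coords Z N \<kappa> W \<psi>" and lc': "open N'" "smooth_on N' \<kappa>'"
    for N N' W \<psi> and \<kappa> :: "'a \<Rightarrow> 'e" and \<kappa>' :: "'a \<Rightarrow> 'f::euclidean_space"
  proof -
    note lc = local_coordsD[OF that(1)]
    let ?S = "{w \<in> W. \<psi> w \<in> N'}"
    have S: "\<kappa> ` (Z \<inter> N \<inter> (Z \<inter> N')) = ?S"
    proof (intro set_eqI iffI)
      show "w \<in> \<kappa> ` (Z \<inter> N \<inter> (Z \<inter> N'))" if "w \<in> ?S" for w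
        using that lc(6,7,8) by (intro image_eqI[of _ _ "\<psi> w"]) auto
    qed (use lc(9,10) in auto)
    have "open ?S"
      by (rule open_preimage_Collect[OF lc(2) smooth_on_imp_continuous_on[OF lc(4)] lc'(1)])
    have "smooth_on ?S (\<lambda>w. \<kappa>' (\<psi> w))"
      by (rule smooth_on_compose[OF \<open>open ?S\<close> lc'(1) smooth_on_subset[OF lc(4)] lc'(2)]) auto
    then show ?thesis
      unfolding S by (rule smooth_on_cong[OF \<open>open ?S\<close>, THEN iffD1, rotated])
        (simp add: local_rep_def lc(12))
  qed
  have "smooth_atlas (top_of_set Z) ?A"
    unfolding smooth_atlas_def
  proof (intro conjI ballI)
    show "is_chart (top_of_set Z) c" if "c \<in> ?A" for c
      using that coord_chart unfolding coord_atlas_def by auto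
    show "(\<Union>c\<in>?A. fst c) = topspace (top_of_set Z)"
    proof
      show "topspace (top_of_set Z) \<subseteq> (\<Union>c\<in>?A. fst c)"
      proof
        fix p assume "p \<in> topspace (top_of_set Z)"
        then have "p \<in> Z" by simp
        then obtain N W \<psi> and \<kappa> :: "'a \<Rightarrow> 'e" where "p \<in> N" "local_coords Z N \<kappa> W \<psi>"
          using assms by blast
        then show "p \<in> (\<Union>c\<in>?A. fst c)"
          using \<open>p \<in> Z\<close> unfolding coord_atlas_def by (intro UN_I[of "(Z \<inter> N, \<kappa>)"]) auto
      qed
    qed (auto simp: coord_atlas_def)
    show "smooth_on (snd c ` (fst c \<inter> fst d)) (local_rep c d id)" if c: "c \<in> ?A" and d: "d \<in> ?A" for c d
    proof -
      obtain N \<kappa> W \<psi> where 1: "c = (Z \<inter> N, \<kappa>)" "local_coords Z N \<kappa> W \<psi>"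
        using c unfolding coord_atlas_def by blast
      obtain N' \<kappa>' W' \<psi>' where 2: "d = (Z \<inter> N', \<kappa>')" "local_coords Z N' \<kappa>' W' \<psi>'"
        using d unfolding coord_atlas_def by blast
      show ?thesis
        using transition[OF 1(2) local_coordsD(1,3)[OF 2(2)]] unfolding 1 2 by simp
    qed
  qed
  moreover have "Hausdorff_space (top_of_set Z)" "second_countable (top_of_set Z)"
    by (simp_all add: Hausdorff_space_subtopology second_countable_top_of_set)
  moreover have "smooth_immersion (top_of_set Z) ?A euclidean {(UNIV, id :: 'a \<Rightarrow> 'a)} id"
    unfolding smooth_immersion_def smooth_map_def
  proof (intro conjI ballI impI)
    show "continuous_map (top_of_set Z) euclidean id" by simp
  next
    fix c :: "('a, 'e) chart" and d :: "('a, 'a) chart"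
    assume "c \<in> ?A" and d: "d \<in> {(UNIV, id)}"
    then obtain N \<kappa> W \<psi> where 1: "c = (Z \<inter> N, \<kappa>)" "local_coords Z N \<kappa> W \<psi>"
      unfolding coord_atlas_def by blast
    note lc = local_coordsD[OF 1(2)]
    have eq: "local_rep c d id w = \<psi> w" if "w \<in> W" for w
      using that d unfolding 1(1) local_rep_def by (simp add: lc(12))
    have S: "snd c ` {x \<in> fst c. id x \<in> fst d} = W"
      using lc(11) d unfolding 1(1) by (simp add: Int_def)
    show "smooth_on (snd c ` {x \<in> fst c. id x \<in> fst d}) (local_rep c d id)"
      unfolding S using lc(4) smooth_on_cong[OF lc(2) eq] by simp
    fix x assume "x \<in> fst c"
    then have w: "\<kappa> x \<in> W" using lc(9) 1(1) by auto
    \<comment> \<open>The derivative of \<open>\<kappa>\<close> is a left inverse of the derivative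
      of \<open>\<psi>\<close>; this is the immersion property.\<close>
    have "frechet_derivative \<kappa> (at (\<psi> (\<kappa> x))) (frechet_derivative \<psi> (at (\<kappa> x)) v) = v" for v
      by (rule left_inverse_derivative[OF lc(2) w smooth_on_has_derivative[OF lc(4) w]
            smooth_on_has_derivative[OF lc(3) lc(8)[OF w]] lc(6)])
    then have "inj (frechet_derivative \<psi> (at (\<kappa> x)))"
      by (rule inj_on_inverseI)
    then show "inj (frechet_derivative (local_rep c d id) (at (snd c x)))"
      using frechet_derivative_cong_open[OF lc(2) w eq] 1(1) by simp
  qed
  ultimately show ?thesis
    unfolding embedded_submanifold_def smooth_manifold_def by blast
qed

section \<open>Coordinates and charts of quotients\<close>

text \<open>\<open>(P, \<beta>)\<close> describes coordinates of the quotient of \<open>Z\<close> by the fibres of \<open>q\<close> on the saturated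
  open set \<open>P\<close>: \<open>\<beta>\<close> separates the fibres and has a smooth section through every point.\<close>

definition quotient_coords ::
  "'a::euclidean_space set \<Rightarrow> ('a \<Rightarrow> 'q) \<Rightarrow> 'a set \<Rightarrow> ('a \<Rightarrow> 'f::euclidean_space) \<Rightarrow> bool" where
  "quotient_coords Z q P \<beta> \<longleftrightarrow> P \<noteq> {} \<and> P \<subseteq> Z \<and> open (\<beta> ` P) \<and>
     (\<forall>x\<in>P. \<forall>y\<in>Z. q x = q y \<longrightarrow> y \<in> P \<and> \<beta> x = \<beta> y) \<and>
     (\<forall>x\<in>P. \<forall>y\<in>P. \<beta> x = \<beta> y \<longrightarrow> q x = q y) \<and>
     (\<forall>x\<in>P. \<exists>N \<beta>'. open N \<and> x \<in> N \<and> Z \<inter> N \<subseteq> P \<and> smooth_on N \<beta>' \<and> (\<forall>y\<in>Z \<inter> N. \<beta>' y = \<beta> y)) \<and>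
     (\<forall>x\<in>P. \<exists>\<sigma>. smooth_on (\<beta> ` P) \<sigma> \<and> \<sigma> ` \<beta> ` P \<subseteq> P \<and> (\<forall>b\<in>\<beta> ` P. \<beta> (\<sigma> b) = b) \<and> \<sigma> (\<beta> x) = x)"

text \<open>The representative is chosen arbitrarily; constancy of \<open>\<beta>\<close> on fibres
  makes the choice immaterial (\<open>quotient_chart_apply\<close>).\<close>

definition quotient_chart ::
  "('a \<Rightarrow> 'q) \<Rightarrow> 'a set \<Rightarrow> ('a \<Rightarrow> 'f::euclidean_space) \<Rightarrow> ('q, 'f) chart" where
  "quotient_chart q P \<beta> = (q ` P, \<lambda>c. \<beta> (SOME x. x \<in> P \<and> q x = c))"

definition quotient_atlas ::
  "'a::euclidean_space set \<Rightarrow> ('a \<Rightarrow> 'q) \<Rightarrow> ('q, 'f::euclidean_space) chart set" where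
  "quotient_atlas Z q = {quotient_chart q P \<beta> | P \<beta>. quotient_coords Z q P \<beta>}"

lemma quotient_coordsD:
  assumes "quotient_coords Z q P \<beta>"
  shows "P \<noteq> {}" "P \<subseteq> Z" "open (\<beta> ` P)" "\<And>x y. x \<in> P \<Longrightarrow> y \<in> Z \<Longrightarrow> q x = q y \<Longrightarrow> y \<in> P"
    and "\<And>x y. x \<in> P \<Longrightarrow> y \<in> Z \<Longrightarrow> q x = q y \<Longrightarrow> \<beta> x = \<beta> y"
    and "\<And>x y. x \<in> P \<Longrightarrow> y \<in> P \<Longrightarrow> \<beta> x = \<beta> y \<Longrightarrow> q x = q y"
    and "\<And>x. x \<in> P \<Longrightarrow> \<exists>N \<beta>'. open N \<and> x \<in> N \<and> Z \<inter> N \<subseteq> P \<and> smooth_on N \<beta>' \<and> (\<forall>y\<in>Z \<inter> N. \<beta>' y = \<beta> y)"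
    and "\<And>x. x \<in> P \<Longrightarrow> \<exists>\<sigma>. smooth_on (\<beta> ` P) \<sigma> \<and> \<sigma> ` \<beta> ` P \<subseteq> P \<and> (\<forall>b\<in>\<beta> ` P. \<beta> (\<sigma> b) = b) \<and> \<sigma> (\<beta> x) = x"
  using assms unfolding quotient_coords_def by blast+

lemma quotient_chart_apply:
  assumes "quotient_coords Z q P \<beta>" "x \<in> P"
  shows "snd (quotient_chart q P \<beta>) (q x) = \<beta> x"
proof -
  have "\<exists>y. y \<in> P \<and> q y = q x" using assms(2) by blast
  then have "(SOME y. y \<in> P \<and> q y = q x) \<in> P \<and> q (SOME y. y \<in> P \<and> q y = q x) = q x"
    by (rule someI_ex)
  then have "\<beta> (SOME y. y \<in> P \<and> q y = q x) = \<beta> x"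
    using quotient_coordsD(2,5)[OF assms(1)] assms(2) by blast
  then show ?thesis unfolding quotient_chart_def by simp
qed

lemma quotient_chart_inverse:
  assumes qc: "quotient_coords Z q P \<beta>" and "x \<in> P" and "b = \<beta> x"
  shows "inv_into (q ` P) (snd (quotient_chart q P \<beta>)) b = q x"
proof -
  have inj: "inj_on (snd (quotient_chart q P \<beta>)) (q ` P)"
  proof (rule inj_onI)
    fix c d assume "c \<in> q ` P" "d \<in> q ` P" and eq: "snd (quotient_chart q P \<beta>) c = snd (quotient_chart q P \<beta>) d"
    then obtain y z where "c = q y" "y \<in> P" "d = q z" "z \<in> P" by blast
    then show "c = d" using eq quotient_chart_apply[OF qc] quotient_coordsD(6)[OF qc] by metis
  qed
  show ?thesis
    using inv_into_f_f[OF inj, of "q x"] assms(2,3) quotient_chart_apply[OF qc assms(2)] by simp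
qed

lemma quotient_coords_openin:
  assumes qc: "quotient_coords Z q P \<beta>" and "open V"
  shows "openin (top_of_set Z) {x \<in> P. \<beta> x \<in> V}"
proof (subst openin_subopen, intro ballI)
  fix x assume x: "x \<in> {x \<in> P. \<beta> x \<in> V}"
  then obtain N \<beta>' where N: "open N" "x \<in> N" "Z \<inter> N \<subseteq> P" "smooth_on N \<beta>'" "\<forall>y\<in>Z \<inter> N. \<beta>' y = \<beta> y"
    using quotient_coordsD(7)[OF qc] by blast
  have "open {y \<in> N. \<beta>' y \<in> V}"
    by (rule open_preimage_Collect[OF N(1) smooth_on_imp_continuous_on[OF N(4)] assms(2)])
  then have "openin (top_of_set Z) (Z \<inter> {y \<in> N. \<beta>' y \<in> V})" by (rule openin_open_Int)
  moreover have "x \<in> Z \<inter> {y \<in> N. \<beta>' y \<in> V}"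
    using x N(2,5) quotient_coordsD(2)[OF qc] by auto
  moreover have "Z \<inter> {y \<in> N. \<beta>' y \<in> V} \<subseteq> {x \<in> P. \<beta> x \<in> V}" using N(3,5) by auto
  ultimately show "\<exists>T. openin (top_of_set Z) T \<and> x \<in> T \<and> T \<subseteq> {x \<in> P. \<beta> x \<in> V}" by blast
qed

text \<open>Openness of the domain and continuity of the chart are statements about saturated sets
  in \<open>Z\<close> and follow from the local smooth extensions of \<open>\<beta>\<close>. The
  inverse is \<open>q\<close> composed with a smooth section, hence continuous.\<close>

lemma quotient_chart_is_chart:
  assumes qm: "quotient_map (top_of_set Z) X q" and qc: "quotient_coords Z q P \<beta>"
  shows "is_chart X (quotient_chart q P \<beta>)"
proof -
  note D = quotient_coordsD[OF qc]
  let ?\<phi> = "snd (quotient_chart q P \<beta>)"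
  have img: "?\<phi> ` q ` P = \<beta> ` P"
    using quotient_chart_apply[OF qc] by (simp add: image_image cong: image_cong)
  have topX: "topspace X = q ` Z" using quotient_imp_surjective_map[OF qm] by simp
  have op: "openin X {c \<in> q ` P. ?\<phi> c \<in> V}" if "open V" for V
  proof -
    have "{x \<in> Z. q x \<in> {c \<in> q ` P. ?\<phi> c \<in> V}} = {x \<in> P. \<beta> x \<in> V}"
    proof (intro set_eqI iffI)
      fix x assume "x \<in> {x \<in> Z. q x \<in> {c \<in> q ` P. ?\<phi> c \<in> V}}"
      then obtain y where "x \<in> Z" "y \<in> P" "q x = q y" "?\<phi> (q x) \<in> V" by auto
      then show "x \<in> {x \<in> P. \<beta> x \<in> V}"
        using D(4)[of y x] quotient_chart_apply[OF qc, of x] by simp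
    next
      fix x assume "x \<in> {x \<in> P. \<beta> x \<in> V}"
      then show "x \<in> {x \<in> Z. q x \<in> {c \<in> q ` P. ?\<phi> c \<in> V}}"
        using D(2) quotient_chart_apply[OF qc, of x] by auto
    qed
    then have "openin (top_of_set Z) {x \<in> topspace (top_of_set Z). q x \<in> {c \<in> q ` P. ?\<phi> c \<in> V}}"
      using quotient_coords_openin[OF qc that] by simp
    moreover have "{c \<in> q ` P. ?\<phi> c \<in> V} \<subseteq> topspace X" using D(2) unfolding topX by auto
    ultimately show ?thesis using qm unfolding quotient_map_def by blast
  qed
  have opP: "openin X (q ` P)" using op[of UNIV] by simp
  have tq: "topspace X \<inter> q ` P = q ` P" using openin_subset[OF opP] by blast
  have mem: "?\<phi> c \<in> \<beta> ` P" if "c \<in> q ` P" for c using img that by blast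
  obtain x0 where "x0 \<in> P" using D(1) by blast
  then obtain \<sigma> where \<sigma>: "smooth_on (\<beta> ` P) \<sigma>" "\<sigma> ` \<beta> ` P \<subseteq> P" "\<forall>b\<in>\<beta> ` P. \<beta> (\<sigma> b) = b"
    using D(8) by blast
  have "homeomorphic_maps (subtopology X (q ` P)) (top_of_set (\<beta> ` P)) ?\<phi> (\<lambda>b. q (\<sigma> b))"
    unfolding homeomorphic_maps_def
  proof (intro conjI ballI)
    show "continuous_map (subtopology X (q ` P)) (top_of_set (\<beta> ` P)) ?\<phi>"
      unfolding continuous_map_def
    proof (intro conjI allI impI)
      show "?\<phi> \<in> topspace (subtopology X (q ` P)) \<rightarrow> topspace (top_of_set (\<beta> ` P))"
        using img by auto
      fix V assume "openin (top_of_set (\<beta> ` P)) V"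
      then obtain V' where V': "open V'" "V = \<beta> ` P \<inter> V'" by (auto simp: openin_open)
      have "{x \<in> topspace (subtopology X (q ` P)). ?\<phi> x \<in> V} = q ` P \<inter> {c \<in> q ` P. ?\<phi> c \<in> V'}"
        using mem tq unfolding V'(2) topspace_subtopology by blast
      then show "openin (subtopology X (q ` P)) {x \<in> topspace (subtopology X (q ` P)). ?\<phi> x \<in> V}"
        using openin_subtopology_Int2[OF op[OF V'(1)]] by simp
    qed
    have "continuous_map (top_of_set (\<beta> ` P)) (top_of_set Z) \<sigma>"
      using \<sigma>(2) D(2) smooth_on_imp_continuous_on[OF \<sigma>(1)] by auto
    then have "continuous_map (top_of_set (\<beta> ` P)) X (q \<circ> \<sigma>)"
      using continuous_map_compose quotient_imp_continuous_map[OF qm] by blast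
    then show "continuous_map (top_of_set (\<beta> ` P)) (subtopology X (q ` P)) (\<lambda>b. q (\<sigma> b))"
      using \<sigma>(2) by (auto simp: continuous_map_in_subtopology comp_def)
    show "q (\<sigma> (?\<phi> c)) = c" if c: "c \<in> topspace (subtopology X (q ` P))" for c
    proof -
      obtain x where x: "x \<in> P" "c = q x" using c unfolding topspace_subtopology by blast
      then have "?\<phi> c = \<beta> x" using quotient_chart_apply[OF qc] by blast
      moreover have "\<sigma> (\<beta> x) \<in> P" "\<beta> (\<sigma> (\<beta> x)) = \<beta> x" using \<sigma>(2,3) x(1) by auto
      ultimately show ?thesis using D(6)[of "\<sigma> (\<beta> x)" x] x by simp
    qed
    show "?\<phi> (q (\<sigma> b)) = b" if "b \<in> topspace (top_of_set (\<beta> ` P))" for b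
    proof -
      have "\<sigma> b \<in> P" "\<beta> (\<sigma> b) = b" using that \<sigma>(2,3) by auto
      then show ?thesis using quotient_chart_apply[OF qc] by metis
    qed
  qed
  then have "homeomorphic_map (subtopology X (q ` P)) (top_of_set (\<beta> ` P)) ?\<phi>"
    using homeomorphic_map_maps by blast
  then show ?thesis
    unfolding is_chart_def case_prod_beta
    using opP D(3) img by (simp add: quotient_chart_def)
qed

text \<open>Serves twice: with a section of another chart it gives smooth transition maps, with the
  parametrization \<open>\<psi>\<close> of \<open>Z\<close> it gives smoothness of the
  projection.\<close>

lemma quotient_coords_section_local:
  assumes qc: "quotient_coords Z q P \<beta>" and S: "open S" and \<sigma>: "smooth_on S \<sigma>"
    and "s \<in> S" "\<sigma> s \<in> P" and inZ: "\<And>s. s \<in> S \<Longrightarrow> \<sigma> s \<in> Z"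
  obtains T where "open T" "s \<in> T" "T \<subseteq> S" "\<And>t. t \<in> T \<Longrightarrow> \<sigma> t \<in> P" "smooth_on T (\<lambda>t. \<beta> (\<sigma> t))"
proof -
  obtain N \<beta>' where N: "open N" "\<sigma> s \<in> N" "Z \<inter> N \<subseteq> P" "smooth_on N \<beta>'" "\<forall>y\<in>Z \<inter> N. \<beta>' y = \<beta> y"
    using quotient_coordsD(7)[OF qc assms(5)] by blast
  let ?T = "{t \<in> S. \<sigma> t \<in> N}"
  have T: "open ?T" by (rule open_preimage_Collect[OF S smooth_on_imp_continuous_on[OF \<sigma>] N(1)])
  have "smooth_on ?T (\<lambda>t. \<beta>' (\<sigma> t))"
    by (rule smooth_on_compose[OF T N(1) smooth_on_subset[OF \<sigma>] N(4)]) auto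
  then have "smooth_on ?T (\<lambda>t. \<beta> (\<sigma> t))"
    by (rule smooth_on_cong[OF T, THEN iffD1, rotated]) (use N(5) inZ in auto)
  then show ?thesis using that[of ?T] T N(2,3) assms(4) inZ by auto
qed

theorem quotient_manifold:
  fixes Z :: "'a::euclidean_space set" and q :: "'a \<Rightarrow> 'q"
  assumes qm: "quotient_map (top_of_set Z) X q" and "Hausdorff_space X" "second_countable X"
    and cov: "\<And>p. p \<in> Z \<Longrightarrow> \<exists>P (\<beta> :: 'a \<Rightarrow> 'f::euclidean_space). p \<in> P \<and> quotient_coords Z q P \<beta>"
  shows "smooth_manifold X (quotient_atlas Z q :: ('q, 'f) chart set)"
    and "smooth_submersion (top_of_set Z) (coord_atlas Z :: ('a, 'e::euclidean_space) chart set) X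
      (quotient_atlas Z q :: ('q, 'f) chart set) q"
proof -
  let ?C = "quotient_atlas Z q :: ('q, 'f) chart set"
  have C: "\<exists>P \<beta>. c = quotient_chart q P \<beta> \<and> quotient_coords Z q P \<beta>" if "c \<in> ?C" for c
    using that unfolding quotient_atlas_def by blast
  have topX: "topspace X = q ` Z" using quotient_imp_surjective_map[OF qm] by simp
  have "smooth_atlas X ?C"
    unfolding smooth_atlas_def
  proof (intro conjI ballI)
    show "is_chart X c" if "c \<in> ?C" for c
      using C[OF that] quotient_chart_is_chart[OF qm] by blast
    show "(\<Union>c\<in>?C. fst c) = topspace X"
    proof
      show "(\<Union>c\<in>?C. fst c) \<subseteq> topspace X"
      proof (rule UN_least)
        fix c assume "c \<in> ?C"
        then obtain P \<beta> where c: "c = quotient_chart q P \<beta>" "quotient_coords Z q P \<beta>"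
          using C by meson
        show "fst c \<subseteq> topspace X"
          unfolding c(1) topX quotient_chart_def fst_conv
          by (rule image_mono[OF quotient_coordsD(2)[OF c(2)]])
      qed
      show "topspace X \<subseteq> (\<Union>c\<in>?C. fst c)"
      proof
        fix c assume "c \<in> topspace X"
        then obtain p where "p \<in> Z" "c = q p" unfolding topX by blast
        moreover from this obtain P and \<beta> :: "'a \<Rightarrow> 'f" where "p \<in> P" "quotient_coords Z q P \<beta>"
          using cov by blast
        ultimately show "c \<in> (\<Union>c\<in>?C. fst c)"
        proof (intro UN_I[of "quotient_chart q P \<beta>"])
          show "quotient_chart q P \<beta> \<in> ?C"
            using \<open>quotient_coords Z q P \<beta>\<close> unfolding quotient_atlas_def by blast
        qed (simp add: quotient_chart_def)
      qed
    qed
    fix c d assume "c \<in> ?C" "d \<in> ?C"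
    then obtain P \<beta> P' \<beta>' where c: "c = quotient_chart q P \<beta>" "quotient_coords Z q P \<beta>"
      and d: "d = quotient_chart q P' \<beta>'" "quotient_coords Z q P' \<beta>'"
      using C by meson
    note D = quotient_coordsD[OF c(2)] and D' = quotient_coordsD[OF d(2)]
    have fst: "fst c = q ` P" "fst d = q ` P'" unfolding c d quotient_chart_def by simp_all
    show "smooth_on (snd c ` (fst c \<inter> fst d)) (local_rep c d id)"
    proof (rule smooth_on_local)
      fix b assume "b \<in> snd c ` (fst c \<inter> fst d)"
      then obtain x y where x: "x \<in> P" "y \<in> P'" "q x = q y" "b = snd c (q x)"
        unfolding fst by auto
      have b: "b = \<beta> x" using x(1,4) quotient_chart_apply[OF c(2)] c(1) by simp
      have xP': "x \<in> P'" using D'(4)[OF x(2), of x] x(1,3) D(2) by auto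
      obtain \<sigma> where \<sigma>: "smooth_on (\<beta> ` P) \<sigma>" "\<sigma> ` \<beta> ` P \<subseteq> P" "\<forall>b\<in>\<beta> ` P. \<beta> (\<sigma> b) = b" "\<sigma> (\<beta> x) = x"
        using D(8)[OF x(1)] by blast
      have "b \<in> \<beta> ` P" "\<sigma> b \<in> P'" using b x(1) \<sigma>(4) xP' by auto
      moreover have "\<sigma> s \<in> Z" if "s \<in> \<beta> ` P" for s using that \<sigma>(2) D(2) by blast
      ultimately obtain T where T: "open T" "b \<in> T" "T \<subseteq> \<beta> ` P" "\<And>t. t \<in> T \<Longrightarrow> \<sigma> t \<in> P'"
        "smooth_on T (\<lambda>t. \<beta>' (\<sigma> t))"
        using quotient_coords_section_local[OF d(2) D(3) \<sigma>(1)] by metis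
      have "smooth_on T (local_rep c d id)"
      proof (rule smooth_on_cong[OF T(1), THEN iffD1, OF _ T(5)])
        fix t assume t: "t \<in> T"
        then have t': "\<sigma> t \<in> P" "t = \<beta> (\<sigma> t)" using T(3) \<sigma>(2,3) by auto
        have "inv_into (fst c) (snd c) t = q (\<sigma> t)"
          unfolding fst using quotient_chart_inverse[OF c(2) t'] c(1) by simp
        then show "\<beta>' (\<sigma> t) = local_rep c d id t"
          unfolding local_rep_def using quotient_chart_apply[OF d(2) T(4)[OF t]] d(1) by simp
      qed
      then show "\<exists>T. open T \<and> b \<in> T \<and> smooth_on T (local_rep c d id)" using T(1,2) by blast
    qed
  qed
  then show "smooth_manifold X ?C"
    unfolding smooth_manifold_def using assms(2,3) by blast
  \<comment> \<open>On a small enough domain the projection, read in the two kinds of charts, is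
    \<open>\<beta>\<close> after \<open>\<psi>\<close>.\<close>
  have key: "\<exists>T. open T \<and> \<kappa> x \<in> T \<and> smooth_on T (local_rep c d q) \<and>
      (\<forall>t\<in>T. \<psi> t \<in> P \<and> local_rep c d q t = \<beta> (\<psi> t)) \<and> T \<subseteq> W"
    if c: "c = (Z \<inter> N, \<kappa>)" and lc: "local_coords Z N \<kappa> W \<psi>"
      and d: "d = quotient_chart q P \<beta>" and qc: "quotient_coords Z q P \<beta>" and x: "x \<in> P" "x \<in> N"
    for c :: "('a, 'e) chart" and d :: "('q, 'f) chart" and N \<kappa> W \<psi> P \<beta> x
  proof -
    note L = local_coordsD[OF lc]
    have xZ: "x \<in> Z" using x quotient_coordsD(2)[OF qc] by auto
    obtain T where T: "open T" "\<kappa> x \<in> T" "T \<subseteq> W" "\<And>t. t \<in> T \<Longrightarrow> \<psi> t \<in> P" "smooth_on T (\<lambda>t. \<beta> (\<psi> t))"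
      using quotient_coords_section_local[OF qc L(2,4) L(9)[OF xZ x(2)]] L(7) L(10)[OF xZ x(2)] x(1)
      by metis
    have eq: "local_rep c d q t = \<beta> (\<psi> t)" if "t \<in> T" for t
      using that T(3) quotient_chart_apply[OF qc T(4)[OF that]] L(12)
      unfolding local_rep_def c d by auto
    have "smooth_on T (local_rep c d q)"
      by (rule smooth_on_cong[OF T(1), THEN iffD2, OF _ T(5)]) (rule eq)
    then show ?thesis using T(1-4) eq by blast
  qed
  show "smooth_submersion (top_of_set Z) (coord_atlas Z :: ('a, 'e) chart set) X ?C q"
    unfolding smooth_submersion_def smooth_map_def
  proof (intro conjI ballI impI)
    show "continuous_map (top_of_set Z) X q" by (rule quotient_imp_continuous_map[OF qm])
  next
    fix c :: "('a, 'e) chart" and d :: "('q, 'f) chart"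
    assume "c \<in> coord_atlas Z" "d \<in> ?C"
    then obtain N \<kappa> W \<psi> P \<beta> where c: "c = (Z \<inter> N, \<kappa>)" "local_coords Z N \<kappa> W \<psi>"
      and d: "d = quotient_chart q P \<beta>" "quotient_coords Z q P \<beta>"
      using C[of d] unfolding coord_atlas_def by blast
    note L = local_coordsD[OF c(2)] and D = quotient_coordsD[OF d(2)]
    have mem: "x \<in> P" if x: "x \<in> fst c" "q x \<in> fst d" for x
    proof -
      obtain y where "y \<in> P" "q x = q y" using x(2) unfolding d quotient_chart_def by auto
      then show ?thesis using D(4)[of y x] x(1) unfolding c(1) by simp
    qed
    show "smooth_on (snd c ` {x \<in> fst c. q x \<in> fst d}) (local_rep c d q)"
    proof (rule smooth_on_local)
      fix w assume "w \<in> snd c ` {x \<in> fst c. q x \<in> fst d}"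
      then obtain x where x: "x \<in> fst c" "q x \<in> fst d" "w = \<kappa> x" unfolding c by auto
      show "\<exists>T. open T \<and> w \<in> T \<and> smooth_on T (local_rep c d q)"
        using key[OF c d mem[OF x(1,2)]] x(1,3) unfolding c(1) by auto
    qed
    fix x assume x: "x \<in> fst c" "q x \<in> fst d"
    have xP: "x \<in> P" "x \<in> N" using mem[OF x] x(1) unfolding c(1) by auto
    obtain T where T: "open T" "\<kappa> x \<in> T" "smooth_on T (local_rep c d q)"
      "\<And>t. t \<in> T \<Longrightarrow> \<psi> t \<in> P" "\<And>t. t \<in> T \<Longrightarrow> local_rep c d q t = \<beta> (\<psi> t)" "T \<subseteq> W"
      using key[OF c d xP] by blast
    obtain \<sigma> where \<sigma>: "smooth_on (\<beta> ` P) \<sigma>" "\<sigma> ` \<beta> ` P \<subseteq> P" "\<forall>b\<in>\<beta> ` P. \<beta> (\<sigma> b) = b" "\<sigma> (\<beta> x) = x"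
      using D(8)[OF xP(1)] by blast
    \<comment> \<open>Where the section stays in the domain of \<open>\<kappa>\<close>, the map
      \<open>\<kappa>\<close> after \<open>\<sigma>\<close> is a smooth right inverse of the
      projection in coordinates. Since the section passes through \<open>x\<close>, differentiating
      there gives surjectivity.\<close>
    let ?S = "{b \<in> \<beta> ` P. \<sigma> b \<in> N}"
    have S: "open ?S" by (rule open_preimage_Collect[OF D(3) smooth_on_imp_continuous_on[OF \<sigma>(1)] L(1)])
    have \<kappa>\<sigma>: "smooth_on ?S (\<lambda>b. \<kappa> (\<sigma> b))"
      by (rule smooth_on_compose[OF S L(1) smooth_on_subset[OF \<sigma>(1)] L(3)]) auto
    let ?R = "{b \<in> ?S. \<kappa> (\<sigma> b) \<in> T}"
    have R: "open ?R" by (rule open_preimage_Collect[OF S smooth_on_imp_continuous_on[OF \<kappa>\<sigma>] T(1)])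
    have bR: "\<beta> x \<in> ?R" using \<sigma>(4) xP T(2) by auto
    have inv: "local_rep c d q (\<kappa> (\<sigma> b)) = b" if "b \<in> ?R" for b
    proof -
      have "\<sigma> b \<in> Z" "\<sigma> b \<in> N" using that \<sigma>(2) D(2) by auto
      moreover have "\<beta> (\<sigma> b) = b" using that \<sigma>(3) by blast
      ultimately show ?thesis using T(5)[of "\<kappa> (\<sigma> b)"] that L(10)[of "\<sigma> b"] by simp
    qed
    have "frechet_derivative (local_rep c d q) (at (\<kappa> x))
        (frechet_derivative (\<lambda>b. \<kappa> (\<sigma> b)) (at (\<beta> x)) v) = v" for v
      by (rule left_inverse_derivative[OF R bR smooth_on_has_derivative[OF \<kappa>\<sigma>] _ inv])
        (use bR smooth_on_has_derivative[OF T(3,2)] \<sigma>(4) in auto)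
    then have "surj (frechet_derivative (local_rep c d q) (at (\<kappa> x)))"
      by (rule surjI)
    then show "surj (frechet_derivative (local_rep c d q) (at (snd c x)))"
      unfolding c(1) snd_conv .
  qed
qed

section \<open>Regular level sets\<close>

lemma rank_nullity_subspace:
  fixes f :: "'a::euclidean_space \<Rightarrow> 'b::euclidean_space"
  assumes f: "linear f" and S: "subspace S"
  shows "dim S = dim (f ` S) + dim {x \<in> S. f x = 0}"
proof -
  obtain g where g: "g ` UNIV \<subseteq> S" "linear g" "\<And>y. y \<in> f ` S \<Longrightarrow> f (g y) = y"
    using linear_exists_right_inverse_on[OF f S] by blast
  let ?T = "g ` f ` S" and ?K = "{x \<in> S. f x = 0}"
  have T: "subspace ?T" by (rule linear_subspace_image[OF g(2) linear_subspace_image[OF f S]])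
  have "{x \<in> S. f x = 0} = S \<inter> {x. f x = 0}" by auto
  then have K: "subspace ?K" using subspace_inter[OF S linear_subspace_kernel[OF f]] by simp
  have "inj_on g (f ` S)" using g(3) by (rule inj_on_inverseI)
  then have "inj_on g (span (f ` S))"
    using linear_subspace_image[OF f S] by (simp add: span_eq_iff[THEN iffD2])
  then have "dim ?T = dim (f ` S)" by (rule dim_image_eq[OF g(2)])
  moreover have "?T \<inter> ?K = {0}"
  proof -
    have "x = 0" if "x \<in> ?T" "f x = 0" for x
    proof -
      obtain y where "y \<in> f ` S" "x = g y" using \<open>x \<in> ?T\<close> by auto
      then show ?thesis using g(3)[of y] linear_0[OF g(2)] \<open>f x = 0\<close> by simp
    qed
    then show ?thesis using subspace_0[OF T] subspace_0[OF K] by auto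
  qed
  moreover have "{x + y | x y. x \<in> ?T \<and> y \<in> ?K} = S"
  proof
    show "{x + y | x y. x \<in> ?T \<and> y \<in> ?K} \<subseteq> S"
      using g(1) subspace_add[OF S] by auto
    show "S \<subseteq> {x + y | x y. x \<in> ?T \<and> y \<in> ?K}"
    proof
      fix x assume x: "x \<in> S"
      have "f (x - g (f x)) = 0" using g(3)[of "f x"] x by (simp add: linear_diff[OF f])
      moreover have "x - g (f x) \<in> S" using g(1) x subspace_diff[OF S] by auto
      moreover have "x = g (f x) + (x - g (f x))" by simp
      ultimately show "x \<in> {x + y | x y. x \<in> ?T \<and> y \<in> ?K}" using x by blast
    qed
  qed
  ultimately show ?thesis using dim_sums_Int[OF T K] by simp
qed

lemma linear_parametrization:
  fixes S :: "'a::euclidean_space set"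
  assumes "subspace S" "dim S = DIM('e::euclidean_space)"
  obtains L :: "'e::euclidean_space \<Rightarrow> 'a" and L' where "linear L" "linear L'" "range L = S" "\<And>e. L' (L e) = e"
proof -
  have "dim (UNIV :: 'e set) = dim S" using assms(2) by simp
  then show ?thesis
  proof (rule isometries_subspaces[OF subspace_UNIV assms(1)])
    fix L :: "'e \<Rightarrow> 'a" and L'
    assume "linear L" "linear L'" "range L = S" "\<And>x. x \<in> UNIV \<Longrightarrow> L' (L x) = x"
    then show ?thesis using that[of L L'] by simp
  qed
qed

text \<open>With a right inverse \<open>R\<close> of \<open>D\<close> on its range, \<open>\<Theta> x = x - p - R (D (x - p)) + R (\<Psi> x)\<close> has the identity
  as derivative at \<open>p\<close> and satisfies \<open>D (\<Theta> x) = \<Psi> x\<close>, so it straightens the level set to the kernel of \<open>D\<close>.\<close>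

theorem regular_level_set:
  fixes \<Psi> :: "'a::euclidean_space \<Rightarrow> 'b::euclidean_space"
  assumes "open S" "p \<in> S" "smooth_on S \<Psi>" and Z: "Z \<inter> S = {x \<in> S. \<Psi> x = 0}" and "p \<in> Z"
    and D: "(\<Psi> has_derivative D) (at p)"
    and range: "\<And>x. x \<in> S \<Longrightarrow> \<Psi> x \<in> range D"
    and dim: "dim {v. D v = 0} = DIM('e::euclidean_space)"
  obtains N and \<kappa> :: "'a \<Rightarrow> 'e::euclidean_space" and W \<psi> where "p \<in> N" "local_coords Z N \<kappa> W \<psi>"
proof -
  have linD: "linear D" using D has_derivative_linear by blast
  obtain R where R: "linear R" "\<And>y. y \<in> range D \<Longrightarrow> D (R y) = y"
    using linear_exists_right_inverse_on[OF linD subspace_UNIV] by blast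
  obtain L :: "'e \<Rightarrow> 'a" and L' where L: "linear L" "linear L'" "range L = {v. D v = 0}" "\<And>e. L' (L e) = e"
    using linear_parametrization[OF linear_subspace_kernel[OF linD] dim] by blast
  define \<Theta> where "\<Theta> = (\<lambda>x. (x - p) - R (D (x - p)) + R (\<Psi> x))"
  \<comment> \<open>The assumption \<open>range\<close> is what makes this hold without
    \<open>D\<close> being onto: the values of \<open>\<Psi>\<close> may lie in a proper subspace,
    as the symmetric matrices do in the application.\<close>
  have D\<Theta>: "D (\<Theta> x) = \<Psi> x" if "x \<in> S" for x
    unfolding \<Theta>_def linear_add[OF linD] linear_diff[OF linD, of "_ - _"]
    using R(2)[OF range[OF that]] R(2)[OF rangeI[of D "x - p"]] by simp
  have smooth: "smooth_on S \<Theta>"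
    unfolding \<Theta>_def
    by (intro smooth_on_add smooth_on_diff smooth_on_linear_compose[OF assms(1) R(1)]
        smooth_on_linear_compose[OF assms(1) linD] assms(1,3) smooth_on_ident smooth_on_const)
  have blR: "bounded_linear R" and blD: "bounded_linear D"
    using R(1) linD linear_conv_bounded_linear by blast+
  have "(\<Theta> has_derivative (\<lambda>v. (v - 0) - R (D (v - 0)) + R (D v))) (at p)"
    unfolding \<Theta>_def
    by (intro has_derivative_add has_derivative_diff has_derivative_ident has_derivative_const D
        bounded_linear.has_derivative[OF blR] bounded_linear.has_derivative[OF blD])
  then have "(\<Theta> has_derivative (\<lambda>v. v)) (at p)" by simp
  then have "inj (frechet_derivative \<Theta> (at p))" by (simp add: frechet_derivative_at[symmetric] inj_on_def)
  then obtain U V g where UV: "open U" "U \<subseteq> S" "p \<in> U" "open V" "\<Theta> ` U = V"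
    "\<And>x. x \<in> U \<Longrightarrow> g (\<Theta> x) = x" "g ` V = U" "\<And>y. y \<in> V \<Longrightarrow> \<Theta> (g y) = y" "smooth_on V g"
    using smooth_inverse_function[OF assms(1) smooth assms(2)] by metis
  define W where "W = {e. L e \<in> V}"
  have W: "open W"
    using open_preimage_Collect[OF open_UNIV linear_continuous_on UV(4), of L] L(1)
      linear_conv_bounded_linear unfolding W_def by auto
  have "local_coords Z U (\<lambda>x. L' (\<Theta> x)) W (\<lambda>e. g (L e))"
    unfolding local_coords_def
  proof (intro conjI ballI)
    show "smooth_on U (\<lambda>x. L' (\<Theta> x))"
      by (rule smooth_on_linear_compose[OF UV(1) L(2) smooth_on_subset[OF smooth UV(2)]])
    show "smooth_on W (\<lambda>e. g (L e))"
      by (rule smooth_on_compose[OF W UV(4) smooth_on_linear[OF L(1)] UV(9)]) (auto simp: W_def)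
    show "L' (\<Theta> (g (L w))) = w" if "w \<in> W" for w
      using that UV(8) L(4) unfolding W_def by simp
    show "(\<lambda>e. g (L e)) ` W = Z \<inter> U"
    proof (intro set_eqI iffI)
      fix x assume "x \<in> (\<lambda>e. g (L e)) ` W"
      then obtain e where e: "L e \<in> V" "x = g (L e)" unfolding W_def by auto
      have xU: "x \<in> U" using e UV(7) by auto
      have "\<Psi> x = D (L e)" using D\<Theta>[of x] xU UV(2,8) e by auto
      also have "\<dots> = 0" using L(3) by auto
      finally show "x \<in> Z \<inter> U" using Z xU UV(2) by auto
    next
      fix x assume x: "x \<in> Z \<inter> U"
      then have "x \<in> Z \<inter> S" using UV(2) by blast
      then have "D (\<Theta> x) = 0" unfolding Z using D\<Theta>[of x] by simp
      then obtain e where e: "\<Theta> x = L e" using L(3) by auto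
      have "\<Theta> x \<in> V" "g (\<Theta> x) = x" using x UV(5,6) by auto
      then show "x \<in> (\<lambda>e. g (L e)) ` W" unfolding W_def e by (intro image_eqI[of _ _ e]) auto
    qed
  qed (use UV(1) W in auto)
  then show ?thesis using that UV(3) by blast
qed

section \<open>Quotients by free proper actions\<close>

lemma smooth_on_Pair:
  assumes "open S" "smooth_on S f" "smooth_on S g"
  shows "smooth_on S (\<lambda>x. (f x, g x))"
proof -
  have 1: "linear (\<lambda>a::'b. (a, 0::'c))" and 2: "linear (\<lambda>b::'c. (0::'b, b))"
    by (auto intro!: linearI)
  have "smooth_on S (\<lambda>x. (f x, 0) + (0, g x))"
    by (intro smooth_on_add smooth_on_linear_compose[OF assms(1) 1] smooth_on_linear_compose[OF assms(1) 2] assms)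
  then show ?thesis by simp
qed

text \<open>The group \<open>\<Gamma>\<close> consists of linear transformations of the ambient space. The map \<open>\<epsilon>\<close> parametrizes
  a neighbourhood of its identity by a neighbourhood of \<open>0\<close> in the vector space \<open>\<gg>\<close>, and \<open>near\<close> and
  \<open>closed\<close> express that the action on \<open>Z\<close> is free and proper.\<close>

locale free_proper_action =
  fixes Z :: "'a::euclidean_space set" and q :: "'a \<Rightarrow> 'q" and X :: "'q topology"
    and \<Gamma> :: "('a \<Rightarrow> 'a) set" and \<gg> :: "'l::euclidean_space set" and \<Lambda> :: "'l set"
    and \<epsilon> :: "'l \<Rightarrow> 'a \<Rightarrow> 'a"
  assumes quotient: "quotient_map (top_of_set Z) X q"
    and orbit: "\<And>x y. x \<in> Z \<Longrightarrow> y \<in> Z \<Longrightarrow> q x = q y \<longleftrightarrow> (\<exists>\<gamma>\<in>\<Gamma>. y = \<gamma> x)"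
    and linear: "\<And>\<gamma>. \<gamma> \<in> \<Gamma> \<Longrightarrow> linear \<gamma>"
    and preserves: "\<And>\<gamma> x. \<gamma> \<in> \<Gamma> \<Longrightarrow> x \<in> Z \<Longrightarrow> \<gamma> x \<in> Z"
    and inverse: "\<And>\<gamma>. \<gamma> \<in> \<Gamma> \<Longrightarrow> \<exists>\<gamma>'\<in>\<Gamma>. (\<forall>x. \<gamma>' (\<gamma> x) = x) \<and> (\<forall>x. \<gamma> (\<gamma>' x) = x)"
    and compose: "\<And>\<gamma> \<delta>. \<gamma> \<in> \<Gamma> \<Longrightarrow> \<delta> \<in> \<Gamma> \<Longrightarrow> (\<lambda>x. \<gamma> (\<delta> x)) \<in> \<Gamma>"
    and subspace: "subspace \<gg>"
    and \<Lambda>: "open \<Lambda>" "0 \<in> \<Lambda>"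
    and smooth: "smooth_on (\<Lambda> \<times> UNIV) (\<lambda>(\<xi>, x). \<epsilon> \<xi> x)"
    and \<epsilon>_0: "\<And>x. \<epsilon> 0 x = x"
    and \<epsilon>_in: "\<And>\<xi>. \<xi> \<in> \<gg> \<Longrightarrow> \<xi> \<in> \<Lambda> \<Longrightarrow> \<epsilon> \<xi> \<in> \<Gamma>"
    and inj_derivative: "\<And>p \<xi>. p \<in> Z \<Longrightarrow> \<xi> \<in> \<gg> \<Longrightarrow> \<xi> \<noteq> 0 \<Longrightarrow>
       \<not> ((\<lambda>t. \<epsilon> (t *\<^sub>R \<xi>) p) has_vector_derivative 0) (at 0)"
    and near: "\<And>p \<delta>. p \<in> Z \<Longrightarrow> \<delta> > 0 \<Longrightarrow> \<exists>\<eta>>0. \<forall>x\<in>Z \<inter> ball p \<eta>. \<forall>\<gamma>\<in>\<Gamma>. \<gamma> x \<in> ball p \<eta> \<longrightarrow>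
       (\<exists>\<xi>\<in>\<gg> \<inter> \<Lambda>. norm \<xi> < \<delta> \<and> \<gamma> = \<epsilon> \<xi>)"
    and closed: "\<And>x y. x \<in> Z \<Longrightarrow> y \<in> Z \<Longrightarrow>
       (\<And>\<eta>. \<eta> > 0 \<Longrightarrow> \<exists>x'\<in>Z \<inter> ball x \<eta>. \<exists>\<gamma>\<in>\<Gamma>. \<gamma> x' \<in> ball y \<eta>) \<Longrightarrow> \<exists>\<gamma>\<in>\<Gamma>. y = \<gamma> x"
begin

lemma q_action: "\<gamma> \<in> \<Gamma> \<Longrightarrow> x \<in> Z \<Longrightarrow> q (\<gamma> x) = q x"
  using orbit[of x "\<gamma> x"] preserves by auto

lemma open_action_preimage:
  assumes "\<gamma> \<in> \<Gamma>" "open S"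
  shows "open {x. \<gamma> x \<in> S}"
  using open_preimage_Collect[OF open_UNIV linear_continuous_on assms(2), of \<gamma>] linear[OF assms(1)]
    linear_conv_bounded_linear by auto

lemma open_map_quotient: "open_map (top_of_set Z) X q"
  unfolding open_map_def
proof (intro allI impI)
  fix U assume U: "openin (top_of_set Z) U"
  then obtain S where S: "open S" "U = Z \<inter> S" by (auto simp: openin_open)
  have eq: "{x \<in> Z. q x \<in> q ` U} = Z \<inter> (\<Union>\<gamma>\<in>\<Gamma>. {x. \<gamma> x \<in> S})"
  proof (intro set_eqI iffI)
    fix x assume "x \<in> {x \<in> Z. q x \<in> q ` U}"
    then obtain y where y: "x \<in> Z" "y \<in> Z" "y \<in> S" "q x = q y" unfolding S(2) by auto
    then obtain \<gamma> where "\<gamma> \<in> \<Gamma>" "y = \<gamma> x" using orbit by blast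
    then show "x \<in> Z \<inter> (\<Union>\<gamma>\<in>\<Gamma>. {x. \<gamma> x \<in> S})" using y by blast
  next
    fix x assume "x \<in> Z \<inter> (\<Union>\<gamma>\<in>\<Gamma>. {x. \<gamma> x \<in> S})"
    then obtain \<gamma> where \<gamma>: "x \<in> Z" "\<gamma> \<in> \<Gamma>" "\<gamma> x \<in> S" by blast
    then have "q x = q (\<gamma> x)" "\<gamma> x \<in> U" using q_action preserves S(2) by auto
    then show "x \<in> {x \<in> Z. q x \<in> q ` U}" using \<gamma>(1) by blast
  qed
  have "open (\<Union>\<gamma>\<in>\<Gamma>. {x. \<gamma> x \<in> S})" using open_action_preimage S(1) by blast
  then have "openin (top_of_set Z) {x \<in> topspace (top_of_set Z). q x \<in> q ` U}"
    using eq by (simp add: openin_open_Int)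
  moreover have "q ` U \<subseteq> topspace X"
    using S(2) quotient_imp_surjective_map[OF quotient] by auto
  ultimately show "openin X (q ` U)"
    using quotient unfolding quotient_map_def by blast
qed

lemma second_countable_quotient: "second_countable X"
  by (rule second_countable_open_map_image[OF quotient_imp_continuous_map[OF quotient] open_map_quotient
        quotient_imp_surjective_map[OF quotient] second_countable_top_of_set])

text \<open>The contrapositive of \<open>closed\<close> yields balls around representatives of
  distinct orbits such that no group element moves a point of one into the other; their images are
  open because the projection is open.\<close>

lemma Hausdorff_quotient: "Hausdorff_space X"
  unfolding Hausdorff_space_def
proof (intro allI impI)
  fix c d assume cd: "c \<in> topspace X \<and> d \<in> topspace X \<and> c \<noteq> d"
  moreover have "topspace X = q ` Z" using quotient_imp_surjective_map[OF quotient] by simp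
  ultimately obtain x y where xy: "x \<in> Z" "y \<in> Z" "c = q x" "d = q y"
    by blast
  have "\<not> (\<exists>\<gamma>\<in>\<Gamma>. y = \<gamma> x)" using orbit[OF xy(1,2)] cd xy(3,4) by auto
  then obtain \<eta> where \<eta>: "\<eta> > 0" "\<not> (\<exists>x'\<in>Z \<inter> ball x \<eta>. \<exists>\<gamma>\<in>\<Gamma>. \<gamma> x' \<in> ball y \<eta>)"
    using closed[OF xy(1,2)] by blast
  let ?U = "q ` (Z \<inter> ball x \<eta>)" and ?V = "q ` (Z \<inter> ball y \<eta>)"
  have "openin X ?U" "openin X ?V"
    using open_map_quotient unfolding open_map_def by (simp_all add: openin_open_Int)
  moreover have "c \<in> ?U" "d \<in> ?V" using xy \<eta>(1) by auto
  moreover have "disjnt ?U ?V"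
    unfolding disjnt_iff
  proof (intro allI notI)
    fix e assume "e \<in> ?U \<and> e \<in> ?V"
    then obtain x' y' where *: "x' \<in> Z \<inter> ball x \<eta>" "y' \<in> Z \<inter> ball y \<eta>" "q x' = q y'" by auto
    then obtain \<gamma> where "\<gamma> \<in> \<Gamma>" "y' = \<gamma> x'" using orbit[of x' y'] by blast
    then show False using \<eta>(2) * by blast
  qed
  ultimately show "\<exists>U V. openin X U \<and> openin X V \<and> c \<in> U \<and> d \<in> V \<and> disjnt U V" by blast
qed

text \<open>In coordinates of \<open>Z\<close>, the orbit directions at \<open>p\<close> get a
  linear complement, which is pushed into \<open>Z\<close> as a slice. Moving the slice by small
  group elements is a local diffeomorphism by the inverse function theorem. The axiom
  \<open>near\<close> excludes that distant group elements bring a slice point back, so after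
  shrinking every orbit meets the slice at most once. \<open>P\<close> is the saturation of the
  slice.\<close>

theorem slice:
  fixes \<kappa> :: "'a \<Rightarrow> 'e::euclidean_space"
  assumes lc: "local_coords Z N \<kappa> W \<psi>" and pN: "p \<in> N" and pZ: "p \<in> Z"
    and dim: "dim \<gg> + DIM('f::euclidean_space) = DIM('e)"
  shows "\<exists>P (\<beta> :: 'a \<Rightarrow> 'f). p \<in> P \<and> quotient_coords Z q P \<beta>"
proof -
  note L = local_coordsD[OF lc]
  define w0 where "w0 = \<kappa> p"
  have w0: "w0 \<in> W" "\<psi> w0 = p" unfolding w0_def using L(9,10)[OF pZ pN] by auto
  define D\<kappa> D\<psi> where "D\<kappa> = frechet_derivative \<kappa> (at p)" and "D\<psi> = frechet_derivative \<psi> (at w0)"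
  have D\<kappa>: "(\<kappa> has_derivative D\<kappa>) (at p)" unfolding D\<kappa>_def by (rule smooth_on_has_derivative[OF L(3) pN])
  have D\<psi>: "(\<psi> has_derivative D\<psi>) (at w0)" unfolding D\<psi>_def by (rule smooth_on_has_derivative[OF L(4) w0(1)])
  have D\<kappa>\<psi>: "D\<kappa> (D\<psi> v) = v" for v
    by (rule left_inverse_derivative[OF L(2) w0(1) D\<psi> _ L(6)]) (simp_all add: w0(2) D\<kappa>)
  define E where "E = frechet_derivative (\<lambda>(\<xi>, x). \<epsilon> \<xi> x) (at (0, p))"
  have \<Lambda>U: "open (\<Lambda> \<times> (UNIV :: 'a set))" by (intro open_Times \<Lambda>(1) open_UNIV)
  have E: "((\<lambda>(\<xi>, x). \<epsilon> \<xi> x) has_derivative E) (at (0, p))"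
    unfolding E_def by (rule smooth_on_has_derivative[OF smooth]) (simp add: \<Lambda>(2))
  have linE: "linear E" using E has_derivative_linear by blast
  define D where "D = (\<lambda>\<xi>. E (\<xi>, 0))"
  have E2: "E (0, x) = x" for x
  proof -
    have "((\<lambda>x. (0, x)) has_derivative (\<lambda>x. (0::'l, x))) (at p)"
      by (intro has_derivative_Pair has_derivative_const has_derivative_ident)
    from has_derivative_compose[OF this E]
    have "((\<lambda>x. x) has_derivative (\<lambda>x. E (0, x))) (at p)" by (simp add: \<epsilon>_0)
    from has_derivative_unique[OF this has_derivative_ident] show ?thesis by metis
  qed
  have Esplit: "E (\<xi>, x) = D \<xi> + x" for \<xi> x
    using linear_add[OF linE, of "(\<xi>, 0)" "(0, x)"] E2 unfolding D_def by simp
  have linD: "linear D"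
    unfolding D_def by (rule linear_compose[of "\<lambda>\<xi>. (\<xi>, 0)" E, unfolded o_def])
      (auto intro!: linearI linE)
  have lin\<kappa>: "linear D\<kappa>" using D\<kappa> has_derivative_linear by blast
  define D' where "D' = (\<lambda>\<xi>. D\<kappa> (D \<xi>))"
  have linD': "linear D'" unfolding D'_def using linear_compose[OF linD lin\<kappa>] by (simp add: o_def)
  have Dcurve: "((\<lambda>t. \<epsilon> (t *\<^sub>R \<xi>) p) has_vector_derivative D \<xi>) (at 0)" for \<xi>
  proof -
    have "((\<lambda>t. (t *\<^sub>R \<xi>, p)) has_derivative (\<lambda>t. (t *\<^sub>R \<xi>, 0))) (at 0)"
      by (intro has_derivative_Pair has_derivative_const bounded_linear.has_derivative[OF bounded_linear_scaleR_left]
          has_derivative_ident)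
    moreover have "((\<lambda>(\<xi>, x). \<epsilon> \<xi> x) has_derivative E) (at (0 *\<^sub>R \<xi>, p))" using E by simp
    ultimately have "((\<lambda>t. case (t *\<^sub>R \<xi>, p) of (\<xi>, x) \<Rightarrow> \<epsilon> \<xi> x) has_derivative (\<lambda>t. E (t *\<^sub>R \<xi>, 0))) (at 0)"
      by (rule has_derivative_compose)
    then show ?thesis
      unfolding has_vector_derivative_def D_def using linear_scale[OF linE, of _ "(\<xi>, 0)"] by simp
  qed
  \<comment> \<open>The curve stays in \<open>Z\<close>, where it equals \<open>\<psi>\<close> of
    its coordinates. Zero velocity in coordinates would therefore mean zero velocity in the ambient
    space, which \<open>inj_derivative\<close> forbids.\<close>
  have injD': "inj_on D' \<gg>"
  proof (subst linear_injective_on_subspace_0[OF linD' subspace], intro ballI impI)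
    fix \<xi> assume \<xi>: "\<xi> \<in> \<gg>" "D' \<xi> = 0"
    let ?c = "\<lambda>t. \<epsilon> (t *\<^sub>R \<xi>) p"
    have c: "(?c has_derivative (\<lambda>t. t *\<^sub>R D \<xi>)) (at 0)" using Dcurve[of \<xi>] unfolding has_vector_derivative_def .
    have c0: "?c 0 = p" by (simp add: \<epsilon>_0)
    have cont: "isCont ?c 0" using c has_derivative_continuous by blast
    have c\<kappa>: "((\<lambda>t. \<kappa> (?c t)) has_derivative (\<lambda>t. D\<kappa> (t *\<^sub>R D \<xi>))) (at 0)"
      using has_derivative_compose[OF c] D\<kappa> c0 by simp
    then have "((\<lambda>t. \<psi> (\<kappa> (?c t))) has_derivative (\<lambda>t. D\<psi> (D\<kappa> (t *\<^sub>R D \<xi>)))) (at 0)"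
      using has_derivative_compose[OF c\<kappa>] D\<psi> c0 unfolding w0_def by simp
    moreover have "D\<psi> (D\<kappa> (t *\<^sub>R D \<xi>)) = 0" for t
      using \<xi>(2) D\<psi> has_derivative_linear linear_0 unfolding D'_def
      by (metis linear_scale[OF lin\<kappa>] scaleR_zero_right)
    ultimately have *: "((\<lambda>t. \<psi> (\<kappa> (?c t))) has_derivative (\<lambda>t. 0)) (at 0)" by simp
    have "\<forall>\<^sub>F t in at 0. ?c t \<in> N"
      using cont pN L(1) unfolding isCont_def c0 by (auto dest: topological_tendstoD)
    moreover have "\<forall>\<^sub>F t in at 0. t *\<^sub>R \<xi> \<in> \<Lambda>"
    proof -
      have "((\<lambda>t. t *\<^sub>R \<xi>) \<longlongrightarrow> 0 *\<^sub>R \<xi>) (at 0)" by (intro tendsto_intros)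
      then show ?thesis using \<Lambda> by (auto dest: topological_tendstoD)
    qed
    ultimately have ev: "\<forall>\<^sub>F t in at 0. \<psi> (\<kappa> (?c t)) = ?c t"
    proof eventually_elim
      case (elim t)
      then have "?c t \<in> Z" using \<epsilon>_in[of "t *\<^sub>R \<xi>"] subspace_scale[OF subspace \<xi>(1)] preserves pZ by blast
      then show ?case using L(10) elim by blast
    qed
    have "(?c has_derivative (\<lambda>t. 0)) (at 0)"
      by (rule has_derivative_transform_eventually[OF * ev]) (simp_all add: \<epsilon>_0 L(10)[OF pZ pN])
    then have "(?c has_vector_derivative 0) (at 0)" unfolding has_vector_derivative_def by simp
    then show "\<xi> = 0" using inj_derivative[OF pZ \<xi>(1)] by blast
  qed
  \<comment> \<open>A left inverse of the orbit map. Its kernel is the complement that becomes the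
    slice, and its value measures the group component of a tangent vector.\<close>
  obtain \<xi>0 where \<xi>0: "\<xi>0 ` UNIV \<subseteq> \<gg>" "linear \<xi>0" "\<And>\<xi>. \<xi> \<in> \<gg> \<Longrightarrow> \<xi>0 (D' \<xi>) = \<xi>"
    using linear_exists_left_inverse_on[OF linD' subspace injD'] by blast
  have \<xi>0_in: "\<xi>0 v \<in> \<gg>" for v using \<xi>0(1) by auto
  have "range \<xi>0 = \<gg>"
  proof
    show "\<gg> \<subseteq> range \<xi>0" using \<xi>0(3) by (metis rangeI subsetI)
  qed (rule \<xi>0(1))
  then have "dim {v. \<xi>0 v = 0} = DIM('f)"
    using rank_nullity_subspace[OF \<xi>0(2) subspace_UNIV] dim by simp
  then obtain M :: "'f \<Rightarrow> 'e" and M' where M: "linear M" "linear M'" "range M = {v. \<xi>0 v = 0}" "\<And>b. M' (M b) = b"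
    using linear_parametrization[OF linear_subspace_kernel[OF \<xi>0(2)]] by blast
  \<comment> \<open>The projection onto the kernel of \<open>\<xi>0\<close> along the orbit
    directions.\<close>
  define \<pi> where "\<pi> = (\<lambda>v. v - D' (\<xi>0 v))"
  have lin\<pi>: "linear \<pi>"
    unfolding \<pi>_def using linear_compose_sub[OF linear_ident linear_compose[OF \<xi>0(2) linD']] by (simp add: o_def)
  have \<xi>0M: "\<xi>0 (M b) = 0" for b using M(3) by auto
  have \<pi>M: "\<pi> (M b) = M b" for b unfolding \<pi>_def \<xi>0M by (simp add: linear_0[OF linD'])
  have \<pi>_ex: "\<exists>b. \<pi> v = M b" for v
  proof -
    have "\<xi>0 (\<pi> v) = 0" unfolding \<pi>_def linear_diff[OF \<xi>0(2)] using \<xi>0(3)[OF \<xi>0_in] by simp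
    then show ?thesis using M(3) by auto
  qed
  have M\<pi>: "M (M' (\<pi> v)) = \<pi> v" for v using \<pi>_ex[of v] M(4) by metis
  have cont_lin: "continuous_on UNIV h" if "linear h" for h :: "'x::euclidean_space \<Rightarrow> 'y::euclidean_space"
    using that linear_continuous_on linear_conv_bounded_linear by blast
  \<comment> \<open>The slice point with coordinate \<open>\<pi> v\<close>, moved by the group
    element with parameter \<open>\<xi>0 v\<close>.\<close>
  define F where "F = (\<lambda>v. \<epsilon> (\<xi>0 v) (\<psi> (w0 + \<pi> v)))"
  define \<Omega>0 where "\<Omega>0 = {v. \<xi>0 v \<in> \<Lambda>} \<inter> {v. w0 + \<pi> v \<in> W}"
  have \<Omega>0: "open \<Omega>0"
  proof -
    have "open {v \<in> UNIV. w0 + \<pi> v \<in> W}"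
      by (rule open_preimage_Collect[OF open_UNIV _ L(2)]) (intro continuous_intros cont_lin lin\<pi>)
    moreover have "open {v \<in> UNIV. \<xi>0 v \<in> \<Lambda>}"
      by (rule open_preimage_Collect[OF open_UNIV cont_lin[OF \<xi>0(2)] \<Lambda>(1)])
    ultimately show ?thesis unfolding \<Omega>0_def by auto
  qed
  have zero: "\<xi>0 0 = 0" "\<pi> 0 = 0" using linear_0[OF \<xi>0(2)] linear_0[OF lin\<pi>] by auto
  have F0: "F 0 = p" unfolding F_def zero using w0(2) by (simp add: \<epsilon>_0)
  have sm\<psi>: "smooth_on \<Omega>0 (\<lambda>v. \<psi> (w0 + \<pi> v))"
  proof (rule smooth_on_compose[OF \<Omega>0 L(2) _ L(4)])
    show "smooth_on \<Omega>0 (\<lambda>v. w0 + \<pi> v)"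
      by (intro smooth_on_add[OF \<Omega>0] smooth_on_const smooth_on_linear[OF lin\<pi>])
  qed (auto simp: \<Omega>0_def)
  have smF: "smooth_on \<Omega>0 F"
  proof -
    have "smooth_on \<Omega>0 (\<lambda>v. case (\<xi>0 v, \<psi> (w0 + \<pi> v)) of (\<xi>, x) \<Rightarrow> \<epsilon> \<xi> x)"
    proof (rule smooth_on_compose[OF \<Omega>0 \<Lambda>U _ smooth])
      show "smooth_on \<Omega>0 (\<lambda>v. (\<xi>0 v, \<psi> (w0 + \<pi> v)))"
        by (intro smooth_on_Pair[OF \<Omega>0 _ sm\<psi>] smooth_on_linear[OF \<xi>0(2)])
    qed (auto simp: \<Omega>0_def)
    then show ?thesis unfolding F_def by simp
  qed
  define \<Omega> where "\<Omega> = {v \<in> \<Omega>0. F v \<in> N}"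
  have \<Omega>: "open \<Omega>" unfolding \<Omega>_def
    by (rule open_preimage_Collect[OF \<Omega>0 smooth_on_imp_continuous_on[OF smF] L(1)])
  have \<Omega>_0: "0 \<in> \<Omega>" unfolding \<Omega>_def \<Omega>0_def using zero \<Lambda>(2) w0(1) F0 pN by simp
  define G where "G = (\<lambda>v. \<kappa> (F v))"
  have smG: "smooth_on \<Omega> G"
    unfolding G_def by (rule smooth_on_compose[OF \<Omega> L(1) smooth_on_subset[OF smF] L(3)]) (auto simp: \<Omega>_def)
  have FZ: "F v \<in> Z" if "v \<in> \<Omega>0" for v
    using that preserves[OF \<epsilon>_in[OF \<xi>0_in] L(7)] unfolding F_def \<Omega>0_def by blast
  have \<psi>G: "\<psi> (G v) = F v" if "v \<in> \<Omega>" for v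
    using that L(10) FZ unfolding G_def \<Omega>_def by blast
  have "(G has_derivative (\<lambda>v. v)) (at 0)"
  proof -
    have 1: "((\<lambda>v. w0 + \<pi> v) has_derivative \<pi>) (at 0)"
      using has_derivative_add[OF has_derivative_const[of w0] bounded_linear_imp_has_derivative[of \<pi>]]
        lin\<pi> linear_conv_bounded_linear by fastforce
    have "((\<lambda>v. \<psi> (w0 + \<pi> v)) has_derivative (\<lambda>v. D\<psi> (\<pi> v))) (at 0)"
      using has_derivative_compose[OF 1] D\<psi> zero(2) by simp
    moreover have "(\<xi>0 has_derivative \<xi>0) (at 0)"
      using bounded_linear_imp_has_derivative \<xi>0(2) linear_conv_bounded_linear by blast
    ultimately have 2: "((\<lambda>v. (\<xi>0 v, \<psi> (w0 + \<pi> v))) has_derivative (\<lambda>v. (\<xi>0 v, D\<psi> (\<pi> v)))) (at 0)"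
      by (rule has_derivative_Pair[rotated])
    have "((\<lambda>v. case (\<xi>0 v, \<psi> (w0 + \<pi> v)) of (\<xi>, x) \<Rightarrow> \<epsilon> \<xi> x) has_derivative (\<lambda>v. E (\<xi>0 v, D\<psi> (\<pi> v)))) (at 0)"
    proof (rule has_derivative_compose[OF 2])
      show "((\<lambda>(\<xi>, x). \<epsilon> \<xi> x) has_derivative E) (at (\<xi>0 0, \<psi> (w0 + \<pi> 0)))"
        using E zero w0(2) by simp
    qed
    then have 3: "(F has_derivative (\<lambda>v. D (\<xi>0 v) + D\<psi> (\<pi> v))) (at 0)"
      unfolding F_def Esplit by simp
    have "(G has_derivative (\<lambda>v. D\<kappa> (D (\<xi>0 v) + D\<psi> (\<pi> v)))) (at 0)"
      unfolding G_def using has_derivative_compose[OF 3] D\<kappa> F0 by simp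
    \<comment> \<open>Orbit part and slice part add up to \<open>v\<close> by the definition of
      \<open>\<pi>\<close>, so the derivative of \<open>G\<close> at 0 is the identity.\<close>
    moreover have "D\<kappa> (D (\<xi>0 v) + D\<psi> (\<pi> v)) = v" for v
      unfolding linear_add[OF lin\<kappa>] D\<kappa>\<psi> unfolding \<pi>_def D'_def by simp
    ultimately show ?thesis by simp
  qed
  then have "inj (frechet_derivative G (at 0))" by (simp add: frechet_derivative_at[symmetric] inj_on_def)
  then obtain U V g where UV: "open U" "U \<subseteq> \<Omega>" "0 \<in> U" "open V" "G ` U = V"
    "\<And>x. x \<in> U \<Longrightarrow> g (G x) = x" "g ` V = U" "\<And>y. y \<in> V \<Longrightarrow> G (g y) = y" "smooth_on V g"
    using smooth_inverse_function[OF \<Omega> smG \<Omega>_0] by metis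
  have injG: "v = v'" if "v \<in> U" "v' \<in> U" "F v = F v'" for v v'
  proof -
    have "G v = G v'" unfolding G_def that(3) ..
    then show ?thesis using UV(6)[OF that(1)] UV(6)[OF that(2)] by metis
  qed
  define \<sigma> where "\<sigma> = (\<lambda>b. \<psi> (w0 + M b))"
  have \<sigma>F: "\<sigma> b = F (M b)" for b unfolding \<sigma>_def F_def \<pi>M \<xi>0M \<epsilon>_0 ..
  have FM: "F v = \<epsilon> (\<xi>0 v) (\<sigma> (M' (\<pi> v)))" for v unfolding F_def \<sigma>_def M\<pi> ..
  \<comment> \<open>Slice parameters below \<open>\<rho>\<close> and group parameters below
    \<open>\<delta>\<close> stay in \<open>U\<close>, where \<open>F\<close> is injective.\<close>
  obtain \<delta> \<rho> where \<delta>: "\<delta> > 0" "\<rho> > 0" "\<And>b \<xi>. norm b < \<rho> \<Longrightarrow> norm \<xi> < \<delta> \<Longrightarrow> M b + D' \<xi> \<in> U"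
  proof -
    have "linear (\<lambda>(b, \<xi>). M b + D' \<xi>)"
      by (rule linearI) (auto simp: linear_add[OF M(1)] linear_add[OF linD'] linear_scale[OF M(1)]
          linear_scale[OF linD'] scaleR_add_right)
    then have "open {z \<in> UNIV. (case z of (b, \<xi>) \<Rightarrow> M b + D' \<xi>) \<in> U}"
      by (rule open_preimage_Collect[OF open_UNIV cont_lin UV(1)])
    moreover have "(0, 0) \<in> {z \<in> UNIV. (case z of (b, \<xi>) \<Rightarrow> M b + D' \<xi>) \<in> U}"
      using UV(3) by (simp add: linear_0[OF M(1)] linear_0[OF linD'])
    ultimately obtain A B where AB: "open A" "open B" "(0, 0) \<in> A \<times> B"
      "A \<times> B \<subseteq> {z \<in> UNIV. (case z of (b, \<xi>) \<Rightarrow> M b + D' \<xi>) \<in> U}"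
      using open_prod_elim by blast
    have "0 \<in> A" "0 \<in> B" using AB(3) by auto
    then obtain \<rho> \<delta> where "\<rho> > 0" "ball 0 \<rho> \<subseteq> A" "\<delta> > 0" "ball 0 \<delta> \<subseteq> B"
      using AB(1,2) by (meson open_contains_ball)
    moreover have "M b + D' \<xi> \<in> U" if "norm b < \<rho>" "norm \<xi> < \<delta>" for b \<xi>
    proof -
      have "b \<in> ball 0 \<rho>" "\<xi> \<in> ball 0 \<delta>" using that by simp_all
      then have "(b, \<xi>) \<in> A \<times> B" using \<open>ball 0 \<rho> \<subseteq> A\<close> \<open>ball 0 \<delta> \<subseteq> B\<close> by blast
      then show ?thesis using AB(4) by auto
    qed
    ultimately show ?thesis using that[of \<delta> \<rho>] by blast
  qed
  have MU: "M b \<in> U" if "norm b < \<rho>" for b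
    using \<delta>(3)[OF that, of 0] \<delta>(1) by (simp add: linear_0[OF linD'])
  obtain \<eta> where \<eta>: "\<eta> > 0" "\<And>x \<gamma>. x \<in> Z \<Longrightarrow> x \<in> ball p \<eta> \<Longrightarrow> \<gamma> \<in> \<Gamma> \<Longrightarrow> \<gamma> x \<in> ball p \<eta> \<Longrightarrow>
     \<exists>\<xi>\<in>\<gg> \<inter> \<Lambda>. norm \<xi> < \<delta> \<and> \<gamma> = \<epsilon> \<xi>"
    using near[OF pZ \<delta>(1)] by blast
  obtain r where r: "r > 0" "r \<le> \<rho>" "\<And>b. norm b < r \<Longrightarrow> \<sigma> b \<in> ball p \<eta>"
  proof -
    have "open {v \<in> \<Omega>0. F v \<in> ball p \<eta>}"
      by (rule open_preimage_Collect[OF \<Omega>0 smooth_on_imp_continuous_on[OF smF] open_ball])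
    then have "open {b \<in> UNIV. M b \<in> {v \<in> \<Omega>0. F v \<in> ball p \<eta>}}"
      by (rule open_preimage_Collect[OF open_UNIV cont_lin[OF M(1)]])
    moreover have "0 \<in> {b \<in> UNIV. M b \<in> {v \<in> \<Omega>0. F v \<in> ball p \<eta>}}"
      using \<Omega>_0 \<eta>(1) F0 unfolding \<Omega>_def by (simp add: linear_0[OF M(1)])
    ultimately obtain r where "r > 0" "ball 0 r \<subseteq> {b \<in> UNIV. M b \<in> {v \<in> \<Omega>0. F v \<in> ball p \<eta>}}"
      by (meson open_contains_ball)
    moreover have "\<sigma> b \<in> ball p \<eta>" if "norm b < r" for b
    proof -
      have "b \<in> ball 0 r" using that by simp
      then show ?thesis using \<open>ball 0 r \<subseteq> _\<close> unfolding \<sigma>F by blast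
    qed
    ultimately show ?thesis using that[of "min r \<rho>"] \<delta>(2) by simp
  qed
  define B :: "'f set" where "B = ball 0 r"
  have B: "open B" "0 \<in> B" unfolding B_def using r(1) by auto
  have BU: "M b \<in> U" if "b \<in> B" for b using that MU[of b] r(2) unfolding B_def by simp
  have BW: "w0 + M b \<in> W" if "b \<in> B" for b
    using BU[OF that] UV(2) \<pi>M unfolding \<Omega>_def \<Omega>0_def by force
  have \<sigma>Z: "\<sigma> b \<in> Z" and \<sigma>N: "\<sigma> b \<in> N" if "b \<in> B" for b
    unfolding \<sigma>_def using L(7,8)[OF BW[OF that]] by auto
  have sm\<sigma>: "smooth_on B \<sigma>"
    unfolding \<sigma>_def
  proof (rule smooth_on_compose[OF B(1) L(2) _ L(4)])
    show "smooth_on B (\<lambda>b. w0 + M b)"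
      by (intro smooth_on_add[OF B(1)] smooth_on_const smooth_on_linear[OF M(1)])
  qed (auto simp: BW)
  \<comment> \<open>By \<open>near\<close> the group element has a small parameter, so both sides
    are values of the injective map \<open>F\<close> on \<open>U\<close>; comparing the slice
    components gives equality.\<close>
  have sep: "b = b'" if b: "b \<in> B" "b' \<in> B" "\<gamma> \<in> \<Gamma>" "\<gamma> (\<sigma> b) = \<sigma> b'" for b b' \<gamma>
  proof -
    have "\<sigma> b \<in> ball p \<eta>" "\<gamma> (\<sigma> b) \<in> ball p \<eta>" using b r(3) unfolding B_def by auto
    then obtain \<xi> where \<xi>: "\<xi> \<in> \<gg>" "\<xi> \<in> \<Lambda>" "norm \<xi> < \<delta>" "\<gamma> = \<epsilon> \<xi>"
      using \<eta>(2)[OF \<sigma>Z[OF b(1)] _ b(3)] by blast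
    let ?v = "M b + D' \<xi>"
    have v: "?v \<in> U" using \<delta>(3)[OF _ \<xi>(3)] b(1) r(2) unfolding B_def by auto
    have \<xi>v: "\<xi>0 ?v = \<xi>" unfolding linear_add[OF \<xi>0(2)] \<xi>0M \<xi>0(3)[OF \<xi>(1)] by simp
    have \<pi>v: "\<pi> ?v = M b" using \<xi>v unfolding \<pi>_def by simp
    have "F ?v = \<gamma> (\<sigma> b)" unfolding FM \<xi>v \<pi>v M(4) \<xi>(4) ..
    then have "?v = M b'" using injG[OF v BU[OF b(2)]] b(4) \<sigma>F by simp
    then have "M b = M b'" using \<pi>v \<pi>M by metis
    then show ?thesis using M(4) by metis
  qed
  define P where "P = {\<gamma> (\<sigma> b) | \<gamma> b. \<gamma> \<in> \<Gamma> \<and> b \<in> B}"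
  define \<beta> where "\<beta> = (\<lambda>x. SOME b. b \<in> B \<and> (\<exists>\<gamma>\<in>\<Gamma>. x = \<gamma> (\<sigma> b)))"
  have \<beta>: "\<beta> (\<gamma> (\<sigma> b)) = b" if "\<gamma> \<in> \<Gamma>" "b \<in> B" for \<gamma> b
  proof -
    have "\<exists>b'. b' \<in> B \<and> (\<exists>\<gamma>'\<in>\<Gamma>. \<gamma> (\<sigma> b) = \<gamma>' (\<sigma> b'))" using that by blast
    then have "\<beta> (\<gamma> (\<sigma> b)) \<in> B \<and> (\<exists>\<gamma>'\<in>\<Gamma>. \<gamma> (\<sigma> b) = \<gamma>' (\<sigma> (\<beta> (\<gamma> (\<sigma> b)))))"
      unfolding \<beta>_def by (rule someI_ex)
    then obtain \<gamma>' where \<gamma>': "\<beta> (\<gamma> (\<sigma> b)) \<in> B" "\<gamma>' \<in> \<Gamma>" "\<gamma> (\<sigma> b) = \<gamma>' (\<sigma> (\<beta> (\<gamma> (\<sigma> b))))" by blast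
    obtain \<gamma>'' where \<gamma>'': "\<gamma>'' \<in> \<Gamma>" "\<And>x. \<gamma>'' (\<gamma>' x) = x" using inverse[OF \<gamma>'(2)] by blast
    have "\<gamma>'' (\<gamma> (\<sigma> b)) = \<sigma> (\<beta> (\<gamma> (\<sigma> b)))" using \<gamma>'(3) \<gamma>''(2) by metis
    then show ?thesis using sep[OF that(2) \<gamma>'(1) compose[OF \<gamma>''(1) that(1)]] by simp
  qed
  have id_in: "\<epsilon> 0 \<in> \<Gamma>" by (rule \<epsilon>_in[OF subspace_0[OF subspace] \<Lambda>(2)])
  have \<beta>\<sigma>: "\<beta> (\<sigma> b) = b" if "b \<in> B" for b using \<beta>[OF id_in that] by (simp add: \<epsilon>_0)
  have PI: "\<gamma> (\<sigma> b) \<in> P" if "\<gamma> \<in> \<Gamma>" "b \<in> B" for \<gamma> b using that unfolding P_def by blast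
  have \<sigma>P: "\<sigma> b \<in> P" if "b \<in> B" for b using PI[OF id_in that] by (simp add: \<epsilon>_0)
  have PZ: "P \<subseteq> Z" unfolding P_def using preserves \<sigma>Z by blast
  have PE: "\<exists>\<gamma> b. \<gamma> \<in> \<Gamma> \<and> b \<in> B \<and> x = \<gamma> (\<sigma> b) \<and> \<beta> x = b" if "x \<in> P" for x
    using that \<beta> unfolding P_def by blast
  have \<beta>P: "\<beta> ` P = B"
  proof
    show "\<beta> ` P \<subseteq> B" using PE by blast
    show "B \<subseteq> \<beta> ` P" using \<beta>\<sigma> \<sigma>P by (metis imageI subsetI)
  qed
  have \<sigma>0: "\<sigma> 0 = p" unfolding \<sigma>_def using w0(2) by (simp add: linear_0[OF M(1)])
  have "p \<in> P" using \<sigma>P[OF B(2)] \<sigma>0 by simp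
  moreover have "quotient_coords Z q P \<beta>"
    unfolding quotient_coords_def
  proof (intro conjI ballI impI)
    show "P \<noteq> {}" using \<open>p \<in> P\<close> by blast
    show "P \<subseteq> Z" by (rule PZ)
    show "open (\<beta> ` P)" unfolding \<beta>P by (rule B(1))
    fix x assume x: "x \<in> P"
    obtain \<gamma> b where \<gamma>: "\<gamma> \<in> \<Gamma>" "b \<in> B" "x = \<gamma> (\<sigma> b)" "\<beta> x = b" using PE[OF x] by blast
    show "y \<in> P" and "\<beta> x = \<beta> y" if y: "y \<in> Z" "q x = q y" for y
    proof -
      obtain \<gamma>' where \<gamma>': "\<gamma>' \<in> \<Gamma>" "y = \<gamma>' x" using orbit[of x y] x PZ y by blast
      have *: "(\<lambda>x. \<gamma>' (\<gamma> x)) \<in> \<Gamma>" by (rule compose[OF \<gamma>'(1) \<gamma>(1)])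
      show "y \<in> P" using PI[OF * \<gamma>(2)] \<gamma>(3) \<gamma>'(2) by simp
      show "\<beta> x = \<beta> y" using \<beta>[OF * \<gamma>(2)] \<gamma>(3,4) \<gamma>'(2) by simp
    qed
    show "q x = q y" if y: "y \<in> P" "\<beta> x = \<beta> y" for y
    proof -
      obtain \<gamma>' b' where "\<gamma>' \<in> \<Gamma>" "b' \<in> B" "y = \<gamma>' (\<sigma> b')" "\<beta> y = b'" using PE[OF y(1)] by blast
      then show ?thesis using \<gamma> y(2) q_action \<sigma>Z by metis
    qed
    \<comment> \<open>A section through an arbitrary point of the orbit is the translate of the
      slice by the element leading there.\<close>
    show "\<exists>\<sigma>. smooth_on (\<beta> ` P) \<sigma> \<and> \<sigma> ` \<beta> ` P \<subseteq> P \<and> (\<forall>b\<in>\<beta> ` P. \<beta> (\<sigma> b) = b) \<and> \<sigma> (\<beta> x) = x"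
      unfolding \<beta>P
    proof (intro exI[of _ "\<lambda>b. \<gamma> (\<sigma> b)"] conjI ballI)
      show "smooth_on B (\<lambda>b. \<gamma> (\<sigma> b))" by (rule smooth_on_linear_compose[OF B(1) linear[OF \<gamma>(1)] sm\<sigma>])
      show "(\<lambda>b. \<gamma> (\<sigma> b)) ` B \<subseteq> P" using PI[OF \<gamma>(1)] by blast
      show "\<gamma> (\<sigma> (\<beta> x)) = x" using \<gamma>(3,4) by simp
    qed (rule \<beta>[OF \<gamma>(1)])
    obtain \<gamma>' where \<gamma>': "\<gamma>' \<in> \<Gamma>" "\<And>x. \<gamma>' (\<gamma> x) = x" "\<And>x. \<gamma> (\<gamma>' x) = x"
      using inverse[OF \<gamma>(1)] by blast
    let ?N0 = "{y. \<gamma>' y \<in> N}"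
    have N0: "open ?N0" by (rule open_action_preimage[OF \<gamma>'(1) L(1)])
    have sm0: "smooth_on ?N0 (\<lambda>y. \<kappa> (\<gamma>' y))"
      by (rule smooth_on_compose[OF N0 L(1) smooth_on_linear[OF linear[OF \<gamma>'(1)]] L(3)]) auto
    let ?N1 = "{y \<in> ?N0. \<kappa> (\<gamma>' y) \<in> V}"
    have N1: "open ?N1"
      by (rule open_preimage_Collect[OF N0 smooth_on_imp_continuous_on[OF sm0] UV(4)])
    \<comment> \<open>The smooth extension of the orbit coordinate: translate back towards the
      slice, read coordinates, invert \<open>G\<close>, and keep the slice component.\<close>
    let ?\<beta> = "\<lambda>y. M' (\<pi> (g (\<kappa> (\<gamma>' y))))"
    have sm1: "smooth_on ?N1 ?\<beta>"
    proof (intro smooth_on_linear_compose[OF N1 M(2)] smooth_on_linear_compose[OF N1 lin\<pi>])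
      show "smooth_on ?N1 (\<lambda>y. g (\<kappa> (\<gamma>' y)))"
        by (rule smooth_on_compose[OF N1 UV(4) smooth_on_subset[OF sm0] UV(9)]) auto
    qed
    let ?N2 = "{y \<in> ?N1. ?\<beta> y \<in> B}"
    have N2: "open ?N2"
      by (rule open_preimage_Collect[OF N1 smooth_on_imp_continuous_on[OF sm1] B(1)])
    have xN2: "x \<in> ?N2"
    proof -
      have "\<kappa> (\<sigma> b) = G (M b)" unfolding G_def \<sigma>F ..
      moreover have "M b \<in> U" by (rule BU[OF \<gamma>(2)])
      moreover have "\<gamma>' x = \<sigma> b" using \<gamma>(3) \<gamma>'(2) by simp
      ultimately show ?thesis using \<sigma>N[OF \<gamma>(2)] UV(5,6) \<pi>M M(4) \<gamma>(2) by auto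
    qed
    have main: "y \<in> P \<and> ?\<beta> y = \<beta> y" if y: "y \<in> Z" "y \<in> ?N2" for y
    proof -
      define z v where "z = \<gamma>' y" and "v = g (\<kappa> z)"
      have z: "z \<in> Z" "z \<in> N" "\<kappa> z \<in> V" using y preserves[OF \<gamma>'(1)] unfolding z_def by auto
      have v: "v \<in> U" using z(3) UV(7) unfolding v_def by auto
      have "F v = \<psi> (G v)" using \<psi>G v UV(2) by auto
      also have "\<dots> = z" unfolding v_def using UV(8)[OF z(3)] L(10)[OF z(1,2)] by simp
      finally have "z = \<epsilon> (\<xi>0 v) (\<sigma> (M' (\<pi> v)))" using FM by simp
      then have *: "y = \<gamma> (\<epsilon> (\<xi>0 v) (\<sigma> (M' (\<pi> v))))" using \<gamma>'(3) unfolding z_def by metis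
      have "\<xi>0 v \<in> \<Lambda>" using v UV(2) unfolding \<Omega>_def \<Omega>0_def by auto
      then have "(\<lambda>x. \<gamma> (\<epsilon> (\<xi>0 v) x)) \<in> \<Gamma>" using compose[OF \<gamma>(1) \<epsilon>_in[OF \<xi>0_in]] by blast
      moreover have "M' (\<pi> v) \<in> B" using y(2) unfolding v_def z_def by simp
      ultimately have "y \<in> P" "\<beta> y = M' (\<pi> v)" using PI \<beta> unfolding * by blast+
      then show ?thesis unfolding v_def z_def by simp
    qed
    show "\<exists>N \<beta>'. open N \<and> x \<in> N \<and> Z \<inter> N \<subseteq> P \<and> smooth_on N \<beta>' \<and> (\<forall>y\<in>Z \<inter> N. \<beta>' y = \<beta> y)"
    proof (rule exI[of _ ?N2], rule exI[of _ ?\<beta>], intro conjI)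
      show "smooth_on ?N2 ?\<beta>" by (rule smooth_on_subset[OF sm1]) auto
    qed (use N2 xN2 main in blast)+
  qed
  ultimately show ?thesis by blast
qed

corollary manifold:
  assumes cov: "\<And>p. p \<in> Z \<Longrightarrow> \<exists>N (\<kappa> :: 'a \<Rightarrow> 'e::euclidean_space) W \<psi>. p \<in> N \<and> local_coords Z N \<kappa> W \<psi>"
    and dim: "dim \<gg> + DIM('f::euclidean_space) = DIM('e)"
  shows "smooth_manifold X (quotient_atlas Z q :: ('q, 'f) chart set)"
    and "smooth_submersion (top_of_set Z) (coord_atlas Z :: ('a, 'e) chart set) X
      (quotient_atlas Z q :: ('q, 'f) chart set) q"
proof -
  have "\<exists>P (\<beta> :: 'a \<Rightarrow> 'f). p \<in> P \<and> quotient_coords Z q P \<beta>" if "p \<in> Z" for p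
    using cov[OF that] slice[OF _ _ that dim] by blast
  note * = quotient_manifold[OF quotient Hausdorff_quotient second_countable_quotient this]
  show "smooth_manifold X (quotient_atlas Z q :: ('q, 'f) chart set)" by (rule *(1))
  show "smooth_submersion (top_of_set Z) (coord_atlas Z :: ('a, 'e) chart set) X
      (quotient_atlas Z q :: ('q, 'f) chart set) q" by (rule *(2))
qed

end

section \<open>Matrix functions and the exponential\<close>

lemma bounded_bilinear_matrix_mult:
  "bounded_bilinear ((**) :: real^'n^'m \<Rightarrow> real^'p^'n \<Rightarrow> real^'p^'m)"
  unfolding bilinear_conv_bounded_bilinear[symmetric] bilinear_def
  by (auto intro!: linearI simp: matrix_add_ldistrib matrix_scalar_ac scalar_matrix_assoc vec_eq_iff
      matrix_matrix_mult_def sum.distrib distrib_right distrib_left sum_distrib_left mult.assoc mult.left_commute)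

interpretation matrix_mult: bounded_bilinear "(**) :: real^'n^'m \<Rightarrow> real^'p^'n \<Rightarrow> real^'p^'m"
  by (rule bounded_bilinear_matrix_mult)

lemma linear_matrix_mult_left: "linear (\<lambda>X :: real^'n^'m. X ** (B :: real^'p^'n))"
  using matrix_mult.bounded_linear_left linear_conv_bounded_linear by blast

lemma linear_matrix_mult_right: "linear (\<lambda>X :: real^'p^'n. (A :: real^'n^'m) ** X)"
  using matrix_mult.bounded_linear_right linear_conv_bounded_linear by blast

lemma smooth_on_matrix_mult:
  "open S \<Longrightarrow> smooth_on S f \<Longrightarrow> smooth_on S g \<Longrightarrow>
    smooth_on S (\<lambda>x. (f x :: real^'n^'m) ** (g x :: real^'p^'n))"
  by (rule smooth_on_bounded_bilinear[OF bounded_bilinear_matrix_mult])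

lemma linear_transpose: "linear (transpose :: real^'n^'m \<Rightarrow> real^'m^'n)"
  by (rule linearI) (simp_all add: transpose_def vec_eq_iff)

lemma transpose_add: "transpose (A + B) = transpose A + transpose (B :: real^'n^'m)"
  by (rule linear_add[OF linear_transpose])

lemma transpose_diff: "transpose (A - B) = transpose A - transpose (B :: real^'n^'m)"
  by (rule linear_diff[OF linear_transpose])

lemma transpose_minus: "transpose (- A) = - transpose (A :: real^'n^'m)"
  by (rule linear_neg[OF linear_transpose])

lemma bounded_linear_transpose: "bounded_linear (transpose :: real^'n^'m \<Rightarrow> real^'m^'n)"
  using linear_transpose linear_conv_bounded_linear by blast

lemma norm_transpose: "norm (transpose (A :: real^'n^'m)) = norm A"
proof -
  have "(norm A)\<^sup>2 = (\<Sum>i\<in>UNIV. \<Sum>j\<in>UNIV. (A $ i $ j)\<^sup>2)" for A :: "real^'a^'b"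
    unfolding power2_norm_eq_inner inner_vec_def by (simp add: power2_eq_square)
  from this[of A] this[of "transpose A"] have "(norm (transpose A))\<^sup>2 = (norm A)\<^sup>2"
    using sum.swap[of "\<lambda>i j. (A $ i $ j)\<^sup>2" UNIV UNIV] by (simp add: transpose_def)
  then show ?thesis by simp
qed

lemma continuous_on_det: "continuous_on S (det :: real^'n^'n \<Rightarrow> real)"
proof -
  have "continuous_on S (\<lambda>A :: real^'n^'n. \<Sum>p\<in>{p. p permutes UNIV}. of_int (sign p) * (\<Prod>i\<in>UNIV. A $ i $ p i))"
    by (intro continuous_intros)
  then show ?thesis by (rule continuous_on_eq) (simp add: det_def)
qed

lemma open_invertible: "open {A :: real^'n^'n. invertible A}"
  using open_preimage_Collect[OF open_UNIV continuous_on_det, of "- {0}"]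
  by (simp add: invertible_det_nz open_Compl)

lemma matrix_inv:
  assumes "invertible (A :: real^'n^'n)"
  shows "matrix_inv A ** A = mat 1" "A ** matrix_inv A = mat 1"
  using someI_ex[OF assms[unfolded invertible_def]] unfolding matrix_inv_def by auto

text \<open>Left multiplication by \<open>A\<close> is a linear map depending linearly on
  \<open>A\<close>, and its inverse is left multiplication by the inverse matrix.\<close>

lemma smooth_on_matrix_inv: "smooth_on {A :: real^'n^'n. invertible A} matrix_inv"
proof -
  have "smooth_on {A :: real^'n^'n. invertible A} (\<lambda>A. matrix_inv A ** (mat 1 :: real^'n^'n))"
  proof (rule smooth_on_inverse_family[OF open_invertible, where M = "\<lambda>A B. A ** B"])
    show "smooth_on {A :: real^'n^'n. invertible A} (\<lambda>A. A ** (B :: real^'n^'n))" for B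
      by (rule smooth_on_linear[OF linear_matrix_mult_left])
    show "linear (\<lambda>B :: real^'n^'n. A ** B)" for A :: "real^'n^'n"
      by (rule linear_matrix_mult_right)
  qed (simp_all add: matrix_mul_assoc matrix_inv)
  then show ?thesis by simp
qed

section \<open>The matrix exponential\<close>

abbreviation mpow :: "real^'n^'n \<Rightarrow> nat \<Rightarrow> real^'n^'n" where
  "mpow X k \<equiv> (((**) X) ^^ k) (mat 1)"

lemma mpow_commute: "mpow X k ** X = X ** mpow X k"
  by (induction k) (simp_all add: matrix_mul_assoc[symmetric])

lemma mpow_scaleR: "mpow (t *\<^sub>R X) k = t ^ k *\<^sub>R mpow X k"
  by (induction k) (simp_all add: matrix_mult.scaleR_left matrix_mult.scaleR_right mult.commute)

lemma summable_mexp: "summable (\<lambda>k. (1 / fact k) *\<^sub>R mpow (X :: real^'n^'n) k)"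
proof -
  \<comment> \<open>The constant of the bounded bilinear product takes the place of
    submultiplicativity of the norm.\<close>
  obtain K where K: "K > 0" "\<And>(A :: real^'n^'n) (B :: real^'n^'n). norm (A ** B) \<le> norm A * norm B * K"
    using matrix_mult.pos_bounded by blast
  have bound: "norm (mpow X k) \<le> norm (mat 1 :: real^'n^'n) * (K * norm X) ^ k" for k
  proof (induction k)
    case (Suc k)
    have "norm (X ** mpow X k) \<le> norm X * norm (mpow X k) * K" by (rule K(2))
    also have "\<dots> \<le> norm X * (norm (mat 1 :: real^'n^'n) * (K * norm X) ^ k) * K"
      using Suc K(1) by (intro mult_right_mono mult_left_mono) auto
    finally show ?case by (simp add: ac_simps)
  qed simp
  show ?thesis
  proof (rule summable_comparison_test')
    show "summable (\<lambda>k. norm (mat 1 :: real^'n^'n) * (inverse (fact k) * (K * norm X) ^ k))"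
      by (intro summable_mult summable_exp)
    show "norm ((1 / fact k) *\<^sub>R mpow X k) \<le> norm (mat 1 :: real^'n^'n) * (inverse (fact k) * (K * norm X) ^ k)"
      for k
      using mult_left_mono[OF bound[of k], of "inverse (fact k)"] by (simp add: divide_inverse ac_simps)
  qed
qed

lemma mexp_0: "mexp 0 = (mat 1 :: real^'n^'n)"
proof -
  have "(1 / fact k) *\<^sub>R mpow (0 :: real^'n^'n) k = (if k = 0 then mat 1 else 0)" for k
    by (cases k) simp_all
  then show ?thesis unfolding mexp_def using suminf_finite[of "{0::nat}" "\<lambda>k. if k = 0 then mat 1 else (0 :: real^'n^'n)"] by simp
qed

lemma mexp_component:
  "(\<lambda>k. mpow X k $ i $ j / fact k * t ^ k) sums (mexp (t *\<^sub>R X) $ i $ j)"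
proof -
  have "(\<lambda>k. (1 / fact k) *\<^sub>R mpow (t *\<^sub>R X) k) sums mexp (t *\<^sub>R X)"
    unfolding mexp_def by (rule summable_sums[OF summable_mexp])
  then have "(\<lambda>k. ((1 / fact k) *\<^sub>R mpow (t *\<^sub>R X) k) $ i $ j) sums (mexp (t *\<^sub>R X) $ i $ j)"
    by (rule bounded_linear.sums[OF bounded_linear_compose[OF bounded_linear_vec_nth bounded_linear_vec_nth]])
  then show ?thesis by (simp add: mpow_scaleR divide_inverse ac_simps)
qed

lemma has_vector_derivative_matrix:
  fixes f :: "real \<Rightarrow> real^'n^'m"
  assumes "\<And>i j. ((\<lambda>t. f t $ i $ j) has_real_derivative f' $ i $ j) (at t)"
  shows "(f has_vector_derivative f') (at t)"
  unfolding has_vector_derivative_def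
proof (subst has_derivative_componentwise_within, rule ballI)
  fix b :: "real^'n^'m" assume "b \<in> Basis"
  then obtain i c where c: "b = axis i c" "c \<in> Basis" unfolding Basis_vec_def by blast
  then obtain j d where d: "c = axis j d" "d \<in> (Basis :: real set)" unfolding Basis_vec_def by blast
  then have b: "b = axis i (axis j 1)" using c(1) by simp
  have eq: "x \<bullet> b = x $ i $ j" for x :: "real^'n^'m"
    unfolding b by (simp add: inner_axis)
  show "((\<lambda>t. f t \<bullet> b) has_derivative (\<lambda>s. (s *\<^sub>R f') \<bullet> b)) (at t)"
    unfolding eq using assms[of i j] unfolding has_field_derivative_def by (simp add: mult_commute_abs)
qed

text \<open>Every entry is an everywhere convergent power series in \<open>t\<close>, which is
  differentiated term by term.\<close>

lemma mexp_derivative: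
  "((\<lambda>t. mexp (t *\<^sub>R X)) has_vector_derivative X ** mexp (t *\<^sub>R X)) (at t)"
  "X ** mexp (t *\<^sub>R X) = mexp (t *\<^sub>R X) ** X"
proof -
  have s: "(\<lambda>k. (1 / fact k) *\<^sub>R mpow (t *\<^sub>R X) k) sums mexp (t *\<^sub>R X)"
    unfolding mexp_def by (rule summable_sums[OF summable_mexp])
  have 1: "(\<lambda>k. X ** ((1 / fact k) *\<^sub>R mpow (t *\<^sub>R X) k)) sums (X ** mexp (t *\<^sub>R X))"
    by (rule bounded_linear.sums[OF matrix_mult.bounded_linear_right s])
  have "(\<lambda>k. ((1 / fact k) *\<^sub>R mpow (t *\<^sub>R X) k) ** X) sums (mexp (t *\<^sub>R X) ** X)"
    by (rule bounded_linear.sums[OF matrix_mult.bounded_linear_left s])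
  moreover have "((1 / fact k) *\<^sub>R mpow (t *\<^sub>R X) k) ** X = X ** ((1 / fact k) *\<^sub>R mpow (t *\<^sub>R X) k)" for k
    by (simp add: mpow_scaleR matrix_mult.scaleR_left matrix_mult.scaleR_right mpow_commute)
  ultimately show "X ** mexp (t *\<^sub>R X) = mexp (t *\<^sub>R X) ** X"
    using sums_unique2[OF 1] by simp
  have D: "((\<lambda>t. mexp (t *\<^sub>R X) $ i $ j) has_real_derivative (X ** mexp (t *\<^sub>R X)) $ i $ j) (at t)" for i j
  proof -
    let ?c = "\<lambda>k. mpow X k $ i $ j / fact k"
    have sum: "summable (\<lambda>k. ?c k * y ^ k)" for y using mexp_component[of X i j y] sums_summable by blast
    have "(\<lambda>k. (X ** ((1 / fact k) *\<^sub>R mpow (t *\<^sub>R X) k)) $ i $ j) sums ((X ** mexp (t *\<^sub>R X)) $ i $ j)"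
      by (rule bounded_linear.sums[OF bounded_linear_compose[OF bounded_linear_vec_nth bounded_linear_vec_nth] 1])
    moreover have "(X ** ((1 / fact k) *\<^sub>R mpow (t *\<^sub>R X) k)) $ i $ j = diffs ?c k * t ^ k" for k
      by (simp add: mpow_scaleR matrix_mult.scaleR_right diffs_def fact_Suc mult.commute del: of_nat_Suc)
    ultimately have "(\<lambda>k. diffs ?c k * t ^ k) sums ((X ** mexp (t *\<^sub>R X)) $ i $ j)" by simp
    then have "(\<Sum>k. diffs ?c k * t ^ k) = (X ** mexp (t *\<^sub>R X)) $ i $ j" by (rule sums_unique[symmetric])
    moreover have "((\<lambda>y. \<Sum>k. ?c k * y ^ k) has_real_derivative (\<Sum>k. diffs ?c k * t ^ k)) (at t)"
      by (rule termdiffs_strong_converges_everywhere) (rule sum)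
    moreover have "(\<lambda>y. \<Sum>k. ?c k * y ^ k) = (\<lambda>y. mexp (y *\<^sub>R X) $ i $ j)"
      by (intro ext sums_unique[symmetric] mexp_component)
    ultimately show ?thesis by simp
  qed
  show "((\<lambda>t. mexp (t *\<^sub>R X)) has_vector_derivative X ** mexp (t *\<^sub>R X)) (at t)"
    by (rule has_vector_derivative_matrix) (rule D)
qed

lemma has_vector_derivative_matrix_mult:
  assumes "((f :: real \<Rightarrow> real^'n^'m) has_vector_derivative f') (at t)"
    and "((g :: real \<Rightarrow> real^'p^'n) has_vector_derivative g') (at t)"
  shows "((\<lambda>t. f t ** g t) has_vector_derivative f t ** g' + f' ** g t) (at t)"
  by (rule matrix_mult.has_vector_derivative[OF assms])

lemma zero_vector_derivative_const:
  assumes "\<And>t. (f has_vector_derivative 0) (at t)"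
  shows "f t = f (0 :: real)"
  using has_vector_derivative_zero_constant[of UNIV f] assms by (metis UNIV_I convex_UNIV)

text \<open>The product of \<open>mexp ((- t) *\<^sub>R X)\<close> with a solution has derivative
  zero. The addition law, commutation with a fixed matrix and Euler's formula are all read off from
  this uniqueness.\<close>

lemma mexp_ode:
  assumes Y: "\<And>t. (Y has_vector_derivative (X :: real^'n^'n) ** Y t) (at t)"
  shows "Y t = mexp (t *\<^sub>R X) ** Y 0"
proof -
  have neg: "((\<lambda>t. mexp ((- t) *\<^sub>R X)) has_vector_derivative - (mexp ((- t) *\<^sub>R X) ** X)) (at t)" for t
  proof -
    have "(uminus has_vector_derivative - 1) (at t)"
      by (auto intro!: derivative_eq_intros)
    from vector_diff_chain_at[OF this mexp_derivative(1)[of X "- t"]] show ?thesis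
      by (simp add: o_def mexp_derivative(2)[of X "- t", simplified])
  qed
  have *: "mexp ((- t) *\<^sub>R X) ** Y t = Y 0" if Y: "\<And>t. (Y has_vector_derivative X ** Y t) (at t)" for t Y
  proof -
    have "((\<lambda>t. mexp ((- t) *\<^sub>R X) ** Y t) has_vector_derivative 0) (at t)" for t
      using has_vector_derivative_matrix_mult[OF neg[of t] Y[of t]]
      by (simp add: matrix_mult.minus_left matrix_mul_assoc)
    from zero_vector_derivative_const[OF this] show ?thesis by (simp add: mexp_0)
  qed
  \<comment> \<open>The exponential itself is a solution, so the constancy just shown, applied to it
    at \<open>- t\<close>, yields the inverse.\<close>
  have "mexp (t *\<^sub>R X) ** mexp ((- t) *\<^sub>R X) = mat 1"
    using *[OF mexp_derivative(1), of "- t"] by (simp add: mexp_0)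
  then show ?thesis using *[OF Y, of t] by (metis matrix_mul_assoc matrix_mul_lid)
qed

lemma mexp_add: "mexp ((s + t) *\<^sub>R X) = mexp (s *\<^sub>R X) ** mexp (t *\<^sub>R X)"
proof -
  have "((\<lambda>s. mexp ((s + t) *\<^sub>R X)) has_vector_derivative X ** mexp ((s + t) *\<^sub>R X)) (at s)" for s
  proof -
    have "((\<lambda>s. s + t) has_vector_derivative 1) (at s)" by (auto intro!: derivative_eq_intros)
    from vector_diff_chain_at[OF this mexp_derivative(1)] show ?thesis by (simp add: o_def)
  qed
  from mexp_ode[OF this] show ?thesis by simp
qed

lemma mexp_inverse: "mexp (t *\<^sub>R X) ** mexp ((- t) *\<^sub>R X) = mat 1" "mexp ((- t) *\<^sub>R X) ** mexp (t *\<^sub>R X) = mat 1"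
  using mexp_add[of t "- t" X] mexp_add[of "- t" t X] by (simp_all add: mexp_0)

lemma mexp_commute:
  assumes "Q ** X = X ** Q"
  shows "Q ** mexp (t *\<^sub>R X) = mexp (t *\<^sub>R X) ** Q"
proof -
  have "((\<lambda>t. Q ** mexp (t *\<^sub>R X)) has_vector_derivative X ** (Q ** mexp (t *\<^sub>R X))) (at t)" for t
    using has_vector_derivative_matrix_mult[OF has_vector_derivative_const[of Q] mexp_derivative(1)[of X t]]
    by (simp add: matrix_mul_assoc assms)
  from mexp_ode[OF this, of t] show ?thesis by (simp add: mexp_0)
qed

text \<open>The matrix \<open>J\<close> is left arbitrary because both the form of signature (3,4)
  and, with \<open>J = mat 1\<close>, the Euclidean one are needed.\<close>

lemma mexp_preserves:
  assumes "transpose X ** J + J ** X = 0"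
  shows "transpose (mexp (t *\<^sub>R X)) ** J ** mexp (t *\<^sub>R X) = J"
proof -
  let ?E = "\<lambda>t. mexp (t *\<^sub>R X)"
  have "((\<lambda>t. transpose (?E t) ** (J ** ?E t)) has_vector_derivative 0) (at t)" for t
  proof -
    have "((\<lambda>t. transpose (?E t)) has_vector_derivative transpose (?E t) ** transpose X) (at t)"
      using bounded_linear.has_vector_derivative[OF bounded_linear_transpose mexp_derivative(1)[of X t]]
      by (simp add: matrix_transpose_mul)
    moreover have "((\<lambda>t. J ** ?E t) has_vector_derivative J ** (X ** ?E t)) (at t)"
      using bounded_linear.has_vector_derivative[OF matrix_mult.bounded_linear_right mexp_derivative(1)[of X t]] .
    ultimately have "((\<lambda>t. transpose (?E t) ** (J ** ?E t)) has_vector_derivative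
        transpose (?E t) ** (J ** (X ** ?E t)) + transpose (?E t) ** transpose X ** (J ** ?E t)) (at t)"
      by (rule has_vector_derivative_matrix_mult)
    moreover have "transpose (?E t) ** (J ** (X ** ?E t)) + transpose (?E t) ** transpose X ** (J ** ?E t)
       = transpose (?E t) ** (transpose X ** J + J ** X) ** ?E t"
      by (simp add: matrix_add_ldistrib matrix_mult.add_left matrix_mul_assoc)
    ultimately show ?thesis using assms by simp
  qed
  from zero_vector_derivative_const[OF this, of t] show ?thesis by (simp add: mexp_0 matrix_mul_assoc)
qed

text \<open>Euler's formula: both sides solve the same linear equation with value 1 at 0.\<close>

lemma mexp_rotation:
  assumes "X ** X = - mat 1"
  shows "mexp (t *\<^sub>R X) = cos t *\<^sub>R mat 1 + sin t *\<^sub>R X"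
proof -
  have "((\<lambda>t. cos t *\<^sub>R mat 1 + sin t *\<^sub>R X) has_vector_derivative X ** (cos t *\<^sub>R mat 1 + sin t *\<^sub>R X)) (at t)" for t
  proof -
    have "((\<lambda>t. cos t *\<^sub>R mat 1 + sin t *\<^sub>R X) has_vector_derivative (- sin t) *\<^sub>R mat 1 + cos t *\<^sub>R X) (at t)"
      by (auto intro!: derivative_eq_intros)
    then show ?thesis
      by (simp add: matrix_add_ldistrib matrix_mult.scaleR_right assms algebra_simps)
  qed
  from mexp_ode[OF this, of t] show ?thesis by simp
qed

lemma continuous_on_mexp: "continuous_on S (\<lambda>t. mexp (t *\<^sub>R X))"
  using mexp_derivative(1) has_vector_derivative_continuous
  by (blast intro: continuous_at_imp_continuous_on)

lemma smooth_on_mexp: "smooth_on UNIV (\<lambda>t. mexp (t *\<^sub>R (X :: real^'n^'n)))"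
proof -
  \<comment> \<open>The constant left factor closes the induction: differentiation replaces
    \<open>B\<close> by a multiple of \<open>B ** X\<close>.\<close>
  have "Ck_on k UNIV (\<lambda>t. B ** mexp (t *\<^sub>R X))" for k and B :: "real^'n^'n"
  proof (induction k arbitrary: B)
    case 0
    then show ?case by (simp add: matrix_mult.continuous_on continuous_on_mexp)
  next
    case (Suc k)
    show ?case
    proof (rule Ck_on_SucI[OF open_UNIV, where f' = "\<lambda>t v. v *\<^sub>R (B ** (X ** mexp (t *\<^sub>R X)))"])
      show "((\<lambda>t. B ** mexp (t *\<^sub>R X)) has_derivative (\<lambda>v. v *\<^sub>R (B ** (X ** mexp (t *\<^sub>R X))))) (at t)" for t
        using bounded_linear.has_vector_derivative[OF matrix_mult.bounded_linear_right mexp_derivative(1)[of X t]]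
        unfolding has_vector_derivative_def .
      show "Ck_on k UNIV (\<lambda>t. v *\<^sub>R (B ** (X ** mexp (t *\<^sub>R X))))" for v
        using Suc[of "v *\<^sub>R (B ** X)"] by (simp add: matrix_mul_assoc matrix_mult.scaleR_left)
    qed
  qed
  from this[of _ "mat 1"] show ?thesis unfolding smooth_on_def by simp
qed

section \<open>The form of signature (3,4)\<close>

lemma sum_UNIV_sum:
  "(\<Sum>r\<in>(UNIV :: ('a::finite + 'b::finite) set). f r) = (\<Sum>i\<in>UNIV. f (Inl i)) + (\<Sum>j\<in>UNIV. f (Inr j))"
  using sum.Plus[of "UNIV :: 'a set" "UNIV :: 'b set" f] by (simp add: UNIV_Plus_UNIV)

definition J34 :: mat34 where
  "J34 = (\<chi> r s. if r = s then case r of Inl _ \<Rightarrow> 1 | Inr _ \<Rightarrow> - 1 else 0)"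

lemma J34_mult_vec: "(J34 *v x) $ Inl i = x $ Inl i" "(J34 *v x) $ Inr j = - (x $ Inr j)"
  by (simp_all add: J34_def matrix_vector_mult_def if_distrib[of "\<lambda>c. c * _"] cong: if_cong)

lemma form34_eq: "form34 x y = x \<bullet> (J34 *v y)"
  unfolding form34_def inner_vec_def sum_UNIV_sum J34_mult_vec by (simp add: sum_negf)

lemma transpose_J34 [simp]: "transpose J34 = J34"
  by (auto simp: J34_def transpose_def vec_eq_iff)

lemma J34_J34 [simp]: "J34 ** J34 = mat 1"
proof -
  have "(J34 *v (J34 *v x)) $ r = x $ r" for x r
    by (cases r) (simp_all add: J34_mult_vec)
  then have "(J34 ** J34) *v x = mat 1 *v x" for x
    by (simp add: matrix_vector_mul_assoc[symmetric] vec_eq_iff)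
  then show ?thesis using matrix_eq by blast
qed

lemma J34_J34_vec [simp]: "J34 *v (J34 *v x) = x"
  by (simp add: matrix_vector_mul_assoc)

lemma inner_matrix_vec: "(x :: real^'m) \<bullet> (A *v (y :: real^'n)) = (transpose A *v x) \<bullet> y"
  by (metis dot_lmul_matrix transpose_matrix_vector)

lemma inner_matrix_vec': "((A :: real^'n^'m) *v x) \<bullet> y = x \<bullet> (transpose A *v y)"
  by (simp only: inner_matrix_vec transpose_transpose)

lemma form34_commute: "form34 x y = form34 y x"
  unfolding form34_eq by (metis inner_commute inner_matrix_vec transpose_J34)

lemma form34_simps:
  "form34 (x + y) z = form34 x z + form34 y z" "form34 z (x + y) = form34 z x + form34 z y"
  "form34 (x - y) z = form34 x z - form34 y z" "form34 z (x - y) = form34 z x - form34 z y"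
  "form34 (c *\<^sub>R x) z = c * form34 x z" "form34 z (c *\<^sub>R x) = c * form34 z x"
  "form34 0 z = 0" "form34 z 0 = 0" "form34 (- x) z = - form34 x z" "form34 z (- x) = - form34 z x"
proof -
  show l: "form34 (x + y) z = form34 x z + form34 y z" "form34 (x - y) z = form34 x z - form34 y z"
    "form34 (c *\<^sub>R x) z = c * form34 x z" "form34 0 z = 0" "form34 (- x) z = - form34 x z" for x y z c
    unfolding form34_eq by (simp_all add: inner_simps)
  show "form34 z (x + y) = form34 z x + form34 z y" "form34 z (x - y) = form34 z x - form34 z y"
    "form34 z (c *\<^sub>R x) = c * form34 z x" "form34 z 0 = 0" "form34 z (- x) = - form34 z x"
    unfolding form34_commute[of z] by (rule l)+
qed

lemma form34_nondegenerate: "(\<And>y. form34 x y = 0) \<Longrightarrow> x = 0"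
  unfolding form34_eq using inner_eq_zero_iff[of x] J34_J34_vec by metis

lemma form34_matrix_iff:
  "(\<forall>x y. form34 (g *v x) (g *v y) = form34 x y) \<longleftrightarrow> transpose g ** J34 ** g = J34"
proof
  assume L: "\<forall>x y. form34 (g *v x) (g *v y) = form34 x y"
  have "(transpose g ** J34 ** g) *v y = J34 *v y" for y
  proof -
    have "x \<bullet> ((transpose g ** J34 ** g) *v y) = x \<bullet> (J34 *v y)" for x
      using L unfolding form34_eq inner_matrix_vec[of x] matrix_transpose_mul transpose_transpose
      by (metis inner_matrix_vec matrix_vector_mul_assoc transpose_J34)
    then show ?thesis using vector_eq_ldot by blast
  qed
  then show "transpose g ** J34 ** g = J34" using matrix_eq by blast
next
  assume R: "transpose g ** J34 ** g = J34"
  show "\<forall>x y. form34 (g *v x) (g *v y) = form34 x y"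
  proof (intro allI)
    fix x y
    have "form34 (g *v x) (g *v y) = x \<bullet> ((transpose g ** J34 ** g) *v y)"
      unfolding form34_eq inner_matrix_vec[of x] by (simp add: matrix_transpose_mul inner_matrix_vec
          matrix_vector_mul_assoc[symmetric])
    then show "form34 (g *v x) (g *v y) = form34 x y" unfolding R form34_eq .
  qed
qed

lemma so34_skew: "A \<in> so34 \<Longrightarrow> form34 (A *v x) y = - form34 x (A *v y)"
  unfolding so34_def by (simp add: eq_neg_iff_add_eq_0)

lemma so34_iff: "A \<in> so34 \<longleftrightarrow> transpose A ** J34 + J34 ** A = 0"
proof -
  have "form34 (A *v x) y + form34 x (A *v y) = x \<bullet> ((transpose A ** J34 + J34 ** A) *v y)" for x y
    by (simp only: form34_eq inner_matrix_vec'[of A] matrix_vector_mul_assoc matrix_vector_mult_add_rdistrib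
        inner_add_right)
  then have "A \<in> so34 \<longleftrightarrow> (\<forall>x y. x \<bullet> ((transpose A ** J34 + J34 ** A) *v y) = 0)"
    unfolding so34_def by simp
  also have "\<dots> \<longleftrightarrow> (\<forall>y. (transpose A ** J34 + J34 ** A) *v y = 0 *v y)"
    by (metis inner_zero_right inner_eq_zero_iff matrix_vector_mult_0)
  finally show ?thesis using matrix_eq by blast
qed

section \<open>Invariant definite subspaces and the family \<open>IV\<^sub>4\<close>\<close>

text \<open>Cauchy-Schwarz for a semidefinite form: a null vector lies in the radical.\<close>

lemma psd_form_null_vector:
  fixes Q :: "real^'n^'n"
  assumes sym: "transpose Q = Q" and F: "subspace F" and psd: "\<And>y. y \<in> F \<Longrightarrow> y \<bullet> (Q *v y) \<ge> 0"
    and x: "x \<in> F" "x \<bullet> (Q *v x) = 0" and y: "y \<in> F"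
  shows "x \<bullet> (Q *v y) = 0"
proof (rule ccontr)
  define b c where "b = x \<bullet> (Q *v y)" and "c = y \<bullet> (Q *v y)"
  assume "x \<bullet> (Q *v y) \<noteq> 0"
  then have b: "b \<noteq> 0" unfolding b_def .
  have c: "c \<ge> 0" unfolding c_def by (rule psd[OF y])
  have yx: "y \<bullet> (Q *v x) = b" unfolding b_def by (metis inner_commute inner_matrix_vec sym)
  \<comment> \<open>Adding 1 keeps the denominator positive even if \<open>c = 0\<close>; at
    \<open>t = - b / u\<close> the quadratic polynomial is negative since
    \<open>c < 2 * u\<close>.\<close>
  define u where "u = c + 1"
  have u: "u > 0" unfolding u_def using c by simp
  define t where "t = - b / u"
  have "0 \<le> (x + t *\<^sub>R y) \<bullet> (Q *v (x + t *\<^sub>R y))"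
    by (intro psd subspace_add[OF F] subspace_scale[OF F] x y)
  also have "\<dots> = 2 * t * b + t\<^sup>2 * c"
    using x(2) yx unfolding b_def c_def
    by (simp add: matrix_vector_right_distrib matrix_vector_mult_scaleR inner_simps power2_eq_square algebra_simps)
  also have "\<dots> = (b\<^sup>2 * (c - 2 * u)) / u\<^sup>2"
    unfolding t_def using u by (simp add: field_simps power2_eq_square)
  also have "\<dots> < 0" using b c u unfolding u_def by (intro divide_neg_pos mult_pos_neg) auto
  finally show False by simp
qed

text \<open>An eigenvector of the pencil \<open>Q - l R\<close> on \<open>F\<close>, found at the
  maximum of the Rayleigh quotient. There \<open>l R - Q\<close> is semidefinite on \<open>F\<close>
  with null vector \<open>x\<close>, so \<open>x\<close> lies in its radical.\<close>

lemma rayleigh_maximum: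
  fixes Q R :: "real^'n^'n"
  assumes sym: "transpose Q = Q" "transpose R = R" and F: "subspace F" "F \<noteq> {0}"
    and pos: "\<And>y. y \<in> F \<Longrightarrow> y \<noteq> 0 \<Longrightarrow> y \<bullet> (R *v y) > 0"
  obtains x l where "x \<in> F" "x \<noteq> 0" "\<And>y. y \<in> F \<Longrightarrow> x \<bullet> (Q *v y) = l * (x \<bullet> (R *v y))"
    "\<And>y. y \<in> F \<Longrightarrow> y \<bullet> (Q *v y) \<le> l * (y \<bullet> (R *v y))"
proof -
  let ?K = "F \<inter> sphere 0 1" and ?f = "\<lambda>y. (y \<bullet> (Q *v y)) / (y \<bullet> (R *v y))"
  obtain y0 where y0: "y0 \<in> F" "y0 \<noteq> 0" using F subspace_0 by blast
  have unit: "(1 / norm y) *\<^sub>R y \<in> ?K" if "y \<in> F" "y \<noteq> 0" for y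
    using that subspace_scale[OF F(1)] by auto
  have "compact ?K" using closed_subspace[OF F(1)] by (simp add: closed_Int_compact)
  moreover have "?K \<noteq> {}" using unit[OF y0] by blast
  moreover have "continuous_on ?K ?f"
  proof (intro continuous_intros)
    show "\<forall>y\<in>?K. y \<bullet> (R *v y) \<noteq> 0" using pos by (force simp: less_le)
  qed
  ultimately have "\<exists>x\<in>?K. \<forall>y\<in>?K. ?f y \<le> ?f x" by (rule continuous_attains_sup)
  then obtain x where x: "x \<in> ?K" "\<And>y. y \<in> ?K \<Longrightarrow> ?f y \<le> ?f x" by blast
  have x0: "x \<in> F" "x \<noteq> 0" using x(1) by auto
  define l where "l = ?f x"
  have le: "y \<bullet> (Q *v y) \<le> l * (y \<bullet> (R *v y))" if y: "y \<in> F" for y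
  proof (cases "y = 0")
    case False
    have "?f ((1 / norm y) *\<^sub>R y) = ?f y"
      using False by (simp add: matrix_vector_mult_scaleR)
    then have "?f y \<le> l" using x(2)[OF unit[OF y False]] unfolding l_def by simp
    then show ?thesis using pos[OF y False] by (simp add: divide_le_eq)
  qed simp
  have "x \<bullet> ((l *\<^sub>R R - Q) *v y) = 0" if "y \<in> F" for y
  proof (rule psd_form_null_vector[OF _ F(1) _ x0(1) _ that])
    show "transpose (l *\<^sub>R R - Q) = l *\<^sub>R R - Q" by (simp add: transpose_diff transpose_scalar sym)
    show "y \<bullet> ((l *\<^sub>R R - Q) *v y) \<ge> 0" if "y \<in> F" for y
      using le[OF that] by (simp add: matrix_vector_mult_diff_rdistrib inner_diff_right scaleR_matrix_vector_assoc[symmetric])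
    show "x \<bullet> ((l *\<^sub>R R - Q) *v x) = 0"
      using pos[OF x0] unfolding l_def
      by (simp add: matrix_vector_mult_diff_rdistrib inner_diff_right scaleR_matrix_vector_assoc[symmetric])
  qed
  then have "x \<bullet> (Q *v y) = l * (x \<bullet> (R *v y))" if "y \<in> F" for y
    using that by (simp add: matrix_vector_mult_diff_rdistrib inner_diff_right scaleR_matrix_vector_assoc[symmetric])
  then show ?thesis using that x0 le by blast
qed

section \<open>Orthogonal complements for the form\<close>

definition form_complement :: "R34 set \<Rightarrow> R34 set" where
  "form_complement P = {x. \<forall>p\<in>P. form34 x p = 0}"

lemma subspace_form_complement: "subspace (form_complement P)"
  unfolding form_complement_def subspace_def by (auto simp: form34_simps)

text \<open>\<open>J34\<close> carries the Euclidean orthogonal complement bijectively onto the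
  complement for the form.\<close>

lemma dim_form_complement:
  assumes "subspace P"
  shows "dim (form_complement P) + dim P = 7"
proof -
  have orth: "form34 (J34 *v y) p = p \<bullet> y" for y p
    unfolding form34_commute[of "J34 *v y" p] unfolding form34_eq J34_J34_vec ..
  have "form_complement P = (\<lambda>y. J34 *v y) ` {y \<in> UNIV. \<forall>p\<in>P. orthogonal p y}" (is "_ = _ ` ?O")
  proof (intro set_eqI iffI)
    fix x assume x: "x \<in> form_complement P"
    have "J34 *v x \<in> ?O"
      using x orth[of "J34 *v x"] unfolding form_complement_def orthogonal_def by simp
    then show "x \<in> (\<lambda>y. J34 *v y) ` ?O" by (intro image_eqI[of _ _ "J34 *v x"]) simp_all
  qed (auto simp: form_complement_def orth orthogonal_def)
  moreover have "dim ((\<lambda>y. J34 *v y) ` ?O) = dim ?O"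
  proof (rule dim_image_eq)
    show "inj_on ((*v) J34) (span ?O)" by (rule inj_on_inverseI[of _ "\<lambda>y. J34 *v y"]) simp
  qed (rule matrix_vector_mul_linear)
  moreover have "dim ?O + dim P = dim (UNIV :: R34 set)"
    by (rule dim_subspace_orthogonal_to_vectors[OF assms subspace_UNIV]) simp
  ultimately show ?thesis by simp
qed

lemma form_complement_split:
  assumes P: "subspace P" and nondeg: "\<And>p. p \<in> P \<Longrightarrow> p \<in> form_complement P \<Longrightarrow> p = 0"
  obtains p where "p \<in> P" "x - p \<in> form_complement P"
proof -
  have "P \<inter> form_complement P = {0}"
    using nondeg subspace_0[OF P] subspace_0[OF subspace_form_complement] by blast
  then have "dim {p + c | p c. p \<in> P \<and> c \<in> form_complement P} = dim (UNIV :: R34 set)"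
    using dim_sums_Int[OF P subspace_form_complement[of P]] dim_form_complement[OF P] by simp
  then have "{p + c | p c. p \<in> P \<and> c \<in> form_complement P} = UNIV"
    using subspace_dim_equal[OF subspace_sums[OF P subspace_form_complement[of P]] subspace_UNIV] by auto
  then obtain p c where "p \<in> P" "c \<in> form_complement P" "x = p + c" by blast
  then show ?thesis using that[of p] by simp
qed

lemma definite_nondegenerate:
  "pos_def_on P \<or> neg_def_on P \<Longrightarrow> p \<in> P \<Longrightarrow> p \<in> form_complement P \<Longrightarrow> p = 0"
  unfolding pos_def_on_def neg_def_on_def form_complement_def by force

lemma definite_split:
  assumes P: "subspace P" "pos_def_on P \<or> neg_def_on P"
  shows "\<exists>p. p \<in> P \<and> x - p \<in> form_complement P"
  using form_complement_split[OF P(1) definite_nondegenerate[OF P(2)]] by blast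

lemma invariant_form_complement:
  "A \<in> so34 \<Longrightarrow> invariant_under A P \<Longrightarrow> invariant_under A (form_complement P)"
  unfolding invariant_under_def form_complement_def by (simp add: so34_skew)

lemma invariant_Int: "invariant_under A P \<Longrightarrow> invariant_under A Q \<Longrightarrow> invariant_under A (P \<inter> Q)"
  unfolding invariant_under_def by blast

lemma dim_complement_in:
  assumes F: "subspace F" and P: "subspace P" "P \<subseteq> F" "pos_def_on P \<or> neg_def_on P"
  shows "dim P + dim (F \<inter> form_complement P) = dim F"
proof -
  let ?C = "F \<inter> form_complement P"
  have C: "subspace ?C" by (rule subspace_inter[OF F subspace_form_complement])
  have "P \<inter> ?C = {0}"
    using definite_nondegenerate[OF P(3)] subspace_0[OF P(1)] subspace_0[OF C] by blast
  moreover have "{p + c | p c. p \<in> P \<and> c \<in> ?C} = F"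
  proof
    show "{p + c | p c. p \<in> P \<and> c \<in> ?C} \<subseteq> F" using P(2) subspace_add[OF F] by blast
    show "F \<subseteq> {p + c | p c. p \<in> P \<and> c \<in> ?C}"
    proof
      fix x assume x: "x \<in> F"
      obtain p where p: "p \<in> P" "x - p \<in> form_complement P"
        using definite_split[OF P(1,3)] by blast
      have "x = p + (x - p)" "x - p \<in> F" using x p(1) P(2) subspace_diff[OF F] by auto
      then show "x \<in> {p + c | p c. p \<in> P \<and> c \<in> ?C}" using p by blast
    qed
  qed
  ultimately show ?thesis using dim_sums_Int[OF P(1) C] by simp
qed

lemma normalized_vector:
  assumes "s * s = 1" "s * form34 x x > 0"
  shows "form34 ((1 / sqrt (s * form34 x x)) *\<^sub>R x) ((1 / sqrt (s * form34 x x)) *\<^sub>R x) = s"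
proof -
  have "form34 x x = s * (s * form34 x x)" using assms(1) by (simp add: mult.assoc[symmetric])
  also have "\<dots> = s * (sqrt (s * form34 x x) * sqrt (s * form34 x x))" using assms(2) by simp
  finally have "form34 x x = s * (sqrt (s * form34 x x) * sqrt (s * form34 x x))" .
  moreover have "sqrt (s * form34 x x) > 0" using assms(2) by simp
  ultimately show ?thesis
    by (simp add: form34_simps) (metis less_irrefl nonzero_mult_div_cancel_right mult_eq_0_iff)
qed

lemma span_pair_cases:
  assumes "x \<in> span {w1, w2 :: R34}"
  obtains a b where "x = a *\<^sub>R w1 + b *\<^sub>R w2"
proof -
  obtain a where "x - a *\<^sub>R w1 \<in> span {w2}" using assms span_breakdown_eq[of x w1] by blast
  then obtain b where "x - a *\<^sub>R w1 = b *\<^sub>R w2" using span_singleton[of w2] by blast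
  then show ?thesis using that[of a b] by (simp add: algebra_simps)
qed

text \<open>The sign \<open>s\<close> treats positive and negative definite \<open>F\<close>
  together. Since \<open>A\<close> is skew, the quotient maximized is that of the square of
  \<open>A\<close> up to sign; its maximizer \<open>x\<close> satisfies
  \<open>A *v (A *v x) = - l *\<^sub>R x\<close>, and \<open>x\<close> with \<open>A *v x\<close>
  spans the plane. If \<open>l\<close> is not positive, any plane in \<open>F\<close> will
  do.\<close>

lemma rotation_plane:
  assumes A: "A \<in> so34" and F: "subspace F" "dim F \<ge> 2" "invariant_under A F"
    and s: "s * s = 1" "\<And>x. x \<in> F \<Longrightarrow> x \<noteq> 0 \<Longrightarrow> s * form34 x x > 0"
  obtains P where "subspace P" "dim P = 2" "P \<subseteq> F" "invariant_under A P" "acts_as_rotation A P"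
proof -
  have AF: "A *v x \<in> F" if "x \<in> F" for x using F(3) that unfolding invariant_under_def by blast
  have "F \<noteq> {0}" using F(2) by auto
  have symQ: "transpose (s *\<^sub>R (transpose A ** J34 ** A)) = s *\<^sub>R (transpose A ** J34 ** A)"
    by (simp add: transpose_scalar matrix_transpose_mul matrix_mul_assoc)
  have symR: "transpose (s *\<^sub>R J34) = s *\<^sub>R J34" by (simp add: transpose_scalar)
  have Q: "x \<bullet> ((s *\<^sub>R (transpose A ** J34 ** A)) *v y) = s * form34 (A *v x) (A *v y)" for x y
    by (simp only: form34_eq inner_matrix_vec'[of A] matrix_vector_mul_assoc matrix_mul_assoc
        scaleR_matrix_vector_assoc[symmetric] inner_scaleR_right)
  have R: "x \<bullet> ((s *\<^sub>R J34) *v y) = s * form34 x y" for x y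
    unfolding form34_eq by (simp add: scaleR_matrix_vector_assoc[symmetric])
  have pos: "y \<bullet> ((s *\<^sub>R J34) *v y) > 0" if "y \<in> F" "y \<noteq> 0" for y unfolding R by (rule s(2)[OF that])
  obtain x l where x: "x \<in> F" "x \<noteq> 0" "\<And>y. y \<in> F \<Longrightarrow> s * form34 (A *v x) (A *v y) = l * (s * form34 x y)"
    "\<And>y. y \<in> F \<Longrightarrow> s * form34 (A *v y) (A *v y) \<le> l * (s * form34 y y)"
    using rayleigh_maximum[OF symQ symR F(1) \<open>F \<noteq> {0}\<close> pos] unfolding Q R by blast
  define a where "a = 1 / sqrt (s * form34 x x)"
  define w1 where "w1 = a *\<^sub>R x"
  have w1: "w1 \<in> F" "form34 w1 w1 = s"
    using subspace_scale[OF F(1) x(1)] normalized_vector[OF s(1) s(2)[OF x(1,2)]] unfolding w1_def a_def by auto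
  have s_cancel: "s * u = s * v \<Longrightarrow> u = v" for u v using s(1) by (metis mult_cancel_left mult_zero_left zero_neq_one)
  have s0: "s \<noteq> 0" using s(1) by auto
  have "\<exists>w2 b. w2 \<in> F \<and> form34 w1 w2 = 0 \<and> form34 w2 w2 = s \<and> A *v w1 = b *\<^sub>R w2 \<and> A *v w2 = - b *\<^sub>R w1"
  proof (cases "l \<le> 0")
    case True
    \<comment> \<open>All values of the quotient are at most 0, while \<open>F\<close> is invariant
      and definite; hence \<open>A\<close> vanishes on \<open>F\<close> and the rotation coefficient
      is 0.\<close>
    have A0: "A *v y = 0" if y: "y \<in> F" for y
    proof (rule ccontr)
      assume "A *v y \<noteq> 0"
      then have "s * form34 (A *v y) (A *v y) > 0" "y \<noteq> 0" using s(2) AF[OF y] by auto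
      moreover have "l * (s * form34 y y) \<le> 0"
        using True s(2)[OF y \<open>y \<noteq> 0\<close>] by (simp add: mult_nonpos_nonneg)
      ultimately show False using x(4)[OF y] by linarith
    qed
    have "\<not> F \<subseteq> span {w1}"
    proof
      assume "F \<subseteq> span {w1}"
      then have "dim F \<le> dim (span {w1})" by (rule dim_subset)
      then show False using F(2) by (simp split: if_splits)
    qed
    then obtain y where y: "y \<in> F" "y \<notin> span {w1}" by blast
    define z where "z = y - (s * form34 w1 y) *\<^sub>R w1"
    have z: "z \<in> F" "z \<noteq> 0"
    proof -
      show "z \<in> F" unfolding z_def using y(1) w1(1) subspace_diff[OF F(1)] subspace_scale[OF F(1)] by blast
      show "z \<noteq> 0" using y(2) span_mul[OF span_base[of w1 "{w1}"], of "s * form34 w1 y"] unfolding z_def by auto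
    qed
    have "form34 w1 z = 0" unfolding z_def by (simp add: form34_simps w1(2) s(1) mult.commute mult.left_commute)
    let ?w2 = "(1 / sqrt (s * form34 z z)) *\<^sub>R z"
    have "?w2 \<in> F" "form34 w1 ?w2 = 0" "form34 ?w2 ?w2 = s"
      using subspace_scale[OF F(1) z(1)] \<open>form34 w1 z = 0\<close> normalized_vector[OF s(1) s(2)[OF z]]
      by (auto simp: form34_simps)
    then show ?thesis using A0 w1(1) by (intro exI[of _ ?w2] exI[of _ 0]) auto
  next
    case False
    define b where "b = sqrt l"
    have b: "b > 0" "b * b = l" unfolding b_def using False by auto
    \<comment> \<open>The eigenvector equation, tested against all of \<open>F\<close>; definiteness
      of the form on \<open>F\<close> turns it into an equation of vectors.\<close>
    have AA: "A *v (A *v x) = - l *\<^sub>R x"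
    proof -
      let ?u = "A *v (A *v x) + l *\<^sub>R x"
      have u: "?u \<in> F" using AF x(1) subspace_add[OF F(1)] subspace_scale[OF F(1)] by blast
      have "form34 ?u y = 0" if "y \<in> F" for y
        using s_cancel[of "form34 (A *v x) (A *v y)" "l * form34 x y"] x(3)[OF that]
        by (simp add: form34_simps so34_skew[OF A, of "A *v x"] mult.left_commute)
      then have "?u = 0" using s(2)[OF u] u by force
      then show ?thesis by (simp add: eq_neg_iff_add_eq_0)
    qed
    define w2 where "w2 = (1 / b) *\<^sub>R (A *v w1)"
    have AA1: "A *v (A *v w1) = - l *\<^sub>R w1" unfolding w1_def by (simp add: matrix_vector_mult_scaleR AA)
    have w1A: "form34 w1 (A *v w1) = 0" using so34_skew[OF A, of w1 w1] form34_commute[of w1] by simp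
    show ?thesis
    proof (intro exI conjI)
      show "w2 \<in> F" unfolding w2_def using AF[OF w1(1)] subspace_scale[OF F(1)] by blast
      show "form34 w1 w2 = 0" unfolding w2_def by (simp add: form34_simps w1A)
      have "form34 (A *v w1) (A *v w1) = l * s"
        unfolding so34_skew[OF A, of w1] AA1 by (simp add: form34_simps w1(2))
      then show "form34 w2 w2 = s" unfolding w2_def using b False by (simp add: form34_simps)
      show "A *v w1 = b *\<^sub>R w2" unfolding w2_def using b(1) by simp
      show "A *v w2 = - b *\<^sub>R w1" unfolding w2_def using b
        by (simp add: matrix_vector_mult_scaleR AA1 b(2)[symmetric])
    qed
  qed
  then obtain w2 b where w2: "w2 \<in> F" "form34 w1 w2 = 0" "form34 w2 w2 = s"
    "A *v w1 = b *\<^sub>R w2" "A *v w2 = - b *\<^sub>R w1" by blast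
  let ?P = "span {w1, w2}"
  have abs: "\<bar>s\<bar> = 1" using s(1) by (metis abs_mult_self_eq abs_one real_sqrt_abs2 real_sqrt_one)
  have w0: "w1 \<noteq> 0" "w2 \<noteq> 0" using w1(2) w2(3) s0 by (auto simp: form34_simps)
  have "w2 \<notin> span {w1}"
  proof
    assume "w2 \<in> span {w1}"
    then obtain k where "w2 = k *\<^sub>R w1" using span_singleton[of w1] by blast
    then show False using w2(2) w1(2) w0 s0 by (simp add: form34_simps)
  qed
  then have "dim ?P = 2"
    using w0(1) dim_insert[of w2 "{w1}"] by (simp add: insert_commute)
  moreover have "?P \<subseteq> F" using w1(1) w2(1) F(1) by (intro span_minimal) auto
  moreover have "invariant_under A ?P"
    unfolding invariant_under_def
  proof
    fix v assume "v \<in> ?P"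
    then obtain c d where v: "v = c *\<^sub>R w1 + d *\<^sub>R w2" by (rule span_pair_cases)
    have "A *v v = (c * b) *\<^sub>R w2 + (- d * b) *\<^sub>R w1"
      unfolding v by (simp add: matrix_vector_right_distrib matrix_vector_mult_scaleR w2(4,5))
    then show "A *v v \<in> ?P"
      by (simp only:) (intro span_add span_mul span_base insertI1 insertI2)
  qed
  moreover have "acts_as_rotation A ?P"
    unfolding acts_as_rotation_def using w1(2) w2 abs by (intro exI[of _ w1] exI[of _ w2] exI[of _ b]) auto
  ultimately show ?thesis using that[of ?P] by simp
qed

section \<open>Coordinate subspaces and the signature\<close>

definition positive_axes :: "R34 set" where "positive_axes = {x. \<forall>j. x $ Inr j = 0}"
definition negative_axes :: "R34 set" where "negative_axes = {x. \<forall>i. x $ Inl i = 0}"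

lemma form34_axes:
  "x \<in> positive_axes \<Longrightarrow> x \<noteq> 0 \<Longrightarrow> form34 x x > 0"
  "x \<in> negative_axes \<Longrightarrow> x \<noteq> 0 \<Longrightarrow> form34 x x < 0"
proof -
  have *: "x \<bullet> x = (\<Sum>i\<in>UNIV. x $ Inl i * x $ Inl i) + (\<Sum>j\<in>UNIV. x $ Inr j * x $ Inr j)"
    unfolding inner_vec_def sum_UNIV_sum by simp
  show "form34 x x > 0" if "x \<in> positive_axes" "x \<noteq> 0"
    using that * inner_gt_zero_iff[of x] unfolding form34_def positive_axes_def by simp
  show "form34 x x < 0" if "x \<in> negative_axes" "x \<noteq> 0"
    using that * inner_gt_zero_iff[of x] unfolding form34_def negative_axes_def by simp
qed

lemma dim_axes: "dim positive_axes = 3" "dim negative_axes = 4" "subspace positive_axes" "subspace negative_axes"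
proof -
  show s: "subspace positive_axes" "subspace negative_axes"
    unfolding positive_axes_def negative_axes_def subspace_def by auto
  have "positive_axes = form_complement negative_axes"
  proof (intro set_eqI iffI)
    fix x assume "x \<in> positive_axes"
    then show "x \<in> form_complement negative_axes"
      unfolding positive_axes_def negative_axes_def form_complement_def form34_def by simp
  next
    fix x assume x: "x \<in> form_complement negative_axes"
    have "form34 x (axis (Inr j) 1) = - (x $ Inr j)" for j
      unfolding form34_def axis_def by (simp add: if_distrib cong: if_cong)
    moreover have "axis (Inr j) 1 \<in> negative_axes" for j
      unfolding negative_axes_def axis_def by simp
    ultimately show "x \<in> positive_axes"
      using x unfolding form_complement_def positive_axes_def by fastforce
  qed
  then have sum: "dim positive_axes + dim negative_axes = 7" using dim_form_complement[OF s(2)] by simp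
  have "dim positive_axes \<ge> 3"
  proof -
    let ?B = "range (\<lambda>i::3. axis (Inl i) (1::real)) :: R34 set"
    have "independent ?B"
      by (rule independent_mono[OF independent_Basis]) (auto simp: Basis_vec_def)
    moreover have "card ?B = 3" by (subst card_image) (auto simp: inj_on_def axis_eq_axis)
    moreover have "?B \<subseteq> positive_axes" unfolding positive_axes_def axis_def by auto
    ultimately show ?thesis using independent_card_le_dim by metis
  qed
  moreover have "dim negative_axes \<ge> 4"
  proof -
    let ?B = "range (\<lambda>i::4. axis (Inr i) (1::real)) :: R34 set"
    have "independent ?B"
      by (rule independent_mono[OF independent_Basis]) (auto simp: Basis_vec_def)
    moreover have "card ?B = 4" by (subst card_image) (auto simp: inj_on_def axis_eq_axis)
    moreover have "?B \<subseteq> negative_axes" unfolding negative_axes_def axis_def by auto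
    ultimately show ?thesis using independent_card_le_dim by metis
  qed
  ultimately show "dim positive_axes = 3" "dim negative_axes = 4" using sum by auto
qed

lemma dim_sum_le_7:
  assumes "subspace P" "subspace Q" "P \<inter> Q \<subseteq> {0}"
  shows "dim P + dim (Q :: R34 set) \<le> 7"
proof -
  have "dim (P \<inter> Q) = 0" using assms(3) by simp
  then have "dim P + dim Q = dim {x + y | x y. x \<in> P \<and> y \<in> Q}" using dim_sums_Int[OF assms(1,2)] by linarith
  also have "\<dots> \<le> 7" using dim_subset_UNIV[of "{x + y | x y. x \<in> P \<and> y \<in> Q}"] by simp
  finally show ?thesis .
qed

text \<open>A vector of nonnegative square in the complement would span with \<open>P\<close> a
  4-dimensional space on which the form is nonnegative. It meets the 4-dimensional
  \<open>negative_axes\<close> only in 0, which is impossible in dimension 7.\<close>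

lemma neg_def_complement:
  assumes P: "subspace P" "dim P = 3" "pos_def_on P"
  shows "neg_def_on (form_complement P)"
  unfolding neg_def_on_def
proof (intro ballI impI, rule ccontr)
  fix x assume x: "x \<in> form_complement P" "x \<noteq> 0" "\<not> form34 x x < 0"
  let ?Q = "{p + c | p c. p \<in> P \<and> c \<in> span {x}}"
  have Q: "subspace ?Q" by (rule subspace_sums[OF P(1) subspace_span])
  have psd: "form34 q q \<ge> 0" if q': "q \<in> ?Q" for q
  proof -
    obtain p k where q: "p \<in> P" "q = p + k *\<^sub>R x" using q' span_singleton[of x] by auto
    have "form34 x p = 0" using x(1) q(1) unfolding form_complement_def by blast
    then have "form34 q q = form34 p p + k * k * form34 x x"
      unfolding q(2) using form34_commute[of p x] by (simp add: form34_simps)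
    moreover have "form34 p p \<ge> 0"
      using P(3) q(1) unfolding pos_def_on_def by (cases "p = 0") (auto simp: form34_simps less_imp_le)
    ultimately show ?thesis using x(3) by simp
  qed
  have "P \<inter> span {x} = {0}"
  proof -
    have "y = 0" if y: "y \<in> P" "y \<in> span {x}" for y
    proof -
      obtain k where "y = k *\<^sub>R x" using y(2) span_singleton[of x] by auto
      then have "y \<in> form_complement P" using x(1) subspace_scale[OF subspace_form_complement] by blast
      then show ?thesis using definite_nondegenerate P(3) y(1) by blast
    qed
    then show ?thesis using subspace_0[OF P(1)] span_zero by blast
  qed
  then have "dim ?Q = 4" using dim_sums_Int[OF P(1) subspace_span, of "{x}"] P(2) x(2) by simp
  moreover have "?Q \<inter> negative_axes \<subseteq> {0}" using psd form34_axes(2) by fastforce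
  ultimately show False using dim_sum_le_7[OF Q dim_axes(4)] dim_axes(2) by simp
qed

text \<open>A rotation plane is split off from \<open>P\<close> and another from its negative
  definite complement. The remainders are a line, which the skew map \<open>A\<close> must
  annihilate, and a negative definite plane.\<close>

theorem IV4_if_positive_invariant:
  assumes A: "A \<in> so34" and P: "subspace P" "dim P = 3" "pos_def_on P" "invariant_under A P"
  shows "A \<in> IV4"
proof -
  let ?N = "form_complement P"
  have N: "subspace ?N" "dim ?N = 4" "neg_def_on ?N" "invariant_under A ?N"
    using subspace_form_complement dim_form_complement[OF P(1)] P(2) neg_def_complement[OF P(1-3)]
      invariant_form_complement[OF A P(4)] by simp_all
  have sub: "pos_def_on Q" if "Q \<subseteq> P" for Q using that P(3) unfolding pos_def_on_def by blast
  have subN: "neg_def_on Q" if "Q \<subseteq> ?N" for Q using that N(3) unfolding neg_def_on_def by blast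
  obtain P1 where P1: "subspace P1" "dim P1 = 2" "P1 \<subseteq> P" "invariant_under A P1" "acts_as_rotation A P1"
    using rotation_plane[OF A P(1) _ P(4), of 1] P(2,3) unfolding pos_def_on_def by auto
  obtain P2 where P2: "subspace P2" "dim P2 = 2" "P2 \<subseteq> ?N" "invariant_under A P2" "acts_as_rotation A P2"
    using rotation_plane[OF A N(1) _ N(4), of "-1"] N(2,3) unfolding neg_def_on_def by auto
  define L where "L = P \<inter> form_complement P1"
  define P3 where "P3 = ?N \<inter> form_complement P2"
  have L: "subspace L" "dim L = 1" "invariant_under A L" "L \<subseteq> P"
    unfolding L_def using subspace_inter[OF P(1) subspace_form_complement] P(2) P1(2)
      dim_complement_in[OF P(1) P1(1,3)] sub[OF P1(3)]
      invariant_Int[OF P(4) invariant_form_complement[OF A P1(4)]] by auto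
  have P3: "subspace P3" "dim P3 = 2" "invariant_under A P3" "P3 \<subseteq> ?N"
    unfolding P3_def using subspace_inter[OF N(1) subspace_form_complement] N(2) P2(2)
      dim_complement_in[OF N(1) P2(1,3)] subN[OF P2(3)]
      invariant_Int[OF N(4) invariant_form_complement[OF A P2(4)]] by auto
  \<comment> \<open>\<open>P3\<close> already has dimension 2, so the rotation plane found inside it
    is \<open>P3\<close> itself.\<close>
  have "acts_as_rotation A P3"
  proof -
    have "dim P3 \<ge> 2" "\<And>x. x \<in> P3 \<Longrightarrow> x \<noteq> 0 \<Longrightarrow> (-1) * form34 x x > 0"
      using P3(2) subN[OF P3(4)] unfolding neg_def_on_def by simp_all
    then obtain Q where Q: "subspace Q" "dim Q = 2" "Q \<subseteq> P3" "invariant_under A Q" "acts_as_rotation A Q"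
      using rotation_plane[OF A P3(1) _ P3(3), of "-1"] by auto
    then have "Q = P3" using subspace_dim_equal[OF Q(1) P3(1) Q(3)] P3(2) by simp
    then show ?thesis using Q(5) by simp
  qed
  have orth: "form_orthogonal P1 L" "form_orthogonal P1 P2" "form_orthogonal P1 P3"
    "form_orthogonal L P2" "form_orthogonal L P3" "form_orthogonal P2 P3"
  proof -
    have o: "form_orthogonal Q R" if "R \<subseteq> form_complement Q" for Q R
      unfolding form_orthogonal_def
    proof (intro ballI)
      fix x y assume "x \<in> Q" "y \<in> R"
      then have "form34 y x = 0" using that unfolding form_complement_def by blast
      then show "form34 x y = 0" by (simp add: form34_commute[of x y])
    qed
    have oN: "form_orthogonal Q R" if "Q \<subseteq> P" "R \<subseteq> ?N" for Q R
    proof (rule o)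
      have "?N \<subseteq> form_complement Q" using that(1) unfolding form_complement_def by blast
      then show "R \<subseteq> form_complement Q" using that(2) by blast
    qed
    show "form_orthogonal P1 L" "form_orthogonal P2 P3"
      by (rule o, simp add: L_def P3_def)+
    show "form_orthogonal P1 P2" "form_orthogonal P1 P3" "form_orthogonal L P2" "form_orthogonal L P3"
      by (rule oN; fact)+
  qed
  have L0: "A *v x = 0" if x: "x \<in> L" for x
  proof (cases "x = 0")
    case False
    have "span {x} = L"
    proof (rule subspace_dim_equal[OF subspace_span L(1)])
      show "span {x} \<subseteq> L" using x L(1) by (intro span_minimal) auto
      show "dim L \<le> dim (span {x})" using L(2) False by simp
    qed
    moreover have "A *v x \<in> L" using L(3) x unfolding invariant_under_def by blast
    ultimately obtain k where k: "A *v x = k *\<^sub>R x" using span_singleton[of x] by blast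
    have "form34 x x \<noteq> 0" using P(3) L(4) x False unfolding pos_def_on_def by force
    moreover have "k * form34 x x = 0" using so34_skew[OF A, of x x] unfolding k by (simp add: form34_simps)
    ultimately show ?thesis using k by simp
  qed simp
  have ex: "\<exists>p1 l p2 p3. p1 \<in> P1 \<and> l \<in> L \<and> p2 \<in> P2 \<and> p3 \<in> P3 \<and> v = p1 + l + p2 + p3" for v
  proof -
    obtain p where p: "p \<in> P" "v - p \<in> ?N"
      using definite_split[OF P(1)] P(3) by blast
    obtain p1 where p1: "p1 \<in> P1" "p - p1 \<in> form_complement P1"
      using definite_split[OF P1(1)] sub[OF P1(3)] by blast
    obtain p2 where p2: "p2 \<in> P2" "v - p - p2 \<in> form_complement P2"
      using definite_split[OF P2(1)] subN[OF P2(3)] by blast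
    have "p - p1 \<in> L" "v - p - p2 \<in> P3"
      using p p1 p2 P1(3) P2(3) subspace_diff[OF P(1)] subspace_diff[OF N(1)] unfolding L_def P3_def by blast+
    moreover have "v = p1 + (p - p1) + p2 + (v - p - p2)" by simp
    ultimately show ?thesis using p1(1) p2(1) by blast
  qed
  have zero: "p1 = 0 \<and> l = 0 \<and> p2 = 0 \<and> p3 = 0"
    if m: "p1 \<in> P1" "l \<in> L" "p2 \<in> P2" "p3 \<in> P3" and e: "p1 + l + p2 + p3 = 0" for p1 l p2 p3
  proof -
    have o: "form34 p1 l = 0" "form34 p1 p2 = 0" "form34 p1 p3 = 0" "form34 l p2 = 0" "form34 l p3 = 0" "form34 p2 p3 = 0"
      using orth m unfolding form_orthogonal_def by blast+
    have z: "form34 x (p1 + l + p2 + p3) = 0" for x unfolding e by (simp add: form34_simps)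
    have "form34 p1 p1 = 0" "form34 l l = 0" "form34 p2 p2 = 0" "form34 p3 p3 = 0"
      using z[of p1] z[of l] z[of p2] z[of p3] o
      by (simp_all add: form34_simps form34_commute[of l p1] form34_commute[of p2 p1] form34_commute[of p2 l]
          form34_commute[of p3 p1] form34_commute[of p3 l] form34_commute[of p3 p2])
    then show ?thesis
      using m sub[OF P1(3)] sub[OF L(4)] subN[OF P2(3)] subN[OF P3(4)]
      unfolding pos_def_on_def neg_def_on_def by (metis less_irrefl)
  qed
  have uniq: "\<exists>!(p1, l, p2, p3). p1 \<in> P1 \<and> l \<in> L \<and> p2 \<in> P2 \<and> p3 \<in> P3 \<and> v = p1 + l + p2 + p3" for v
  proof -
    obtain p1 l p2 p3 where v: "p1 \<in> P1" "l \<in> L" "p2 \<in> P2" "p3 \<in> P3" "v = p1 + l + p2 + p3"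
      using ex[of v] by blast
    show ?thesis
    proof (rule ex1I[of _ "(p1, l, p2, p3)"])
      fix q assume q: "case q of (p1, l, p2, p3) \<Rightarrow> p1 \<in> P1 \<and> l \<in> L \<and> p2 \<in> P2 \<and> p3 \<in> P3 \<and> v = p1 + l + p2 + p3"
      obtain q1 m q2 q3 where q': "q = (q1, m, q2, q3)" by (cases q) auto
      have "(q1 - p1) + (m - l) + (q2 - p2) + (q3 - p3) = 0" using q v(5) unfolding q' by (simp add: algebra_simps)
      moreover have "q1 - p1 \<in> P1" "m - l \<in> L" "q2 - p2 \<in> P2" "q3 - p3 \<in> P3"
        using q v unfolding q' by (auto intro: subspace_diff[OF P1(1)] subspace_diff[OF L(1)]
            subspace_diff[OF P2(1)] subspace_diff[OF P3(1)])
      ultimately have "q1 - p1 = 0 \<and> m - l = 0 \<and> q2 - p2 = 0 \<and> q3 - p3 = 0" using zero by blast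
      then show "q = (p1, l, p2, p3)" unfolding q' by simp
    qed (use v in simp)
  qed
  show ?thesis
    unfolding IV4_def mem_Collect_eq
    by (rule exI[of _ P1], rule exI[of _ L], rule exI[of _ P2], rule exI[of _ P3], intro conjI allI ballI)
      (use P1 P2 P3 L orth uniq L0 sub[OF P1(3)] sub[OF L(4)] subN[OF P2(3)] subN[OF P3(4)]
        \<open>acts_as_rotation A P3\<close> in \<open>auto\<close>)
qed

text \<open>Choose an invariant positive definite \<open>P\<close> of largest dimension. A vector of
  positive square in its complement would produce a positive eigenspace of the form relative to
  \<open>S\<close>; that eigenspace is invariant under \<open>A\<close> and enlarges
  \<open>P\<close>. So the complement is negative definite, and counting dimensions gives
  \<open>dim P = 3\<close>.\<close>

theorem IV4_if_invariant_inner_product: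
  assumes A: "A \<in> so34" and S: "transpose S = S" "\<And>x. x \<noteq> 0 \<Longrightarrow> x \<bullet> (S *v x) > 0"
    and inv: "transpose A ** S + S ** A = 0"
  shows "A \<in> IV4"
proof -
  have skewS: "(A *v x) \<bullet> (S *v y) = - (x \<bullet> (S *v (A *v y)))" for x y
  proof -
    have "(A *v x) \<bullet> (S *v y) + x \<bullet> (S *v (A *v y)) = x \<bullet> ((transpose A ** S + S ** A) *v y)"
      by (simp only: inner_matrix_vec'[of A] matrix_vector_mul_assoc matrix_vector_mult_add_rdistrib
          inner_add_right)
    then show ?thesis unfolding inv by (simp add: eq_neg_iff_add_eq_0)
  qed
  let ?good = "\<lambda>P. subspace P \<and> pos_def_on P \<and> invariant_under A P"
  have "?good {0}" by (simp add: pos_def_on_def invariant_under_def)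
  then have ex: "\<exists>P. ?good P \<and> dim P = dim {0 :: R34}" by blast
  have "dim P \<le> 7" for P :: "R34 set" using dim_subset_UNIV[of P] by simp
  then have "\<forall>n. (\<exists>P. ?good P \<and> dim P = n) \<longrightarrow> n \<le> 7" by blast
  with ex obtain n where n: "\<exists>P. ?good P \<and> dim P = n" "\<And>m. (\<exists>P. ?good P \<and> dim P = m) \<Longrightarrow> m \<le> n"
    using Nat.ex_has_greatest_nat[of "\<lambda>n. \<exists>P. ?good P \<and> dim P = n" _ 7] by blast
  then obtain P where P: "subspace P" "pos_def_on P" "invariant_under A P"
    "\<And>Q. ?good Q \<Longrightarrow> dim Q \<le> dim P" by blast
  let ?N = "form_complement P"
  note N = subspace_form_complement[of P] invariant_form_complement[OF A P(3)]
  have AN: "A *v x \<in> ?N" if "x \<in> ?N" for x using N(2) that unfolding invariant_under_def by blast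
  have le: "form34 x x \<le> 0" if x: "x \<in> ?N" for x
  proof (rule ccontr)
    assume "\<not> form34 x x \<le> 0"
    then have x0: "form34 x x > 0" "x \<noteq> 0" by (auto simp: form34_simps)
    then have "?N \<noteq> {0}" using x by blast
    then obtain z l where z: "z \<in> ?N" "z \<noteq> 0" "\<And>y. y \<in> ?N \<Longrightarrow> z \<bullet> (J34 *v y) = l * (z \<bullet> (S *v y))"
      "\<And>y. y \<in> ?N \<Longrightarrow> y \<bullet> (J34 *v y) \<le> l * (y \<bullet> (S *v y))"
      using rayleigh_maximum[OF transpose_J34 S(1) N(1) _ S(2)] by blast
    have "0 < l * (x \<bullet> (S *v x))" using z(4)[OF x] x0(1) unfolding form34_eq by simp
    then have l: "l > 0" using S(2)[OF x0(2)] by (simp add: zero_less_mult_iff)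
    \<comment> \<open>The full eigenspace is taken because \<open>A\<close> preserves it, although
      \<open>A\<close> need not preserve the line through a single eigenvector.\<close>
    define E where "E = {z \<in> ?N. \<forall>y\<in>?N. form34 z y = l * (z \<bullet> (S *v y))}"
    have E: "subspace E"
      unfolding E_def using N(1) unfolding subspace_def by (auto simp: form34_simps inner_simps algebra_simps)
    have zE: "z \<in> E" unfolding E_def form34_eq using z by blast
    have invE: "invariant_under A E"
      unfolding invariant_under_def E_def by (simp add: AN so34_skew[OF A] skewS)
    have posE: "form34 e e > 0" if "e \<in> E" "e \<noteq> 0" for e
      using that l S(2)[of e] unfolding E_def by simp
    let ?Q = "{p + e | p e. p \<in> P \<and> e \<in> E}"
    have orth: "form34 e p = 0" if "p \<in> P" "e \<in> E" for p e
      using that unfolding E_def form_complement_def by blast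
    have "pos_def_on ?Q"
      unfolding pos_def_on_def
    proof (intro ballI impI)
      fix q assume "q \<in> ?Q" "q \<noteq> 0"
      then obtain p e where q: "p \<in> P" "e \<in> E" "q = p + e" by blast
      then have "p \<noteq> 0 \<or> e \<noteq> 0" using \<open>q \<noteq> 0\<close> by auto
      have "form34 q q = form34 p p + form34 e e"
        unfolding q(3) using orth[OF q(1,2)] form34_commute[of p e] by (simp add: form34_simps)
      moreover have "p \<noteq> 0 \<Longrightarrow> form34 p p > 0" using P(2) q(1) unfolding pos_def_on_def by blast
      moreover have "e \<noteq> 0 \<Longrightarrow> form34 e e > 0" using posE[OF q(2)] by blast
      ultimately show "form34 q q > 0"
        using \<open>p \<noteq> 0 \<or> e \<noteq> 0\<close> by (cases "p = 0"; cases "e = 0") (auto simp: form34_simps)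
    qed
    moreover have "invariant_under A ?Q"
      using P(3) invE unfolding invariant_under_def by (fastforce simp: matrix_vector_right_distrib)
    ultimately have "dim ?Q \<le> dim P" using P(4) subspace_sums[OF P(1) E] by blast
    moreover have "P \<inter> E = {0}"
      using definite_nondegenerate P(2) subspace_0[OF P(1)] subspace_0[OF E] unfolding E_def by blast
    moreover have "dim E \<noteq> 0" using zE z(2) by auto
    ultimately show False using dim_sums_Int[OF P(1) E] by simp
  qed
  \<comment> \<open>A null vector of the semidefinite form on the complement is orthogonal to the
    complement and to \<open>P\<close>, hence to everything; nondegeneracy excludes it.\<close>
  have neg: "form34 x x < 0" if x: "x \<in> ?N" "x \<noteq> 0" for x
  proof (rule ccontr)
    assume "\<not> form34 x x < 0"
    then have x0: "form34 x x = 0" using le[OF x(1)] by simp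
    have "form34 x y = 0" for y
    proof -
      obtain p where p: "p \<in> P" "y - p \<in> ?N"
        using definite_split[OF P(1)] P(2) by blast
      have "x \<bullet> ((- J34) *v (y - p)) = 0"
      proof (rule psd_form_null_vector[OF _ N(1) _ x(1) _ p(2)])
        show "transpose (- J34) = - J34" by (simp add: transpose_minus)
        have m: "u \<bullet> ((- J34) *v u) = - form34 u u" for u
          unfolding form34_eq by (simp add: matrix_vector_mult_def inner_vec_def sum_negf)
        show "x \<bullet> ((- J34) *v x) = 0" unfolding m x0 by simp
        show "0 \<le> u \<bullet> ((- J34) *v u)" if "u \<in> ?N" for u unfolding m using le[OF that] by simp
      qed
      moreover have "x \<bullet> ((- J34) *v (y - p)) = - form34 x (y - p)"
        unfolding form34_eq by (simp add: matrix_vector_mult_def inner_vec_def sum_negf)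
      moreover have "form34 x p = 0" using x(1) p(1) unfolding form_complement_def by blast
      ultimately show ?thesis by (simp add: form34_simps)
    qed
    then show False using form34_nondegenerate x(2) by blast
  qed
  \<comment> \<open>Comparison with the coordinate subspaces bounds the two dimensions by 3 and 4,
    and they add up to 7.\<close>
  have "P \<inter> negative_axes \<subseteq> {0}"
    using P(2) form34_axes(2) unfolding pos_def_on_def by force
  then have "dim P \<le> 3" using dim_sum_le_7[OF P(1) dim_axes(4)] dim_axes(2) by simp
  moreover have "?N \<inter> positive_axes \<subseteq> {0}" using neg form34_axes(1) by force
  then have "dim ?N \<le> 4" using dim_sum_le_7[OF N(1) dim_axes(3)] dim_axes(1) by simp
  ultimately have "dim P = 3" using dim_form_complement[OF P(1)] by simp
  then show ?thesis using IV4_if_positive_invariant[OF A P(1) _ P(2,3)] by blast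
qed

section \<open>One-parameter groups outside \<open>IV\<^sub>4\<close> are unbounded\<close>

lemma bounded_bilinear_matrix_vector_mult:
  "bounded_bilinear ((*v) :: real^'n^'m \<Rightarrow> real^'n \<Rightarrow> real^'m)"
  unfolding bilinear_conv_bounded_bilinear[symmetric] bilinear_def
  by (auto intro!: linearI simp: matrix_vector_mult_add_rdistrib matrix_vector_right_distrib
      matrix_vector_mult_scaleR scaleR_matrix_vector_assoc[symmetric])

lemma matrix_inv_unique:
  fixes A :: "real^'n^'n"
  assumes "A ** B = mat 1" "B ** A = mat 1"
  shows "matrix_inv A = B"
proof -
  have "invertible A" using assms unfolding invertible_def by blast
  have "matrix_inv A = (matrix_inv A ** A) ** B" unfolding matrix_mul_assoc[symmetric] assms(1) by simp
  also have "\<dots> = B" unfolding matrix_inv(1)[OF \<open>invertible A\<close>] by simp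
  finally show ?thesis .
qed

lemma preserving_inverse:
  assumes "transpose g ** J34 ** g = J34"
  shows "(J34 ** transpose g ** J34) ** g = mat 1" "g ** (J34 ** transpose g ** J34) = mat 1"
    "invertible g" "matrix_inv g = J34 ** transpose g ** J34"
proof -
  show 1: "(J34 ** transpose g ** J34) ** g = mat 1"
    using assms by (metis J34_J34 matrix_mul_assoc)
  then show 2: "g ** (J34 ** transpose g ** J34) = mat 1" using matrix_left_right_inverse by blast
  show "invertible g" using 1 2 unfolding invertible_def by blast
  show "matrix_inv g = J34 ** transpose g ** J34" by (rule matrix_inv_unique[OF 2 1])
qed

text \<open>For an isometry the inverse is \<open>J34 ** transpose g ** J34\<close>, so it is
  controlled linearly by \<open>g\<close>. This makes boundedness of \<open>exp(tA)\<close>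
  symmetric in the sign of \<open>t\<close>.\<close>

lemma norm_preserving_inverse:
  obtains c where "c > 0" "\<And>g. transpose g ** J34 ** g = J34 \<Longrightarrow> norm (matrix_inv g) \<le> c * norm g"
proof -
  obtain K where K: "K > 0" "\<And>(A :: mat34) (B :: mat34). norm (A ** B) \<le> norm A * norm B * K"
    using matrix_mult.pos_bounded by blast
  let ?c = "norm J34 * K * (norm J34 * K) + 1"
  have "norm (matrix_inv g) \<le> ?c * norm g" if g: "transpose g ** J34 ** g = J34" for g
  proof -
    have "norm (matrix_inv g) \<le> norm (J34 ** transpose g) * norm J34 * K"
      unfolding preserving_inverse(4)[OF g] by (rule K(2))
    also have "\<dots> \<le> (norm J34 * norm (transpose g) * K) * norm J34 * K"
      using K by (intro mult_right_mono) auto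
    also have "\<dots> \<le> ?c * norm g" by (simp add: norm_transpose algebra_simps)
    finally show ?thesis .
  qed
  moreover have "?c > 0" using K(1) by (simp add: add_nonneg_pos)
  ultimately show ?thesis using that by blast
qed

lemma mexp_preserves_form: "A \<in> so34 \<Longrightarrow> transpose (mexp (t *\<^sub>R A)) ** J34 ** mexp (t *\<^sub>R A) = J34"
  by (rule mexp_preserves) (simp add: so34_iff)

lemma mexp_matrix_inv: "matrix_inv (mexp (t *\<^sub>R A)) = mexp ((- t) *\<^sub>R A)"
  by (rule matrix_inv_unique[OF mexp_inverse])

text \<open>Weil's argument for monothetic groups: if \<open>exp(tA)\<close> is bounded along a sequence \<open>t\<close> tending to infinity, it
  returns to every neighbourhood of \<open>1\<close>, and by compactness the gaps between successive returns to the
  ball of radius \<open>1/2\<close> are bounded.\<close>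

lemma recurrent_one_parameter_group_bounded:
  assumes A: "A \<in> so34" and rec: "\<And>R. \<exists>t. \<bar>t\<bar> \<ge> R \<and> norm (mexp (t *\<^sub>R A)) \<le> C"
  obtains B where "\<And>t. norm (mexp (t *\<^sub>R A)) \<le> B"
proof -
  let ?E = "\<lambda>t. mexp (t *\<^sub>R A)"
  obtain K where K: "K > 0" "\<And>(A :: mat34) (B :: mat34). norm (A ** B) \<le> norm A * norm B * K"
    using matrix_mult.pos_bounded by blast
  obtain c where c: "c > 0" "\<And>g. transpose g ** J34 ** g = J34 \<Longrightarrow> norm (matrix_inv g) \<le> c * norm g"
    using norm_preserving_inverse by blast
  have inv: "norm (?E (- t)) \<le> c * norm (?E t)" for t
    using c(2)[OF mexp_preserves_form[OF A, of t]] unfolding mexp_matrix_inv .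
  have diff: "norm (?E (- s) ** y - mat 1) \<le> K * c * norm (?E s) * norm (y - ?E s)" for s y
  proof -
    have "?E (- s) ** y - mat 1 = ?E (- s) ** (y - ?E s)"
      unfolding matrix_mult.diff_right mexp_inverse(2) ..
    then have "norm (?E (- s) ** y - mat 1) \<le> norm (?E (- s)) * norm (y - ?E s) * K" by (simp add: K(2))
    also have "\<dots> \<le> (c * norm (?E s)) * norm (y - ?E s) * K"
      using K(1) inv by (intro mult_right_mono) auto
    finally show ?thesis by (simp add: mult.commute mult.left_commute)
  qed
  \<comment> \<open>Replaces the recurrence times by positive ones, at the price of a larger
    bound.\<close>
  have C0: "norm (?E \<bar>t\<bar>) \<le> (c + 1) * C" if "norm (?E t) \<le> C" for t
  proof (cases "t \<ge> 0")
    case True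
    have "0 \<le> C" using that norm_ge_zero[of "?E t"] by linarith
    then have "C \<le> (c + 1) * C" using c(1) by (simp add: algebra_simps)
    then show ?thesis using True that by simp
  next
    case False
    have "norm (?E \<bar>t\<bar>) \<le> c * norm (?E t)" using inv[of t] False by simp
    also have "\<dots> \<le> c * C" using that c(1) by simp
    also have "\<dots> \<le> (c + 1) * C" using order_trans[OF norm_ge_zero that] by (simp add: algebra_simps)
    finally show ?thesis .
  qed
  have "\<forall>n::nat. \<exists>t. t \<ge> real n \<and> norm (?E t) \<le> (c + 1) * C"
    using rec C0 by blast
  then obtain \<tau> where \<tau>: "\<And>n. \<tau> n \<ge> real n" "\<And>n. norm (?E (\<tau> n)) \<le> (c + 1) * C" by metis
  have "bounded (range (\<lambda>n. ?E (\<tau> n)))" unfolding bounded_iff using \<tau>(2) by blast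
  then obtain g r where r: "strict_mono (r :: nat \<Rightarrow> nat)" "(\<lambda>n. ?E (\<tau> (r n))) \<longlonglongrightarrow> g"
    using bounded_imp_convergent_subsequence unfolding o_def by blast
  have D0: "(c + 1) * C \<ge> 0" using \<tau>(2)[of 0] norm_ge_zero order_trans by blast
  \<comment> \<open>Two members of a convergent subsequence are close to each other, so the
    exponential at the difference of their times is close to 1; the later index can be taken as
    large as desired.\<close>
  have return: "\<exists>s>M. norm (?E s - mat 1) < e" if e: "e > 0" for e M
  proof -
    \<comment> \<open>The summand 1 keeps the denominator positive when the bound is 0.\<close>
    define d where "d = e / (K * c * ((c + 1) * C) + 1)"
    have pos: "K * c * ((c + 1) * C) + 1 > 0" using K(1) c(1) D0 by (simp add: add_nonneg_pos)
    have "d > 0" unfolding d_def using e pos by simp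
    then obtain N where N: "\<And>m. m \<ge> N \<Longrightarrow> norm (?E (\<tau> (r m)) - g) < d / 2"
      using LIMSEQ_D[OF r(2), of "d / 2"] by auto
    define m where "m = max N (nat \<lceil>M + \<tau> (r N)\<rceil> + 1)"
    have "real m \<le> \<tau> (r m)"
      using \<tau>(1)[of "r m"] seq_suble[OF r(1), of m] by linarith
    moreover have "M + \<tau> (r N) < real m" unfolding m_def by linarith
    ultimately have 1: "\<tau> (r m) - \<tau> (r N) > M" by linarith
    have "norm (?E (\<tau> (r m)) - ?E (\<tau> (r N))) < d"
      using N[of m] N[of N] norm_triangle_ineq4[of "?E (\<tau> (r m)) - g" "?E (\<tau> (r N)) - g"]
      unfolding m_def by simp
    then have "K * c * norm (?E (\<tau> (r N))) * norm (?E (\<tau> (r m)) - ?E (\<tau> (r N))) \<le> K * c * ((c + 1) * C) * d"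
      using \<tau>(2) K(1) c(1) D0 by (intro mult_mono mult_left_mono) auto
    also have "\<dots> < e" unfolding d_def using e pos by (simp add: field_simps)
    finally have "norm (?E (- \<tau> (r N)) ** ?E (\<tau> (r m)) - mat 1) < e" using diff order_le_less_trans by blast
    then show ?thesis using 1 mexp_add[of "- \<tau> (r N)" "\<tau> (r m)" A]
      by (intro exI[of _ "\<tau> (r m) - \<tau> (r N)"]) simp
  qed
  \<comment> \<open>The part of the orbit closure near 1 is compact. Each set \<open>O' s\<close>
    consists of the points that flowing back by time \<open>s\<close> brings within 1/2 of the
    identity.\<close>
  define V where "V = closure (range ?E) \<inter> cball (mat 1) (1/2)"
  define O' where "O' = (\<lambda>s. {y. norm (?E (- s) ** y - mat 1) < 1/2})"
  have "compact V" unfolding V_def by (simp add: closed_Int_compact)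
  moreover have "open (O' s)" for s
  proof -
    have "continuous_on UNIV (\<lambda>y. norm (?E (- s) ** y - mat 1))"
      by (intro continuous_intros matrix_mult.continuous_on)
    from open_preimage_Collect[OF open_UNIV this open_lessThan[of "1/2"]] show ?thesis
      unfolding O'_def by simp
  qed
  \<comment> \<open>A point of \<open>V\<close> is approximated by some \<open>?E t\<close>. Adding
    a return time larger than \<open>- t\<close> barely moves this approximation and makes the total
    time positive.\<close>
  moreover have "V \<subseteq> (\<Union>s\<in>{0<..}. O' s)"
  proof
    fix y assume y: "y \<in> V"
    define L where "L = norm y + 1"
    have L: "L > 0" unfolding L_def by (simp add: add_nonneg_pos)
    \<comment> \<open>Chosen so that \<open>K * c * L * \<eta>\<close> is at most 1/4, and at most 1
      so that approximations of \<open>y\<close> within \<open>\<eta>\<close> have norm at most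
      \<open>L\<close>.\<close>
    define \<eta> where "\<eta> = min 1 (1 / (4 * (K * c * L)))"
    have \<eta>: "\<eta> > 0" "\<eta> \<le> 1" "K * c * L * \<eta> < 1/2"
    proof -
      have p: "K * c * L > 0" using K(1) c(1) L by simp
      then show "\<eta> > 0" "\<eta> \<le> 1" unfolding \<eta>_def by simp_all
      have "K * c * L * \<eta> \<le> K * c * L * (1 / (4 * (K * c * L)))"
        using p unfolding \<eta>_def by (intro mult_left_mono) auto
      also have "\<dots> < 1/2" using p K(1) c(1) L by (simp add: field_simps)
      finally show "K * c * L * \<eta> < 1/2" .
    qed
    have "\<exists>z\<in>range ?E. dist z y < \<eta> / 2"
      using y \<eta>(1) closure_approachable[of y "range ?E"] half_gt_zero unfolding V_def by blast
    then obtain t where t: "norm (?E t - y) < \<eta> / 2" unfolding dist_norm by blast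
    obtain s where s: "s > - t" "norm (?E s - mat 1) < \<eta> / (2 * K * L)"
      using return[of "\<eta> / (2 * K * L)" "- t"] \<eta>(1) K(1) L by auto
    have Et: "norm (?E t) \<le> L"
      using t \<eta>(2) norm_triangle_ineq[of "?E t - y" y] unfolding L_def by simp
    have "norm (?E (t + s) - ?E t) = norm (?E t ** (?E s - mat 1))"
      unfolding mexp_add by (simp add: matrix_mult.diff_right)
    also have "\<dots> \<le> norm (?E t) * norm (?E s - mat 1) * K" by (rule K(2))
    also have "\<dots> \<le> L * norm (?E s - mat 1) * K" using Et K(1) by (intro mult_right_mono) auto
    also have "\<dots> < \<eta> / 2" using s(2) K(1) L by (simp add: field_simps)
    finally have y1: "norm (y - ?E (t + s)) < \<eta>"
      using t norm_triangle_ineq[of "y - ?E t" "?E t - ?E (t + s)"] by (simp add: norm_minus_commute)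
    have "norm (?E (t + s)) \<le> L"
      using y1 \<eta>(2) norm_triangle_ineq4[of y "y - ?E (t + s)"] unfolding L_def by simp
    then have "K * c * norm (?E (t + s)) * norm (y - ?E (t + s)) \<le> K * c * L * \<eta>"
      using y1 K(1) c(1) L by (intro mult_mono) auto
    then have "y \<in> O' (t + s)" using diff[of "t + s" y] \<eta>(3) unfolding O'_def by simp
    then show "y \<in> (\<Union>s\<in>{0<..}. O' s)" using s(1) by auto
  qed
  ultimately obtain D where D: "D \<subseteq> {0<..}" "finite D" "V \<subseteq> (\<Union>s\<in>D. O' s)"
    by (rule compactE_image)
  \<comment> \<open>From every time at which the flow is near 1, one of finitely many positive
    shifts leads back to an earlier such time.\<close>
  have step: "\<exists>s\<in>D. norm (?E (u - s) - mat 1) \<le> 1/2" if "norm (?E u - mat 1) \<le> 1/2" for u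
  proof -
    have "?E u \<in> V" using that closure_subset[of "range ?E"] unfolding V_def by (auto simp: dist_norm norm_minus_commute)
    then obtain s where "s \<in> D" "?E u \<in> O' s" using D(3) by blast
    moreover have "?E (- s) ** ?E u = ?E (u - s)" using mexp_add[of "- s" u A] by simp
    ultimately show ?thesis unfolding O'_def by (intro bexI[of _ s]) auto
  qed
  have one: "norm (?E 0 - mat 1) \<le> 1/2" by (simp add: mexp_0)
  then have Dne: "D \<noteq> {}" using step by blast
  define m M where "m = Min D" and "M = Max D"
  have mD: "\<And>s. s \<in> D \<Longrightarrow> m \<le> s" "\<And>s. s \<in> D \<Longrightarrow> s \<le> M" and m: "m > 0"
    unfolding m_def M_def using D(1,2) Dne Min_in[OF D(2) Dne] by auto
  \<comment> \<open>Return times descend from 0 in jumps between \<open>m\<close> and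
    \<open>M\<close>, so every window of length \<open>M\<close> on the negative axis contains
    one.\<close>
  have gap: "\<exists>r. u \<le> r \<and> r \<le> u + M \<and> norm (?E r - mat 1) \<le> 1/2" if u: "u \<le> 0" for u
  proof -
    define S where "S = {r. u \<le> r \<and> norm (?E r - mat 1) \<le> 1/2}"
    have S0: "0 \<in> S" unfolding S_def using u one by simp
    have bdd: "bdd_below S" unfolding S_def by (rule bdd_belowI[of _ u]) simp
    \<comment> \<open>The infimum need not be attained; coming within \<open>m\<close> of it
      suffices, because the next jump has length at least \<open>m\<close> and must leave
      \<open>S\<close>.\<close>
    obtain r where r: "r \<in> S" "r < Inf S + m"
      using cInf_lessD[of S "Inf S + m"] S0 m by auto
    obtain s where s: "s \<in> D" "norm (?E (r - s) - mat 1) \<le> 1/2" using step r(1) unfolding S_def by blast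
    have "r - s \<notin> S"
      using cInf_lower[OF _ bdd, of "r - s"] r(2) mD(1)[OF s(1)] by linarith
    then have "r - s < u" using s(2) unfolding S_def by auto
    then show ?thesis using r(1) mD(2)[OF s(1)] unfolding S_def by (intro exI[of _ r]) auto
  qed
  obtain B0 where B0: "\<And>u. u \<in> {- M..0} \<Longrightarrow> norm (?E u) \<le> B0"
  proof -
    have "compact (?E ` {- M..0})" by (rule compact_continuous_image[OF continuous_on_mexp compact_Icc])
    then have "bounded (?E ` {- M..0})" by (rule compact_imp_bounded)
    then obtain b where "\<forall>x\<in>?E ` {- M..0}. norm x \<le> b" unfolding bounded_iff by (rule exE)
    then show ?thesis using that[of b] by simp
  qed
  have B0': "norm (?E u) \<le> \<bar>B0\<bar>" if "u \<in> {- M..0}" for u using B0[OF that] by linarith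
  define B where "B = \<bar>B0\<bar> * (norm (mat 1 :: mat34) + 1/2) * K"
  \<comment> \<open>Up to a nearby return time, \<open>?E u\<close> is the flow over a time between
    \<open>- M\<close> and 0, where compactness bounds it.\<close>
  have neg: "norm (?E u) \<le> B" if u: "u \<le> 0" for u
  proof -
    obtain r where r: "u \<le> r" "r \<le> u + M" "norm (?E r - mat 1) \<le> 1/2" using gap[OF u] by blast
    have "norm (?E u) = norm (?E (u - r) ** ?E r)" using mexp_add[of "u - r" r A] by simp
    also have "\<dots> \<le> norm (?E (u - r)) * norm (?E r) * K" by (rule K(2))
    also have "\<dots> \<le> \<bar>B0\<bar> * (norm (mat 1 :: mat34) + 1/2) * K"
      using B0'[of "u - r"] r K(1) norm_triangle_ineq[of "?E r - mat 1" "mat 1"]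
      by (intro mult_right_mono mult_mono) auto
    finally show ?thesis unfolding B_def .
  qed
  have B: "B \<ge> 0" unfolding B_def using K(1) by simp
  have "norm (?E t) \<le> B + c * B" for t
  proof (cases "t \<le> 0")
    case True
    then show ?thesis using neg[OF True] c(1) B by (simp add: add_increasing2)
  next
    case False
    have "norm (?E t) \<le> c * norm (?E (- t))" using inv[of "- t"] by simp
    also have "\<dots> \<le> c * B" using neg[of "- t"] False c(1) by simp
    finally show ?thesis using B by linarith
  qed
  then show ?thesis using that by blast
qed

text \<open>The limit of time averages of \<open>exp(tA)\<^sup>T exp(tA)\<close> is an invariant inner product.\<close>

lemma IV4_if_bounded:
  assumes A: "A \<in> so34" and bd: "\<And>t. norm (mexp (t *\<^sub>R A)) \<le> B"
  shows "A \<in> IV4"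
proof -
  let ?E = "\<lambda>t. mexp (t *\<^sub>R A)"
  define X where "X = (\<lambda>t. transpose (?E t) ** ?E t)"
  \<comment> \<open>The operator whose kernel consists of the invariant bilinear forms; it is also
    the generator of the evolution \<open>X\<close>.\<close>
  define L where "L = (\<lambda>Y :: mat34. transpose A ** Y + Y ** A)"
  have L: "bounded_linear L"
    unfolding L_def by (intro bounded_linear_add matrix_mult.bounded_linear_right matrix_mult.bounded_linear_left)
  obtain K where K: "K > 0" "\<And>(A :: mat34) (B :: mat34). norm (A ** B) \<le> norm A * norm B * K"
    using matrix_mult.pos_bounded by blast
  obtain K' where K': "K' > 0" "\<And>(A :: mat34) x. norm (A *v x) \<le> norm A * norm x * K'"
    using bounded_bilinear.pos_bounded[OF bounded_bilinear_matrix_vector_mult] by blast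
  have B0: "B \<ge> 0" using bd[of 0] norm_ge_zero order_trans by blast
  have Xb: "norm (X t) \<le> B * B * K" for t
  proof -
    have "norm (X t) \<le> norm (?E t) * norm (?E t) * K"
      using K(2)[of "transpose (?E t)" "?E t"] unfolding X_def norm_transpose .
    also have "\<dots> \<le> B * B * K" using bd[of t] K(1) B0 by (intro mult_right_mono mult_mono) auto
    finally show ?thesis .
  qed
  have dX: "(X has_vector_derivative L (X t)) (at t)" for t
  proof -
    have 1: "((\<lambda>t. ?E t) has_vector_derivative ?E t ** A) (at t)"
      using mexp_derivative(1)[of A t] unfolding mexp_derivative(2) .
    have 2: "((\<lambda>t. transpose (?E t)) has_vector_derivative transpose A ** transpose (?E t)) (at t)"
      using bounded_linear.has_vector_derivative[OF bounded_linear_transpose 1] by (simp add: matrix_transpose_mul)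
    show ?thesis
      using has_vector_derivative_matrix_mult[OF 2 1] unfolding X_def L_def
      by (simp add: matrix_mul_assoc add.commute)
  qed
  have contX: "continuous_on S X" for S
    using dX has_vector_derivative_continuous by (blast intro: continuous_at_imp_continuous_on)
  have intX: "X integrable_on {0..t}" for t by (rule integrable_continuous_interval[OF contX])
  define S where "S = (\<lambda>n::nat. (1 / real (Suc n)) *\<^sub>R integral {0..real (Suc n)} X)"
  have linS: "f (S n) = (1 / real (Suc n)) *\<^sub>R integral {0..real (Suc n)} (\<lambda>t. f (X t))"
    if "bounded_linear f" for f :: "mat34 \<Rightarrow> 'b::euclidean_space" and n
    unfolding S_def linear_scale[OF bounded_linear.linear[OF that]] using integral_linear[OF intX that] by (simp add: o_def)
  \<comment> \<open>The integral of \<open>L (X t)\<close> is a boundary term, bounded independently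
    of the length of the interval, so the averages become invariant in the limit.\<close>
  have LS: "norm (L (S n)) \<le> (2 * (B * B * K)) * (1 / real (Suc n))" for n
  proof -
    have "((\<lambda>t. L (X t)) has_integral X (real (Suc n)) - X 0) {0..real (Suc n)}"
      by (rule fundamental_theorem_of_calculus) (auto intro: has_vector_derivative_at_within dX)
    then have "L (S n) = (1 / real (Suc n)) *\<^sub>R (X (real (Suc n)) - X 0)"
      unfolding linS[OF L] by (simp add: integral_unique)
    then have "norm (L (S n)) = (1 / real (Suc n)) * norm (X (real (Suc n)) - X 0)" by simp
    also have "\<dots> \<le> (1 / real (Suc n)) * (2 * (B * B * K))"
      using Xb[of "real (Suc n)"] Xb[of 0] norm_triangle_ineq4[of "X (real (Suc n))" "X 0"]
      by (intro mult_left_mono) auto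
    finally show ?thesis by (simp add: mult.commute)
  qed
  have Sb: "norm (S n) \<le> B * B * K" for n
  proof -
    have "norm (integral {0..real (Suc n)} X) \<le> B * B * K * (real (Suc n) - 0)"
      by (rule integral_bound[OF _ contX]) (use Xb in auto)
    then have "(1 / real (Suc n)) * norm (integral {0..real (Suc n)} X) \<le> (1 / real (Suc n)) * (B * B * K * real (Suc n))"
      by (intro mult_left_mono) auto
    then show ?thesis unfolding S_def by simp
  qed
  have symS: "transpose (S n) = S n" for n
    unfolding linS[OF bounded_linear_transpose] by (simp add: X_def S_def matrix_transpose_mul)
  \<comment> \<open>A lower bound for the quadratic forms, uniform in time: the vector is recovered
    from its image by \<open>?E (- t)\<close>, which is bounded as well. It keeps the limit positive
    definite.\<close>
  define k where "k = (1 / (B * K' + 1))\<^sup>2"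
  have den: "B * K' + 1 > 0" using B0 K'(1) by (simp add: add_nonneg_pos)
  have k: "k > 0" unfolding k_def using den by simp
  have Xpos: "x \<bullet> (X t *v x) \<ge> k * (norm x)\<^sup>2" for t x
  proof -
    have "x = ?E (- t) *v (?E t *v x)" unfolding matrix_vector_mul_assoc mexp_inverse(2) by simp
    then have "norm x \<le> norm (?E (- t)) * norm (?E t *v x) * K'" using K'(2) by metis
    also have "\<dots> \<le> B * norm (?E t *v x) * K'" using bd[of "- t"] K'(1) by (intro mult_right_mono) auto
    also have "\<dots> \<le> (B * K' + 1) * norm (?E t *v x)" by (simp add: algebra_simps)
    finally have "(1 / (B * K' + 1)) * norm x \<le> norm (?E t *v x)" using den by (simp add: field_simps)
    then have "((1 / (B * K' + 1)) * norm x)\<^sup>2 \<le> (norm (?E t *v x))\<^sup>2"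
      using den by (intro power_mono) auto
    also have "\<dots> = x \<bullet> (X t *v x)"
      unfolding power2_norm_eq_inner X_def inner_matrix_vec' matrix_vector_mul_assoc ..
    finally show ?thesis unfolding k_def power_mult_distrib .
  qed
  have Spos: "x \<bullet> (S n *v x) \<ge> k * (norm x)\<^sup>2" for n x
  proof -
    have lin: "bounded_linear (\<lambda>Y :: mat34. x \<bullet> (Y *v x))"
      by (rule bounded_linear_compose[OF bounded_linear_inner_right
            bounded_bilinear.bounded_linear_left[OF bounded_bilinear_matrix_vector_mult]])
    have "integral {0..real (Suc n)} (\<lambda>t. k * (norm x)\<^sup>2) \<le> integral {0..real (Suc n)} (\<lambda>t. x \<bullet> (X t *v x))"
      using integrable_linear[OF intX lin] by (intro integral_le integrable_const_ivl Xpos) (simp add: o_def)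
    moreover have "integral {0..real (Suc n)} (\<lambda>t. k * (norm x)\<^sup>2) = real (Suc n) * (k * (norm x)\<^sup>2)"
      by (simp del: of_nat_Suc)
    ultimately have "real (Suc n) * (k * (norm x)\<^sup>2) \<le> integral {0..real (Suc n)} (\<lambda>t. x \<bullet> (X t *v x))" by argo
    then have "(1 / real (Suc n)) * (real (Suc n) * (k * (norm x)\<^sup>2))
        \<le> (1 / real (Suc n)) * integral {0..real (Suc n)} (\<lambda>t. x \<bullet> (X t *v x))"
      by (rule mult_left_mono) simp
    moreover have "(1 / real (Suc n)) * (real (Suc n) * (k * (norm x)\<^sup>2)) = k * (norm x)\<^sup>2"
      by (simp del: of_nat_Suc)
    ultimately show ?thesis by (simp only: linS[OF lin] real_scaleR_def)
  qed
  have "bounded (range S)" unfolding bounded_iff using Sb by blast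
  then obtain S' r where r: "strict_mono (r :: nat \<Rightarrow> nat)" "(\<lambda>n. S (r n)) \<longlonglongrightarrow> S'"
    using bounded_imp_convergent_subsequence unfolding o_def by blast
  show ?thesis
  proof (rule IV4_if_invariant_inner_product[OF A])
    show "transpose S' = S'"
      using bounded_linear.tendsto[OF bounded_linear_transpose r(2)] r(2) unfolding symS by (rule LIMSEQ_unique)
    have "(\<lambda>n. (2 * (B * B * K)) * (1 / real (Suc (r n)))) \<longlonglongrightarrow> (2 * (B * B * K)) * 0"
      using LIMSEQ_subseq_LIMSEQ[OF LIMSEQ_inverse_real_of_nat r(1)]
      by (intro tendsto_mult tendsto_const) (simp add: o_def inverse_eq_divide)
    then have "(\<lambda>n. (2 * (B * B * K)) * (1 / real (Suc (r n)))) \<longlonglongrightarrow> 0" by simp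
    then have "(\<lambda>n. L (S (r n))) \<longlonglongrightarrow> 0"
      by (rule Lim_null_comparison[rotated]) (intro always_eventually allI LS)
    from LIMSEQ_unique[OF bounded_linear.tendsto[OF L r(2)] this]
    show "transpose A ** S' + S' ** A = 0" unfolding L_def .
    fix x :: R34 assume "x \<noteq> 0"
    have "(\<lambda>n. x \<bullet> (S (r n) *v x)) \<longlonglongrightarrow> x \<bullet> (S' *v x)"
      by (intro tendsto_inner tendsto_const bounded_bilinear.tendsto[OF bounded_bilinear_matrix_vector_mult] r(2))
    then have "k * (norm x)\<^sup>2 \<le> x \<bullet> (S' *v x)"
      by (rule LIMSEQ_le_const) (use Spos in blast)
    moreover have "k * (norm x)\<^sup>2 > 0" using k \<open>x \<noteq> 0\<close> by simp
    ultimately show "x \<bullet> (S' *v x) > 0" by linarith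
  qed
qed

theorem mexp_proper:
  assumes "A \<in> so34" "A \<notin> IV4"
  obtains R where "\<And>t. norm (mexp (t *\<^sub>R A)) \<le> C \<Longrightarrow> \<bar>t\<bar> < R"
proof (rule ccontr)
  assume "\<not> thesis"
  then have "\<exists>t. \<bar>t\<bar> \<ge> R \<and> norm (mexp (t *\<^sub>R A)) \<le> C" for R using that not_less by blast
  then obtain B where "\<And>t. norm (mexp (t *\<^sub>R A)) \<le> B"
    using recurrent_one_parameter_group_bounded[OF assms(1)] by blast
  then show False using IV4_if_bounded[OF assms(1)] assms(2) by blast
qed

text \<open>\<open>B\<close> is \<open>A\<close> in the frame \<open>p\<close>. The vanishing block
  says that \<open>B\<close> preserves \<open>positive_axes\<close>, so \<open>A\<close> preserves
  the image of \<open>positive_axes\<close> under the isometry \<open>p\<close>.\<close>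

lemma block_diagonal_imp_IV4:
  assumes A: "A \<in> so34" and p: "transpose p ** J34 ** p = J34" and B: "A ** p = p ** B"
    and diag: "\<And>i j. B $ Inr j $ Inl i = 0"
  shows "A \<in> IV4"
proof -
  let ?P = "(*v) p ` positive_axes"
  have inj: "inj ((*v) p)"
    using preserving_inverse(1)[OF p]
    by (intro inj_on_inverseI[of _ "(*v) (J34 ** transpose p ** J34)"]) (simp add: matrix_vector_mul_assoc)
  have form: "form34 (p *v x) (p *v y) = form34 x y" for x y using p form34_matrix_iff by blast
  show ?thesis
  proof (rule IV4_if_positive_invariant[OF A])
    show "subspace ?P" by (rule linear_subspace_image[OF matrix_vector_mul_linear dim_axes(3)])
    show "dim ?P = 3"
      using dim_image_eq[OF matrix_vector_mul_linear inj_on_subset[OF inj]] dim_axes(1) by simp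
    show "pos_def_on ?P"
      unfolding pos_def_on_def
    proof (intro ballI impI)
      fix y assume "y \<in> ?P" "y \<noteq> 0"
      then obtain x where x: "x \<in> positive_axes" "y = p *v x" by blast
      moreover have "x \<noteq> 0" using \<open>y \<noteq> 0\<close> x(2) by auto
      ultimately show "form34 y y > 0" using form form34_axes(1) by simp
    qed
    show "invariant_under A ?P"
      unfolding invariant_under_def
    proof
      fix x assume "x \<in> ?P"
      then obtain y where y: "y \<in> positive_axes" "x = p *v y" by blast
      have "(B *v y) $ Inr j = 0" for j
        using y(1) diag unfolding positive_axes_def matrix_vector_mult_def by (simp add: sum_UNIV_sum)
      then have "B *v y \<in> positive_axes" unfolding positive_axes_def by simp
      moreover have "A *v x = p *v (B *v y)" unfolding y(2) matrix_vector_mul_assoc B ..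
      ultimately show "A *v x \<in> ?P" by blast
    qed
  qed
qed

section \<open>The Cayley transform\<close>

text \<open>Like the exponential it maps skew matrices to isometries and preserves commutation
  relations, but both it and its inverse are rational, so smoothness is a consequence of smooth
  matrix inversion.\<close>

definition cay :: "real^'n^'n \<Rightarrow> real^'n^'n" where
  "cay X = matrix_inv (mat 1 - X) ** (mat 1 + X)"

lemma matrix_inv_commute:
  fixes Q :: "real^'n^'n"
  assumes "invertible B" "Q ** B = B ** Q"
  shows "Q ** matrix_inv B = matrix_inv B ** Q"
proof -
  have "Q ** matrix_inv B = matrix_inv B ** (B ** Q) ** matrix_inv B"
    by (simp add: matrix_mul_assoc matrix_inv[OF assms(1)])
  also have "\<dots> = matrix_inv B ** Q ** (B ** matrix_inv B)"
    unfolding assms(2)[symmetric] by (simp only: matrix_mul_assoc)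
  finally show ?thesis by (simp add: matrix_inv[OF assms(1)])
qed

lemma cay_0: "cay 0 = mat 1"
  unfolding cay_def using matrix_inv(1)[of "mat 1 :: real^'n^'n"]
  by (simp add: invertible_def)

lemma cay_mult:
  assumes "invertible (mat 1 - X)"
  shows "(mat 1 - X) ** cay X = mat 1 + X"
  unfolding cay_def matrix_mul_assoc matrix_inv(2)[OF assms] by simp

lemma cay_commute:
  assumes "invertible (mat 1 - X)" "Q ** X = X ** Q"
  shows "Q ** cay X = cay X ** Q"
proof -
  have c: "Q ** (mat 1 - X) = (mat 1 - X) ** Q" "Q ** (mat 1 + X) = (mat 1 + X) ** Q"
    by (simp_all add: matrix_mult.diff_left matrix_mult.diff_right matrix_mult.add_left matrix_mult.add_right assms(2))
  have "Q ** cay X = (Q ** matrix_inv (mat 1 - X)) ** (mat 1 + X)"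
    unfolding cay_def by (simp only: matrix_mul_assoc)
  also have "\<dots> = matrix_inv (mat 1 - X) ** (Q ** (mat 1 + X))"
    unfolding matrix_inv_commute[OF assms(1) c(1)] by (simp only: matrix_mul_assoc)
  also have "\<dots> = cay X ** Q" unfolding c(2) cay_def by (simp only: matrix_mul_assoc)
  finally show ?thesis .
qed

text \<open>Skewness lets \<open>1 - X\<close> pass through the form as \<open>1 + X\<close>, and
  \<open>1 + X\<close> as \<open>1 - X\<close>; the factors then cancel against the inverse.\<close>

lemma cay_preserves:
  assumes X: "X \<in> so34" and i: "invertible (mat 1 - X)"
  shows "transpose (cay X) ** J34 ** cay X = J34"
proof -
  let ?N = "matrix_inv (mat 1 - X)"
  have TJ: "transpose X ** J34 = - (J34 ** X)" using X unfolding so34_iff by (simp add: eq_neg_iff_add_eq_0)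
  have 1: "transpose (mat 1 - X) ** J34 = J34 ** (mat 1 + X)" "transpose (mat 1 + X) ** J34 = J34 ** (mat 1 - X)"
    by (simp_all add: transpose_diff transpose_add matrix_mult.diff_left matrix_mult.add_left
        matrix_mult.diff_right matrix_mult.add_right TJ)
  have "(mat 1 + X) ** (mat 1 - X) = (mat 1 - X) ** (mat 1 + X)"
    by (simp add: matrix_mult.diff_left matrix_mult.add_left matrix_mult.diff_right matrix_mult.add_right)
  then have c: "cay X = (mat 1 + X) ** ?N" unfolding cay_def using matrix_inv_commute[OF i] by metis
  have "transpose (cay X) ** J34 ** cay X = transpose (cay X) ** (J34 ** (mat 1 + X)) ** ?N"
    unfolding c by (simp only: matrix_mul_assoc)
  also have "\<dots> = transpose ((mat 1 - X) ** cay X) ** J34 ** ?N"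
    unfolding 1(1)[symmetric] matrix_transpose_mul by (simp only: matrix_mul_assoc)
  also have "\<dots> = J34 ** ((mat 1 - X) ** ?N)"
    unfolding cay_mult[OF i] 1(2) by (simp only: matrix_mul_assoc)
  finally show ?thesis unfolding matrix_inv(2)[OF i] by simp
qed

text \<open>With M the inverse of \<open>1 + k\<close> one has \<open>1 - X = 2 M\<close> and
  \<open>1 + X = 2 M k\<close>, and the quotient of the two is \<open>k\<close>.\<close>

lemma cay_inverse:
  fixes k :: "real^'n^'n"
  assumes i: "invertible (mat 1 + k)" and X: "X = matrix_inv (mat 1 + k) ** (k - mat 1)"
  shows "invertible (mat 1 - X)" "cay X = k" "X ** (mat 1 + k) = k - mat 1"
proof -
  let ?M = "matrix_inv (mat 1 + k)"
  have m1: "mat 1 = ?M ** (mat 1 + k)" using matrix_inv(1)[OF i] by simp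
  have two: "(mat 1 + k) - (k - mat 1) = 2 *\<^sub>R mat 1" "(mat 1 + k) + (k - mat 1) = 2 *\<^sub>R k"
    by (simp_all add: scaleR_2)
  have "mat 1 - X = ?M ** ((mat 1 + k) - (k - mat 1))"
    unfolding X by (subst m1) (simp only: matrix_mult.diff_right)
  then have a: "mat 1 - X = 2 *\<^sub>R ?M" unfolding two matrix_mult.scaleR_right by (simp only: matrix_mul_rid)
  have "mat 1 + X = ?M ** ((mat 1 + k) + (k - mat 1))"
    unfolding X by (subst m1) (simp only: matrix_mult.add_right)
  then have b: "mat 1 + X = 2 *\<^sub>R (?M ** k)" unfolding two matrix_mult.scaleR_right .
  have c: "(mat 1 - X) ** ((1/2) *\<^sub>R (mat 1 + k)) = mat 1" "((1/2) *\<^sub>R (mat 1 + k)) ** (mat 1 - X) = mat 1"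
    unfolding a matrix_mult.scaleR_left matrix_mult.scaleR_right matrix_inv[OF i] by simp_all
  then show "invertible (mat 1 - X)" unfolding invertible_def by blast
  have "cay X = ((1/2) *\<^sub>R (mat 1 + k)) ** (2 *\<^sub>R (?M ** k))"
    unfolding cay_def matrix_inv_unique[OF c] b ..
  also have "\<dots> = ((mat 1 + k) ** ?M) ** k"
    by (simp add: matrix_mult.scaleR_left matrix_mult.scaleR_right matrix_mul_assoc)
  finally show "cay X = k" unfolding matrix_inv(2)[OF i] by simp
  have "(k - mat 1) ** (mat 1 + k) = (mat 1 + k) ** (k - mat 1)"
    by (simp add: matrix_mult.diff_left matrix_mult.add_left matrix_mult.diff_right matrix_mult.add_right)
  then have "X ** (mat 1 + k) = ?M ** (mat 1 + k) ** (k - mat 1)" unfolding X by (metis matrix_mul_assoc)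
  then show "X ** (mat 1 + k) = k - mat 1" unfolding matrix_inv(1)[OF i] by simp
qed

text \<open>Conjugating the defect of skewness by \<open>1 + k\<close> and using
  \<open>X (1 + k) = k - 1\<close>, the result is twice the difference of
  \<open>transpose k ** J34 ** k\<close> and \<open>J34\<close>, which is 0.\<close>

lemma cay_inverse_so34:
  assumes i: "invertible (mat 1 + k)" and X: "X = matrix_inv (mat 1 + k) ** (k - mat 1)"
    and k: "transpose k ** J34 ** k = J34"
  shows "X \<in> so34"
proof -
  let ?S = "mat 1 + k"
  have XS: "X ** ?S = k - mat 1" by (rule cay_inverse(3)[OF i X])
  have "transpose S ** (transpose X ** J34 + J34 ** X) ** S
      = transpose (X ** S) ** J34 ** S + transpose S ** J34 ** (X ** S)" for S
    by (simp only: matrix_transpose_mul matrix_mult.add_left matrix_mult.add_right matrix_mul_assoc)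
  from this[of ?S] have "transpose ?S ** (transpose X ** J34 + J34 ** X) ** ?S
      = transpose (X ** ?S) ** J34 ** ?S + transpose ?S ** J34 ** (X ** ?S)" .
  also have "\<dots> = 0"
    unfolding XS using k by (simp add: transpose_diff transpose_add matrix_mult.diff_left matrix_mult.add_left
        matrix_mult.diff_right matrix_mult.add_right)
  finally have "transpose (matrix_inv ?S) ** (transpose ?S ** (transpose X ** J34 + J34 ** X) ** ?S) ** matrix_inv ?S = 0"
    by simp
  then have "transpose (?S ** matrix_inv ?S) ** (transpose X ** J34 + J34 ** X) ** (?S ** matrix_inv ?S) = 0"
    by (simp only: matrix_transpose_mul matrix_mul_assoc)
  then show ?thesis unfolding matrix_inv(2)[OF i] so34_iff by simp
qed

lemma open_cay_domain: "open {X :: real^'n^'n. invertible (mat 1 - X)}"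
  using open_preimage_Collect[OF open_UNIV _ open_invertible, of "\<lambda>X. mat 1 - X"]
  by (simp add: continuous_on_diff)

lemma smooth_on_cay: "smooth_on {X :: real^'n^'n. invertible (mat 1 - X)} cay"
proof -
  let ?S = "{X :: real^'n^'n. invertible (mat 1 - X)}"
  have "smooth_on ?S (\<lambda>X. matrix_inv (mat 1 - X) ** (mat 1 + X))"
    by (intro smooth_on_matrix_mult smooth_on_add open_cay_domain smooth_on_const smooth_on_ident
        smooth_on_compose[OF open_cay_domain open_invertible _ smooth_on_matrix_inv] smooth_on_diff) auto
  then show ?thesis unfolding cay_def .
qed

lemma invertible_mat_1: "invertible (mat 1 :: real^'n^'n)"
  unfolding invertible_def by (rule exI[of _ "mat 1"]) simp

definition icay :: "real^'n^'n \<Rightarrow> real^'n^'n" where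
  "icay k = matrix_inv (mat 1 + k) ** (k - mat 1)"

lemma icay_domain: "open {k :: real^'n^'n. invertible (mat 1 + k)}" "invertible (mat 1 + mat 1 :: real^'n^'n)"
proof -
  show "open {k :: real^'n^'n. invertible (mat 1 + k)}"
    using open_preimage_Collect[OF open_UNIV _ open_invertible, of "\<lambda>k. mat 1 + k"]
    by (simp add: continuous_on_add)
  have "mat 1 + mat 1 = 2 *\<^sub>R (mat 1 :: real^'n^'n)" by (simp add: scaleR_2)
  then show "invertible (mat 1 + mat 1 :: real^'n^'n)"
    unfolding invertible_def
    by (intro exI[of _ "(1/2) *\<^sub>R mat 1"]) (simp add: matrix_mult.scaleR_left matrix_mult.scaleR_right)
qed

lemma smooth_on_icay: "smooth_on {k :: real^'n^'n. invertible (mat 1 + k)} icay"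
proof -
  let ?S = "{k :: real^'n^'n. invertible (mat 1 + k)}"
  have "smooth_on ?S (\<lambda>k. matrix_inv (mat 1 + k) ** (k - mat 1))"
    by (intro smooth_on_matrix_mult smooth_on_diff icay_domain smooth_on_const smooth_on_ident
        smooth_on_compose[OF icay_domain(1) open_invertible _ smooth_on_matrix_inv] smooth_on_add) auto
  then show ?thesis unfolding icay_def .
qed

lemma icay_1: "icay (mat 1) = 0"
  unfolding icay_def by simp

lemma isCont_icay_1: "isCont icay (mat 1 :: real^'n^'n)"
  using smooth_on_imp_continuous_on[OF smooth_on_icay] continuous_on_eq_continuous_at[OF icay_domain(1)]
    icay_domain(2) by blast

text \<open>Differentiating \<open>(1 - t X) cay (t X) = 1 + t X\<close> at 0 gives
  \<open>c' - X = X\<close>; hence the factor 2, which returns in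
  \<open>infinitesimally_free\<close>.\<close>

lemma cay_curve_derivative: "((\<lambda>t. cay (t *\<^sub>R (X :: real^'n^'n))) has_vector_derivative 2 *\<^sub>R X) (at 0)"
proof -
  let ?c = "\<lambda>t. cay (t *\<^sub>R X)" and ?S = "{X :: real^'n^'n. invertible (mat 1 - X)}"
  have S0: "(0 :: real^'n^'n) \<in> ?S" by (simp add: invertible_mat_1)
  have "((\<lambda>t. t *\<^sub>R X) has_derivative (\<lambda>t. t *\<^sub>R X)) (at 0)"
    by (intro bounded_linear.has_derivative[OF bounded_linear_scaleR_left] has_derivative_ident)
  moreover have "(cay has_derivative frechet_derivative cay (at 0)) (at (0 *\<^sub>R X))"
    using smooth_on_has_derivative[OF smooth_on_cay S0] by simp
  ultimately have d: "(?c has_derivative (\<lambda>t. frechet_derivative cay (at 0) (t *\<^sub>R X))) (at 0)"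
    by (rule has_derivative_compose)
  define c' where "c' = frechet_derivative cay (at 0) X"
  have "linear (frechet_derivative cay (at (0 :: real^'n^'n)))"
    using smooth_on_has_derivative[OF smooth_on_cay S0] has_derivative_linear by blast
  then have c: "(?c has_vector_derivative c') (at 0)"
    using d unfolding has_vector_derivative_def c'_def by (simp add: linear_scale)
  have "((\<lambda>t. mat 1 - t *\<^sub>R X) has_vector_derivative - X) (at 0)"
    by (auto intro!: derivative_eq_intros)
  from has_vector_derivative_matrix_mult[OF this c]
  have 1: "((\<lambda>t. (mat 1 - t *\<^sub>R X) ** ?c t) has_vector_derivative c' - X) (at 0)"
    by (simp add: cay_0 matrix_mult.minus_left)
  have 2: "((\<lambda>t. mat 1 + t *\<^sub>R X) has_vector_derivative X) (at 0)"
    by (auto intro!: derivative_eq_intros)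
  let ?T = "{t \<in> UNIV. t *\<^sub>R X \<in> ?S}"
  have T: "open ?T" by (rule open_preimage_Collect[OF open_UNIV _ open_cay_domain]) (intro continuous_intros)
  have "((\<lambda>t. mat 1 + t *\<^sub>R X) has_vector_derivative c' - X) (at 0)"
    by (rule has_vector_derivative_transform_within_open[OF 1 T]) (use S0 cay_mult in auto)
  then have "c' - X = X" using vector_derivative_unique_at[OF _ 2] by blast
  then have "c' = 2 *\<^sub>R X" by (simp add: scaleR_2 algebra_simps)
  then show ?thesis using c by simp
qed

section \<open>Reduction by a one-parameter group and a compact group\<close>

text \<open>Near \<open>1\<close> the group \<open>K\<close> is the centralizer of \<open>\<Q>\<close> in the isometry group of the form, so the Cayley
  transform identifies a neighbourhood of \<open>0\<close> in its Lie algebra with a neighbourhood of \<open>1\<close> in \<open>K\<close>.\<close>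

definition centralizer_algebra :: "mat34 set \<Rightarrow> mat34 set" where
  "centralizer_algebra \<Q> = {X \<in> so34. \<forall>Q\<in>\<Q>. Q ** X = X ** Q}"

locale compact_matrix_group =
  fixes K \<Q> :: "mat34 set"
  assumes compact: "compact K" and one: "mat 1 \<in> K"
    and mult: "\<And>k l. k \<in> K \<Longrightarrow> l \<in> K \<Longrightarrow> k ** l \<in> K"
    and inv: "\<And>k. k \<in> K \<Longrightarrow> matrix_inv k \<in> K"
    and preserves: "\<And>k. k \<in> K \<Longrightarrow> transpose k ** J34 ** k = J34"
    and J34_in: "J34 \<in> \<Q>"
    and near_one: "\<exists>\<delta>>0. \<forall>k. norm (k - mat 1) < \<delta> \<longrightarrow>
      (k \<in> K \<longleftrightarrow> transpose k ** J34 ** k = J34 \<and> (\<forall>Q\<in>\<Q>. Q ** k = k ** Q))"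

locale reduction = compact_matrix_group +
  fixes A :: mat34 and Z :: "mat34 set"
  assumes A: "A \<in> so34" "A \<notin> IV4"
    and Z: "\<And>g. g \<in> Z \<Longrightarrow> transpose g ** J34 ** g = J34"
    and Z_left: "\<And>g t. g \<in> Z \<Longrightarrow> mexp (t *\<^sub>R A) ** g \<in> Z"
    and Z_right: "\<And>g k. g \<in> Z \<Longrightarrow> k \<in> K \<Longrightarrow> g ** k \<in> Z"
begin

abbreviation E :: "real \<Rightarrow> mat34" where "E t \<equiv> mexp (t *\<^sub>R A)"

lemma K_inv: "k \<in> K \<Longrightarrow> k ** matrix_inv k = mat 1" "k \<in> K \<Longrightarrow> matrix_inv k ** k = mat 1"
  using matrix_inv preserving_inverse(3)[OF preserves] by blast+

lemma E_inv: "E (- s) ** E s = mat 1" "E s ** E (- s) = mat 1"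
  by (rule mexp_inverse)+

lemma solve_E:
  assumes "transpose x ** J34 ** x = J34" "k \<in> K" "y = E s ** x ** k"
  shows "E s = y ** matrix_inv k ** matrix_inv x"
proof -
  have "y ** matrix_inv k ** matrix_inv x = E s ** (x ** (k ** matrix_inv k) ** matrix_inv x)"
    unfolding assms(3) by (simp only: matrix_mul_assoc)
  then show ?thesis
    unfolding K_inv(1)[OF assms(2)] by (simp add: matrix_inv(2)[OF preserving_inverse(3)[OF assms(1)]])
qed

text \<open>Solving the relation for \<open>E s\<close> expresses it by \<open>y\<close>, an element
  of the compact group and the inverse of an isometry. The constant is uniform in \<open>x\<close>,
  \<open>y\<close> and \<open>k\<close>; both properness and freeness rest on it.\<close>

lemma solve_E_bound:
  obtains C where "\<And>x k y s. transpose x ** J34 ** x = J34 \<Longrightarrow> k \<in> K \<Longrightarrow> y = E s ** x ** k \<Longrightarrow>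
    norm (E s) \<le> C * (norm x * norm y)"
proof -
  obtain L where L: "L > 0" "\<And>(A :: mat34) (B :: mat34). norm (A ** B) \<le> norm A * norm B * L"
    using matrix_mult.pos_bounded by blast
  obtain c where c: "c > 0" "\<And>g. transpose g ** J34 ** g = J34 \<Longrightarrow> norm (matrix_inv g) \<le> c * norm g"
    using norm_preserving_inverse by blast
  have "bounded K" by (rule compact_imp_bounded[OF compact])
  then obtain b where b: "\<forall>k\<in>K. norm k \<le> b" unfolding bounded_iff by (rule exE)
  have "norm (E s) \<le> (b * L * c * L) * (norm x * norm y)"
    if x: "transpose x ** J34 ** x = J34" and k: "k \<in> K" and y: "y = E s ** x ** k" for x k y s
  proof -
    have b0: "0 \<le> b" using b k norm_ge_zero order_trans by blast
    have "norm (E s) \<le> norm (y ** matrix_inv k) * norm (matrix_inv x) * L"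
      unfolding solve_E[OF that] by (rule L(2))
    also have "\<dots> \<le> (norm y * norm (matrix_inv k) * L) * norm (matrix_inv x) * L"
      using L by (intro mult_right_mono) auto
    also have "\<dots> \<le> (norm y * b * L) * (c * norm x) * L"
      using L(1) c b inv[OF k] x b0 by (intro mult_right_mono mult_mono mult_left_mono) auto
    finally show ?thesis by (simp add: ac_simps)
  qed
  then show ?thesis using that by blast
qed

text \<open>Convergence of \<open>x\<close> and \<open>y\<close> bounds \<open>E (s n)\<close>,
  hence \<open>s n\<close> by \<open>mexp_proper\<close>, and a subsequence converges in a compact
  product of an interval with \<open>K\<close>.\<close>

lemma proper:
  assumes x: "x \<longlonglongrightarrow> a" and y: "y \<longlonglongrightarrow> b" and xZ: "\<And>n. x n \<in> Z"
    and k: "\<And>n::nat. k n \<in> K" and eq: "\<And>n. y n = E (s n) ** x n ** k n"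
  obtains r s' k' where "strict_mono (r :: nat \<Rightarrow> nat)" "(\<lambda>n. s (r n)) \<longlonglongrightarrow> s'" "(\<lambda>n. k (r n)) \<longlonglongrightarrow> k'" "k' \<in> K"
    "b = E s' ** a ** k'"
proof -
  obtain C where C: "\<And>x k y s. transpose x ** J34 ** x = J34 \<Longrightarrow> k \<in> K \<Longrightarrow> y = E s ** x ** k \<Longrightarrow>
    norm (E s) \<le> C * (norm x * norm y)" using solve_E_bound by blast
  have "(\<lambda>n. C * (norm (x n) * norm (y n))) \<longlonglongrightarrow> C * (norm a * norm b)"
    by (intro tendsto_intros x y)
  then have "Bseq (\<lambda>n. C * (norm (x n) * norm (y n)))" by (rule convergent_imp_Bseq[OF convergentI])
  then obtain D where D: "\<And>n. norm (C * (norm (x n) * norm (y n))) \<le> D" unfolding Bseq_def by blast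
  have "norm (E (s n)) \<le> D" for n
    using C[OF Z[OF xZ] k eq, of n] D[of n] by (simp add: abs_le_iff)
  moreover obtain R where "\<And>t. norm (E t) \<le> D \<Longrightarrow> \<bar>t\<bar> < R" using mexp_proper[OF A, of D] by blast
  ultimately have sR: "\<bar>s n\<bar> < R" for n by blast
  have "compact ({- R..R} \<times> K)" by (intro compact_Times compact_Icc compact)
  then have sc: "seq_compact ({- R..R} \<times> K)" by (simp add: compact_eq_seq_compact_metric)
  have mem: "(s n, k n) \<in> {- R..R} \<times> K" for n using sR[of n] k[of n] by auto
  have "\<exists>l\<in>{- R..R} \<times> K. \<exists>r. strict_mono r \<and> ((\<lambda>n. (s n, k n)) \<circ> r) \<longlonglongrightarrow> l"
    by (rule sc[unfolded seq_compact_def, rule_format]) (rule mem)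
  then obtain l r where r: "l \<in> {- R..R} \<times> K" "strict_mono r" "((\<lambda>n. (s n, k n)) \<circ> r) \<longlonglongrightarrow> l"
    by blast
  have s': "(\<lambda>n. s (r n)) \<longlonglongrightarrow> fst l" and k': "(\<lambda>n. k (r n)) \<longlonglongrightarrow> snd l"
    using tendsto_fst[OF r(3)] tendsto_snd[OF r(3)] by (simp_all add: o_def)
  have "isCont E (fst l)" using mexp_derivative(1) has_vector_derivative_continuous by blast
  then have "(\<lambda>n. E (s (r n))) \<longlonglongrightarrow> E (fst l)" using s' by (rule isCont_tendsto_compose)
  moreover have "(\<lambda>n. x (r n)) \<longlonglongrightarrow> a" "(\<lambda>n. y (r n)) \<longlonglongrightarrow> b"
    using LIMSEQ_subseq_LIMSEQ[OF x r(2)] LIMSEQ_subseq_LIMSEQ[OF y r(2)] by (simp_all add: o_def)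
  ultimately have "(\<lambda>n. E (s (r n)) ** x (r n) ** k (r n)) \<longlonglongrightarrow> E (fst l) ** a ** snd l"
    using k' by (intro matrix_mult.tendsto)
  then have "(\<lambda>n. y (r n)) \<longlonglongrightarrow> E (fst l) ** a ** snd l" unfolding eq .
  then have "b = E (fst l) ** a ** snd l" using \<open>(\<lambda>n. y (r n)) \<longlonglongrightarrow> b\<close> LIMSEQ_unique by blast
  then show ?thesis using that[OF r(2) s' k'] r(1) by auto
qed

lemma free:
  assumes p: "p \<in> Z" and k: "k \<in> K" and eq: "E s ** p ** k = p"
  shows "s = 0" "k = mat 1"
proof -
  \<comment> \<open>Iterating the relation keeps the right factor in \<open>K\<close>, so the bound
    of \<open>solve_E_bound\<close> is the same for all multiples of \<open>s\<close>.\<close>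
  have pow: "\<exists>l\<in>K. p = E (real n * s) ** p ** l" for n
  proof (induction n)
    case 0
    show ?case using one by (intro bexI[of _ "mat 1"]) (simp_all add: mexp_0)
  next
    case (Suc n)
    then obtain l where l: "l \<in> K" "p = E (real n * s) ** p ** l" by blast
    have "E (real (Suc n) * s) ** p ** (l ** k) = E s ** (E (real n * s) ** p ** l) ** k"
      using mexp_add[of s "real n * s" A] by (simp add: distrib_right matrix_mul_assoc)
    also have "\<dots> = p" unfolding l(2)[symmetric] by (rule eq)
    finally show ?case using mult[OF l(1) k] by metis
  qed
  obtain C where C: "\<And>x k y s. transpose x ** J34 ** x = J34 \<Longrightarrow> k \<in> K \<Longrightarrow> y = E s ** x ** k \<Longrightarrow>
    norm (E s) \<le> C * (norm x * norm y)" using solve_E_bound by blast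
  obtain R where R: "\<And>t. norm (E t) \<le> C * (norm p * norm p) \<Longrightarrow> \<bar>t\<bar> < R" using mexp_proper[OF A] by blast
  have b: "\<bar>real n * s\<bar> < R" for n using pow[of n] C[OF Z[OF p]] R by blast
  show s0: "s = 0"
  proof (rule ccontr)
    assume "s \<noteq> 0"
    then obtain n :: nat where "R < real n * \<bar>s\<bar>" using reals_Archimedean3[of "\<bar>s\<bar>"] by auto
    then show False using b[of n] by (simp add: abs_mult)
  qed
  have "p ** k = p" using eq unfolding s0 by (simp add: mexp_0)
  then have "matrix_inv p ** p ** k = matrix_inv p ** p" by (simp add: matrix_mul_assoc[symmetric])
  then show "k = mat 1" unfolding matrix_inv(1)[OF preserving_inverse(3)[OF Z[OF p]]] by simp
qed

text \<open>Commuting with \<open>J34\<close> makes \<open>X\<close> block diagonal. If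
  \<open>s\<close> were nonzero, the relation would show that \<open>A\<close> is block diagonal in
  the frame \<open>p\<close>, against \<open>A \<notin> IV4\<close>.\<close>

lemma infinitesimally_free:
  assumes p: "p \<in> Z" and X: "X \<in> centralizer_algebra \<Q>" and eq: "s *\<^sub>R (A ** p) + 2 *\<^sub>R (p ** X) = 0"
  shows "s = 0" "X = 0"
proof -
  have JX: "J34 ** X = X ** J34" using X J34_in unfolding centralizer_algebra_def by blast
  have diag: "X $ Inr j $ Inl i = 0" for i j
  proof -
    have "(J34 ** X) $ Inr j $ Inl i = - (X $ Inr j $ Inl i)" "(X ** J34) $ Inr j $ Inl i = X $ Inr j $ Inl i"
      unfolding matrix_matrix_mult_def J34_def
      by (simp_all add: if_distrib[of "\<lambda>c. c * _"] if_distrib[of "\<lambda>c. _ * c"] cong: if_cong)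
    then show ?thesis using JX by simp
  qed
  show s: "s = 0"
  proof (rule ccontr)
    assume s: "s \<noteq> 0"
    have "s *\<^sub>R (A ** p) = - (2 *\<^sub>R (p ** X))" using eq by (simp add: eq_neg_iff_add_eq_0)
    then have "(1 / s) *\<^sub>R (s *\<^sub>R (A ** p)) = (1 / s) *\<^sub>R (- (2 *\<^sub>R (p ** X)))" by simp
    then have "A ** p = p ** ((- 2 / s) *\<^sub>R X)" using s by (simp add: matrix_mult.scaleR_right matrix_mult.minus_right)
    then have "A \<in> IV4"
      by (rule block_diagonal_imp_IV4[OF A(1) Z[OF p]]) (simp add: diag)
    then show False using A(2) by blast
  qed
  have "p ** X = 0" using eq unfolding s by simp
  then have "matrix_inv p ** p ** X = 0" by (simp add: matrix_mul_assoc[symmetric])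
  then show "X = 0" unfolding matrix_inv(1)[OF preserving_inverse(3)[OF Z[OF p]]] by simp
qed

text \<open>Left translations by \<open>T\<close> and right translations by \<open>K\<close> are
  combined into one group of linear maps, so that a single slice theorem covers the double
  quotient.\<close>

definition \<Gamma> :: "(mat34 \<Rightarrow> mat34) set" where
  "\<Gamma> = {\<lambda>x. E s ** x ** k | s k. k \<in> K}"

lemma \<Gamma>I: "k \<in> K \<Longrightarrow> (\<lambda>x. E s ** x ** k) \<in> \<Gamma>"
  unfolding \<Gamma>_def by blast

definition \<delta>0 :: real where
  "\<delta>0 = (SOME \<delta>. \<delta> > 0 \<and> (\<forall>k. norm (k - mat 1) < \<delta> \<longrightarrow>
      (k \<in> K \<longleftrightarrow> transpose k ** J34 ** k = J34 \<and> (\<forall>Q\<in>\<Q>. Q ** k = k ** Q))))"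

lemma \<delta>0: "\<delta>0 > 0" "\<And>k. norm (k - mat 1) < \<delta>0 \<Longrightarrow>
      k \<in> K \<longleftrightarrow> transpose k ** J34 ** k = J34 \<and> (\<forall>Q\<in>\<Q>. Q ** k = k ** Q)"
  using someI_ex[OF near_one] unfolding \<delta>0_def[symmetric] by blast+

text \<open>The radius restricts \<open>cay X\<close> and not \<open>X\<close>, since
  \<open>near_one\<close> decides membership in \<open>K\<close> for matrices close to 1.\<close>

definition \<Lambda> :: "(real \<times> mat34) set" where
  "\<Lambda> = UNIV \<times> {X. invertible (mat 1 - X) \<and> cay X \<in> ball (mat 1) \<delta>0}"

definition \<epsilon> :: "real \<times> mat34 \<Rightarrow> mat34 \<Rightarrow> mat34" where
  "\<epsilon> = (\<lambda>(s, X) x. E s ** x ** cay X)"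

lemma subspace_centralizer: "subspace (centralizer_algebra \<Q>)"
proof -
  have "linear (\<lambda>X. transpose X ** J34 + J34 ** X)"
    by (intro linear_compose_add linear_matrix_mult_right
        linear_compose[OF linear_transpose linear_matrix_mult_left, unfolded o_def])
  moreover have "linear (\<lambda>X. Q ** X - X ** Q)" for Q :: mat34
    by (intro linear_compose_sub linear_matrix_mult_right linear_matrix_mult_left)
  ultimately have "subspace ({X. transpose X ** J34 + J34 ** X = 0} \<inter> (\<Inter>Q\<in>\<Q>. {X. Q ** X - X ** Q = 0}))"
    by (intro subspace_inter subspace_Int linear_subspace_kernel)
  moreover have "centralizer_algebra \<Q> =
      {X. transpose X ** J34 + J34 ** X = 0} \<inter> (\<Inter>Q\<in>\<Q>. {X. Q ** X - X ** Q = 0})"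
    unfolding centralizer_algebra_def so34_iff by auto
  ultimately show ?thesis by simp
qed

sublocale free_proper_action Z "double_coset (one_parameter_group A) K"
  "reduced_space (one_parameter_group A) Z K" \<Gamma> "UNIV \<times> centralizer_algebra \<Q>" \<Lambda> \<epsilon>
proof (rule free_proper_action.intro)
  let ?q = "double_coset (one_parameter_group A) K"
  show "quotient_map (top_of_set Z) (reduced_space (one_parameter_group A) Z K) ?q"
    by (rule quotient_map_reduced_space)
  have qI: "E t ** x ** k \<in> ?q x" if "k \<in> K" for t k x
    using that unfolding double_coset_def one_parameter_group_def by blast
  have qE: "\<exists>t k. k \<in> K \<and> z = E t ** x ** k" if "z \<in> ?q x" for z x
    using that unfolding double_coset_def one_parameter_group_def by blast
  have sub: "?q (E s ** x ** k) \<subseteq> ?q x" if k: "k \<in> K" for s x k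
  proof
    fix z assume "z \<in> ?q (E s ** x ** k)"
    then obtain t l where l: "l \<in> K" "z = E t ** (E s ** x ** k) ** l" using qE by blast
    have "z = E (t + s) ** x ** (k ** l)" unfolding l(2) mexp_add by (simp only: matrix_mul_assoc)
    then show "z \<in> ?q x" using qI[OF mult[OF k l(1)]] by metis
  qed
  show "?q x = ?q y \<longleftrightarrow> (\<exists>\<gamma>\<in>\<Gamma>. y = \<gamma> x)" if "x \<in> Z" "y \<in> Z" for x y
  proof
    assume "?q x = ?q y"
    moreover have "y \<in> ?q y" using qI[OF one, of 0 y] by (simp add: mexp_0)
    ultimately obtain t k where "k \<in> K" "y = E t ** x ** k" using qE[of y x] by auto
    then show "\<exists>\<gamma>\<in>\<Gamma>. y = \<gamma> x" by (intro bexI[OF _ \<Gamma>I])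
  next
    assume "\<exists>\<gamma>\<in>\<Gamma>. y = \<gamma> x"
    then obtain s k where k: "k \<in> K" "y = E s ** x ** k" unfolding \<Gamma>_def by blast
    have "E (- s) ** y ** matrix_inv k = (E (- s) ** E s) ** x ** (k ** matrix_inv k)"
      unfolding k(2) by (simp only: matrix_mul_assoc)
    then have "x = E (- s) ** y ** matrix_inv k" unfolding E_inv K_inv(1)[OF k(1)] by simp
    then have "?q x \<subseteq> ?q y" using sub[OF inv[OF k(1)], of "- s" y] by simp
    then show "?q x = ?q y" using sub[OF k(1)] k(2) by blast
  qed
  show "linear \<gamma>" if \<gamma>: "\<gamma> \<in> \<Gamma>" for \<gamma>
  proof -
    obtain s k where "\<gamma> = (\<lambda>x. E s ** x ** k)" using \<gamma> unfolding \<Gamma>_def by blast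
    moreover have "linear ((\<lambda>x. x ** k) \<circ> (\<lambda>x. E s ** x))"
      by (intro linear_compose linear_matrix_mult_left linear_matrix_mult_right)
    ultimately show ?thesis by (simp add: o_def)
  qed
  show "\<gamma> x \<in> Z" if "\<gamma> \<in> \<Gamma>" "x \<in> Z" for \<gamma> x
    using that Z_left Z_right unfolding \<Gamma>_def by blast
  show "\<exists>\<gamma>'\<in>\<Gamma>. (\<forall>x. \<gamma>' (\<gamma> x) = x) \<and> (\<forall>x. \<gamma> (\<gamma>' x) = x)" if \<gamma>: "\<gamma> \<in> \<Gamma>" for \<gamma>
  proof -
    obtain s k where k: "k \<in> K" "\<gamma> = (\<lambda>x. E s ** x ** k)" using \<gamma> unfolding \<Gamma>_def by blast
    have "E (- s) ** (E s ** x ** k) ** matrix_inv k = (E (- s) ** E s) ** x ** (k ** matrix_inv k)"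
      "E s ** (E (- s) ** x ** matrix_inv k) ** k = (E s ** E (- s)) ** x ** (matrix_inv k ** k)" for x
      by (simp_all only: matrix_mul_assoc)
    then have *: "E (- s) ** (E s ** x ** k) ** matrix_inv k = x" "E s ** (E (- s) ** x ** matrix_inv k) ** k = x" for x
      unfolding E_inv K_inv[OF k(1)] by simp_all
    show ?thesis
      unfolding k(2) by (rule bexI[OF _ \<Gamma>I[OF inv[OF k(1)], of "- s"]]) (intro conjI allI *)
  qed
  show "(\<lambda>x. \<gamma> (\<delta> x)) \<in> \<Gamma>" if \<gamma>: "\<gamma> \<in> \<Gamma>" "\<delta> \<in> \<Gamma>" for \<gamma> \<delta>
  proof -
    obtain s k t l where k: "k \<in> K" "l \<in> K" "\<gamma> = (\<lambda>x. E s ** x ** k)" "\<delta> = (\<lambda>x. E t ** x ** l)"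
      using \<gamma> unfolding \<Gamma>_def by blast
    have "(\<lambda>x. \<gamma> (\<delta> x)) = (\<lambda>x. E (s + t) ** x ** (l ** k))"
      unfolding k(3,4) mexp_add by (simp only: matrix_mul_assoc)
    then show ?thesis unfolding \<Gamma>_def using mult[OF k(2,1)] by blast
  qed
  show "subspace (UNIV \<times> centralizer_algebra \<Q>)" by (intro subspace_Times subspace_UNIV subspace_centralizer)
  have oC: "open {X \<in> {X. invertible (mat 1 - X)}. cay X \<in> ball (mat 1 :: mat34) \<delta>0}"
    by (rule open_preimage_Collect[OF open_cay_domain smooth_on_imp_continuous_on[OF smooth_on_cay] open_ball])
  then show \<Lambda>: "open \<Lambda>" unfolding \<Lambda>_def by (intro open_Times open_UNIV) simp
  show "0 \<in> \<Lambda>" unfolding \<Lambda>_def zero_prod_def using \<delta>0(1) by (simp add: cay_0 invertible_mat_1)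
  show "smooth_on (\<Lambda> \<times> UNIV) (\<lambda>(\<xi>, x). \<epsilon> \<xi> x)"
  proof -
    have o: "open (\<Lambda> \<times> (UNIV :: mat34 set))" by (intro open_Times \<Lambda> open_UNIV)
    have l: "linear (\<lambda>z :: (real \<times> mat34) \<times> mat34. fst (fst z))" "linear (\<lambda>z :: (real \<times> mat34) \<times> mat34. snd (fst z))"
      "linear (\<lambda>z :: (real \<times> mat34) \<times> mat34. snd z)"
      by (auto intro!: linearI)
    have 1: "smooth_on (\<Lambda> \<times> UNIV) (\<lambda>z :: (real \<times> mat34) \<times> mat34. E (fst (fst z)))"
      by (rule smooth_on_compose[OF o open_UNIV smooth_on_linear[OF l(1)] smooth_on_mexp]) simp
    have 2: "smooth_on (\<Lambda> \<times> UNIV) (\<lambda>z :: (real \<times> mat34) \<times> mat34. cay (snd (fst z)))"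
      by (rule smooth_on_compose[OF o open_cay_domain smooth_on_linear[OF l(2)] smooth_on_cay]) (auto simp: \<Lambda>_def)
    have "smooth_on (\<Lambda> \<times> UNIV) (\<lambda>z :: (real \<times> mat34) \<times> mat34. E (fst (fst z)) ** snd z ** cay (snd (fst z)))"
      by (intro smooth_on_matrix_mult[OF o] 1 2 smooth_on_linear[OF l(3)])
    then show ?thesis unfolding \<epsilon>_def by (simp add: case_prod_unfold)
  qed
  show "\<epsilon> 0 x = x" for x unfolding \<epsilon>_def zero_prod_def by (simp add: mexp_0 cay_0)
  show "\<epsilon> \<xi> \<in> \<Gamma>" if \<xi>: "\<xi> \<in> UNIV \<times> centralizer_algebra \<Q>" "\<xi> \<in> \<Lambda>" for \<xi>
  proof -
    obtain s X where sX: "\<xi> = (s, X)" "X \<in> centralizer_algebra \<Q>" "invertible (mat 1 - X)" "cay X \<in> ball (mat 1) \<delta>0"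
      using \<xi> unfolding \<Lambda>_def by blast
    have "cay X \<in> K"
      using \<delta>0(2)[of "cay X"] sX(4) cay_preserves[OF _ sX(3)] cay_commute[OF sX(3)] sX(2)
      unfolding centralizer_algebra_def by (simp add: dist_norm norm_minus_commute)
    then show ?thesis unfolding \<Gamma>_def \<epsilon>_def sX(1) by auto
  qed
  show "\<not> ((\<lambda>t. \<epsilon> (t *\<^sub>R \<xi>) p) has_vector_derivative 0) (at 0)"
    if p: "p \<in> Z" and \<xi>: "\<xi> \<in> UNIV \<times> centralizer_algebra \<Q>" "\<xi> \<noteq> 0" for p \<xi>
  proof
    assume 0: "((\<lambda>t. \<epsilon> (t *\<^sub>R \<xi>) p) has_vector_derivative 0) (at 0)"
    obtain s X where sX: "\<xi> = (s, X)" "X \<in> centralizer_algebra \<Q>" using \<xi>(1) by blast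
    have "((\<lambda>t. E (t * s)) has_vector_derivative s *\<^sub>R A) (at 0)"
    proof -
      have "((\<lambda>t. t * s) has_vector_derivative s) (at 0)" by (auto intro!: derivative_eq_intros)
      from vector_diff_chain_at[OF this mexp_derivative(1)[of A]] show ?thesis
        by (simp add: o_def mexp_0)
    qed
    from has_vector_derivative_matrix_mult[OF has_vector_derivative_matrix_mult[OF this
        has_vector_derivative_const[of p]] cay_curve_derivative[of X]]
    have "((\<lambda>t. \<epsilon> (t *\<^sub>R \<xi>) p) has_vector_derivative s *\<^sub>R (A ** p) + 2 *\<^sub>R (p ** X)) (at 0)"
      unfolding \<epsilon>_def sX(1)
      by (simp add: cay_0 mexp_0 matrix_mult.scaleR_left matrix_mult.scaleR_right add.commute)
    then have "s *\<^sub>R (A ** p) + 2 *\<^sub>R (p ** X) = 0" using vector_derivative_unique_at[OF _ 0] by blast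
    from infinitesimally_free[OF p sX(2) this] show False using \<xi>(2) unfolding sX(1) zero_prod_def by simp
  qed
  \<comment> \<open>Passage from radii to sequences with radius 1/(n+1). The predicate
    \<open>P\<close> carries along what is assumed of the group elements: nothing for
    \<open>closed\<close>, the negated conclusion for \<open>near\<close>.\<close>
  have seq: "\<exists>x y s k. (\<forall>n. x n \<in> Z \<and> k n \<in> K \<and> y n = E (s n) ** x n ** k n \<and> P (s n) (k n)) \<and> x \<longlonglongrightarrow> a \<and> y \<longlonglongrightarrow> b"
    if ex: "\<And>\<eta>. \<eta> > 0 \<Longrightarrow> \<exists>x s k. x \<in> Z \<inter> ball a \<eta> \<and> k \<in> K \<and> E s ** x ** k \<in> ball b \<eta> \<and> P s k" for a b P
  proof -
    have "\<forall>n. \<exists>x s k. x \<in> Z \<inter> ball a (inverse (real (Suc n))) \<and> k \<in> K \<and>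
        E s ** x ** k \<in> ball b (inverse (real (Suc n))) \<and> P s k"
      by (intro allI ex) simp
    then obtain x s k where *: "\<And>n. x n \<in> Z \<inter> ball a (inverse (real (Suc n))) \<and> k n \<in> K \<and>
        E (s n) ** x n ** k n \<in> ball b (inverse (real (Suc n))) \<and> P (s n) (k n)" by metis
    have lim: "u \<longlonglongrightarrow> c" if u: "\<And>n. u n \<in> ball c (inverse (real (Suc n)))" for u and c :: mat34
    proof (rule LIMSEQ_I)
      fix e :: real assume "e > 0"
      then obtain N where N: "inverse (real (Suc N)) < e" using reals_Archimedean by blast
      have "norm (u n - c) < e" if "n \<ge> Suc N" for n
      proof -
        have "norm (u n - c) < inverse (real (Suc n))"
          using u[of n] by (simp add: dist_norm norm_minus_commute)
        also have "\<dots> \<le> inverse (real (Suc N))" using that by (intro le_imp_inverse_le) auto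
        finally show ?thesis using N by simp
      qed
      then show "\<exists>N. \<forall>n\<ge>N. norm (u n - c) < e" by blast
    qed
    show ?thesis
      by (rule exI[of _ x], rule exI[of _ "\<lambda>n. E (s n) ** x n ** k n"], rule exI[of _ s], rule exI[of _ k])
        (use * in \<open>intro conjI lim; blast\<close>)
  qed
  show "\<exists>\<gamma>\<in>\<Gamma>. y = \<gamma> x"
    if "x \<in> Z" "y \<in> Z" and ex: "\<And>\<eta>. \<eta> > 0 \<Longrightarrow> \<exists>x'\<in>Z \<inter> ball x \<eta>. \<exists>\<gamma>\<in>\<Gamma>. \<gamma> x' \<in> ball y \<eta>" for x y
  proof -
    have "\<exists>x' s k. x' \<in> Z \<inter> ball x \<eta> \<and> k \<in> K \<and> E s ** x' ** k \<in> ball y \<eta> \<and> True" if "\<eta> > 0" for \<eta>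
      using ex[OF that] unfolding \<Gamma>_def by blast
    from seq[of x y "\<lambda>_ _. True", OF this] obtain x' y' s k where *: "\<And>n. x' n \<in> Z" "\<And>n. k n \<in> K"
      "\<And>n. y' n = E (s n) ** x' n ** k n" "x' \<longlonglongrightarrow> x" "y' \<longlonglongrightarrow> y" by blast
    from proper[OF *(4,5,1,2,3)] obtain s' k' where "k' \<in> K" "y = E s' ** x ** k'" by blast
    then show ?thesis by (intro bexI[OF _ \<Gamma>I])
  qed
  show "\<exists>\<eta>>0. \<forall>x\<in>Z \<inter> ball p \<eta>. \<forall>\<gamma>\<in>\<Gamma>. \<gamma> x \<in> ball p \<eta> \<longrightarrow>
      (\<exists>\<xi>\<in>(UNIV \<times> centralizer_algebra \<Q>) \<inter> \<Lambda>. norm \<xi> < \<delta> \<and> \<gamma> = \<epsilon> \<xi>)" if p: "p \<in> Z" and \<delta>: "\<delta> > 0" for p \<delta>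
  proof (rule ccontr)
    let ?P = "\<lambda>s k. \<not> (\<exists>\<xi>\<in>(UNIV \<times> centralizer_algebra \<Q>) \<inter> \<Lambda>. norm \<xi> < \<delta> \<and> (\<lambda>x. E s ** x ** k) = \<epsilon> \<xi>)"
    assume neg: "\<not> ?thesis"
    have "\<exists>x s k. x \<in> Z \<inter> ball p \<eta> \<and> k \<in> K \<and> E s ** x ** k \<in> ball p \<eta> \<and> ?P s k" if "\<eta> > 0" for \<eta>
      using neg that unfolding \<Gamma>_def by blast
    from seq[of p p ?P, OF this] obtain x y s k where *: "\<And>n. x n \<in> Z" "\<And>n. k n \<in> K"
      "\<And>n. y n = E (s n) ** x n ** k n" "x \<longlonglongrightarrow> p" "y \<longlonglongrightarrow> p" and P: "\<And>n. ?P (s n) (k n)" by blast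
    from proper[OF *(4,5,1,2,3)] obtain r s' k' where r: "(\<lambda>n. s (r n)) \<longlonglongrightarrow> s'" "(\<lambda>n. k (r n)) \<longlonglongrightarrow> k'"
      "k' \<in> K" "p = E s' ** p ** k'" by blast
    \<comment> \<open>The limit fixes \<open>p\<close>, so freeness makes it the identity. Along the
      subsequence the parameters \<open>(s, icay k)\<close> then tend to 0 and eventually are
      parameters of the kind assumed not to exist.\<close>
    have s0: "s' = 0" and k1: "k' = mat 1" using free[OF p r(3) r(4)[symmetric]] by auto
    have "(\<lambda>n. icay (k (r n))) \<longlonglongrightarrow> icay (mat 1)"
      using isCont_icay_1 r(2) unfolding k1 by (rule isCont_tendsto_compose)
    then have Xlim: "(\<lambda>n. (s (r n), icay (k (r n)))) \<longlonglongrightarrow> 0"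
      using tendsto_Pair[OF r(1)[unfolded s0]] unfolding icay_1 zero_prod_def by blast
    have "\<forall>\<^sub>F n in sequentially. norm (s (r n), icay (k (r n))) < \<delta>"
      using order_tendstoD(2)[OF tendsto_norm[OF Xlim]] \<delta> by simp
    moreover have "\<forall>\<^sub>F n in sequentially. k (r n) \<in> {k. invertible (mat 1 + k)}"
      using topological_tendstoD[OF r(2) icay_domain(1)] icay_domain(2) unfolding k1 by blast
    moreover have "\<forall>\<^sub>F n in sequentially. k (r n) \<in> ball (mat 1) \<delta>0"
      using topological_tendstoD[OF r(2) open_ball[of "mat 1" \<delta>0]] \<delta>0(1) unfolding k1 by simp
    ultimately have "\<forall>\<^sub>F n in sequentially. False"
    proof eventually_elim
      case (elim n)
      let ?k = "k (r n)"
      have i: "invertible (mat 1 + ?k)" using elim(2) by blast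
      note c = cay_inverse[OF i icay_def]
      have "?k \<in> K" by (rule *(2))
      then have k: "transpose ?k ** J34 ** ?k = J34" "\<And>Q. Q \<in> \<Q> \<Longrightarrow> Q ** ?k = ?k ** Q"
        using \<delta>0(2)[of ?k] elim(3) by (auto simp: dist_norm norm_minus_commute)
      have "icay ?k \<in> so34" by (rule cay_inverse_so34[OF i icay_def k(1)])
      moreover have "Q ** icay ?k = icay ?k ** Q" if Q: "Q \<in> \<Q>" for Q
      proof -
        have q: "Q ** (mat 1 + ?k) = (mat 1 + ?k) ** Q" "Q ** (?k - mat 1) = (?k - mat 1) ** Q"
          by (simp_all add: matrix_mult.diff_left matrix_mult.diff_right matrix_mult.add_left matrix_mult.add_right k(2)[OF Q])
        have "Q ** icay ?k = (Q ** matrix_inv (mat 1 + ?k)) ** (?k - mat 1)" unfolding icay_def by (simp only: matrix_mul_assoc)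
        also have "\<dots> = matrix_inv (mat 1 + ?k) ** (Q ** (?k - mat 1))"
          unfolding matrix_inv_commute[OF i q(1)] by (simp only: matrix_mul_assoc)
        also have "\<dots> = icay ?k ** Q" unfolding q(2) icay_def by (simp only: matrix_mul_assoc)
        finally show ?thesis .
      qed
      ultimately have "icay ?k \<in> centralizer_algebra \<Q>" unfolding centralizer_algebra_def by blast
      moreover have "(s (r n), icay ?k) \<in> \<Lambda>" unfolding \<Lambda>_def using c(1,2) elim(3) by simp
      moreover have "(\<lambda>x. E (s (r n)) ** x ** ?k) = \<epsilon> (s (r n), icay ?k)" unfolding \<epsilon>_def using c(2) by simp
      ultimately show False using P[of "r n"] elim(1) by blast
    qed
    then show False by simp
  qed
qed

text \<open>The summand 1 is the dimension of \<open>T\<close>; the condition says that the quotient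
  loses exactly the dimension of the acting group.\<close>

theorem reduced_manifold_exists:
  assumes cov: "\<And>p. p \<in> Z \<Longrightarrow> \<exists>N (\<kappa> :: mat34 \<Rightarrow> 'e::euclidean_space) W \<psi>. p \<in> N \<and> local_coords Z N \<kappa> W \<psi>"
    and dim: "dim (centralizer_algebra \<Q>) + 1 + DIM('f::euclidean_space) = DIM('e)"
  shows "\<exists>\<C> :: (mat34 set, 'f) chart set.
    reduced_manifold (one_parameter_group A) Z (coord_atlas Z :: (mat34, 'e) chart set) K \<C>"
proof -
  have "dim (UNIV \<times> centralizer_algebra \<Q> :: (real \<times> mat34) set) = 1 + dim (centralizer_algebra \<Q>)"
    using dim_Times[of "UNIV :: real set", OF subspace_UNIV subspace_centralizer] by simp
  then have d: "dim (UNIV \<times> centralizer_algebra \<Q> :: (real \<times> mat34) set) + DIM('f) = DIM('e)" using dim by simp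
  show ?thesis unfolding reduced_manifold_def using manifold[OF cov d] by blast
qed

end

section \<open>Rotation groups\<close>

text \<open>The Householder reflection in the hyperplane orthogonal to \<open>u\<close>; for
  \<open>u = 0\<close> the division yields 0 and the matrix is the identity.\<close>

definition refl :: "real^'n \<Rightarrow> real^'n^'n" where
  "refl u = mat 1 - (2 / (u \<bullet> u)) *\<^sub>R (\<chi> i j. u $ i * u $ j)"

lemma refl_mult_vec: "refl u *v x = x - (2 * (u \<bullet> x) / (u \<bullet> u)) *\<^sub>R u"
proof -
  have "(\<chi> i j. u $ i * u $ j) *v x = (u \<bullet> x) *\<^sub>R u"
    by (simp add: vec_eq_iff matrix_vector_mult_def inner_vec_def sum_distrib_left mult.commute mult.left_commute)
  then show ?thesis
    unfolding refl_def by (simp add: matrix_vector_mult_diff_rdistrib scaleR_matrix_vector_assoc[symmetric])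
qed

lemma refl_refl:
  assumes "u \<noteq> 0"
  shows "refl u ** refl u = mat 1" "orthogonal_matrix (refl u)"
proof -
  have "refl u *v (refl u *v x) = mat 1 *v x" for x
    using assms unfolding refl_mult_vec by (simp add: inner_diff_right)
  then show 1: "refl u ** refl u = mat 1"
    by (simp add: matrix_eq matrix_vector_mul_assoc)
  have "transpose (refl u) = refl u"
    by (simp add: refl_def transpose_diff transpose_scalar) (simp add: transpose_def mult.commute)
  then show "orthogonal_matrix (refl u)" using 1 by (simp add: orthogonal_matrix)
qed

lemma continuous_on_refl: "continuous_on (- {0}) (refl :: real^'n \<Rightarrow> real^'n^'n)"
proof -
  have "continuous_on (- {0}) (\<lambda>u :: real^'n. mat 1 - (2 / (u \<bullet> u)) *\<^sub>R (\<chi> i j. u $ i * u $ j))"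
    by (intro continuous_intros continuous_on_vec_lambda) auto
  then show ?thesis by (rule continuous_on_eq) (simp add: refl_def)
qed

abbreviation orthogonal_component :: "(real^'n^'n) set" where
  "orthogonal_component \<equiv> connected_component_set {g. orthogonal_matrix g} (mat 1)"

lemma orthogonal_component_orthogonal: "g \<in> orthogonal_component \<Longrightarrow> orthogonal_matrix g"
  using connected_component_in by blast

lemma one_orthogonal_component: "mat 1 \<in> orthogonal_component"
  using connected_component_refl[of "mat 1" "{g. orthogonal_matrix g}"] orthogonal_matrix_id by simp

lemma orthogonal_component_mult:
  assumes "g \<in> orthogonal_component" "h \<in> orthogonal_component"
  shows "g ** h \<in> orthogonal_component"
proof -
  let ?C = "(\<lambda>h. g ** h) ` orthogonal_component"
  have g: "orthogonal_matrix g" using assms(1) connected_component_in by blast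
  have "connected ?C"
    by (intro connected_continuous_image connected_connected_component matrix_mult.continuous_on
        continuous_on_const continuous_on_id)
  moreover have "?C \<subseteq> {g. orthogonal_matrix g}"
    using g connected_component_in orthogonal_matrix_mul by blast
  moreover have "g \<in> ?C"
    using connected_component_refl[of "mat 1" "{g. orthogonal_matrix g}"] orthogonal_matrix_id
    by (intro image_eqI[of _ _ "mat 1"]) auto
  ultimately have "?C \<subseteq> connected_component_set {g. orthogonal_matrix g} g"
    by (intro connected_component_maximal)
  then have "?C \<subseteq> orthogonal_component" unfolding connected_component_eq[OF assms(1)] .
  then show ?thesis using assms(2) by blast
qed

text \<open>Deform the second vector to \<open>u\<close> within the punctured space, which is
  connected in dimension at least 2; there the product becomes 1.\<close>

lemma refl_pair_component:
  assumes "CARD('n) \<ge> 2" "u \<noteq> 0" "v \<noteq> (0 :: real^'n)"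
  shows "refl u ** refl v \<in> orthogonal_component"
proof -
  let ?C = "(\<lambda>w. refl u ** refl w) ` (- {0})"
  have "connected (- {0 :: real^'n})" by (intro connected_punctured_universe) (use assms(1) in simp)
  then have "connected ?C"
    by (intro connected_continuous_image matrix_mult.continuous_on continuous_on_const continuous_on_refl)
  moreover have "?C \<subseteq> {g. orthogonal_matrix g}"
    using refl_refl(2) assms(2) orthogonal_matrix_mul by blast
  moreover have "mat 1 \<in> ?C" using refl_refl(1)[OF assms(2)] assms(2) by (intro image_eqI[of _ _ u]) auto
  ultimately have "?C \<subseteq> orthogonal_component" by (intro connected_component_maximal)
  then show ?thesis using assms(3) by blast
qed

lemma connected_det_1:
  fixes C :: "(real^'n^'n) set"
  assumes "connected C" "x \<in> C" "det x = 1" "\<And>g. g \<in> C \<Longrightarrow> det g = 1 \<or> det g = - 1" "g \<in> C"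
  shows "det g = 1"
proof (rule ccontr)
  assume "det g \<noteq> 1"
  then have g: "det g = - 1" using assms(4,5) by blast
  have "connected (det ` C)" by (rule connected_continuous_image[OF continuous_on_det assms(1)])
  then have "0 \<in> det ` C"
    using assms(2,3,5) g unfolding connected_iff_interval by (metis imageI le_minus_one_simps(1) zero_le_one)
  then show False using assms(4) by force
qed

text \<open>Multiplication by suitable pairs of reflections increases the set of fixed coordinate
  axes while staying in the component of 1. The induction is on the number of axis vectors that are
  moved.\<close>

lemma orthogonal_component_eq:
  fixes g :: "real^'n^'n"
  assumes n: "CARD('n) \<ge> 2" and g: "orthogonal_matrix g" "det g = 1"
  shows "g \<in> orthogonal_component"
  using g
proof (induction "card {i. g *v axis i 1 \<noteq> axis i 1}" arbitrary: g rule: less_induct)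
  case less
  let ?F = "{i. g *v axis i 1 \<noteq> axis i 1}"
  have one: "mat 1 \<in> (orthogonal_component :: (real^'n^'n) set)" by (rule one_orthogonal_component)
  have gab: "(g *v axis b 1) $ a = g $ a $ b" for a b
    unfolding matrix_vector_mult_basis by (simp add: column_def)
  have inner: "(g *v x) \<bullet> (g *v y) = x \<bullet> y" for x y
    using less.prems(1) unfolding orthogonal_matrix inner_matrix_vec' by (simp add: matrix_vector_mul_assoc)
  consider "?F = {}" | j where "?F = {j}" | j l where "j \<in> ?F" "l \<in> ?F" "j \<noteq> l" by blast
  then show ?case
  proof cases
    case 1
    have "g $ a $ b = mat 1 $ a $ b" for a b
    proof -
      have "g *v axis b 1 = axis b 1" using 1 by blast
      then have "column b g $ a = axis b 1 $ a" by (simp add: matrix_vector_mult_basis)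
      then show ?thesis by (simp add: column_def mat_def axis_def)
    qed
    then have "g = mat 1" by (simp add: vec_eq_iff)
    then show ?thesis using one by simp
  next
    case (2 j)
    \<comment> \<open>A single moved axis cannot occur: orthogonality makes \<open>g\<close>
      diagonal with all other entries 1, and the determinant forces the last entry to be 1.\<close>
    have col: "g $ a $ b = mat 1 $ a $ b" if "b \<noteq> j" for a b
    proof -
      have "g *v axis b 1 = axis b 1" using 2 that by blast
      then have "column b g $ a = axis b 1 $ a" by (simp add: matrix_vector_mult_basis)
      then show ?thesis by (simp add: column_def mat_def axis_def)
    qed
    have jj: "g $ a $ j = 0" if "a \<noteq> j" for a
    proof -
      have ga: "g *v axis a 1 = axis a 1" using 2 that by blast
      have "axis a 1 \<bullet> (g *v axis j 1) = axis a 1 \<bullet> axis j (1 :: real)"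
        using inner[of "axis a 1" "axis j 1"] unfolding ga .
      then show ?thesis unfolding inner_axis' gab using that by (simp add: axis_def)
    qed
    have "det g = (\<Prod>i\<in>UNIV. g $ i $ i)"
    proof (rule det_diagonal)
      show "g $ a $ b = 0" if "a \<noteq> b" for a b
        using col[of b a] jj[of a] that by (cases "b = j") (auto simp: mat_def)
    qed
    also have "\<dots> = g $ j $ j" using col by (subst prod.remove[of UNIV j]) (simp_all add: mat_def)
    finally have "g $ j $ j = 1" using less.prems(2) by simp
    then have "g *v axis j 1 = axis j 1"
      unfolding vec_eq_iff gab using jj by (simp add: axis_def)
    then show ?thesis using 2 by blast
  next
    case (3 j l)
    define u where "u = g *v axis j 1 - axis j (1 :: real)"
    \<comment> \<open>The reflection in \<open>u\<close> returns the image of axis \<open>j\<close>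
      to its place. The reflection in another moved axis \<open>l\<close> makes the factor a pair
      and disturbs neither axis \<open>j\<close> nor the axes already fixed.\<close>
    define h where "h = refl (axis l 1) ** refl u"
    have u: "u \<noteq> 0" using 3(1) unfolding u_def by simp
    have h: "h \<in> orthogonal_component"
      unfolding h_def by (rule refl_pair_component[OF n _ u]) (simp add: axis_eq_0_iff)
    have ho: "orthogonal_matrix h" by (rule orthogonal_component_orthogonal[OF h])
    have "det h = 1"
      by (rule connected_det_1[OF connected_connected_component one det_I _ h])
        (rule det_orthogonal_matrix[OF orthogonal_component_orthogonal])
    then have hg: "orthogonal_matrix (h ** g)" "det (h ** g) = 1"
      using ho less.prems by (simp_all add: orthogonal_matrix_mul det_mul)
    have uu: "u \<bullet> u = - 2 * (u \<bullet> axis j 1)"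
      using inner[of "axis j 1" "axis j 1"] unfolding u_def
      by (simp add: inner_diff_left inner_diff_right inner_commute inner_axis_axis)
    have "refl u *v (g *v axis j 1) = axis j 1"
    proof -
      have "u \<bullet> (g *v axis j 1) = u \<bullet> u + u \<bullet> axis j 1" unfolding u_def by (simp add: inner_diff_right)
      then have "2 * (u \<bullet> (g *v axis j 1)) = u \<bullet> u" using uu by simp
      moreover have "u \<bullet> u \<noteq> 0" using u by simp
      ultimately have "2 * (u \<bullet> (g *v axis j 1)) / (u \<bullet> u) = 1" by simp
      then have "refl u *v (g *v axis j 1) = g *v axis j 1 - 1 *\<^sub>R u" unfolding refl_mult_vec by (simp only:)
      then show ?thesis unfolding u_def by simp
    qed
    then have fj: "(h ** g) *v axis j 1 = axis j 1"
      unfolding h_def using 3(3) by (simp add: matrix_vector_mul_assoc[symmetric] refl_mult_vec inner_axis_axis)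
    have fi: "(h ** g) *v axis i 1 = axis i 1" if i: "g *v axis i 1 = axis i 1" for i
    proof -
      have ij: "i \<noteq> j" "i \<noteq> l" using i 3(1,2) by auto
      have "u \<bullet> axis i 1 = 0"
        unfolding u_def using inner[of "axis j 1" "axis i 1"] i ij by (simp add: inner_diff_left inner_axis_axis)
      then show ?thesis
        unfolding h_def using i ij by (simp add: matrix_vector_mul_assoc[symmetric] refl_mult_vec inner_axis_axis)
    qed
    have "{i. (h ** g) *v axis i 1 \<noteq> axis i 1} \<subset> ?F" using fj fi 3(1) by blast
    then have "h ** g \<in> orthogonal_component" using less.hyps[OF psubset_card_mono] hg by simp
    moreover have "h ** h' = mat 1 \<Longrightarrow> h' ** h = mat 1" for h' by (simp add: matrix_left_right_inverse)
    moreover have "refl u ** refl (axis l 1) \<in> orthogonal_component"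
      by (rule refl_pair_component[OF n u]) (simp add: axis_eq_0_iff)
    moreover have "(refl u ** refl (axis l 1)) ** (h ** g) = g"
    proof -
      have "(refl u ** refl (axis l 1)) ** (h ** g) = refl u ** (refl (axis l 1) ** refl (axis l 1)) ** refl u ** g"
        unfolding h_def by (simp only: matrix_mul_assoc)
      moreover have "refl (axis l (1 :: real)) ** refl (axis l 1) = mat 1"
        by (rule refl_refl(1)) (simp add: axis_eq_0_iff)
      ultimately show ?thesis using refl_refl(1)[OF u] by simp
    qed
    ultimately show ?thesis using orthogonal_component_mult by metis
  qed
qed

lemma connected_special_orthogonal:
  assumes "CARD('n) \<ge> 2"
  shows "connected (special_orthogonal :: (real^'n^'n) set)"
proof -
  have "special_orthogonal = (orthogonal_component :: (real^'n^'n) set)"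
  proof
    show "special_orthogonal \<subseteq> (orthogonal_component :: (real^'n^'n) set)"
      using orthogonal_component_eq[OF assms] unfolding special_orthogonal_def rotation_matrix_def by blast
    show "(orthogonal_component :: (real^'n^'n) set) \<subseteq> special_orthogonal"
    proof
      fix g :: "real^'n^'n" assume g: "g \<in> orthogonal_component"
      have "det g = 1"
        by (rule connected_det_1[OF connected_connected_component one_orthogonal_component det_I _ g])
          (rule det_orthogonal_matrix[OF orthogonal_component_orthogonal])
      then show "g \<in> special_orthogonal"
        using orthogonal_component_orthogonal[OF g] unfolding special_orthogonal_def rotation_matrix_def by blast
    qed
  qed
  then show ?thesis by (metis connected_connected_component)
qed

lemma special_orthogonal_iff: "g \<in> special_orthogonal \<longleftrightarrow> transpose g ** g = mat 1 \<and> det g = 1"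
  unfolding special_orthogonal_def rotation_matrix_def orthogonal_matrix by simp

lemma compact_special_orthogonal: "compact (special_orthogonal :: (real^'n^'n) set)"
proof -
  have "norm g \<le> (\<Sum>i\<in>(UNIV :: 'n set). 1)" if "g \<in> special_orthogonal" for g :: "real^'n^'n"
  proof -
    have "orthogonal_matrix g" using that unfolding special_orthogonal_def rotation_matrix_def by simp
    then have "norm (g $ i) = 1" for i
      unfolding orthogonal_matrix_orthonormal_rows row_def by (simp add: vec_nth_inverse)
    then show ?thesis
      unfolding norm_vec_def[of g] using L2_set_le_sum[of UNIV "\<lambda>i. norm (g $ i)"] by simp
  qed
  then have "bounded (special_orthogonal :: (real^'n^'n) set)" unfolding bounded_iff by blast
  moreover have "closed (special_orthogonal :: (real^'n^'n) set)"
  proof -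
    have e: "(special_orthogonal :: (real^'n^'n) set) = {g. transpose g ** g = mat 1} \<inter> {g. det g = 1}"
      using special_orthogonal_iff by blast
    moreover have "closed {g :: real^'n^'n. transpose g ** g = mat 1}"
      by (intro closed_Collect_eq matrix_mult.continuous_on continuous_on_const continuous_on_id
          linear_continuous_on bounded_linear_transpose)
    moreover have "closed {g :: real^'n^'n. det g = 1}"
      by (intro closed_Collect_eq continuous_on_det continuous_on_const)
    ultimately show ?thesis unfolding e by (intro closed_Int)
  qed
  ultimately show ?thesis by (simp add: compact_eq_bounded_closed)
qed

lemma special_orthogonal_mult:
  "a \<in> special_orthogonal \<Longrightarrow> b \<in> special_orthogonal \<Longrightarrow> a ** b \<in> special_orthogonal"
  unfolding special_orthogonal_def rotation_matrix_def by (simp add: orthogonal_matrix_mul det_mul)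

section \<open>Block diagonal matrices\<close>

lemma block_diag_nth [simp]:
  "block_diag a b $ Inl i $ Inl i' = a $ i $ i'" "block_diag a b $ Inl i $ Inr j = 0"
  "block_diag a b $ Inr j $ Inl i = 0" "block_diag a b $ Inr j $ Inr j' = b $ j $ j'"
  unfolding block_diag_def by simp_all

lemma mat34_eq_iff:
  "(x :: mat34) = y \<longleftrightarrow> (\<forall>i i'. x $ Inl i $ Inl i' = y $ Inl i $ Inl i') \<and> (\<forall>i j. x $ Inl i $ Inr j = y $ Inl i $ Inr j)
    \<and> (\<forall>j i. x $ Inr j $ Inl i = y $ Inr j $ Inl i) \<and> (\<forall>j j'. x $ Inr j $ Inr j' = y $ Inr j $ Inr j')"
  unfolding vec_eq_iff by (metis sum.exhaust)

lemma mat34_mult_nth: "((x :: mat34) ** y) $ r $ s =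
   (\<Sum>i\<in>UNIV. x $ r $ Inl i * y $ Inl i $ s) + (\<Sum>j\<in>UNIV. x $ r $ Inr j * y $ Inr j $ s)"
  unfolding matrix_matrix_mult_def by (simp add: sum_UNIV_sum)

lemma block_diag_simps:
  "block_diag a b ** block_diag a' b' = block_diag (a ** a') (b ** b')"
  "transpose (block_diag a b) = block_diag (transpose a) (transpose b)"
  "block_diag (mat 1) (mat 1) = mat 1" "J34 = block_diag (mat 1) (- mat 1)"
  "block_diag a b = block_diag a' b' \<longleftrightarrow> a = a' \<and> b = b'"
  "block_diag a b + block_diag a' b' = block_diag (a + a') (b + b')"
  "block_diag 0 0 = 0" "c *\<^sub>R block_diag a b = block_diag (c *\<^sub>R a) (c *\<^sub>R b)"
  "block_diag a b = 0 \<longleftrightarrow> a = 0 \<and> b = 0"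
proof -
  show "block_diag a b ** block_diag a' b' = block_diag (a ** a') (b ** b')"
    by (simp add: mat34_eq_iff mat34_mult_nth) (simp add: matrix_matrix_mult_def)
qed (auto simp: mat34_eq_iff transpose_def mat_def J34_def vec_eq_iff)

definition upper :: "mat34 \<Rightarrow> real^3^3" where "upper k = (\<chi> i j. k $ Inl i $ Inl j)"
definition lower :: "mat34 \<Rightarrow> real^4^4" where "lower k = (\<chi> i j. k $ Inr i $ Inr j)"

lemma upper_lower_block [simp]: "upper (block_diag a b) = a" "lower (block_diag a b) = b"
  unfolding upper_def lower_def by (simp_all add: vec_eq_iff)

lemma linear_upper: "linear upper" and linear_lower: "linear lower"
  by (auto intro!: linearI simp: upper_def lower_def vec_eq_iff)

lemma commute_J34_iff: "J34 ** k = k ** J34 \<longleftrightarrow> k = block_diag (upper k) (lower k)"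
proof
  assume c: "J34 ** k = k ** J34"
  have "(J34 ** k) $ Inl i $ Inr j = k $ Inl i $ Inr j" "(k ** J34) $ Inl i $ Inr j = - (k $ Inl i $ Inr j)"
    "(J34 ** k) $ Inr j $ Inl i = - (k $ Inr j $ Inl i)" "(k ** J34) $ Inr j $ Inl i = k $ Inr j $ Inl i" for i j
    unfolding mat34_mult_nth by (simp_all add: J34_def if_distrib[of "\<lambda>c. c * _"] if_distrib[of "\<lambda>c. _ * c"] cong: if_cong)
  then have "k $ Inl i $ Inr j = 0" "k $ Inr j $ Inl i = 0" for i j using c by (metis equal_neg_zero neg_equal_zero)+
  then show "k = block_diag (upper k) (lower k)" by (simp add: mat34_eq_iff upper_def lower_def)
next
  assume "k = block_diag (upper k) (lower k)"
  then obtain a b where "k = block_diag a b" by blast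
  then show "J34 ** k = k ** J34"
    by (simp add: block_diag_simps matrix_mult.minus_left matrix_mult.minus_right)
qed

lemma preserving_block_diag:
  "transpose (block_diag a b) ** J34 ** block_diag a b = J34 \<longleftrightarrow> transpose a ** a = mat 1 \<and> transpose b ** b = mat 1"
  by (simp add: block_diag_simps matrix_mult.minus_left matrix_mult.minus_right)

lemma continuous_on_block_diag: "continuous_on S (\<lambda>(a, b). block_diag a b)"
proof -
  have "linear (\<lambda>(a, b). block_diag a b)" by (rule linearI) (auto simp: block_diag_simps)
  then show ?thesis by (simp add: linear_continuous_on linear_conv_bounded_linear)
qed

text \<open>The common shape of the three nontrivial groups: no condition gives \<open>H\<close>,
  \<open>sp1_plus\<close> gives \<open>H'\<close>, and a single unit imaginary quaternion gives
  \<open>H'\<close> times a circle.\<close>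

definition block_centralizer :: "(real^4^4) set \<Rightarrow> mat34 set" where
  "block_centralizer \<Y> = {block_diag a b | a b. a \<in> special_orthogonal \<and> b \<in> special_orthogonal \<and> (\<forall>Y\<in>\<Y>. Y ** b = b ** Y)}"

lemma block_centralizerI:
  "a \<in> special_orthogonal \<Longrightarrow> b \<in> special_orthogonal \<Longrightarrow> (\<And>Y. Y \<in> \<Y> \<Longrightarrow> Y ** b = b ** Y) \<Longrightarrow>
    block_diag a b \<in> block_centralizer \<Y>"
  unfolding block_centralizer_def by blast

lemma one_special_orthogonal: "mat 1 \<in> special_orthogonal"
  by (simp add: special_orthogonal_iff)

text \<open>Commuting with \<open>J34\<close> encodes block diagonality, so membership in a block
  centralizer is, near 1, a centralizer condition in the isometry group.\<close>

definition block_commutant :: "(real^4^4) set \<Rightarrow> mat34 set" where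
  "block_commutant \<Y> = insert J34 (block_diag 0 ` \<Y>)"

lemma block_commutant_iff:
  "(\<forall>Q\<in>block_commutant \<Y>. Q ** k = k ** Q) \<longleftrightarrow>
    k = block_diag (upper k) (lower k) \<and> (\<forall>Y\<in>\<Y>. Y ** lower k = lower k ** Y)"
proof -
  have *: "block_diag 0 Y ** block_diag a b = block_diag a b ** block_diag 0 Y \<longleftrightarrow> Y ** b = b ** Y" for Y a b
    by (simp add: block_diag_simps)
  have "block_diag 0 Y ** k = k ** block_diag 0 Y \<longleftrightarrow> Y ** lower k = lower k ** Y"
    if "k = block_diag (upper k) (lower k)" for Y
    using *[of Y "upper k" "lower k"] that by simp
  then show ?thesis
    unfolding block_commutant_def ball_simps commute_J34_iff by (intro conj_cong refl ball_cong)
qed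

lemma compact_block_centralizer: "compact_matrix_group (block_centralizer \<Y>) (block_commutant \<Y>)"
proof
  have "compact (special_orthogonal \<inter> {b. \<forall>Y\<in>\<Y>. Y ** b = b ** Y})"
  proof (rule compact_Int_closed[OF compact_special_orthogonal])
    have "{b. \<forall>Y\<in>\<Y>. Y ** b = b ** Y} = (\<Inter>Y\<in>\<Y>. {b. Y ** b = b ** Y})" by blast
    moreover have "closed {b. Y ** b = b ** Y}" for Y :: "real^4^4"
      by (intro closed_Collect_eq matrix_mult.continuous_on continuous_on_const continuous_on_id)
    ultimately show "closed {b. \<forall>Y\<in>\<Y>. Y ** b = b ** Y}" by auto
  qed
  then have "compact ((\<lambda>(a, b). block_diag a b) `
      (special_orthogonal \<times> (special_orthogonal \<inter> {b. \<forall>Y\<in>\<Y>. Y ** b = b ** Y})))"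
    by (intro compact_continuous_image continuous_on_block_diag compact_Times compact_special_orthogonal)
  moreover have "(\<lambda>(a, b). block_diag a b) ` (special_orthogonal \<times> (special_orthogonal \<inter> {b. \<forall>Y\<in>\<Y>. Y ** b = b ** Y}))
      = block_centralizer \<Y>"
    unfolding block_centralizer_def by auto
  ultimately show "compact (block_centralizer \<Y>)" by simp
  show "mat 1 \<in> block_centralizer \<Y>"
    unfolding block_diag_simps(3)[symmetric] by (intro block_centralizerI one_special_orthogonal) simp
  show "k ** l \<in> block_centralizer \<Y>" if kl: "k \<in> block_centralizer \<Y>" "l \<in> block_centralizer \<Y>" for k l
  proof -
    obtain a b c d where *: "k = block_diag a b" "l = block_diag c d" "a \<in> special_orthogonal" "b \<in> special_orthogonal"
      "c \<in> special_orthogonal" "d \<in> special_orthogonal" "\<And>Y. Y \<in> \<Y> \<Longrightarrow> Y ** b = b ** Y" "\<And>Y. Y \<in> \<Y> \<Longrightarrow> Y ** d = d ** Y"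
      using kl unfolding block_centralizer_def by blast
    have "Y ** (b ** d) = (b ** d) ** Y" if "Y \<in> \<Y>" for Y
      using *(7,8)[OF that] by (metis matrix_mul_assoc)
    then show ?thesis
      unfolding *(1,2) block_diag_simps(1) block_centralizer_def
      using special_orthogonal_mult[OF *(3,5)] special_orthogonal_mult[OF *(4,6)] by blast
  qed
  show "matrix_inv k \<in> block_centralizer \<Y>" if k: "k \<in> block_centralizer \<Y>" for k
  proof -
    obtain a b where *: "k = block_diag a b" "a \<in> special_orthogonal" "b \<in> special_orthogonal" "\<And>Y. Y \<in> \<Y> \<Longrightarrow> Y ** b = b ** Y"
      using k unfolding block_centralizer_def by blast
    have o: "transpose a ** a = mat 1" "transpose b ** b = mat 1" "a ** transpose a = mat 1" "b ** transpose b = mat 1"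
      using *(2,3) unfolding special_orthogonal_iff by (simp_all add: matrix_left_right_inverse)
    have "matrix_inv k = block_diag (transpose a) (transpose b)"
      unfolding *(1) by (rule matrix_inv_unique) (simp_all add: block_diag_simps o)
    moreover have "Y ** transpose b = transpose b ** Y" if "Y \<in> \<Y>" for Y
    proof -
      have "transpose b ** (Y ** b) ** transpose b = transpose b ** (b ** Y) ** transpose b" using *(4)[OF that] by simp
      then have "transpose b ** Y ** (b ** transpose b) = (transpose b ** b) ** Y ** transpose b"
        by (simp only: matrix_mul_assoc)
      then show ?thesis unfolding o by simp
    qed
    moreover have "transpose a \<in> special_orthogonal" "transpose b \<in> special_orthogonal"
      using *(2,3) o by (simp_all add: special_orthogonal_iff det_transpose)
    ultimately show ?thesis by (simp add: block_centralizerI)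
  qed
  show "transpose k ** J34 ** k = J34" if "k \<in> block_centralizer \<Y>" for k
    using that unfolding block_centralizer_def by (auto simp: preserving_block_diag special_orthogonal_iff)
  show "J34 \<in> block_commutant \<Y>" unfolding block_commutant_def by simp
  \<comment> \<open>Near 1 the determinants of the blocks stay positive, which distinguishes
    rotations from other orthogonal matrices.\<close>
  let ?O = "{k \<in> UNIV. det (upper k) \<in> {0<..}} \<inter> {k \<in> UNIV. det (lower k) \<in> {0<..}}"
  have "open ?O"
  proof (intro open_Int open_preimage_Collect open_UNIV open_greaterThan)
    show "continuous_on UNIV (\<lambda>k. det (upper k))" "continuous_on UNIV (\<lambda>k. det (lower k))"
      by (intro continuous_on_compose2[OF continuous_on_det[of UNIV]] linear_continuous_on
          linear_upper linear_lower linear_conv_bounded_linear[THEN iffD1]; simp)+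
  qed
  moreover have "mat 1 \<in> ?O" unfolding block_diag_simps(3)[symmetric] by simp
  ultimately obtain \<delta> where \<delta>: "\<delta> > 0" "ball (mat 1) \<delta> \<subseteq> ?O" by (meson open_contains_ball)
  have "k \<in> block_centralizer \<Y> \<longleftrightarrow> transpose k ** J34 ** k = J34 \<and> (\<forall>Q\<in>block_commutant \<Y>. Q ** k = k ** Q)"
    if "norm (k - mat 1) < \<delta>" for k
  proof -
    have "k \<in> ?O" using that \<delta>(2) by (auto simp: dist_norm norm_minus_commute)
    then have d: "det (upper k) > 0" "det (lower k) > 0" by auto
    have so: "a \<in> special_orthogonal" if "transpose a ** a = mat 1" "det a > 0" for a :: "real^'m^'m"
      using that det_orthogonal_matrix[of a] unfolding special_orthogonal_iff orthogonal_matrix by auto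
    show ?thesis
    proof
      assume "k \<in> block_centralizer \<Y>"
      then show "transpose k ** J34 ** k = J34 \<and> (\<forall>Q\<in>block_commutant \<Y>. Q ** k = k ** Q)"
        unfolding block_commutant_iff unfolding block_centralizer_def
        by (auto simp: preserving_block_diag special_orthogonal_iff)
    next
      assume R: "transpose k ** J34 ** k = J34 \<and> (\<forall>Q\<in>block_commutant \<Y>. Q ** k = k ** Q)"
      then have e: "k = block_diag (upper k) (lower k)" and c: "\<forall>Y\<in>\<Y>. Y ** lower k = lower k ** Y"
        unfolding block_commutant_iff by auto
      have "transpose (upper k) ** upper k = mat 1" "transpose (lower k) ** lower k = mat 1"
        using R preserving_block_diag[of "upper k" "lower k"] e by auto
      then have "block_diag (upper k) (lower k) \<in> block_centralizer \<Y>"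
        using c by (intro block_centralizerI so d) blast+
      then show "k \<in> block_centralizer \<Y>" using e by simp
    qed
  qed
  then show "\<exists>\<delta>>0. \<forall>k. norm (k - mat 1) < \<delta> \<longrightarrow> (k \<in> block_centralizer \<Y> \<longleftrightarrow>
      transpose k ** J34 ** k = J34 \<and> (\<forall>Q\<in>block_commutant \<Y>. Q ** k = k ** Q))"
    using \<delta>(1) by blast
qed

lemma so34_block_diag: "block_diag a b \<in> so34 \<longleftrightarrow> transpose a = - a \<and> transpose b = - b"
proof -
  have "- x = b \<longleftrightarrow> x + b = 0" for x by (metis add_eq_0_iff2 minus_minus)
  then show ?thesis
    unfolding so34_iff
    by (simp add: block_diag_simps matrix_mult.minus_left matrix_mult.minus_right eq_neg_iff_add_eq_0)
qed

lemma dim_block_centralizer_algebra: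
  "dim (centralizer_algebra (block_commutant \<Y>)) =
    dim {a :: real^3^3. transpose a = - a} + dim {b :: real^4^4. transpose b = - b \<and> (\<forall>Y\<in>\<Y>. Y ** b = b ** Y)}"
proof -
  let ?A = "{a :: real^3^3. transpose a = - a}" and ?B = "{b :: real^4^4. transpose b = - b \<and> (\<forall>Y\<in>\<Y>. Y ** b = b ** Y)}"
  let ?f = "\<lambda>(a, b). block_diag a b"
  have lin: "linear ?f" by (rule linearI) (auto simp: block_diag_simps)
  have A: "subspace ?A" unfolding subspace_def by (auto simp: transpose_add transpose_scalar linear_0[OF linear_transpose])
  have B: "subspace ?B" unfolding subspace_def
    by (auto simp: transpose_add transpose_scalar linear_0[OF linear_transpose] matrix_mult.add_left matrix_mult.add_right
        matrix_mult.scaleR_left matrix_mult.scaleR_right)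
  have "centralizer_algebra (block_commutant \<Y>) = ?f ` (?A \<times> ?B)"
  proof (intro set_eqI iffI)
    fix X assume X: "X \<in> centralizer_algebra (block_commutant \<Y>)"
    then have e: "X = block_diag (upper X) (lower X)" "\<forall>Y\<in>\<Y>. Y ** lower X = lower X ** Y" "X \<in> so34"
      unfolding centralizer_algebra_def using block_commutant_iff by auto
    then have "transpose (upper X) = - upper X \<and> transpose (lower X) = - lower X" using so34_block_diag by metis
    then show "X \<in> ?f ` (?A \<times> ?B)" using e(1,2) by (intro image_eqI[of _ _ "(upper X, lower X)"]) auto
  next
    fix X assume "X \<in> ?f ` (?A \<times> ?B)"
    then show "X \<in> centralizer_algebra (block_commutant \<Y>)"
      unfolding centralizer_algebra_def using so34_block_diag by (auto simp: block_commutant_iff)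
  qed
  moreover have "dim (?f ` (?A \<times> ?B)) = dim (?A \<times> ?B)"
    by (rule dim_image_eq[OF lin]) (auto simp: inj_on_def block_diag_simps)
  ultimately show ?thesis using dim_Times[OF A B] by simp
qed

section \<open>The identity component\<close>

lemma SO34_iff: "g \<in> SO34 \<longleftrightarrow> transpose g ** J34 ** g = J34 \<and> det g = 1"
  unfolding SO34_def form34_matrix_iff by simp

lemma SO0_34_preserves: "g \<in> SO0_34 \<Longrightarrow> transpose g ** J34 ** g = J34"
  using connected_component_in SO34_iff unfolding SO0_34_def by blast

lemma one_SO0_34: "mat 1 \<in> SO0_34"
  unfolding SO0_34_def using connected_component_refl[of "mat 1" SO34] by (simp add: SO34_iff)

lemma preserving_det:
  assumes "transpose g ** J34 ** g = J34"
  shows "det g = 1 \<or> det g = - 1"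
proof -
  have "det J34 * det J34 = 1" using det_mul[of J34 J34] by simp
  then have "det J34 \<noteq> 0" by auto
  moreover have "det g * det J34 * det g = det J34" using assms by (metis det_mul det_transpose)
  ultimately have "det g * det g = 1" by (simp add: mult.commute mult.left_commute)
  then show ?thesis by (simp add: square_eq_1_iff)
qed

lemma connected_subset_SO0_34:
  assumes C: "connected C" "x \<in> C" "x \<in> SO0_34" and pres: "\<And>g. g \<in> C \<Longrightarrow> transpose g ** J34 ** g = J34"
  shows "C \<subseteq> SO0_34"
proof -
  have "x \<in> SO34" using C(3) connected_component_in unfolding SO0_34_def by blast
  then have "det x = 1" by (simp add: SO34_iff)
  then have "C \<subseteq> SO34"
    using connected_det_1[OF C(1,2) _ preserving_det[OF pres]] pres by (auto simp: SO34_iff)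
  then have "C \<subseteq> connected_component_set SO34 x" by (rule connected_component_maximal[OF C(2,1)])
  then show ?thesis using C(3) connected_component_eq unfolding SO0_34_def by blast
qed

lemma preserving_mult:
  "transpose g ** J34 ** g = J34 \<Longrightarrow> transpose h ** J34 ** h = J34 \<Longrightarrow> transpose (g ** h) ** J34 ** (g ** h) = J34"
proof -
  assume g: "transpose g ** J34 ** g = J34" and h: "transpose h ** J34 ** h = J34"
  have "transpose (g ** h) ** J34 ** (g ** h) = transpose h ** (transpose g ** J34 ** g) ** h"
    by (simp only: matrix_transpose_mul matrix_mul_assoc)
  then show "transpose (g ** h) ** J34 ** (g ** h) = J34" unfolding g h .
qed

lemma SO0_34_mult:
  assumes "g \<in> SO0_34" "h \<in> SO0_34"
  shows "g ** h \<in> SO0_34"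
proof -
  have "(\<lambda>h. g ** h) ` SO0_34 \<subseteq> SO0_34"
  proof (rule connected_subset_SO0_34)
    show "connected ((\<lambda>h. g ** h) ` SO0_34)"
      unfolding SO0_34_def by (intro connected_continuous_image connected_connected_component
          matrix_mult.continuous_on continuous_on_const continuous_on_id)
    show "g \<in> (\<lambda>h. g ** h) ` SO0_34" using one_SO0_34 by (intro image_eqI[of _ _ "mat 1"]) auto
  qed (use assms SO0_34_preserves preserving_mult in auto)
  then show ?thesis using assms(2) by blast
qed

lemma mexp_SO0_34:
  assumes "A \<in> so34"
  shows "mexp (t *\<^sub>R A) \<in> SO0_34"
proof -
  have "range (\<lambda>t. mexp (t *\<^sub>R A)) \<subseteq> SO0_34"
  proof (rule connected_subset_SO0_34[OF _ _ one_SO0_34])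
    show "connected (range (\<lambda>t. mexp (t *\<^sub>R A)))"
      by (intro connected_continuous_image continuous_on_mexp connected_UNIV)
    show "mat 1 \<in> range (\<lambda>t. mexp (t *\<^sub>R A))" by (rule range_eqI[of _ _ 0]) (simp add: mexp_0)
  qed (use mexp_preserves_form[OF assms] in auto)
  then show ?thesis by blast
qed

lemma H_SO0_34: "H \<subseteq> SO0_34"
proof (rule connected_subset_SO0_34[OF _ _ one_SO0_34])
  have eq: "H = (\<lambda>(a, b). block_diag a b) ` (special_orthogonal \<times> special_orthogonal)"
    unfolding H_def by auto
  show "connected H"
    unfolding eq by (intro connected_continuous_image continuous_on_block_diag connected_Times
        connected_special_orthogonal) simp_all
  show "mat 1 \<in> H" unfolding H_def block_diag_simps(3)[symmetric]
    by (intro CollectI exI[of _ "mat 1"] conjI refl one_special_orthogonal)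
  show "transpose g ** J34 ** g = J34" if "g \<in> H" for g
    using that unfolding H_def by (auto simp: preserving_block_diag special_orthogonal_iff)
qed

text \<open>The component of \<open>p\<close> is a neighbourhood of \<open>p\<close> because the Cayley transform provides the paths
  \<open>p cay(tX)\<close>.\<close>

lemma SO0_34_neighbourhood:
  assumes p: "p \<in> SO0_34"
  obtains N where "open N" "p \<in> N" "\<And>g. g \<in> N \<Longrightarrow> transpose g ** J34 ** g = J34 \<Longrightarrow> g \<in> SO0_34"
proof -
  have pp: "transpose p ** J34 ** p = J34" by (rule SO0_34_preserves[OF p])
  let ?q = "J34 ** transpose p ** J34"
  note q = preserving_inverse(1,2)[OF pp]
  have qq: "transpose ?q ** J34 ** ?q = J34"
  proof -
    have "transpose ?q ** J34 ** ?q = J34 ** p ** (J34 ** J34) ** (J34 ** transpose p ** J34)"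
      by (simp only: matrix_transpose_mul transpose_transpose transpose_J34 matrix_mul_assoc)
    also have "\<dots> = J34 ** (p ** (J34 ** transpose p ** J34))" by (simp add: matrix_mul_assoc)
    finally show ?thesis unfolding q by simp
  qed
  \<comment> \<open>A ball about 0 is star-shaped, so the whole segment from 0 to
    \<open>icay ?k\<close> remains in the domain of the Cayley transform.\<close>
  obtain r where r: "r > 0" "ball 0 r \<subseteq> {X :: mat34. invertible (mat 1 - X)}"
  proof -
    have "0 \<in> {X :: mat34. invertible (mat 1 - X)}" by (simp add: invertible_mat_1)
    then obtain r where "r > 0" "ball 0 r \<subseteq> {X :: mat34. invertible (mat 1 - X)}"
      by (rule openE[OF open_cay_domain])
    then show ?thesis using that by blast
  qed
  let ?D = "{k :: mat34. invertible (mat 1 + k)}"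
  let ?M = "{k \<in> ?D. icay k \<in> ball 0 r}"
  have M: "open ?M"
    by (rule open_preimage_Collect[OF icay_domain(1) smooth_on_imp_continuous_on[OF smooth_on_icay] open_ball])
  let ?N = "{g \<in> UNIV. ?q ** g \<in> ?M}"
  have "open ?N"
    by (rule open_preimage_Collect[OF open_UNIV _ M])
      (intro matrix_mult.continuous_on continuous_on_const continuous_on_id)
  moreover have "p \<in> ?N" using q(1) icay_domain(2) r(1) by (simp add: icay_1)
  moreover have "g \<in> SO0_34" if g: "g \<in> ?N" "transpose g ** J34 ** g = J34" for g
  proof -
    let ?k = "?q ** g"
    have k: "invertible (mat 1 + ?k)" "norm (icay ?k) < r" using g(1) by auto
    have kp: "transpose ?k ** J34 ** ?k = J34" by (rule preserving_mult[OF qq g(2)])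
    have X: "icay ?k \<in> so34" by (rule cay_inverse_so34[OF k(1) icay_def kp])
    have tX: "t *\<^sub>R icay ?k \<in> so34" for t
      using X unfolding so34_iff by (simp add: transpose_scalar matrix_mult.scaleR_left matrix_mult.scaleR_right scaleR_add_right[symmetric])
    have inv: "invertible (mat 1 - t *\<^sub>R icay ?k)" if "t \<in> {0..1}" for t
    proof -
      have "\<bar>t\<bar> * norm (icay ?k) \<le> 1 * norm (icay ?k)" using that by (intro mult_right_mono) auto
      then have "t *\<^sub>R icay ?k \<in> ball 0 r" using k(2) by simp
      then show ?thesis using r(2) by blast
    qed
    let ?C = "(\<lambda>t. p ** cay (t *\<^sub>R icay ?k)) ` {0..1}"
    have "?C \<subseteq> SO0_34"
    proof (rule connected_subset_SO0_34[OF _ _ p])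
      have "continuous_on {0..1} (\<lambda>t. cay (t *\<^sub>R icay ?k))"
        by (rule continuous_on_compose2[OF smooth_on_imp_continuous_on[OF smooth_on_cay]])
          (use inv in \<open>auto intro!: continuous_intros\<close>)
      then show "connected ?C"
        by (intro connected_continuous_image matrix_mult.continuous_on continuous_on_const) auto
      show "p \<in> ?C" by (rule image_eqI[of _ _ 0]) (simp_all add: cay_0)
      show "transpose h ** J34 ** h = J34" if "h \<in> ?C" for h
        using that preserving_mult[OF pp cay_preserves[OF tX inv]] by blast
    qed
    moreover have "p ** cay (icay ?k) = g"
      unfolding cay_inverse(2)[OF k(1) icay_def] matrix_mul_assoc[of p ?q g] q(2) by simp
    then have "g \<in> ?C" by (intro image_eqI[of _ _ 1]) simp_all
    ultimately show ?thesis by blast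
  qed
  ultimately show ?thesis using that by blast
qed

section \<open>Unit quaternions in \<open>SO(4)\<close>\<close>

text \<open>\<open>hp\<close> and \<open>hm\<close> are the two commuting copies of the quaternions in the \<open>4 \<times> 4\<close> matrices.\<close>

definition rows4 :: "real \<times> real \<times> real \<times> real \<Rightarrow> real \<times> real \<times> real \<times> real \<Rightarrow>
    real \<times> real \<times> real \<times> real \<Rightarrow> real \<times> real \<times> real \<times> real \<Rightarrow> real^4^4" where
  "rows4 r1 r2 r3 r4 = (\<chi> i j. case (if i = 1 then r1 else if i = 2 then r2 else if i = 3 then r3 else r4) of
     (a, b, c, d) \<Rightarrow> if j = 1 then a else if j = 2 then b else if j = 3 then c else d)"

lemma distinct_4: "(1::4) \<noteq> 2" "(1::4) \<noteq> 3" "(1::4) \<noteq> 4" "(2::4) \<noteq> 3" "(2::4) \<noteq> 4" "(3::4) \<noteq> 4"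
  "(2::4) \<noteq> 1" "(3::4) \<noteq> 1" "(4::4) \<noteq> 1" "(3::4) \<noteq> 2" "(4::4) \<noteq> 2" "(4::4) \<noteq> 3"
  by simp_all

definition hp :: "real \<Rightarrow> real \<Rightarrow> real \<Rightarrow> real \<Rightarrow> real^4^4" where
  "hp w x y z = rows4 (w, x, y, z) (- x, w, z, - y) (- y, - z, w, x) (- z, y, - x, w)"

definition hm :: "real \<Rightarrow> real \<Rightarrow> real \<Rightarrow> real \<Rightarrow> real^4^4" where
  "hm w x y z = rows4 (w, x, y, z) (- x, w, - z, y) (- y, z, w, - x) (- z, - y, x, w)"

lemmas mat4_simps = vec_eq_iff forall_4 matrix_matrix_mult_def sum_4 transpose_def mat_def hp_def hm_def rows4_def
  distinct_4

lemma hp_hm_commute: "hp w x y z ** hm w' x' y' z' = hm w' x' y' z' ** hp w x y z"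
  by (simp add: mat4_simps algebra_simps)

text \<open>The cross product appears with a minus sign: \<open>hp\<close> reverses the order of
  Hamilton's product, whereas \<open>hm\<close> keeps it.\<close>

lemma hp_mult: "hp w x y z ** hp w' x' y' z' =
   hp (w*w' - x*x' - y*y' - z*z') (w*x' + x*w' - (y*z' - z*y')) (w*y' + y*w' - (z*x' - x*z')) (w*z' + z*w' - (x*y' - y*x'))"
  by (simp add: mat4_simps algebra_simps)

lemma hm_mult: "hm w x y z ** hm w' x' y' z' =
   hm (w*w' - x*x' - y*y' - z*z') (w*x' + x*w' + (y*z' - z*y')) (w*y' + y*w' + (z*x' - x*z')) (w*z' + z*w' + (x*y' - y*x'))"
  by (simp add: mat4_simps algebra_simps)

lemma h_transpose: "transpose (hp w x y z) = hp w (- x) (- y) (- z)" "transpose (hm w x y z) = hm w (- x) (- y) (- z)"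
  by (simp_all add: mat4_simps)

lemma h_one: "hp 1 0 0 0 = mat 1" "hm 1 0 0 0 = mat 1"
  by (simp_all add: mat4_simps)

lemma h_linear:
  "hp w x y z + hp w' x' y' z' = hp (w + w') (x + x') (y + y') (z + z')"
  "hm w x y z + hm w' x' y' z' = hm (w + w') (x + x') (y + y') (z + z')"
  "c *\<^sub>R hp w x y z = hp (c * w) (c * x) (c * y) (c * z)" "c *\<^sub>R hm w x y z = hm (c * w) (c * x) (c * y) (c * z)"
  by (simp_all add: mat4_simps)

lemma h_eq_iff:
  "hp w x y z = hp w' x' y' z' \<longleftrightarrow> w = w' \<and> x = x' \<and> y = y' \<and> z = z'"
  "hm w x y z = hm w' x' y' z' \<longleftrightarrow> w = w' \<and> x = x' \<and> y = y' \<and> z = z'"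
  by (auto simp: mat4_simps)

lemma sp1_plus_iff: "b \<in> sp1_plus \<longleftrightarrow> (\<exists>x y z. b = hp 0 x y z)"
proof
  assume b: "b \<in> sp1_plus"
  then have tb: "transpose b = - b" unfolding sp1_plus_def by blast
  have t: "b $ i $ j = - (b $ j $ i)" for i j
  proof -
    have "transpose b $ j $ i = (- b) $ j $ i" by (simp only: tb)
    then show ?thesis by (simp add: transpose_def)
  qed
  have e: "b $ 1 $ 2 = b $ 3 $ 4" "b $ 1 $ 3 = - (b $ 2 $ 4)" "b $ 1 $ 4 = b $ 2 $ 3"
    using b unfolding sp1_plus_def by auto
  have d: "b $ i $ i = 0" for i using t[of i i] by simp
  have "b = hp 0 (b $ 1 $ 2) (b $ 1 $ 3) (b $ 1 $ 4)"
    using e t[of 2 1] t[of 3 1] t[of 4 1] t[of 3 2] t[of 4 2] t[of 4 3] d by (simp add: mat4_simps)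
  then show "\<exists>x y z. b = hp 0 x y z" by blast
qed (auto simp: sp1_plus_def h_transpose, auto simp: mat4_simps)

lemma sp1_minus_iff: "b \<in> sp1_minus \<longleftrightarrow> (\<exists>x y z. b = hm 0 x y z)"
proof
  assume b: "b \<in> sp1_minus"
  then have tb: "transpose b = - b" unfolding sp1_minus_def by blast
  have t: "b $ i $ j = - (b $ j $ i)" for i j
  proof -
    have "transpose b $ j $ i = (- b) $ j $ i" by (simp only: tb)
    then show ?thesis by (simp add: transpose_def)
  qed
  have e: "b $ 1 $ 2 = - (b $ 3 $ 4)" "b $ 1 $ 3 = b $ 2 $ 4" "b $ 1 $ 4 = - (b $ 2 $ 3)"
    using b unfolding sp1_minus_def by auto
  have d: "b $ i $ i = 0" for i using t[of i i] by simp
  have "b = hm 0 (b $ 1 $ 2) (b $ 1 $ 3) (b $ 1 $ 4)"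
    using e t[of 2 1] t[of 3 1] t[of 4 1] t[of 3 2] t[of 4 2] t[of 4 3] d by (simp add: mat4_simps)
  then show "\<exists>x y z. b = hm 0 x y z" by blast
qed (auto simp: sp1_minus_def h_transpose, auto simp: mat4_simps)

text \<open>The first rows of the commutation relations with the three imaginary units express every
  entry of \<open>b\<close> by its first row.\<close>

lemma commutes_hp:
  assumes "\<And>x y z. hp 0 x y z ** b = b ** hp 0 x y z"
  shows "b = hm (b $ 1 $ 1) (b $ 1 $ 2) (b $ 1 $ 3) (b $ 1 $ 4)"
proof -
  have e: "(hp 0 x y z ** b) $ 1 $ j = (b ** hp 0 x y z) $ 1 $ j" for x y z j using assms by simp
  show ?thesis
    using e[of 1 0 0 1] e[of 1 0 0 2] e[of 1 0 0 3] e[of 1 0 0 4] e[of 0 1 0 1] e[of 0 1 0 2] e[of 0 1 0 3] e[of 0 1 0 4]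
      e[of 0 0 1 1] e[of 0 0 1 2] e[of 0 0 1 3] e[of 0 0 1 4] by (simp add: mat4_simps)
qed

lemma commutes_hm:
  assumes "\<And>x y z. hm 0 x y z ** b = b ** hm 0 x y z"
  shows "b = hp (b $ 1 $ 1) (b $ 1 $ 2) (b $ 1 $ 3) (b $ 1 $ 4)"
proof -
  have e: "(hm 0 x y z ** b) $ 1 $ j = (b ** hm 0 x y z) $ 1 $ j" for x y z j using assms by simp
  show ?thesis
    using e[of 1 0 0 1] e[of 1 0 0 2] e[of 1 0 0 3] e[of 1 0 0 4] e[of 0 1 0 1] e[of 0 1 0 2] e[of 0 1 0 3] e[of 0 1 0 4]
      e[of 0 0 1 1] e[of 0 0 1 2] e[of 0 0 1 3] e[of 0 0 1 4] by (simp add: mat4_simps)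
qed

lemma h_orthogonal:
  "transpose (hp w x y z) ** hp w x y z = mat 1 \<longleftrightarrow> w\<^sup>2 + x\<^sup>2 + y\<^sup>2 + z\<^sup>2 = 1"
  "transpose (hm w x y z) ** hm w x y z = mat 1 \<longleftrightarrow> w\<^sup>2 + x\<^sup>2 + y\<^sup>2 + z\<^sup>2 = 1"
proof -
  show "transpose (hp w x y z) ** hp w x y z = mat 1 \<longleftrightarrow> w\<^sup>2 + x\<^sup>2 + y\<^sup>2 + z\<^sup>2 = 1"
    unfolding h_transpose hp_mult h_one(1)[symmetric] h_eq_iff by (auto simp: power2_eq_square algebra_simps)
  show "transpose (hm w x y z) ** hm w x y z = mat 1 \<longleftrightarrow> w\<^sup>2 + x\<^sup>2 + y\<^sup>2 + z\<^sup>2 = 1"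
    unfolding h_transpose hm_mult h_one(2)[symmetric] h_eq_iff by (auto simp: power2_eq_square algebra_simps)
qed

lemma mexp_special_orthogonal:
  fixes X :: "real^'n^'n"
  assumes "transpose X = - X"
  shows "mexp (t *\<^sub>R X) \<in> special_orthogonal"
proof -
  have o: "transpose (mexp (t *\<^sub>R X)) ** mexp (t *\<^sub>R X) = mat 1" for t
    using mexp_preserves[of X "mat 1" t] assms by simp
  have "mexp (t *\<^sub>R X) = mexp ((t / 2) *\<^sub>R X) ** mexp ((t / 2) *\<^sub>R X)" using mexp_add[of "t/2" "t/2" X] by simp
  then have "det (mexp (t *\<^sub>R X)) = det (mexp ((t / 2) *\<^sub>R X)) * det (mexp ((t / 2) *\<^sub>R X))" by (simp add: det_mul)
  moreover have "orthogonal_matrix (mexp ((t / 2) *\<^sub>R X))" using o unfolding orthogonal_matrix .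
  then have "det (mexp ((t / 2) *\<^sub>R X)) = 1 \<or> det (mexp ((t / 2) *\<^sub>R X)) = - 1" by (rule det_orthogonal_matrix)
  ultimately show ?thesis unfolding special_orthogonal_iff using o by auto
qed

section \<open>The subgroups Sp(1) and their circles\<close>

lemma connected_subgroup_subset:
  fixes B :: "(real^'n^'n) set"
  assumes skew: "\<And>X. X \<in> \<k> \<Longrightarrow> transpose X = - X" and "\<And>X. X \<in> \<k> \<Longrightarrow> \<forall>Y\<in>B. Y ** X = X ** Y"
    and "g \<in> connected_subgroup \<k>"
  shows "g \<in> special_orthogonal \<and> (\<forall>Y\<in>B. Y ** g = g ** Y)"
  using assms(3)
proof induction
  case one
  then show ?case using one_special_orthogonal by simp
next
  case (mult_exp g X)
  have "mexp X \<in> special_orthogonal" using mexp_special_orthogonal[OF skew[OF mult_exp(2)], of 1] by simp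
  moreover have "Y ** mexp X = mexp X ** Y" if "Y \<in> B" for Y
    using mexp_commute[of Y X 1] assms(2)[OF mult_exp(2)] that by simp
  ultimately show ?case
    using mult_exp(3) special_orthogonal_mult by (metis matrix_mul_assoc)
qed

text \<open>Polar form: a unit quaternion is \<open>cos t + sin t u\<close> with \<open>u\<close>
  unit imaginary, which is the exponential of \<open>t u\<close>. For vanishing imaginary part any
  direction serves as \<open>u\<close>.\<close>

lemma hm_unit_exp:
  assumes "w\<^sup>2 + x\<^sup>2 + y\<^sup>2 + z\<^sup>2 = 1"
  shows "hm w x y z \<in> Sp1_minus"
proof -
  define s where "s = sqrt (x\<^sup>2 + y\<^sup>2 + z\<^sup>2)"
  have s2: "s\<^sup>2 = x\<^sup>2 + y\<^sup>2 + z\<^sup>2" unfolding s_def by simp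
  then have "w\<^sup>2 + s\<^sup>2 = 1" using assms by simp
  then obtain t where t: "w = cos t" "s = sin t" using sincos_total_2pi by metis
  obtain a b c where abc: "x = s * a" "y = s * b" "z = s * c" "a\<^sup>2 + b\<^sup>2 + c\<^sup>2 = 1"
  proof (cases "s = 0")
    case True
    then have "x\<^sup>2 + y\<^sup>2 + z\<^sup>2 = 0" using s2 by simp
    then have "x = 0" "y = 0" "z = 0" by (auto simp: sum_power2_eq_zero_iff add_nonneg_eq_0_iff)
    then show ?thesis using that[of 1 0 0] True by simp
  next
    case False
    then have "(x / s)\<^sup>2 + (y / s)\<^sup>2 + (z / s)\<^sup>2 = 1"
      by (simp add: power_divide add_divide_distrib[symmetric] s2[symmetric])
    then show ?thesis using that[of "x / s" "y / s" "z / s"] False by simp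
  qed
  let ?u = "hm 0 a b c"
  have "?u ** ?u = - mat 1"
    using abc(4) unfolding hm_mult h_one(2)[symmetric]
    by (simp add: mat4_simps power2_eq_square algebra_simps)
  from mexp_rotation[OF this, of t] have "mexp (t *\<^sub>R ?u) = hm w x y z"
    unfolding h_one(2)[symmetric] h_linear t(1) abc(1-3) t(2) by simp
  moreover have "t *\<^sub>R ?u \<in> sp1_minus" unfolding sp1_minus_iff h_linear by auto
  then have "mat 1 ** mexp (t *\<^sub>R ?u) \<in> Sp1_minus"
    unfolding Sp1_minus_def by (intro connected_subgroup.intros)
  ultimately show ?thesis by simp
qed

lemma skew_sp1: "X \<in> sp1_plus \<Longrightarrow> transpose X = - X" "X \<in> sp1_minus \<Longrightarrow> transpose X = - X"
  unfolding sp1_plus_def sp1_minus_def by auto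

lemma sp1_commute: "X \<in> sp1_plus \<Longrightarrow> Y \<in> sp1_minus \<Longrightarrow> Y ** X = X ** Y"
  unfolding sp1_plus_iff sp1_minus_iff using hp_hm_commute by metis

text \<open>Replaces a group generated by exponentials by a closed linear condition: the commutant
  of the first quaternion copy is the second one, whose unit elements are exponentials.\<close>

lemma Sp1_minus_iff: "b \<in> Sp1_minus \<longleftrightarrow> b \<in> special_orthogonal \<and> (\<forall>Y\<in>sp1_plus. Y ** b = b ** Y)"
proof
  assume "b \<in> Sp1_minus"
  then show "b \<in> special_orthogonal \<and> (\<forall>Y\<in>sp1_plus. Y ** b = b ** Y)"
    unfolding Sp1_minus_def
    by (intro connected_subgroup_subset[of sp1_minus]) (auto simp: skew_sp1 intro: sp1_commute sp1_commute[symmetric])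
next
  assume b: "b \<in> special_orthogonal \<and> (\<forall>Y\<in>sp1_plus. Y ** b = b ** Y)"
  then have "b = hm (b $ 1 $ 1) (b $ 1 $ 2) (b $ 1 $ 3) (b $ 1 $ 4)"
    using sp1_plus_iff by (intro commutes_hp) blast
  then obtain w x y z where e: "b = hm w x y z" by blast
  then show "b \<in> Sp1_minus" using b h_orthogonal(2) hm_unit_exp unfolding special_orthogonal_iff by blast
qed

lemma Sp1_plus_hp:
  assumes "b \<in> Sp1_plus"
  obtains w x y z where "b = hp w x y z" "w\<^sup>2 + x\<^sup>2 + y\<^sup>2 + z\<^sup>2 = 1" "b \<in> special_orthogonal"
proof -
  have b: "b \<in> special_orthogonal \<and> (\<forall>Y\<in>sp1_minus. Y ** b = b ** Y)"
    using assms unfolding Sp1_plus_def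
    by (intro connected_subgroup_subset[of sp1_plus]) (auto simp: skew_sp1 intro: sp1_commute sp1_commute[symmetric])
  then have e: "b = hp (b $ 1 $ 1) (b $ 1 $ 2) (b $ 1 $ 3) (b $ 1 $ 4)"
    using sp1_minus_iff by (intro commutes_hm) blast
  then have "(b $ 1 $ 1)\<^sup>2 + (b $ 1 $ 2)\<^sup>2 + (b $ 1 $ 3)\<^sup>2 + (b $ 1 $ 4)\<^sup>2 = 1"
    using b h_orthogonal(1) unfolding special_orthogonal_iff by metis
  then show ?thesis using that e b by blast
qed

text \<open>\<open>U\<close> is abelian, so all its elements commute with one noncentral element and
  lie on the great circle through it. Connectedness gives an arc of that circle, and the group law
  the rest.\<close>

lemma circle_subgroup_Sp1_plus:
  assumes U: "circle_subgroup U" "U \<subseteq> Sp1_plus"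
  obtains x y z where "x\<^sup>2 + y\<^sup>2 + z\<^sup>2 = 1" "U = range (\<lambda>t. hp (cos t) (sin t * x) (sin t * y) (sin t * z))"
proof -
  obtain \<rho> :: "complex \<Rightarrow> real^4^4" where \<rho>0: "continuous_on (sphere 0 1) \<rho> \<and> inj_on \<rho> (sphere 0 1) \<and>
     \<rho> 1 = mat 1 \<and> (\<forall>z\<in>sphere 0 1. \<forall>w\<in>sphere 0 1. \<rho> (z * w) = \<rho> z ** \<rho> w) \<and> U = \<rho> ` sphere 0 1"
    using U(1) unfolding circle_subgroup_def by (rule exE)
  note \<rho> = \<rho>0[THEN conjunct1] \<rho>0[THEN conjunct2, THEN conjunct1] \<rho>0[THEN conjunct2, THEN conjunct2, THEN conjunct1]
    \<rho>0[THEN conjunct2, THEN conjunct2, THEN conjunct2, THEN conjunct1, rule_format] \<rho>0[THEN conjunct2, THEN conjunct2, THEN conjunct2, THEN conjunct2]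
  have Uh: "\<exists>w x y z. u = hp w x y z \<and> w\<^sup>2 + x\<^sup>2 + y\<^sup>2 + z\<^sup>2 = 1" if u: "u \<in> U" for u
  proof -
    obtain w x y z where "u = hp w x y z" "w\<^sup>2 + x\<^sup>2 + y\<^sup>2 + z\<^sup>2 = 1"
      by (rule Sp1_plus_hp[OF subsetD[OF U(2) u]])
    then show ?thesis by blast
  qed
  have mult: "u ** v \<in> U" if uv: "u \<in> U" "v \<in> U" for u v
  proof -
    obtain a b where ab: "u = \<rho> a" "v = \<rho> b" "a \<in> sphere 0 1" "b \<in> sphere 0 1" using uv \<rho>(5) by blast
    then have "a * b \<in> sphere 0 1" by (simp add: norm_mult)
    then have "\<rho> (a * b) \<in> U" unfolding \<rho>(5) by (rule imageI)
    then show ?thesis unfolding \<rho>(4)[OF ab(3,4)] ab(1,2) .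
  qed
  have comm: "u ** v = v ** u" if uv: "u \<in> U" "v \<in> U" for u v
  proof -
    obtain a b where ab: "u = \<rho> a" "v = \<rho> b" "a \<in> sphere 0 1" "b \<in> sphere 0 1" using uv \<rho>(5) by blast
    then show ?thesis using \<rho>(4)[OF ab(3,4)] \<rho>(4)[OF ab(4,3)] by (simp add: mult.commute)
  qed
  have oneU: "mat 1 \<in> U" unfolding \<rho>(5) using \<rho>(3) by (intro image_eqI[of _ _ 1]) auto
  have inv: "transpose u \<in> U" if u: "u \<in> U" for u
  proof -
    obtain a where a: "u = \<rho> a" "a \<in> sphere 0 1" using u \<rho>(5) by blast
    have c: "cnj a \<in> sphere 0 1" using a(2) by simp
    have "a * cnj a = 1" using a(2) by (simp add: complex_norm_square[symmetric])
    then have 1: "u ** \<rho> (cnj a) = mat 1" using \<rho>(4)[OF a(2) c] \<rho>(3) a(1) by simp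
    obtain w x y z where h: "u = hp w x y z" "w\<^sup>2 + x\<^sup>2 + y\<^sup>2 + z\<^sup>2 = 1" using Uh[OF u] by blast
    have "transpose u ** u = mat 1" unfolding h(1) h_orthogonal(1) by (rule h(2))
    then have "\<rho> (cnj a) = transpose u ** (u ** \<rho> (cnj a))" by (simp add: matrix_mul_assoc)
    then have "\<rho> (cnj a) = transpose u" unfolding 1 by simp
    moreover have "\<rho> (cnj a) \<in> U" unfolding \<rho>(5) using c by (rule imageI)
    ultimately show ?thesis by simp
  qed
  \<comment> \<open>The images of 1, -1 and the imaginary unit are three distinct elements of
    \<open>U\<close>; at most two can be central.\<close>
  have "\<exists>u\<in>U. u \<noteq> mat 1 \<and> u \<noteq> - mat 1"
  proof (rule ccontr)
    assume n: "\<not> ?thesis"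
    have s: "(1::complex) \<in> sphere 0 1" "(-1::complex) \<in> sphere 0 1" "\<i> \<in> sphere 0 1" by simp_all
    have "\<rho> (-1) \<noteq> \<rho> 1" "\<rho> \<i> \<noteq> \<rho> 1" "\<rho> \<i> \<noteq> \<rho> (-1)"
      using inj_onD[OF \<rho>(2)] s by (force simp: complex_eq_iff)+
    moreover have "\<rho> (-1) \<in> U" "\<rho> \<i> \<in> U" using s \<rho>(5) by auto
    ultimately show False using n \<rho>(3) by metis
  qed
  then obtain u0 where u0: "u0 \<in> U" "u0 \<noteq> mat 1" "u0 \<noteq> - mat 1" by blast
  obtain w0 x0 y0 z0 where h0: "u0 = hp w0 x0 y0 z0" "w0\<^sup>2 + x0\<^sup>2 + y0\<^sup>2 + z0\<^sup>2 = 1" using Uh[OF u0(1)] by blast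
  define s0 where "s0 = sqrt (x0\<^sup>2 + y0\<^sup>2 + z0\<^sup>2)"
  have s02: "s0\<^sup>2 = x0\<^sup>2 + y0\<^sup>2 + z0\<^sup>2" unfolding s0_def by simp
  have s0: "s0 > 0"
  proof -
    have "x0\<^sup>2 + y0\<^sup>2 + z0\<^sup>2 \<noteq> 0"
    proof
      assume 0: "x0\<^sup>2 + y0\<^sup>2 + z0\<^sup>2 = 0"
      then have "x0 = 0" "y0 = 0" "z0 = 0" by (auto simp: sum_power2_eq_zero_iff add_nonneg_eq_0_iff)
      moreover have "w0\<^sup>2 = 1" using h0(2) 0 by linarith
      then have "w0 = 1 \<or> w0 = - 1" by (simp add: power2_eq_1_iff)
      moreover have "hp (-1) 0 0 0 = - mat 1" by (simp add: mat4_simps)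
      ultimately show False using u0(2,3) h0(1) h_one(1) by auto
    qed
    then show ?thesis unfolding s0_def by (simp add: less_le)
  qed
  define x y z where "x = x0 / s0" and "y = y0 / s0" and "z = z0 / s0"
  have xyz0: "x0 = s0 * x" "y0 = s0 * y" "z0 = s0 * z" unfolding x_def y_def z_def using s0 by simp_all
  have xyz: "x\<^sup>2 + y\<^sup>2 + z\<^sup>2 = 1"
    unfolding x_def y_def z_def power_divide add_divide_distrib[symmetric] s02[symmetric] using s0 by simp
  let ?c = "\<lambda>t. hp (cos t) (sin t * x) (sin t * y) (sin t * z)"
  \<comment> \<open>Commuting quaternions have parallel imaginary parts; here parallel to the axis
    \<open>(x, y, z)\<close> of \<open>u0\<close>.\<close>
  have par: "\<exists>t. u = ?c t" if u: "u \<in> U" for u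
  proof -
    obtain w a b c where h: "u = hp w a b c" "w\<^sup>2 + a\<^sup>2 + b\<^sup>2 + c\<^sup>2 = 1" using Uh[OF u] by blast
    have e: "a * y0 = b * x0" "b * z0 = c * y0" "c * x0 = a * z0"
      using comm[OF u u0(1)] unfolding h(1) h0(1) hp_mult h_eq_iff by (simp_all add: algebra_simps)
    have e': "a * y = b * x" "b * z = c * y" "c * x = a * z"
      using e s0 unfolding xyz0 by (simp_all add: mult.left_commute)
    define s where "s = a * x + b * y + c * z"
    have abc: "a = s * x" "b = s * y" "c = s * z"
    proof -
      have "s * x = a * (x\<^sup>2 + y\<^sup>2 + z\<^sup>2) + y * (b * x - a * y) + z * (c * x - a * z)"
        unfolding s_def by (simp add: power2_eq_square algebra_simps)
      then show "a = s * x" using e' xyz by simp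
      have "s * y = b * (x\<^sup>2 + y\<^sup>2 + z\<^sup>2) + x * (a * y - b * x) + z * (c * y - b * z)"
        unfolding s_def by (simp add: power2_eq_square algebra_simps)
      then show "b = s * y" using e' xyz by simp
      have "s * z = c * (x\<^sup>2 + y\<^sup>2 + z\<^sup>2) + x * (a * z - c * x) + y * (b * z - c * y)"
        unfolding s_def by (simp add: power2_eq_square algebra_simps)
      then show "c = s * z" using e' xyz by simp
    qed
    have "w\<^sup>2 + s\<^sup>2 * (x\<^sup>2 + y\<^sup>2 + z\<^sup>2) = 1" using h(2) unfolding abc by (simp add: power_mult_distrib algebra_simps)
    then have "w\<^sup>2 + s\<^sup>2 = 1" unfolding xyz by simp
    then obtain t where "w = cos t" "s = sin t" using sincos_total_2pi by metis
    then show ?thesis unfolding h(1) abc by blast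
  qed
  have c_add: "?c (s + t) = ?c s ** ?c t" for s t
  proof -
    have "sin s * sin t * (x * x + y * y + z * z) = sin s * sin t" using xyz by (simp add: power2_eq_square)
    then show ?thesis unfolding hp_mult h_eq_iff
      by (simp add: cos_add sin_add algebra_simps)
  qed
  \<comment> \<open>Entry \<open>(1, 1)\<close> is the real part. On \<open>U\<close> it takes an
    interval of values, containing 1 and \<open>w0\<close>.\<close>
  have "connected U" unfolding \<rho>(5) by (intro connected_continuous_image \<rho>(1) connected_sphere) simp
  then have conn: "connected ((\<lambda>u. u $ 1 $ 1) ` U)"
    by (intro connected_continuous_image continuous_intros)
  define t0 where "t0 = arccos w0"
  have w1: "w0\<^sup>2 < 1" using h0(2) s02 s0 zero_less_power[OF s0, of 2] by linarith
  then have w01: "\<bar>w0\<bar> < 1" by (simp add: abs_square_less_1)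
  have t0: "t0 > 0" "t0 \<le> pi" "cos t0 = w0"
  proof -
    have "- 1 < w0" "w0 < 1" using w01 by linarith+
    from arccos_lt_bounded[OF this] show "t0 > 0" "t0 \<le> pi" unfolding t0_def by linarith+
    show "cos t0 = w0" unfolding t0_def using w01 by (simp add: cos_arccos_abs)
  qed
  \<comment> \<open>The real part determines an element of the circle only up to inversion; the
    inverse is the transpose, which also belongs to \<open>U\<close>.\<close>
  have small: "?c t \<in> U" if t: "0 \<le> t" "t \<le> t0" for t
  proof -
    have "w0 \<le> cos t" unfolding t0(3)[symmetric] using t t0(2) by (intro cos_monotone_0_pi_le) auto
    moreover have "w0 \<in> (\<lambda>u. u $ 1 $ 1) ` U"
      using u0(1) unfolding h0(1) by (intro image_eqI[of _ _ "hp w0 x0 y0 z0"]) (simp_all add: mat4_simps)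
    moreover have "1 \<in> (\<lambda>u. u $ 1 $ 1) ` U"
      using oneU by (intro image_eqI[of _ _ "mat 1"]) (simp_all add: mat_def)
    ultimately have "cos t \<in> (\<lambda>u. u $ 1 $ 1) ` U"
      using conn unfolding connected_iff_interval by (meson cos_le_one)
    then obtain u where u: "u \<in> U" "u $ 1 $ 1 = cos t" by auto
    obtain r where r: "u = ?c r" using par[OF u(1)] by blast
    then have c: "cos r = cos t" using u(2) by (simp add: mat4_simps)
    have "(sin r)\<^sup>2 = (sin t)\<^sup>2" unfolding sin_squared_eq c ..
    then have "sin r = sin t \<or> sin r = - sin t" by (simp add: power2_eq_iff)
    then show ?thesis
    proof
      assume "sin r = sin t"
      then show ?thesis using u(1) unfolding r c by simp
    next
      assume s: "sin r = - sin t"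
      have "transpose u \<in> U" by (rule inv[OF u(1)])
      then show ?thesis unfolding r h_transpose c s by simp
    qed
  qed
  \<comment> \<open>Large angles are multiples of a small one within the arc already
    obtained.\<close>
  have nonneg: "?c t \<in> U" if t: "0 \<le> t" for t
  proof -
    obtain n :: nat where n: "t < real n * t0" using reals_Archimedean3[OF t0(1)] by blast
    then have n0: "n > 0" using t t0(1) by (cases n) auto
    have d: "0 \<le> t / real n" "t / real n \<le> t0" using t n n0 by (auto simp: field_simps)
    have "?c (real k * (t / real n)) \<in> U" for k
    proof (induction k)
      case 0
      then show ?case using oneU by (simp add: h_one)
    next
      case (Suc k)
      have "?c (real (Suc k) * (t / real n)) = ?c (t / real n) ** ?c (real k * (t / real n))"
      proof -
        have "real (Suc k) * (t / real n) = t / real n + real k * (t / real n)" by (simp only: of_nat_Suc distrib_right mult_1_left add.commute)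
        then show ?thesis using c_add[of "t / real n" "real k * (t / real n)"] by (simp only:)
      qed
      then show ?case using mult[OF small[OF d] Suc] by simp
    qed
    from this[of n] show ?thesis using n0 by simp
  qed
  have "?c t \<in> U" for t
  proof (cases "t \<ge> 0")
    case False
    have "?c t = transpose (?c (- t))" unfolding h_transpose by simp
    then show ?thesis using inv[OF nonneg[of "- t"]] False by simp
  qed (rule nonneg)
  then have "U = range ?c" using par by blast
  then show ?thesis using that xyz by blast
qed

section \<open>The centralizer of a unit imaginary quaternion\<close>

text \<open>A matrix commuting with a unit imaginary quaternion \<open>X\<close> of the first copy is \<open>p + q X\<close> with \<open>p\<close>, \<open>q\<close> in the
  second copy; orthogonality makes \<open>p\<close> and \<open>q\<close> proportional.\<close>

lemma rows4_add: "rows4 (a1, b1, c1, d1) (a2, b2, c2, d2) (a3, b3, c3, d3) (a4, b4, c4, d4) + rows4 (a1', b1', c1', d1') (a2', b2', c2', d2') (a3', b3', c3', d3') (a4', b4', c4', d4') =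
    rows4 (a1 + a1', b1 + b1', c1 + c1', d1 + d1') (a2 + a2', b2 + b2', c2 + c2', d2 + d2') (a3 + a3', b3 + b3', c3 + c3', d3 + d3') (a4 + a4', b4 + b4', c4 + c4', d4 + d4')"
  by (simp add: vec_eq_iff rows4_def)

lemma rows4_eq_iff: "g = rows4 (a1, b1, c1, d1) (a2, b2, c2, d2) (a3, b3, c3, d3) (a4, b4, c4, d4) \<longleftrightarrow>
    g $ 1 $ 1 = a1 \<and> g $ 1 $ 2 = b1 \<and> g $ 1 $ 3 = c1 \<and> g $ 1 $ 4 = d1 \<and> g $ 2 $ 1 = a2 \<and> g $ 2 $ 2 = b2 \<and> g $ 2 $ 3 = c2 \<and> g $ 2 $ 4 = d2 \<and> g $ 3 $ 1 = a3 \<and> g $ 3 $ 2 = b3 \<and> g $ 3 $ 3 = c3 \<and> g $ 3 $ 4 = d3 \<and> g $ 4 $ 1 = a4 \<and> g $ 4 $ 2 = b4 \<and> g $ 4 $ 3 = c4 \<and> g $ 4 $ 4 = d4"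
  by (simp add: vec_eq_iff forall_4 rows4_def conj_assoc)

text \<open>The real 4 by 4 matrices are the tensor product of the two quaternion copies. The
  sixteen products of units are mutually orthogonal with squared norm 4, whence the quarter sums of
  signed entries.\<close>

lemma quaternion_decomposition:
  obtains a0 a1 a2 a3 b0 b1 b2 b3 c0 c1 c2 c3 d0 d1 d2 d3 where
    "g = hm a0 a1 a2 a3 + hm b0 b1 b2 b3 ** hp 0 1 0 0 + hm c0 c1 c2 c3 ** hp 0 0 1 0 + hm d0 d1 d2 d3 ** hp 0 0 0 1"
proof -
  have k1: "hm p q r s ** hp 0 1 0 0 = rows4 (- q, p, - s, r) (- p, - q, - r, - s) (- s, - r, q, p) (r, - s, - p, q)" for p q r s
    by (simp add: mat4_simps)
  have k2: "hm p q r s ** hp 0 0 1 0 = rows4 (- r, s, p, - q) (s, r, - q, - p) (- p, - q, - r, - s) (- q, p, - s, r)" for p q r s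
    by (simp add: mat4_simps)
  have k3: "hm p q r s ** hp 0 0 0 1 = rows4 (- s, - r, q, p) (- r, s, p, - q) (q, - p, s, - r) (- p, - q, - r, - s)" for p q r s
    by (simp add: mat4_simps)
  have "g =
      hm ((g $ 1 $ 1 + g $ 2 $ 2 + g $ 3 $ 3 + g $ 4 $ 4) / 4) ((g $ 1 $ 2 - g $ 2 $ 1 - g $ 3 $ 4 + g $ 4 $ 3) / 4) ((g $ 1 $ 3 + g $ 2 $ 4 - g $ 3 $ 1 - g $ 4 $ 2) / 4) ((g $ 1 $ 4 - g $ 2 $ 3 + g $ 3 $ 2 - g $ 4 $ 1) / 4)
      + hm ((g $ 1 $ 2 - g $ 2 $ 1 + g $ 3 $ 4 - g $ 4 $ 3) / 4) ((- g $ 1 $ 1 - g $ 2 $ 2 + g $ 3 $ 3 + g $ 4 $ 4) / 4) ((g $ 1 $ 4 - g $ 2 $ 3 - g $ 3 $ 2 + g $ 4 $ 1) / 4) ((- g $ 1 $ 3 - g $ 2 $ 4 - g $ 3 $ 1 - g $ 4 $ 2) / 4) ** hp 0 1 0 0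
      + hm ((g $ 1 $ 3 - g $ 2 $ 4 - g $ 3 $ 1 + g $ 4 $ 2) / 4) ((- g $ 1 $ 4 - g $ 2 $ 3 - g $ 3 $ 2 - g $ 4 $ 1) / 4) ((- g $ 1 $ 1 + g $ 2 $ 2 - g $ 3 $ 3 + g $ 4 $ 4) / 4) ((g $ 1 $ 2 + g $ 2 $ 1 - g $ 3 $ 4 - g $ 4 $ 3) / 4) ** hp 0 0 1 0
      + hm ((g $ 1 $ 4 + g $ 2 $ 3 - g $ 3 $ 2 - g $ 4 $ 1) / 4) ((g $ 1 $ 3 - g $ 2 $ 4 + g $ 3 $ 1 - g $ 4 $ 2) / 4) ((- g $ 1 $ 2 - g $ 2 $ 1 - g $ 3 $ 4 - g $ 4 $ 3) / 4) ((- g $ 1 $ 1 + g $ 2 $ 2 + g $ 3 $ 3 - g $ 4 $ 4) / 4) ** hp 0 0 0 1"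
    unfolding k1 k2 k3 unfolding hm_def rows4_add rows4_eq_iff by (intro conjI; simp add: field_simps)
  then show ?thesis by (rule that)
qed

text \<open>The conclusions say that each of the four vectors \<open>(b, c, d)\<close> of
  coefficients is parallel to \<open>(x, y, z)\<close>. They are linear combinations of the sixteen
  entries of the equation.\<close>

lemma quaternion_commutator_zero:
  assumes "hm b0 b1 b2 b3 ** hp 0 0 (- 2 * z) (2 * y) + hm c0 c1 c2 c3 ** hp 0 (2 * z) 0 (- 2 * x)
    + hm d0 d1 d2 d3 ** hp 0 (- 2 * y) (2 * x) 0 = 0"
  shows "b0 * y = c0 * x" "c0 * z = d0 * y" "d0 * x = b0 * z"
    "b1 * y = c1 * x" "c1 * z = d1 * y" "d1 * x = b1 * z"
    "b2 * y = c2 * x" "c2 * z = d2 * y" "d2 * x = b2 * z"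
    "b3 * y = c3 * x" "c3 * z = d3 * y" "d3 * x = b3 * z"
proof -
  have e: "(hm b0 b1 b2 b3 ** hp 0 0 (- 2 * z) (2 * y) + hm c0 c1 c2 c3 ** hp 0 (2 * z) 0 (- 2 * x)
    + hm d0 d1 d2 d3 ** hp 0 (- 2 * y) (2 * x) 0) $ i $ j = 0" for i j
    by (subst assms) simp
  have e11: "2*(b2*z) - 2*(b3*y) - 2*(c1*z) + 2*(c3*x) + 2*(d1*y) - 2*(d2*x) = 0"
    using e[of 1 1] by (simp add: mat4_simps algebra_simps)
  have e12: "- 2*(b2*y) - 2*(b3*z) + 2*(c0*z) + 2*(c2*x) - 2*(d0*y) + 2*(d3*x) = 0"
    using e[of 1 2] by (simp add: mat4_simps algebra_simps)
  have e13: "- 2*(b0*z) + 2*(b1*y) - 2*(c1*x) - 2*(c3*z) + 2*(d0*x) + 2*(d3*y) = 0"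
    using e[of 1 3] by (simp add: mat4_simps algebra_simps)
  have e14: "2*(b0*y) + 2*(b1*z) - 2*(c0*x) + 2*(c2*z) - 2*(d1*x) - 2*(d2*y) = 0"
    using e[of 1 4] by (simp add: mat4_simps algebra_simps)
  have e21: "- 2*(b3*z) - 2*(b2*y) - 2*(c0*z) + 2*(c2*x) + 2*(d0*y) + 2*(d3*x) = 0"
    using e[of 2 1] by (simp add: mat4_simps algebra_simps)
  have e22: "2*(b3*y) - 2*(b2*z) - 2*(c1*z) - 2*(c3*x) + 2*(d1*y) + 2*(d2*x) = 0"
    using e[of 2 2] by (simp add: mat4_simps algebra_simps)
  have e23: "2*(b1*z) + 2*(b0*y) - 2*(c0*x) - 2*(c2*z) - 2*(d1*x) + 2*(d2*y) = 0"
    using e[of 2 3] by (simp add: mat4_simps algebra_simps)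
  have e24: "- 2*(b1*y) + 2*(b0*z) + 2*(c1*x) - 2*(c3*z) - 2*(d0*x) + 2*(d3*y) = 0"
    using e[of 2 4] by (simp add: mat4_simps algebra_simps)
  have e31: "2*(b0*z) + 2*(b1*y) - 2*(c3*z) - 2*(c1*x) + 2*(d3*y) - 2*(d0*x) = 0"
    using e[of 3 1] by (simp add: mat4_simps algebra_simps)
  have e32: "- 2*(b0*y) + 2*(b1*z) - 2*(c2*z) + 2*(c0*x) + 2*(d2*y) - 2*(d1*x) = 0"
    using e[of 3 2] by (simp add: mat4_simps algebra_simps)
  have e33: "2*(b2*z) + 2*(b3*y) - 2*(c3*x) + 2*(c1*z) - 2*(d2*x) - 2*(d1*y) = 0"
    using e[of 3 3] by (simp add: mat4_simps algebra_simps)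
  have e34: "- 2*(b2*y) + 2*(b3*z) + 2*(c2*x) + 2*(c0*z) - 2*(d3*x) - 2*(d0*y) = 0"
    using e[of 3 4] by (simp add: mat4_simps algebra_simps)
  have e41: "2*(b1*z) - 2*(b0*y) + 2*(c2*z) + 2*(c0*x) - 2*(d2*y) - 2*(d1*x) = 0"
    using e[of 4 1] by (simp add: mat4_simps algebra_simps)
  have e42: "- 2*(b1*y) - 2*(b0*z) - 2*(c3*z) + 2*(c1*x) + 2*(d3*y) + 2*(d0*x) = 0"
    using e[of 4 2] by (simp add: mat4_simps algebra_simps)
  have e43: "2*(b3*z) - 2*(b2*y) + 2*(c2*x) - 2*(c0*z) - 2*(d3*x) + 2*(d0*y) = 0"
    using e[of 4 3] by (simp add: mat4_simps algebra_simps)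
  have e44: "- 2*(b3*y) - 2*(b2*z) + 2*(c3*x) + 2*(c1*z) + 2*(d2*x) - 2*(d1*y) = 0"
    using e[of 4 4] by (simp add: mat4_simps algebra_simps)
  note es = e11 e12 e13 e14 e21 e22 e23 e24 e31 e32 e33 e34 e41 e42 e43 e44
  show "b0 * y = c0 * x" "c0 * z = d0 * y" "d0 * x = b0 * z" "b1 * y = c1 * x" "c1 * z = d1 * y" "d1 * x = b1 * z" "b2 * y = c2 * x" "c2 * z = d2 * y" "d2 * x = b2 * z" "b3 * y = c3 * x" "c3 * z = d3 * y" "d3 * x = b3 * z"
    using es by linarith+
qed

lemma commutes_unit_hp:
  assumes x: "x\<^sup>2 + y\<^sup>2 + z\<^sup>2 = 1" and c: "hp 0 x y z ** g = g ** hp 0 x y z"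
    and o: "transpose g ** g = mat 1"
  obtains b t where "b \<in> Sp1_minus" "g = b ** hp (cos t) (sin t * x) (sin t * y) (sin t * z)"
proof -
  obtain a0 a1 a2 a3 b0 b1 b2 b3 c0 c1 c2 c3 d0 d1 d2 d3 where g:
    "g = hm a0 a1 a2 a3 + hm b0 b1 b2 b3 ** hp 0 1 0 0 + hm c0 c1 c2 c3 ** hp 0 0 1 0 + hm d0 d1 d2 d3 ** hp 0 0 0 1"
    by (rule quaternion_decomposition)
  have e: "b0 * y = c0 * x" "c0 * z = d0 * y" "d0 * x = b0 * z"
    "b1 * y = c1 * x" "c1 * z = d1 * y" "d1 * x = b1 * z"
    "b2 * y = c2 * x" "c2 * z = d2 * y" "d2 * x = b2 * z"
    "b3 * y = c3 * x" "c3 * z = d3 * y" "d3 * x = b3 * z"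
  proof -
    let ?X = "hp 0 x y z"
    have m: "?X ** (hm p0 p1 p2 p3 ** Q) = hm p0 p1 p2 p3 ** (?X ** Q)" for p0 p1 p2 p3 Q
      unfolding matrix_mul_assoc hp_hm_commute ..
    have d: "?X ** hp 0 1 0 0 - hp 0 1 0 0 ** ?X = hp 0 0 (- 2 * z) (2 * y)"
      "?X ** hp 0 0 1 0 - hp 0 0 1 0 ** ?X = hp 0 (2 * z) 0 (- 2 * x)"
      "?X ** hp 0 0 0 1 - hp 0 0 0 1 ** ?X = hp 0 (- 2 * y) (2 * x) 0"
      by (simp_all add: mat4_simps)
    have "?X ** g - g ** ?X = hm b0 b1 b2 b3 ** (?X ** hp 0 1 0 0 - hp 0 1 0 0 ** ?X)
        + hm c0 c1 c2 c3 ** (?X ** hp 0 0 1 0 - hp 0 0 1 0 ** ?X) + hm d0 d1 d2 d3 ** (?X ** hp 0 0 0 1 - hp 0 0 0 1 ** ?X)"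
      unfolding g matrix_mult.add_right matrix_mult.add_left m matrix_mult.diff_right
      by (simp add: hp_hm_commute matrix_mul_assoc[symmetric])
    then have "hm b0 b1 b2 b3 ** hp 0 0 (- 2 * z) (2 * y) + hm c0 c1 c2 c3 ** hp 0 (2 * z) 0 (- 2 * x)
        + hm d0 d1 d2 d3 ** hp 0 (- 2 * y) (2 * x) 0 = 0"
      unfolding d using c by simp
    from quaternion_commutator_zero[OF this] show "b0 * y = c0 * x" "c0 * z = d0 * y" "d0 * x = b0 * z"
      "b1 * y = c1 * x" "c1 * z = d1 * y" "d1 * x = b1 * z" "b2 * y = c2 * x" "c2 * z = d2 * y" "d2 * x = b2 * z"
      "b3 * y = c3 * x" "c3 * z = d3 * y" "d3 * x = b3 * z" by blast+
  qed
  define q0 q1 q2 q3 where "q0 = b0 * x + c0 * y + d0 * z" and "q1 = b1 * x + c1 * y + d1 * z"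
    and "q2 = b2 * x + c2 * y + d2 * z" and "q3 = b3 * x + c3 * y + d3 * z"
  have par: "b = (b * x + c * y + d * z) * x \<and> c = (b * x + c * y + d * z) * y \<and> d = (b * x + c * y + d * z) * z"
    if e: "b * y = c * x" "c * z = d * y" "d * x = b * z" for b c d
  proof -
    have "(b * x + c * y + d * z) * x = b * (x\<^sup>2 + y\<^sup>2 + z\<^sup>2) + y * (c * x - b * y) + z * (d * x - b * z)"
      "(b * x + c * y + d * z) * y = c * (x\<^sup>2 + y\<^sup>2 + z\<^sup>2) + x * (b * y - c * x) + z * (d * y - c * z)"
      "(b * x + c * y + d * z) * z = d * (x\<^sup>2 + y\<^sup>2 + z\<^sup>2) + x * (b * z - d * x) + y * (c * z - d * y)"
      by (simp_all add: power2_eq_square algebra_simps)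
    then show ?thesis using e x by simp
  qed
  note p = par[OF e(1-3), folded q0_def] par[OF e(4-6), folded q1_def] par[OF e(7-9), folded q2_def]
    par[OF e(10-12), folded q3_def]
  have g2: "g = hm a0 a1 a2 a3 + hm q0 q1 q2 q3 ** hp 0 x y z"
    unfolding g using p by (simp add: mat4_simps algebra_simps)
  let ?a = "hm a0 a1 a2 a3" and ?q = "hm q0 q1 q2 q3" and ?X = "hp 0 x y z"
  have XX: "?X ** ?X = - mat 1"
    using x unfolding hp_mult by (simp add: mat4_simps power2_eq_square algebra_simps)
  have tg: "transpose g = transpose ?a - transpose ?q ** ?X"
    unfolding g2 transpose_add matrix_transpose_mul h_transpose hp_hm_commute by (simp add: mat4_simps)
  let ?N = "a0\<^sup>2 + a1\<^sup>2 + a2\<^sup>2 + a3\<^sup>2 + (q0\<^sup>2 + q1\<^sup>2 + q2\<^sup>2 + q3\<^sup>2)"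
  have "transpose g ** g = (transpose ?a ** ?a + transpose ?q ** ?q) + (transpose ?a ** ?q - transpose ?q ** ?a) ** ?X"
  proof -
    have "transpose ?q ** ?X ** (?q ** ?X) = transpose ?q ** (?X ** ?q) ** ?X" by (simp only: matrix_mul_assoc)
    also have "\<dots> = transpose ?q ** ?q ** (?X ** ?X)" unfolding hp_hm_commute by (simp only: matrix_mul_assoc)
    finally have 1: "transpose ?q ** ?X ** (?q ** ?X) = - (transpose ?q ** ?q)"
      unfolding XX by (simp add: matrix_mult.minus_right)
    have 2: "transpose ?q ** ?X ** ?a = transpose ?q ** ?a ** ?X"
      using hp_hm_commute by (metis matrix_mul_assoc)
    have "transpose g ** g = (transpose ?a - transpose ?q ** ?X) ** g" unfolding tg ..
    also have "\<dots> = (transpose ?a - transpose ?q ** ?X) ** (?a + ?q ** ?X)" by (subst g2) (rule refl)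
    also have "\<dots> = (transpose ?a ** ?a + transpose ?q ** ?q) + (transpose ?a ** ?q - transpose ?q ** ?a) ** ?X"
      by (simp add: matrix_mult.diff_left matrix_mult.add_right 1 2 matrix_mul_assoc[of "transpose ?a" ?q ?X])
    finally show ?thesis .
  qed
  then have eq: "(transpose ?a ** ?a + transpose ?q ** ?q) + (transpose ?a ** ?q - transpose ?q ** ?a) ** ?X = mat 1"
    using o by simp
  \<comment> \<open>The imaginary part of the quaternion product of conjugate \<open>a\<close> with
    \<open>q\<close>. Its vanishing, which orthogonality of \<open>g\<close> will give, means that
    \<open>a\<close> and \<open>q\<close> are proportional.\<close>
  let ?v1 = "a0*q1 - a1*q0 - (a2*q3 - a3*q2)" and ?v2 = "a0*q2 - a2*q0 - (a3*q1 - a1*q3)" and ?v3 = "a0*q3 - a3*q0 - (a1*q2 - a2*q1)"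
  have 1: "transpose ?a ** ?a + transpose ?q ** ?q = ?N *\<^sub>R mat 1"
    by (simp add: mat4_simps power2_eq_square algebra_simps)
  have 2: "transpose ?a ** ?q - transpose ?q ** ?a = 2 *\<^sub>R hm 0 ?v1 ?v2 ?v3"
    by (simp add: mat4_simps algebra_simps)
  have N1: "?N = 1" and v0: "?v1 * x = 0 \<and> ?v1 * y = 0 \<and> ?v1 * z = 0 \<and> ?v2 * x = 0 \<and> ?v2 * y = 0 \<and> ?v2 * z = 0
      \<and> ?v3 * x = 0 \<and> ?v3 * y = 0 \<and> ?v3 * z = 0"
  proof -
    have *: "n = 1 \<and> v1 * x = 0 \<and> v1 * y = 0 \<and> v1 * z = 0 \<and> v2 * x = 0 \<and> v2 * y = 0 \<and> v2 * z = 0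
      \<and> v3 * x = 0 \<and> v3 * y = 0 \<and> v3 * z = 0"
      if nv: "n *\<^sub>R mat 1 + (2 *\<^sub>R hm 0 v1 v2 v3) ** ?X = mat 1" for n v1 v2 v3
    proof -
      have e: "(n *\<^sub>R mat 1 + (2 *\<^sub>R hm 0 v1 v2 v3) ** ?X) $ i $ j = (mat 1 :: real^4^4) $ i $ j" for i j
        by (subst nv) (rule refl)
      have e11: "n - 2*(v1*x) - 2*(v2*y) - 2*(v3*z) = 1"
        using e[of 1 1] by (simp add: mat4_simps algebra_simps)
      have e12: "- 2*(v2*z) + 2*(v3*y) = 0"
        using e[of 1 2] by (simp add: mat4_simps algebra_simps)
      have e13: "2*(v1*z) - 2*(v3*x) = 0"
        using e[of 1 3] by (simp add: mat4_simps algebra_simps)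
      have e14: "- 2*(v1*y) + 2*(v2*x) = 0"
        using e[of 1 4] by (simp add: mat4_simps algebra_simps)
      have e21: "2*(v3*y) - 2*(v2*z) = 0"
        using e[of 2 1] by (simp add: mat4_simps algebra_simps)
      have e22: "n - 2*(v1*x) + 2*(v3*z) + 2*(v2*y) = 1"
        using e[of 2 2] by (simp add: mat4_simps algebra_simps)
      have e23: "- 2*(v1*y) - 2*(v2*x) = 0"
        using e[of 2 3] by (simp add: mat4_simps algebra_simps)
      have e24: "- 2*(v1*z) - 2*(v3*x) = 0"
        using e[of 2 4] by (simp add: mat4_simps algebra_simps)
      have e31: "- 2*(v3*x) + 2*(v1*z) = 0"
        using e[of 3 1] by (simp add: mat4_simps algebra_simps)
      have e32: "- 2*(v2*x) - 2*(v1*y) = 0"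
        using e[of 3 2] by (simp add: mat4_simps algebra_simps)
      have e33: "n - 2*(v2*y) + 2*(v3*z) + 2*(v1*x) = 1"
        using e[of 3 3] by (simp add: mat4_simps algebra_simps)
      have e34: "- 2*(v2*z) - 2*(v3*y) = 0"
        using e[of 3 4] by (simp add: mat4_simps algebra_simps)
      have e41: "2*(v2*x) - 2*(v1*y) = 0"
        using e[of 4 1] by (simp add: mat4_simps algebra_simps)
      have e42: "- 2*(v3*x) - 2*(v1*z) = 0"
        using e[of 4 2] by (simp add: mat4_simps algebra_simps)
      have e43: "- 2*(v3*y) - 2*(v2*z) = 0"
        using e[of 4 3] by (simp add: mat4_simps algebra_simps)
      have e44: "n - 2*(v3*z) + 2*(v2*y) + 2*(v1*x) = 1"
        using e[of 4 4] by (simp add: mat4_simps algebra_simps)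
      note es = e11 e12 e13 e14 e21 e22 e23 e24 e31 e32 e33 e34 e41 e42 e43 e44
      show ?thesis using es by (intro conjI) linarith+
    qed
    from *[OF eq[unfolded 1 2]] show "?N = 1" "?v1 * x = 0 \<and> ?v1 * y = 0 \<and> ?v1 * z = 0 \<and> ?v2 * x = 0 \<and> ?v2 * y = 0 \<and> ?v2 * z = 0
      \<and> ?v3 * x = 0 \<and> ?v3 * y = 0 \<and> ?v3 * z = 0" by blast+
  qed
  have "x \<noteq> 0 \<or> y \<noteq> 0 \<or> z \<noteq> 0" using x by auto
  then have v: "?v1 = 0" "?v2 = 0" "?v3 = 0" using v0 by (metis mult_eq_0_iff)+
  define S where "S = q0\<^sup>2 + q1\<^sup>2 + q2\<^sup>2 + q3\<^sup>2"
  show ?thesis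
  proof (cases "S = 0")
    case True
    then have q: "q0 = 0" "q1 = 0" "q2 = 0" "q3 = 0"
      unfolding S_def by (auto simp: add_nonneg_eq_0_iff)
    have "?a \<in> Sp1_minus" using N1 q by (intro hm_unit_exp) simp
    moreover have "g = ?a ** hp (cos 0) (sin 0 * x) (sin 0 * y) (sin 0 * z)"
      unfolding g2 q by (simp add: h_one) (simp add: mat4_simps)
    ultimately show ?thesis using that by blast
  next
    case False
    define s where "s = sqrt S"
    have S: "S > 0" using False unfolding S_def by (simp add: less_le)
    have s: "s > 0" "s * s = S" unfolding s_def using S by auto
    define k where "k = (a0 * q0 + a1 * q1 + a2 * q2 + a3 * q3) / S"
    have "a0 = k * q0 \<and> a1 = k * q1 \<and> a2 = k * q2 \<and> a3 = k * q3"
    proof -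
      \<comment> \<open>Multiplying conjugate \<open>a\<close> times \<open>q\<close> by the
        conjugate of \<open>q\<close> recovers \<open>S\<close> times conjugate \<open>a\<close>;
        with vanishing imaginary part this exhibits \<open>a\<close> as a multiple of
        \<open>q\<close>.\<close>
      have "S * a0 = (a0 * q0 + a1 * q1 + a2 * q2 + a3 * q3) * q0 + ?v1 * q1 + ?v2 * q2 + ?v3 * q3"
        "S * a1 = (a0 * q0 + a1 * q1 + a2 * q2 + a3 * q3) * q1 - ?v1 * q0 + (?v2 * q3 - ?v3 * q2)"
        "S * a2 = (a0 * q0 + a1 * q1 + a2 * q2 + a3 * q3) * q2 - ?v2 * q0 + (?v3 * q1 - ?v1 * q3)"
        "S * a3 = (a0 * q0 + a1 * q1 + a2 * q2 + a3 * q3) * q3 - ?v3 * q0 + (?v1 * q2 - ?v2 * q1)"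
        unfolding S_def power2_eq_square by algebra+
      then show ?thesis unfolding v k_def using S by (simp add: field_simps)
    qed
    then have a: "a0 = k * q0" "a1 = k * q1" "a2 = k * q2" "a3 = k * q3" by auto
    have "(k * s)\<^sup>2 + s\<^sup>2 = 1"
      using N1 s(2) unfolding a S_def by (simp add: power_mult_distrib power2_eq_square algebra_simps)
    then obtain t where t: "k * s = cos t" "s = sin t" using sincos_total_2pi by metis
    let ?b = "hm (q0 / s) (q1 / s) (q2 / s) (q3 / s)"
    have "?b \<in> Sp1_minus"
      using s S unfolding S_def by (intro hm_unit_exp) (simp add: power_divide add_divide_distrib[symmetric] power2_eq_square)
    moreover have "g = ?b ** hp (cos t) (sin t * x) (sin t * y) (sin t * z)"
      unfolding t[symmetric] g2 a using s(1) by (simp add: mat4_simps field_simps)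
    ultimately show ?thesis using that by blast
  qed
qed

lemma H_eq: "H = block_centralizer {}"
  unfolding H_def block_centralizer_def by simp

lemma H'_eq: "H' = block_centralizer sp1_plus"
  unfolding H'_def block_centralizer_def Sp1_minus_iff by blast

text \<open>The circle is replaced by its axis \<open>hp 0 x y z\<close>. One inclusion is
  commutation of the factors, the other is the factorization in
  \<open>commutes_unit_hp\<close>.\<close>

lemma H'_times_eq:
  assumes U: "circle_subgroup U" "U \<subseteq> Sp1_plus"
  obtains x y z where "x\<^sup>2 + y\<^sup>2 + z\<^sup>2 = 1" "H'_times U = block_centralizer {hp 0 x y z}"
proof -
  obtain x y z where x: "x\<^sup>2 + y\<^sup>2 + z\<^sup>2 = 1" and Ueq: "U = range (\<lambda>t. hp (cos t) (sin t * x) (sin t * y) (sin t * z))"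
    using circle_subgroup_Sp1_plus[OF U] by blast
  have X: "hp 0 x y z \<in> sp1_plus" unfolding sp1_plus_iff by blast
  have "H'_times U = block_centralizer {hp 0 x y z}"
  proof (intro set_eqI iffI)
    fix k assume "k \<in> H'_times U"
    then obtain a b u where k: "k = block_diag a b ** block_diag (mat 1) u" "a \<in> special_orthogonal" "b \<in> Sp1_minus" "u \<in> U"
      unfolding H'_times_def H'_def by blast
    have u: "u \<in> special_orthogonal" using Sp1_plus_hp[of u] U(2) k(4) by blast
    have b: "b \<in> special_orthogonal" "hp 0 x y z ** b = b ** hp 0 x y z" using k(3) X unfolding Sp1_minus_iff by auto
    obtain t where "u = hp (cos t) (sin t * x) (sin t * y) (sin t * z)" using k(4) unfolding Ueq by blast
    then have "hp 0 x y z ** u = u ** hp 0 x y z" by (simp add: hp_mult h_eq_iff algebra_simps)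
    then have "hp 0 x y z ** (b ** u) = (b ** u) ** hp 0 x y z" using b(2) by (metis matrix_mul_assoc)
    then show "k \<in> block_centralizer {hp 0 x y z}"
      unfolding k(1) block_diag_simps(1) using k(2) special_orthogonal_mult[OF b(1) u]
      by (intro block_centralizerI) auto
  next
    fix k assume "k \<in> block_centralizer {hp 0 x y z}"
    then obtain a g where k: "k = block_diag a g" "a \<in> special_orthogonal" "g \<in> special_orthogonal"
      "hp 0 x y z ** g = g ** hp 0 x y z" unfolding block_centralizer_def by blast
    obtain b t where b: "b \<in> Sp1_minus" "g = b ** hp (cos t) (sin t * x) (sin t * y) (sin t * z)"
      using commutes_unit_hp[OF x k(4)] k(3) unfolding special_orthogonal_iff by blast
    have "k = block_diag a b ** block_diag (mat 1) (hp (cos t) (sin t * x) (sin t * y) (sin t * z))"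
      unfolding k(1) b(2) block_diag_simps(1) by simp
    then show "k \<in> H'_times U" unfolding H'_times_def H'_def Ueq using k(2) b(1) by blast
  qed
  then show ?thesis using that x by blast
qed

section \<open>Dimensions of the isotropy algebras\<close>

definition skew3 :: "real^3 \<Rightarrow> real^3^3" where
  "skew3 v = vector [vector [0, v $ 1, v $ 2], vector [- (v $ 1), 0, v $ 3], vector [- (v $ 2), - (v $ 3), 0]]"

lemma dim_skew_3: "dim {a :: real^3^3. transpose a = - a} = 3"
proof -
  have lin: "linear skew3"
    by (rule linearI) (simp_all add: skew3_def vec_eq_iff forall_3)
  have inj: "inj skew3"
    by (rule injI) (simp add: skew3_def vec_eq_iff forall_3)
  have "{a :: real^3^3. transpose a = - a} = range skew3"
  proof (intro set_eqI iffI)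
    fix a :: "real^3^3" assume "a \<in> {a. transpose a = - a}"
    then have ta: "transpose a = - a" by simp
    have t: "a $ i $ j = - (a $ j $ i)" for i j
    proof -
      have "transpose a $ j $ i = (- a) $ j $ i" by (simp only: ta)
      then show ?thesis by (simp add: transpose_def)
    qed
    have d: "a $ i $ i = 0" for i using t[of i i] by simp
    have "a = skew3 (vector [a $ 1 $ 2, a $ 1 $ 3, a $ 2 $ 3])"
      using t[of 2 1] t[of 3 1] t[of 3 2] d by (simp add: skew3_def vec_eq_iff forall_3)
    then show "a \<in> range skew3" by blast
  next
    fix a assume "a \<in> range skew3"
    then show "a \<in> {a. transpose a = - a}" by (auto simp: skew3_def vec_eq_iff forall_3 transpose_def)
  qed
  then show ?thesis using dim_image_eq[OF lin, of UNIV] inj by simp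
qed

definition hpv :: "real^3 \<Rightarrow> real^4^4" where "hpv p = hp 0 (p $ 1) (p $ 2) (p $ 3)"
definition hmv :: "real^3 \<Rightarrow> real^4^4" where "hmv p = hm 0 (p $ 1) (p $ 2) (p $ 3)"

text \<open>The self-dual and anti-self-dual parts of a skew matrix; \<open>sd\<close> collects the three equations defining \<^const>\<open>Z_G\<close>.\<close>

definition sd :: "real^4^4 \<Rightarrow> real^3" where
  "sd W = vector [W $ 1 $ 2 + W $ 3 $ 4, W $ 1 $ 3 - W $ 2 $ 4, W $ 1 $ 4 + W $ 2 $ 3]"
definition asd :: "real^4^4 \<Rightarrow> real^3" where
  "asd W = vector [W $ 1 $ 2 - W $ 3 $ 4, W $ 1 $ 3 + W $ 2 $ 4, W $ 1 $ 4 - W $ 2 $ 3]"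

lemma linear_hpv: "linear hpv" and linear_hmv: "linear hmv"
  by (rule linearI; simp add: hpv_def hmv_def h_linear)+

lemma linear_sd: "linear sd" and linear_asd: "linear asd"
  by (rule linearI; simp add: sd_def asd_def vec_eq_iff forall_3 algebra_simps)+

lemma sd_hv: "sd (hpv p + hmv m) = 2 *\<^sub>R p" "asd (hpv p + hmv m) = 2 *\<^sub>R m"
  by (simp_all add: sd_def asd_def hpv_def hmv_def hp_def hm_def rows4_def vec_eq_iff forall_3 distinct_4)

lemma skew_hv: "transpose (hpv p + hmv m) = - (hpv p + hmv m)"
  unfolding transpose_add hpv_def hmv_def h_transpose by (simp add: mat4_simps)

lemma skew_decomposition:
  assumes tb: "transpose b = - b"
  shows "b = hpv ((1/2) *\<^sub>R sd b) + hmv ((1/2) *\<^sub>R asd b)"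
proof -
  have t: "b $ i $ j = - (b $ j $ i)" for i j
  proof -
    have "transpose b $ j $ i = (- b) $ j $ i" by (simp only: tb)
    then show ?thesis by (simp add: transpose_def)
  qed
  have d: "b $ i $ i = 0" for i using t[of i i] by simp
  show ?thesis
    unfolding vec_eq_iff forall_4
    using t[of 2 1] t[of 3 1] t[of 4 1] t[of 3 2] t[of 4 2] t[of 4 3] d
    by (intro conjI; simp add: hpv_def hmv_def hp_def hm_def rows4_def distinct_4 sd_def asd_def field_simps)
qed

lemma dim_skew_4: "dim {b :: real^4^4. transpose b = - b} = 6"
proof -
  let ?f = "\<lambda>(p, m). hpv p + hmv m"
  have lin: "linear ?f"
    by (rule linearI) (auto simp: linear_add[OF linear_hpv] linear_add[OF linear_hmv] linear_scale[OF linear_hpv]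
        linear_scale[OF linear_hmv] scaleR_add_right)
  have inj: "inj ?f"
  proof (rule injI)
    fix x y assume e: "?f x = ?f y"
    have "2 *\<^sub>R fst x = 2 *\<^sub>R fst y" "2 *\<^sub>R snd x = 2 *\<^sub>R snd y"
      using arg_cong[OF e, of sd] arg_cong[OF e, of asd] by (simp_all add: sd_hv case_prod_beta)
    then show "x = y" by (simp add: prod_eq_iff)
  qed
  have "{b :: real^4^4. transpose b = - b} = range ?f"
  proof (intro set_eqI iffI)
    fix b :: "real^4^4" assume "b \<in> {b. transpose b = - b}"
    then show "b \<in> range ?f"
      using skew_decomposition[of b] by (intro image_eqI[of _ _ "((1/2) *\<^sub>R sd b, (1/2) *\<^sub>R asd b)"]) simp_all
  next
    fix b assume "b \<in> range ?f"
    then obtain p m where "b = hpv p + hmv m" by auto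
    then show "b \<in> {b. transpose b = - b}" using skew_hv by simp
  qed
  then show ?thesis using dim_image_eq[OF lin, of UNIV] inj by simp
qed

text \<open>The right side is the vanishing of the cross product of \<open>p\<close> with
  \<open>(x, y, z)\<close>; the anti-self-dual part commutes automatically.\<close>

lemma hp_commute_iff:
  "hp 0 x y z ** (hpv p + hmv m) = (hpv p + hmv m) ** hp 0 x y z \<longleftrightarrow>
    p $ 2 * z = p $ 3 * y \<and> p $ 3 * x = p $ 1 * z \<and> p $ 1 * y = p $ 2 * x"
proof -
  have "hp 0 x y z ** (hpv p + hmv m) = (hpv p + hmv m) ** hp 0 x y z \<longleftrightarrow> hp 0 x y z ** hpv p = hpv p ** hp 0 x y z"
    unfolding matrix_mult.add_left matrix_mult.add_right hmv_def hp_hm_commute by simp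
  also have "\<dots> \<longleftrightarrow> p $ 2 * z = p $ 3 * y \<and> p $ 3 * x = p $ 1 * z \<and> p $ 1 * y = p $ 2 * x"
    unfolding hpv_def hp_mult h_eq_iff by (auto simp: algebra_simps)
  finally show ?thesis .
qed

lemma dim_skew_commuting_sp1_plus:
  "dim {b :: real^4^4. transpose b = - b \<and> (\<forall>Y\<in>sp1_plus. Y ** b = b ** Y)} = 3"
proof -
  have z: "hpv 0 = 0" by (rule linear_0[OF linear_hpv])
  have inj: "inj hmv"
  proof (rule injI)
    fix x y assume "hmv x = hmv y"
    then show "x = y" unfolding hmv_def h_eq_iff by (simp add: vec_eq_iff forall_3)
  qed
  have "{b :: real^4^4. transpose b = - b \<and> (\<forall>Y\<in>sp1_plus. Y ** b = b ** Y)} = range hmv"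
  proof (intro set_eqI iffI)
    fix b :: "real^4^4" assume b: "b \<in> {b. transpose b = - b \<and> (\<forall>Y\<in>sp1_plus. Y ** b = b ** Y)}"
    then obtain p m where e: "b = hpv p + hmv m" using skew_decomposition by blast
    have "hp 0 x y z ** (hpv p + hmv m) = (hpv p + hmv m) ** hp 0 x y z" for x y z
      using b sp1_plus_iff unfolding e by blast
    then have c: "p $ 2 * z = p $ 3 * y \<and> p $ 3 * x = p $ 1 * z \<and> p $ 1 * y = p $ 2 * x" for x y z
      unfolding hp_commute_iff .
    have "p = 0" using c[of 1 0 0] c[of 0 0 1] by (simp add: vec_eq_iff forall_3)
    then show "b \<in> range hmv" using e z by simp
  next
    fix b assume "b \<in> range hmv"
    then obtain m where e: "b = hpv 0 + hmv m" using z by auto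
    have "Y ** b = b ** Y" if Y: "Y \<in> sp1_plus" for Y
    proof -
      obtain x y z where Y': "Y = hp 0 x y z" using Y unfolding sp1_plus_iff by blast
      show ?thesis unfolding e Y' hp_commute_iff by simp
    qed
    then show "b \<in> {b. transpose b = - b \<and> (\<forall>Y\<in>sp1_plus. Y ** b = b ** Y)}" using skew_hv e by simp
  qed
  then show ?thesis using dim_image_eq[OF linear_hmv, of UNIV] inj by simp
qed

lemma dim_skew_commuting_unit_hp:
  assumes x: "x\<^sup>2 + y\<^sup>2 + z\<^sup>2 = 1"
  shows "dim {b :: real^4^4. transpose b = - b \<and> (\<forall>Y\<in>{hp 0 x y z}. Y ** b = b ** Y)} = 4"
proof -
  define v :: "real^3" where "v = vector [x, y, z]"
  let ?f = "\<lambda>(m :: real^3, t :: real). hpv (t *\<^sub>R v) + hmv m"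
  have lin: "linear ?f"
    by (rule linearI) (auto simp: linear_add[OF linear_hpv] linear_add[OF linear_hmv] linear_scale[OF linear_hpv]
        linear_scale[OF linear_hmv] scaleR_add_right scaleR_add_left)
  have v0: "v \<noteq> 0" using x unfolding v_def by (auto simp: vec_eq_iff forall_3)
  have inj: "inj ?f"
  proof (rule injI)
    fix a b :: "(real^3) \<times> real" assume e: "?f a = ?f b"
    have "snd a *\<^sub>R v = snd b *\<^sub>R v" "fst a = fst b"
      using arg_cong[OF e, of sd] arg_cong[OF e, of asd] by (simp_all only: sd_hv case_prod_beta scaleR_cancel_left; simp)+
    then show "a = b" using v0 by (simp add: prod_eq_iff)
  qed
  have "{b :: real^4^4. transpose b = - b \<and> (\<forall>Y\<in>{hp 0 x y z}. Y ** b = b ** Y)} = range ?f"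
  proof (intro set_eqI iffI)
    fix b :: "real^4^4" assume b: "b \<in> {b. transpose b = - b \<and> (\<forall>Y\<in>{hp 0 x y z}. Y ** b = b ** Y)}"
    then obtain p m where e: "b = hpv p + hmv m" using skew_decomposition by blast
    have "hp 0 x y z ** (hpv p + hmv m) = (hpv p + hmv m) ** hp 0 x y z" using b unfolding e by simp
    then have c: "p $ 2 * z = p $ 3 * y" "p $ 3 * x = p $ 1 * z" "p $ 1 * y = p $ 2 * x" unfolding hp_commute_iff by simp_all
    define s where "s = p $ 1 * x + p $ 2 * y + p $ 3 * z"
    have "s * x = p $ 1 * (x\<^sup>2 + y\<^sup>2 + z\<^sup>2) + y * (p $ 2 * x - p $ 1 * y) + z * (p $ 3 * x - p $ 1 * z)"
      "s * y = p $ 2 * (x\<^sup>2 + y\<^sup>2 + z\<^sup>2) + x * (p $ 1 * y - p $ 2 * x) + z * (p $ 3 * y - p $ 2 * z)"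
      "s * z = p $ 3 * (x\<^sup>2 + y\<^sup>2 + z\<^sup>2) + x * (p $ 1 * z - p $ 3 * x) + y * (p $ 2 * z - p $ 3 * y)"
      unfolding s_def by (simp_all add: power2_eq_square algebra_simps)
    then have "p $ 1 = s * x" "p $ 2 = s * y" "p $ 3 = s * z" using c x by simp_all
    then have "p = s *\<^sub>R v" unfolding v_def by (simp add: vec_eq_iff forall_3)
    then show "b \<in> range ?f" using e by (intro image_eqI[of _ _ "(m, s)"]) simp_all
  next
    fix b assume "b \<in> range ?f"
    then obtain m t where e: "b = hpv (t *\<^sub>R v) + hmv m" by auto
    have "hp 0 x y z ** b = b ** hp 0 x y z" unfolding e hp_commute_iff v_def by simp
    then show "b \<in> {b. transpose b = - b \<and> (\<forall>Y\<in>{hp 0 x y z}. Y ** b = b ** Y)}" using skew_hv e by simp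
  qed
  then show ?thesis using dim_image_eq[OF lin, of UNIV] inj by simp
qed

text \<open>These are 3 + 6, 3 + 3 and 3 + 4, where the first summand comes from the skew 3 by 3
  block.\<close>

lemma dim_centralizer_algebras:
  "dim (centralizer_algebra (block_commutant {})) = 9"
  "dim (centralizer_algebra (block_commutant sp1_plus)) = 6"
  "x\<^sup>2 + y\<^sup>2 + z\<^sup>2 = 1 \<Longrightarrow> dim (centralizer_algebra (block_commutant {hp 0 x y z})) = 7"
  unfolding dim_block_centralizer_algebra dim_skew_3 dim_skew_commuting_sp1_plus
  by (simp_all add: dim_skew_4 dim_skew_commuting_unit_hp[simplified])

section \<open>The trivial group as a centralizer\<close>

lemma commutes_all_scalar:
  fixes k :: "real^'n^'n"
  assumes "\<And>Q. Q ** k = k ** Q"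
  shows "k = (k $ r $ r) *\<^sub>R mat 1"
proof -
  have "k $ s $ t = (if s = t then k $ r $ r else 0)" for s t
  proof -
    define Q :: "real^'n^'n" where "Q = (\<chi> i j. if i = r then (if j = s then 1 else 0) else 0)"
    have "(Q ** k) $ r $ t = k $ s $ t"
      unfolding matrix_matrix_mult_def Q_def by (simp add: if_distrib[of "\<lambda>c. c * _"] cong: if_cong)
    moreover have "(k ** Q) $ r $ t = (if s = t then k $ r $ r else 0)"
    proof -
      have "(k ** Q) $ r $ t = (\<Sum>i\<in>UNIV. k $ r $ i * (if i = r then (if t = s then 1 else 0) else 0))"
        unfolding matrix_matrix_mult_def Q_def by simp
      also have "\<dots> = (\<Sum>i\<in>UNIV. if i = r then k $ r $ i * (if t = s then 1 else 0) else 0)"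
        by (intro sum.cong) auto
      finally show ?thesis by simp
    qed
    ultimately show ?thesis using assms[of Q] by simp
  qed
  then have e: "k $ s $ t = (if s = t then k $ r $ r else 0)" for s t by blast
  show ?thesis
    unfolding vec_eq_iff
  proof (intro allI)
    fix s t
    have "((k $ r $ r) *\<^sub>R mat 1 :: real^'n^'n) $ s $ t = (if s = t then k $ r $ r else 0)" by (simp add: mat_def)
    then show "k $ s $ t = ((k $ r $ r) *\<^sub>R mat 1) $ s $ t" using e[of s t] by argo
  qed
qed

lemma sum_mat_1:
  "(\<Sum>k\<in>UNIV. (mat 1 :: real^'n^'n) $ i $ k * f k) = f i" "(\<Sum>k\<in>UNIV. f k * (mat 1 :: real^'n^'n) $ k $ i) = f i"
proof -
  have "(mat 1 :: real^'n^'n) $ i $ k * f k = (if i = k then f k else 0)"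
    "f k * (mat 1 :: real^'n^'n) $ k $ i = (if i = k then f k else 0)" for k
    by (auto simp: mat_def)
  then show "(\<Sum>k\<in>UNIV. (mat 1 :: real^'n^'n) $ i $ k * f k) = f i" "(\<Sum>k\<in>UNIV. f k * (mat 1 :: real^'n^'n) $ k $ i) = f i"
    by simp_all
qed

lemma J34_nth:
  "(J34 ** X) $ Inl i $ s = X $ Inl i $ s" "(J34 ** X) $ Inr j $ s = - (X $ Inr j $ s)"
  "(X ** J34) $ s $ Inl i = X $ s $ Inl i" "(X ** J34) $ s $ Inr j = - (X $ s $ Inr j)"
  unfolding mat34_mult_nth block_diag_simps(4) block_diag_nth
  by (simp_all add: sum_mat_1 sum_negf)

lemma J34_scaled_zero:
  assumes "c *\<^sub>R J34 = d *\<^sub>R J34" shows "c = d"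
proof -
  have "J34 $ Inl 1 $ Inl 1 \<noteq> (0 :: mat34) $ Inl 1 $ Inl 1"
    unfolding block_diag_simps(4) block_diag_nth by (simp add: mat_def)
  then have "J34 \<noteq> 0" by metis
  then show ?thesis using assms by simp
qed

text \<open>Lets the quotient by \<open>T\<close> alone be treated like the others. A matrix
  commuting with everything is scalar, an isometric scalar is 1 or -1, and the radius 1 excludes
  -1.\<close>

lemma compact_trivial_group: "compact_matrix_group {mat 1} UNIV"
proof
  show "matrix_inv k \<in> {mat 1}" if "k \<in> {mat 1}" for k :: mat34
    using that matrix_inv_unique[of "mat 1 :: mat34" "mat 1"] by simp
  have "k = mat 1" if n: "norm (k - mat 1) < 1" and p: "transpose k ** J34 ** k = J34" and c: "\<forall>Q\<in>UNIV. Q ** k = k ** Q" for k :: mat34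
  proof -
    define c where "c = k $ Inl 1 $ Inl 1"
    have k: "k = c *\<^sub>R mat 1" unfolding c_def by (rule commutes_all_scalar) (use c in blast)
    have "(c * c) *\<^sub>R J34 = 1 *\<^sub>R J34"
      using p unfolding k by (simp add: transpose_scalar matrix_mult.scaleR_left matrix_mult.scaleR_right)
    then have "c * c = 1" by (rule J34_scaled_zero)
    then have c1: "c = 1 \<or> c = - 1" by (simp only: square_eq_1_iff)
    have "\<bar>(k - mat 1) $ Inl 1 $ Inl 1\<bar> \<le> norm (k - mat 1)"
      by (rule order_trans[OF component_le_norm_cart Finite_Cartesian_Product.norm_nth_le])
    then have "\<bar>c - 1\<bar> < 1" using n unfolding c_def by (simp add: mat_def)
    then have "c = 1" using c1 by auto
    then show ?thesis using k by simp
  qed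
  then show "\<exists>\<delta>>0. \<forall>k. norm (k - mat 1) < \<delta> \<longrightarrow>
      (k \<in> {mat 1 :: mat34}) = (transpose k ** J34 ** k = J34 \<and> (\<forall>Q\<in>UNIV. Q ** k = k ** Q))"
    by (intro exI[of _ 1]) auto
qed auto

lemma dim_trivial_algebra: "dim (centralizer_algebra UNIV) = 0"
proof -
  have "X = 0" if X: "X \<in> centralizer_algebra UNIV" for X
  proof -
    define c where "c = X $ Inl 1 $ Inl 1"
    have k: "X = c *\<^sub>R mat 1"
      unfolding c_def by (rule commutes_all_scalar) (use X in \<open>simp add: centralizer_algebra_def\<close>)
    have "transpose X ** J34 + J34 ** X = 0" using X unfolding centralizer_algebra_def so34_iff by blast
    moreover have "transpose X ** J34 + J34 ** X = (c + c) *\<^sub>R J34"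
      unfolding k by (simp only: transpose_scalar transpose_mat matrix_mult.scaleR_left matrix_mult.scaleR_right
          matrix_mul_lid matrix_mul_rid scaleR_add_left)
    ultimately have "(c + c) *\<^sub>R J34 = 0 *\<^sub>R J34" by (simp only: scaleR_zero_left)
    then have "c + c = 0" by (rule J34_scaled_zero)
    then show ?thesis using k by simp
  qed
  then have "centralizer_algebra UNIV \<subseteq> {0}" by blast
  then show ?thesis by (simp add: dim_eq_0)
qed

section \<open>The moment map\<close>

lemma hm_hp_scalar:
  assumes "hm 0 v1 v2 v3 ** hp 0 x y z = k *\<^sub>R mat 1"
  shows "v1 * x = 0 \<and> v1 * y = 0 \<and> v1 * z = 0 \<and> v2 * x = 0 \<and> v2 * y = 0 \<and> v2 * z = 0
      \<and> v3 * x = 0 \<and> v3 * y = 0 \<and> v3 * z = 0"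
proof -
  have e: "(hm 0 v1 v2 v3 ** hp 0 x y z) $ i $ j = (k *\<^sub>R mat 1) $ i $ j" for i j by (simp only: assms)
  have "- (v1 * x) - v2 * y - v3 * z = k" using e[of 1 1] by (simp add: mat4_simps)
  moreover have "- (v1 * x) + v3 * z + v2 * y = k" using e[of 2 2] by (simp add: mat4_simps)
  moreover have "- (v2 * y) + v3 * z + v1 * x = k" using e[of 3 3] by (simp add: mat4_simps)
  moreover have "- (v3 * z) + v2 * y + v1 * x = k" using e[of 4 4] by (simp add: mat4_simps)
  moreover have "v3 * y - v2 * z = 0" using e[of 1 2] by (simp add: mat4_simps)
  moreover have "v3 * y + v2 * z = 0" using e[of 3 4] by (simp add: mat4_simps)
  moreover have "v1 * z - v3 * x = 0" using e[of 1 3] by (simp add: mat4_simps)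
  moreover have "v1 * z + v3 * x = 0" using e[of 2 4] by (simp add: mat4_simps)
  moreover have "v2 * x - v1 * y = 0" using e[of 1 4] by (simp add: mat4_simps)
  moreover have "v2 * x + v1 * y = 0" using e[of 2 3] by (simp add: mat4_simps)
  ultimately show ?thesis by (intro conjI; linarith)
qed

lemma hv_square: "hpv p ** hpv p = - (p \<bullet> p) *\<^sub>R mat 1" "hmv p ** hmv p = - (p \<bullet> p) *\<^sub>R mat 1"
proof -
  have "p \<bullet> p = p $ 1 * p $ 1 + p $ 2 * p $ 2 + p $ 3 * p $ 3" by (simp add: inner_vec_def sum_3)
  then have s: "- (p \<bullet> p) = - (p $ 1 * p $ 1) - p $ 2 * p $ 2 - p $ 3 * p $ 3" by simp
  show "hpv p ** hpv p = - (p \<bullet> p) *\<^sub>R mat 1"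
    unfolding s hpv_def hp_mult h_one(1)[symmetric] h_linear h_eq_iff by (simp add: algebra_simps)
  show "hmv p ** hmv p = - (p \<bullet> p) *\<^sub>R mat 1"
    unfolding s hmv_def hm_mult h_one(2)[symmetric] h_linear h_eq_iff by (simp add: algebra_simps)
qed

text \<open>The square of the sum of a self-dual and an anti-self-dual part is a scalar plus twice
  their product. If that product is scalar, all products of their components vanish, so one of the
  two parts is 0.\<close>

lemma skew_scalar_square:
  assumes V: "transpose V = - V" "V ** V = c *\<^sub>R mat 1"
  shows "sd V = 0 \<or> asd V = 0"
proof -
  obtain p m where e: "V = hpv p + hmv m" using skew_decomposition[OF V(1)] by blast
  have com: "hpv p ** hmv m = hmv m ** hpv p" unfolding hpv_def hmv_def by (rule hp_hm_commute)
  have "V ** V = (hpv p ** hpv p + hmv m ** hmv m) + 2 *\<^sub>R (hmv m ** hpv p)"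
    unfolding e matrix_mult.add_left matrix_mult.add_right com by (simp add: scaleR_2)
  then have "2 *\<^sub>R (hmv m ** hpv p) = c *\<^sub>R mat 1 + ((p \<bullet> p) *\<^sub>R mat 1 + (m \<bullet> m) *\<^sub>R mat 1)"
    unfolding V(2) hv_square by simp
  also have "\<dots> = 2 *\<^sub>R (((c + (p \<bullet> p) + (m \<bullet> m)) / 2) *\<^sub>R mat 1)" by (simp add: scaleR_add_left[symmetric] add.assoc)
  finally have "hm 0 (m $ 1) (m $ 2) (m $ 3) ** hp 0 (p $ 1) (p $ 2) (p $ 3) = ((c + (p \<bullet> p) + (m \<bullet> m)) / 2) *\<^sub>R mat 1"
    unfolding hmv_def hpv_def by (simp only: scaleR_cancel_left) simp
  from hm_hp_scalar[OF this] have "p = 0 \<or> m = 0" by (auto simp: vec_eq_iff forall_3)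
  then show ?thesis unfolding e sd_hv by auto
qed

lemma smooth_on_quadratic:
  assumes "open S"
  shows "smooth_on S (\<lambda>g :: real^'n^'n. transpose g ** M ** g)"
  by (intro smooth_on_matrix_mult assms smooth_on_linear linear_transpose linear_matrix_mult_left
      linear_ident smooth_on_const)

text \<open>By connectedness of \<open>SO(4)\<close>, conjugation cannot move an anti-self-dual form to a self-dual one.\<close>

lemma sd_invariant:
  assumes W: "transpose W = - W" "sd W = 0" and b: "b \<in> special_orthogonal"
  shows "sd (transpose b ** W ** b) = 0"
proof (cases "W = 0")
  case True
  then show ?thesis using linear_0[OF linear_sd] by simp
next
  case False
  obtain m where m: "W = hmv m" using skew_decomposition[OF W(1)] unfolding W(2) by (auto simp: linear_0[OF linear_hpv])
  have o: "transpose b ** b = mat 1" "b ** transpose b = mat 1" if "b \<in> special_orthogonal" for b :: "real^4^4"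
    using that unfolding special_orthogonal_def rotation_matrix_def orthogonal_matrix_def by auto
  have cases: "sd (transpose b ** W ** b) = 0 \<or> asd (transpose b ** W ** b) = 0" if b: "b \<in> special_orthogonal" for b
  proof (rule skew_scalar_square)
    show "transpose (transpose b ** W ** b) = - (transpose b ** W ** b)"
      by (simp add: matrix_transpose_mul W(1) matrix_mul_assoc matrix_mult.minus_left matrix_mult.minus_right)
    have "transpose b ** W ** b ** (transpose b ** W ** b) = transpose b ** W ** (b ** transpose b) ** W ** b"
      by (simp only: matrix_mul_assoc)
    also have "\<dots> = transpose b ** (W ** W) ** b" unfolding o(2)[OF b] by (simp add: matrix_mul_assoc)
    also have "\<dots> = - (m \<bullet> m) *\<^sub>R (transpose b ** b)"
      unfolding m hv_square by (simp add: matrix_mult.scaleR_left matrix_mult.scaleR_right matrix_mult.minus_left matrix_mult.minus_right)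
    finally show "transpose b ** W ** b ** (transpose b ** W ** b) = - (m \<bullet> m) *\<^sub>R mat 1" unfolding o(1)[OF b] .
  qed
  \<comment> \<open>A conjugate with both parts zero would vanish, and so would \<open>W\<close>.
    Hence the two closed conditions separate the connected rotation group.\<close>
  have disjoint: "\<not> (sd (transpose b ** W ** b) = 0 \<and> asd (transpose b ** W ** b) = 0)" if b: "b \<in> special_orthogonal" for b
  proof
    assume z: "sd (transpose b ** W ** b) = 0 \<and> asd (transpose b ** W ** b) = 0"
    have "transpose (transpose b ** W ** b) = - (transpose b ** W ** b)"
      by (simp add: matrix_transpose_mul W(1) matrix_mul_assoc matrix_mult.minus_left matrix_mult.minus_right)
    from skew_decomposition[OF this] have 0: "transpose b ** W ** b = 0"
      using z by (simp add: linear_0[OF linear_hpv] linear_0[OF linear_hmv])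
    have "W = (b ** transpose b) ** W ** (b ** transpose b)" unfolding o(2)[OF b] by simp
    also have "\<dots> = b ** (transpose b ** W ** b) ** transpose b" by (simp only: matrix_mul_assoc)
    finally show False using False unfolding 0 by simp
  qed
  let ?C = "{b :: real^4^4. sd (transpose b ** W ** b) = 0}" and ?D = "{b :: real^4^4. asd (transpose b ** W ** b) = 0}"
  have "closed ?C"
    by (rule closed_Collect_eq[OF smooth_on_imp_continuous_on[OF smooth_on_linear_compose[OF open_UNIV linear_sd
        smooth_on_quadratic[OF open_UNIV]]] continuous_on_const])
  moreover have "closed ?D"
    by (rule closed_Collect_eq[OF smooth_on_imp_continuous_on[OF smooth_on_linear_compose[OF open_UNIV linear_asd
        smooth_on_quadratic[OF open_UNIV]]] continuous_on_const])
  moreover have "connected (special_orthogonal :: (real^4^4) set)" by (rule connected_special_orthogonal) simp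
  moreover have "special_orthogonal \<subseteq> ?C \<union> ?D" using cases by blast
  moreover have "?C \<inter> ?D \<inter> special_orthogonal = {}" using disjoint by blast
  moreover have "mat 1 \<in> ?C \<inter> special_orthogonal" using W(2) one_special_orthogonal by simp
  then have "?C \<inter> special_orthogonal \<noteq> {}" by blast
  ultimately have "?D \<inter> special_orthogonal = {}" unfolding connected_closed by blast
  then show ?thesis using cases[OF b] b by blast
qed

definition moment :: "mat34 \<Rightarrow> mat34 \<Rightarrow> real^3" where
  "moment A g = sd (lower (transpose g ** (transpose A ** J34) ** g))"

lemma omega_columns:
  "omega A (column r g) (column s g) = (transpose g ** (transpose A ** J34) ** g) $ r $ s"
proof -
  have "omega A (g *v axis r 1) (g *v axis s 1) = axis r 1 \<bullet> ((transpose g ** (transpose A ** J34) ** g) *v axis s 1)"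
    unfolding omega_def form34_eq inner_matrix_vec' by (simp only: matrix_vector_mul_assoc matrix_mul_assoc)
  then show ?thesis by (simp add: matrix_vector_mult_basis column_def inner_axis')
qed

lemma Z_G_iff: "g \<in> Z_G A \<longleftrightarrow> g \<in> SO0_34 \<and> moment A g = 0"
  unfolding Z_G_def moment_def Let_def
  by (simp add: omega_columns sd_def vec_eq_iff forall_3 lower_def)

lemma skew_form:
  assumes "A \<in> so34"
  shows "transpose (transpose A ** J34) = - (transpose A ** J34)"
  using assms unfolding so34_iff by (simp add: matrix_transpose_mul eq_neg_iff_add_eq_0 add.commute)

lemma moment_left:
  assumes "transpose E ** J34 ** E = J34" "A ** E = E ** A"
  shows "moment A (E ** g) = moment A g"
proof -
  have t: "transpose E ** transpose A = transpose A ** transpose E"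
    using arg_cong[OF assms(2), of transpose] by (simp add: matrix_transpose_mul)
  have "transpose (E ** g) ** (transpose A ** J34) ** (E ** g) = transpose g ** (transpose E ** transpose A) ** J34 ** E ** g"
    by (simp only: matrix_transpose_mul matrix_mul_assoc)
  also have "\<dots> = transpose g ** transpose A ** (transpose E ** J34 ** E) ** g" unfolding t by (simp only: matrix_mul_assoc)
  finally show ?thesis unfolding assms(1) moment_def by (simp add: matrix_mul_assoc)
qed

lemma lower_block_mult: "lower (block_diag a b ** Y ** block_diag a' b') = b ** lower Y ** b'"
  by (simp add: vec_eq_iff lower_def mat34_mult_nth) (simp add: matrix_matrix_mult_def)

lemma transpose_lower: "transpose (lower Y) = lower (transpose Y)"
  by (simp add: vec_eq_iff lower_def transpose_def)

text \<open>Right translation by \<open>block_diag a b\<close> conjugates the lower block by the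
  rotation \<open>b\<close>, and \<open>sd_invariant\<close> applies to this skew block.\<close>

lemma moment_right:
  assumes A: "A \<in> so34" and g: "moment A g = 0" and k: "k \<in> H"
  shows "moment A (g ** k) = 0"
proof -
  obtain a b where ab: "k = block_diag a b" "b \<in> special_orthogonal" using k unfolding H_def by blast
  let ?Y = "transpose g ** (transpose A ** J34) ** g"
  have "transpose ?Y = transpose g ** transpose (transpose A ** J34) ** g"
    by (simp only: matrix_transpose_mul transpose_transpose matrix_mul_assoc)
  then have "transpose ?Y = - ?Y" unfolding skew_form[OF A] by (simp add: matrix_mult.minus_left matrix_mult.minus_right)
  then have "transpose (lower ?Y) = - lower ?Y" unfolding transpose_lower by (simp add: linear_neg[OF linear_lower])
  from sd_invariant[OF this g[unfolded moment_def] ab(2)] have "sd (transpose b ** lower ?Y ** b) = 0" .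
  moreover have "transpose (g ** k) ** (transpose A ** J34) ** (g ** k) = transpose k ** ?Y ** k"
    by (simp only: matrix_transpose_mul matrix_mul_assoc)
  ultimately show ?thesis unfolding moment_def ab(1) block_diag_simps(2) by (simp only: lower_block_mult)
qed

lemma reduction_Z_G:
  assumes "compact_matrix_group K \<Q>" "K \<subseteq> H" "A \<in> so34" "A \<notin> IV4"
  shows "reduction K \<Q> A (Z_G A)"
proof (intro reduction.intro reduction_axioms.intro)
  show "compact_matrix_group K \<Q>" "A \<in> so34" "A \<notin> IV4" by (rule assms)+
  show "transpose g ** J34 ** g = J34" if "g \<in> Z_G A" for g using that Z_G_iff SO0_34_preserves by blast
  show "mexp (t *\<^sub>R A) ** g \<in> Z_G A" if "g \<in> Z_G A" for g t
  proof -
    have E: "mexp (t *\<^sub>R A) \<in> SO0_34" by (rule mexp_SO0_34[OF assms(3)])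
    show ?thesis using that SO0_34_mult[OF E] moment_left[OF SO0_34_preserves[OF E] mexp_derivative(2)]
      unfolding Z_G_iff by simp
  qed
  show "g ** k \<in> Z_G A" if "g \<in> Z_G A" "k \<in> K" for g k
    using that SO0_34_mult[of g k] H_SO0_34 moment_right[OF assms(3), of g k] assms(2) unfolding Z_G_iff by blast
qed

section \<open>Regularity of the zero locus\<close>

definition blocks :: "real^3^3 \<Rightarrow> real^4^3 \<Rightarrow> real^3^4 \<Rightarrow> real^4^4 \<Rightarrow> mat34" where
  "blocks a m n b = (\<chi> r s. case (r, s) of (Inl i, Inl j) \<Rightarrow> a $ i $ j | (Inl i, Inr j) \<Rightarrow> m $ i $ j
    | (Inr i, Inl j) \<Rightarrow> n $ i $ j | (Inr i, Inr j) \<Rightarrow> b $ i $ j)"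

lemma blocks_nth [simp]:
  "blocks a m n b $ Inl i $ Inl i' = a $ i $ i'" "blocks a m n b $ Inl i $ Inr j = m $ i $ j"
  "blocks a m n b $ Inr j $ Inl i = n $ j $ i" "blocks a m n b $ Inr j $ Inr j' = b $ j $ j'"
  unfolding blocks_def by simp_all

lemma so34_entries:
  "X \<in> so34 \<longleftrightarrow> (\<forall>i i'. X $ Inl i' $ Inl i + X $ Inl i $ Inl i' = 0) \<and> (\<forall>i j. X $ Inr j $ Inl i = X $ Inl i $ Inr j)
    \<and> (\<forall>j j'. X $ Inr j' $ Inr j + X $ Inr j $ Inr j' = 0)"
proof -
  have "- x = y \<longleftrightarrow> x + y = 0" for x y :: real by auto
  then show ?thesis unfolding so34_iff mat34_eq_iff by (auto simp: J34_nth transpose_def)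
qed

text \<open>3 + 6 for the skew diagonal blocks and 12 for the off-diagonal block, which determines
  its transpose partner.\<close>

lemma dim_so34: "dim so34 = 21"
proof -
  let ?A = "{a :: real^3^3. transpose a = - a}" and ?B = "{b :: real^4^4. transpose b = - b}"
  let ?f = "\<lambda>((a, b), m). blocks a m (transpose m) b"
  have A: "subspace ?A" and B: "subspace ?B" unfolding subspace_def
    by (auto simp: transpose_add transpose_scalar linear_0[OF linear_transpose])
  have lin: "linear ?f"
    by (rule linearI) (auto simp: mat34_eq_iff transpose_def)
  have inj: "inj ?f"
    by (rule injI) (auto simp: mat34_eq_iff vec_eq_iff)
  have skew: "transpose a = - a \<longleftrightarrow> (\<forall>i i'. a $ i' $ i + a $ i $ i' = 0)" for a :: "real^'n^'n"
    by (simp add: vec_eq_iff transpose_def add_eq_0_iff2)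
  have "so34 = ?f ` ((?A \<times> ?B) \<times> UNIV)"
  proof (intro set_eqI iffI)
    fix X assume X: "X \<in> so34"
    let ?m = "\<chi> i j. X $ Inl i $ Inr j"
    have "X = blocks (upper X) ?m (transpose ?m) (lower X)"
      using X unfolding so34_entries by (simp add: mat34_eq_iff upper_def lower_def transpose_def)
    moreover have "upper X \<in> ?A" "lower X \<in> ?B"
      using X unfolding so34_entries by (simp_all add: skew upper_def lower_def)
    ultimately show "X \<in> ?f ` ((?A \<times> ?B) \<times> UNIV)" by (intro image_eqI[of _ _ "((upper X, lower X), ?m)"]) simp_all
  next
    fix X assume "X \<in> ?f ` ((?A \<times> ?B) \<times> UNIV)"
    then obtain a b m where "X = blocks a m (transpose m) b" "transpose a = - a" "transpose b = - b" by auto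
    then show "X \<in> so34" unfolding so34_entries skew by (simp add: transpose_def)
  qed
  moreover have "dim (?f ` ((?A \<times> ?B) \<times> UNIV)) = dim ((?A \<times> ?B) \<times> (UNIV :: (real^4^3) set))"
    by (rule dim_image_eq[OF lin]) (rule inj_on_subset[OF inj], simp)
  ultimately show ?thesis
    using dim_Times[OF subspace_Times[OF A B] subspace_UNIV[where ?'a = "real^4^3"]] dim_Times[OF A B]
    by (simp add: dim_skew_3 dim_skew_4)
qed

text \<open>The left sides are the self-dual components of the wedge of \<open>v\<close> and
  \<open>n\<close>; wedging with a nonzero vector is onto the self-dual forms.\<close>

lemma wedge_surjective:
  fixes n1 n2 n3 n4 :: real
  assumes "n1 \<noteq> 0 \<or> n2 \<noteq> 0 \<or> n3 \<noteq> 0 \<or> n4 \<noteq> 0"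
  obtains v1 v2 v3 v4 where "(v1 * n2 - n1 * v2) + (v3 * n4 - n3 * v4) = c1"
    "(v1 * n3 - n1 * v3) - (v2 * n4 - n2 * v4) = c2" "(v1 * n4 - n1 * v4) + (v2 * n3 - n2 * v3) = c3"
proof -
  let ?N = "n1 * n1 + n2 * n2 + n3 * n3 + n4 * n4"
  have "?N \<noteq> 0"
    using assms by (metis add_nonneg_eq_0_iff add_nonneg_nonneg mult_eq_0_iff zero_le_square)
  then have d: "c1 = c1 / ?N * ?N" "c2 = c2 / ?N * ?N" "c3 = c3 / ?N * ?N" by simp_all
  define d1 d2 d3 where "d1 = c1 / ?N" and "d2 = c2 / ?N" and "d3 = c3 / ?N"
  note d' = d[folded d1_def d2_def d3_def]
  show ?thesis
    \<comment> \<open>The coefficients of \<open>d1\<close>, \<open>d2\<close>, \<open>d3\<close>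
      are the images of \<open>n\<close> under three anticommuting complex structures; they are
      mutually orthogonal with squared norm \<open>?N\<close>.\<close>
    by (rule that[of "d1 * n2 + d2 * n3 + d3 * n4" "- d1 * n1 - d2 * n4 + d3 * n3" "d1 * n4 - d2 * n1 - d3 * n2"
          "- d1 * n3 + d2 * n2 - d3 * n1"]; subst d'; simp add: algebra_simps)
qed

text \<open>Choose \<open>X\<close> off-diagonal and supported in the row \<open>i0\<close> and its
  transpose. The variation of the lower block is then the wedge of that row \<open>v\<close> with
  the nonzero row \<open>n\<close> of \<open>\<Theta>\<close>.\<close>

lemma infinitesimal_moment_surjective:
  assumes \<Theta>: "transpose \<Theta> = - \<Theta>" and n: "\<Theta> $ Inl i0 $ Inr j0 \<noteq> 0"
  obtains X where "X \<in> so34" "sd (lower (transpose X ** \<Theta> + \<Theta> ** X)) = c"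
proof -
  define n where "n = (\<lambda>j. \<Theta> $ Inl i0 $ Inr j)"
  have neg: "\<Theta> $ Inr j $ Inl i0 = - n j" for j
  proof -
    have "transpose \<Theta> $ Inl i0 $ Inr j = (- \<Theta>) $ Inl i0 $ Inr j" by (simp only: \<Theta>)
    then show ?thesis unfolding n_def by (simp add: transpose_def)
  qed
  have "\<not> (\<forall>j. n j = 0)" using n unfolding n_def by blast
  then have "n 1 \<noteq> 0 \<or> n 2 \<noteq> 0 \<or> n 3 \<noteq> 0 \<or> n 4 \<noteq> 0" unfolding forall_4 by blast
  then obtain v1 v2 v3 v4 where v: "(v1 * n 2 - n 1 * v2) + (v3 * n 4 - n 3 * v4) = c $ 1"
    "(v1 * n 3 - n 1 * v3) - (v2 * n 4 - n 2 * v4) = c $ 2" "(v1 * n 4 - n 1 * v4) + (v2 * n 3 - n 2 * v3) = c $ 3"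
    by (rule wedge_surjective)
  define v :: "real^4" where "v = (\<chi> j. if j = 1 then v1 else if j = 2 then v2 else if j = 3 then v3 else v4)"
  have vn: "v $ 1 = v1" "v $ 2 = v2" "v $ 3 = v3" "v $ 4 = v4" unfolding v_def by (simp_all add: distinct_4)
  define m :: "real^4^3" where "m = (\<chi> i j. if i = i0 then v $ j else 0)"
  define X where "X = blocks 0 m (transpose m) 0"
  have X: "X \<in> so34" unfolding X_def so34_entries by (simp add: transpose_def)
  have s1: "(\<Sum>i\<in>UNIV. m $ i $ j * f i) = v $ j * f i0" for j f
    unfolding m_def by (simp add: if_distrib[of "\<lambda>c. c * _"] cong: if_cong)
  have "lower (transpose X ** \<Theta> + \<Theta> ** X) $ j $ k = v $ j * n k - n j * v $ k" for j k
  proof -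
    have "lower (transpose X ** \<Theta> + \<Theta> ** X) $ j $ k
      = (\<Sum>i\<in>UNIV. m $ i $ j * \<Theta> $ Inl i $ Inr k) + (\<Sum>i\<in>UNIV. m $ i $ k * \<Theta> $ Inr j $ Inl i)"
      unfolding lower_def X_def by (simp add: mat34_mult_nth transpose_def mult.commute)
    then show ?thesis unfolding s1 neg by (simp add: n_def mult.commute)
  qed
  then have "sd (lower (transpose X ** \<Theta> + \<Theta> ** X)) = c"
    using v unfolding sd_def by (simp add: vec_eq_iff forall_3 vn)
  then show ?thesis using that X by blast
qed

lemma quadratic_derivative:
  "((\<lambda>g :: real^'n^'n. transpose g ** M ** g) has_derivative (\<lambda>h. transpose p ** M ** h + transpose h ** M ** p)) (at p)"
proof -
  have "linear (\<lambda>g :: real^'n^'n. transpose g ** M)"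
    using linear_compose[OF linear_transpose linear_matrix_mult_left[of M]] by (simp add: o_def)
  then have "((\<lambda>g :: real^'n^'n. transpose g ** M) has_derivative (\<lambda>g. transpose g ** M)) (at p)"
    by (simp add: bounded_linear_imp_has_derivative linear_conv_bounded_linear)
  from matrix_mult.FDERIV[OF this has_derivative_ident] show ?thesis .
qed

text \<open>Tangent vectors are written as \<open>p ** X\<close>. In this frame the isometry
  equation becomes \<open>X \<in> so34\<close> and the moment equation three independent conditions
  on it, leaving dimension 21 - 3 = 18.\<close>

lemma Z_G_local_coords:
  assumes A: "A \<in> so34" "A \<notin> IV4" and p: "p \<in> Z_G A"
  shows "\<exists>N (\<kappa> :: mat34 \<Rightarrow> real^18) W \<psi>. p \<in> N \<and> local_coords (Z_G A) N \<kappa> W \<psi>"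
proof -
  define \<Omega> where "\<Omega> = transpose A ** J34"
  have p0: "p \<in> SO0_34" using p Z_G_iff by blast
  have pp: "transpose p ** J34 ** p = J34" by (rule SO0_34_preserves[OF p0])
  let ?q = "J34 ** transpose p ** J34"
  note q = preserving_inverse(1,2)[OF pp]
  obtain S where S: "open S" "p \<in> S" "\<And>g. g \<in> S \<Longrightarrow> transpose g ** J34 ** g = J34 \<Longrightarrow> g \<in> SO0_34"
    using SO0_34_neighbourhood[OF p0] by blast
  define \<Psi> where "\<Psi> = (\<lambda>g. (transpose g ** J34 ** g - J34, sd (lower (transpose g ** \<Omega> ** g))))"
  define D where "D = (\<lambda>h. (transpose p ** J34 ** h + transpose h ** J34 ** p,
      sd (lower (transpose p ** \<Omega> ** h + transpose h ** \<Omega> ** p))))"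
  define \<Theta> where "\<Theta> = transpose p ** \<Omega> ** p"
  have lin: "linear (\<lambda>Y. sd (lower Y))"
    using linear_compose[OF linear_lower linear_sd] by (simp add: o_def)
  have "((\<lambda>g. sd (lower (transpose g ** \<Omega> ** g))) has_derivative (\<lambda>h. sd (lower (transpose p ** \<Omega> ** h + transpose h ** \<Omega> ** p)))) (at p)"
    using bounded_linear.has_derivative[OF _ quadratic_derivative] lin linear_conv_bounded_linear by blast
  moreover have "((\<lambda>g. transpose g ** J34 ** g - J34) has_derivative (\<lambda>h. transpose p ** J34 ** h + transpose h ** J34 ** p)) (at p)"
    using has_derivative_diff[OF quadratic_derivative[of J34 p] has_derivative_const[of J34]] by simp
  ultimately have deriv: "(\<Psi> has_derivative D) (at p)"
    unfolding \<Psi>_def D_def by (intro has_derivative_Pair)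
  have linD: "linear D" using deriv has_derivative_linear by blast
  have Dp: "D (p ** X) = (J34 ** X + transpose X ** J34, sd (lower (transpose X ** \<Theta> + \<Theta> ** X)))" for X
  proof -
    have "transpose p ** M ** (p ** X) = (transpose p ** M ** p) ** X"
      "transpose (p ** X) ** M ** p = transpose X ** (transpose p ** M ** p)" for M
      by (simp_all only: matrix_transpose_mul matrix_mul_assoc)
    then show ?thesis unfolding D_def \<Theta>_def pp by (simp add: pp add.commute)
  qed
  have \<Omega>t: "transpose \<Omega> = - \<Omega>" unfolding \<Omega>_def by (rule skew_form[OF A(1)])
  have "transpose \<Theta> = transpose p ** transpose \<Omega> ** p"
    unfolding \<Theta>_def by (simp only: matrix_transpose_mul transpose_transpose matrix_mul_assoc)
  then have \<Theta>t: "transpose \<Theta> = - \<Theta>"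
    unfolding \<Omega>t \<Theta>_def by (simp add: matrix_mult.minus_left matrix_mult.minus_right)
  define B where "B = ?q ** A ** p"
  have AB: "A ** p = p ** B"
  proof -
    have "p ** B = (p ** ?q) ** A ** p" unfolding B_def by (simp only: matrix_mul_assoc)
    then show ?thesis unfolding q(2) by simp
  qed
  have \<Theta>B: "\<Theta> = transpose B ** J34"
  proof -
    have "\<Theta> = transpose (A ** p) ** J34 ** p" unfolding \<Theta>_def \<Omega>_def by (simp only: matrix_transpose_mul matrix_mul_assoc)
    also have "\<dots> = transpose B ** (transpose p ** J34 ** p)" unfolding AB by (simp only: matrix_transpose_mul matrix_mul_assoc)
    finally show ?thesis unfolding pp .
  qed
  \<comment> \<open>An off-diagonal entry exists because otherwise \<open>B\<close>, which is
    \<open>A\<close> in the frame \<open>p\<close>, would preserve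
    \<open>positive_axes\<close>.\<close>
  obtain i0 j0 where n: "\<Theta> $ Inl i0 $ Inr j0 \<noteq> 0"
  proof -
    have "\<not> (\<forall>i j. B $ Inr j $ Inl i = 0)" using block_diagonal_imp_IV4[OF A(1) pp AB] A(2) by blast
    then obtain i j where "B $ Inr j $ Inl i \<noteq> 0" by blast
    then have "\<Theta> $ Inl i $ Inr j \<noteq> 0" unfolding \<Theta>B by (simp add: J34_nth transpose_def)
    then show thesis by (rule that)
  qed
  let ?l = "\<lambda>X. sd (lower (transpose X ** \<Theta> + \<Theta> ** X))"
  have linl: "linear ?l"
  proof -
    have "linear (\<lambda>X. transpose X ** \<Theta> + \<Theta> ** X)"
      using linear_compose_add[OF linear_compose[OF linear_transpose linear_matrix_mult_left[of \<Theta>]] linear_matrix_mult_right[of \<Theta>]]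
      by (simp add: o_def)
    from linear_compose[OF this lin] show ?thesis by (simp add: o_def)
  qed
  have surj: "\<exists>X\<in>so34. ?l X = c" for c using infinitesimal_moment_surjective[OF \<Theta>t n, of c] by blast
  \<comment> \<open>The symmetric defect \<open>Y\<close> is the image of \<open>?X0\<close>, half
    of \<open>J34 ** Y\<close>. An element of \<open>so34\<close> then corrects the moment component
    without changing the first one.\<close>
  have range: "\<Psi> x \<in> range D" for x
  proof -
    define Y where "Y = transpose x ** J34 ** x - J34"
    have Yt: "transpose Y = Y" unfolding Y_def transpose_diff by (simp add: matrix_transpose_mul matrix_mul_assoc)
    let ?X0 = "(1/2) *\<^sub>R (J34 ** Y)"
    obtain X1 where X1: "X1 \<in> so34" "?l X1 = sd (lower (transpose x ** \<Omega> ** x)) - ?l ?X0" using surj by blast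
    have "transpose ?X0 = (1/2) *\<^sub>R (Y ** J34)" by (simp add: transpose_scalar matrix_transpose_mul Yt)
    then have "J34 ** ?X0 + transpose ?X0 ** J34 = (1/2) *\<^sub>R ((J34 ** J34) ** Y + Y ** (J34 ** J34))"
      by (simp only: matrix_mult.scaleR_left matrix_mult.scaleR_right scaleR_add_right matrix_mul_assoc)
    then have Y0: "J34 ** ?X0 + transpose ?X0 ** J34 = Y" by (simp add: J34_J34 scaleR_2[symmetric])
    have X10: "J34 ** X1 + transpose X1 ** J34 = 0" using X1(1) unfolding so34_iff by (simp add: add.commute)
    have "D (p ** ?X0 + p ** X1) = (Y, sd (lower (transpose x ** \<Omega> ** x)))"
      unfolding linear_add[OF linD] Dp Y0 X10 X1(2) by simp
    then show ?thesis unfolding \<Psi>_def Y_def[symmetric] by (metis rangeI)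
  qed
  have ker: "{h. D h = 0} = (\<lambda>X. p ** X) ` {X \<in> so34. ?l X = 0}"
  proof (intro set_eqI iffI)
    fix h assume h: "h \<in> {h. D h = 0}"
    have e: "h = p ** (?q ** h)" using q(2) by (simp add: matrix_mul_assoc)
    have "D (p ** (?q ** h)) = 0" using h e by simp
    then have "?q ** h \<in> {X \<in> so34. ?l X = 0}" unfolding Dp by (simp add: so34_iff zero_prod_def add.commute)
    then show "h \<in> (\<lambda>X. p ** X) ` {X \<in> so34. ?l X = 0}" using e by (rule image_eqI[rotated])
  next
    fix h assume "h \<in> (\<lambda>X. p ** X) ` {X \<in> so34. ?l X = 0}"
    then obtain X where X: "h = p ** X" "X \<in> so34" "?l X = 0" by blast
    then have "J34 ** X + transpose X ** J34 = 0" unfolding so34_iff by (simp add: add.commute)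
    then have "D (p ** X) = 0" unfolding Dp X(3) by (simp add: zero_prod_def)
    then show "h \<in> {h. D h = 0}" using X(1) by simp
  qed
  have so: "subspace so34"
    unfolding subspace_def so34_def by (simp add: matrix_vector_mult_add_rdistrib form34_simps scaleR_matrix_vector_assoc[symmetric] distrib_left[symmetric] add_ac)
  have "c \<in> ?l ` so34" for c
  proof -
    obtain X where X: "X \<in> so34" "?l X = c" using surj by blast
    show ?thesis by (rule image_eqI[of c ?l X so34, OF X(2)[symmetric] X(1)])
  qed
  then have "?l ` so34 = UNIV" by blast
  then have "dim {X \<in> so34. ?l X = 0} = 18"
    using rank_nullity_subspace[OF linl so] dim_so34 by simp
  moreover have "dim ((\<lambda>X. p ** X) ` {X \<in> so34. ?l X = 0}) = dim {X \<in> so34. ?l X = 0}"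
  proof (rule dim_image_eq[OF linear_matrix_mult_right])
    have "inj (\<lambda>X. p ** X)"
      using q(1) by (intro inj_on_inverseI[of _ "\<lambda>X. ?q ** X"]) (simp add: matrix_mul_assoc)
    then show "inj_on (\<lambda>X. p ** X) (span {X \<in> so34. ?l X = 0})" by (rule inj_on_subset) simp
  qed
  ultimately have dim: "dim {h. D h = 0} = DIM(real^18)" unfolding ker by simp
  have Z: "Z_G A \<inter> S = {x \<in> S. \<Psi> x = 0}"
    unfolding \<Psi>_def zero_prod_def \<Omega>_def using S(3) SO0_34_preserves by (auto simp: Z_G_iff moment_def)
  have smooth: "smooth_on S \<Psi>"
    unfolding \<Psi>_def
    by (intro smooth_on_Pair S(1) smooth_on_diff smooth_on_const smooth_on_quadratic smooth_on_linear_compose[OF S(1) lin])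
  from regular_level_set[OF S(1,2) smooth Z p deriv range dim] show ?thesis by metis
qed

theorem corollary7p10:
  fixes A :: mat34 and U :: "(real^4^4) set"
  assumes "A \<in> so34"
    and "A \<notin> IV4"
    and "circle_subgroup U"
    and "U \<subseteq> Sp1_plus"
  shows "\<exists>\<B> :: (mat34, real^18) chart set.
      embedded_submanifold (Z_G A) \<B> \<and>
      (\<exists>\<C> :: (mat34 set, real^17) chart set.
         reduced_manifold (one_parameter_group A) (Z_G A) \<B> {mat 1} \<C>) \<and>
      (\<exists>\<C> :: (mat34 set, real^11) chart set.
         reduced_manifold (one_parameter_group A) (Z_G A) \<B> H' \<C>) \<and>
      (\<exists>\<C> :: (mat34 set, real^10) chart set.
         reduced_manifold (one_parameter_group A) (Z_G A) \<B> (H'_times U) \<C>) \<and>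
      (\<exists>\<C> :: (mat34 set, real^8) chart set.
         reduced_manifold (one_parameter_group A) (Z_G A) \<B> H \<C>)"
proof -
  \<comment> \<open>One atlas of the zero locus serves all four quotients, so the four projections
    are submersions for the same smooth structure.\<close>
  let ?\<B> = "coord_atlas (Z_G A) :: (mat34, real^18) chart set"
  note coords = Z_G_local_coords[OF assms(1,2)]
  obtain x y z where x: "x\<^sup>2 + y\<^sup>2 + z\<^sup>2 = 1" and U: "H'_times U = block_centralizer {hp 0 x y z}"
    using H'_times_eq[OF assms(3,4)] by blast
  have sub: "block_centralizer \<Y> \<subseteq> H" for \<Y>
    unfolding block_centralizer_def H_def by blast
  have "mat 1 \<in> H"
    unfolding H_def block_diag_simps(3)[symmetric] 
    by (rule CollectI, rule exI[of _ "mat 1"], rule exI[of _ "mat 1"]) (simp add: one_special_orthogonal)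
  then have r0: "reduction {mat 1} UNIV A (Z_G A)"
    using reduction_Z_G[OF compact_trivial_group _ assms(1,2)] by simp
  have r: "reduction (block_centralizer \<Y>) (block_commutant \<Y>) A (Z_G A)" for \<Y>
    by (rule reduction_Z_G[OF compact_block_centralizer sub assms(1,2)])
  show ?thesis
  proof (intro exI[of _ ?\<B>] conjI)
    show "embedded_submanifold (Z_G A) ?\<B>"
      by (rule embedded_submanifold_coord_atlas[OF coords])
    show "\<exists>\<C> :: (mat34 set, real^17) chart set. reduced_manifold (one_parameter_group A) (Z_G A) ?\<B> {mat 1} \<C>"
      by (rule reduction.reduced_manifold_exists[OF r0 coords]) (simp_all add: dim_trivial_algebra)
    show "\<exists>\<C> :: (mat34 set, real^11) chart set. reduced_manifold (one_parameter_group A) (Z_G A) ?\<B> H' \<C>"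
      unfolding H'_eq by (rule reduction.reduced_manifold_exists[OF r coords]) (simp_all add: dim_centralizer_algebras)
    show "\<exists>\<C> :: (mat34 set, real^10) chart set. reduced_manifold (one_parameter_group A) (Z_G A) ?\<B> (H'_times U) \<C>"
      unfolding U by (rule reduction.reduced_manifold_exists[OF r coords]) (simp_all add: dim_centralizer_algebras(3)[OF x])
    show "\<exists>\<C> :: (mat34 set, real^8) chart set. reduced_manifold (one_parameter_group A) (Z_G A) ?\<B> H \<C>"
      unfolding H_eq by (rule reduction.reduced_manifold_exists[OF r coords]) (simp_all add: dim_centralizer_algebras)
  qed
qed

end
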